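(* Let $3\le\gamma<6$, $p(\rho)=\rho^\gamma$, and let $G\in D_0^{1,\frac{6\gamma}{5\gamma-6}}(\mathbb{R}^3)$. Let $(\rho,\mathbf{u})$ be a weak solution in $\mathbb{R}^3$ of the steady barotropic Navier--Stokes system with pressure $p$ and force potential $G$. If $\rho\in L^\gamma(\mathbb{R}^3)$, then $\mathbf{u}=0$ a.e. in $\mathbb{R}^3$.
   Context: The system is $\operatorname{div}(\rho\mathbf{u})=0$, $\operatorname{div}(\rho\mathbf{u}\otimes\mathbf{u})+\nabla p(\rho)-\operatorname{div}\mathbb{S}(\nabla\mathbf{u})=\rho\nabla G$ in $\mathbb{R}^3$, where $\mathbb{S}(\nabla\mathbf{u})=\mu\left(\nabla\mathbf{u}+\nabla^t\mathbf{u}-\frac23\operatorname{div}\mathbf{u}\,\mathbb{I}\right)+\eta\operatorname{div}\mathbf{u}\,\mathbb{I}$ with constants $\mu>0$, $\eta\ge0$. Function space: for $1\le q<\infty$, $D_0^{1,q}(\mathbb{R}^3)$ is the completion of $C_c^\infty(\mathbb{R}^3)$ in the norm $\left(\int_{\mathbb{R}^3}|\nabla v|^q\,dx\right)^{1/q}$; $D_0^{1,q}(\mathbb{R}^3;\mathbb{R}^3)$ is the vector-valued version. For matrices, $F:G=\sum_{i,j}F_{ij}G_{ij}$. Weak solution: $(\rho,\mathbf{u})$ is a weak solution if (1) $\rho,\mathbf{u}$ are measurable in $\mathbb{R}^3$ and $\rho\ge0$ a.e.; (2) $\rho\mathbf{u}\in L^1_{\rm loc}(\mathbb{R}^3;\mathbb{R}^3)$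 and $\int_{\mathbb{R}^3}\rho\mathbf{u}\cdot\nabla\phi\,dx=0$ for all $\phi\in C_c^\infty(\mathbb{R}^3)$; (3) $\rho,\ \rho|\mathbf{u}|^2,\ p(\rho),\ \rho\nabla G$ are in $L^1_{\rm loc}(\mathbb{R}^3)$, $\mathbf{u}\in D_0^{1,2}(\mathbb{R}^3;\mathbb{R}^3)$, and $$\int_{\mathbb{R}^3}[\rho\mathbf{u}\otimes\mathbf{u}:\nabla\boldsymbol{\varphi}+p(\rho)\operatorname{div}\boldsymbol{\varphi}]\,dx=\int_{\mathbb{R}^3}\mathbb{S}(\nabla\mathbf{u}):\nabla\boldsymbol{\varphi}\,dx-\int_{\mathbb{R}^3}\rho\nabla G\cdot\boldsymbol{\varphi}\,dx$$ for all $\boldsymbol{\varphi}\in C_c^1(\mathbb{R}^3;\mathbb{R}^3)$. *)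

theory Defs
  imports "HOL-Analysis.Analysis"
begin

section \<open>Test functions\<close>

definition partial :: "3 \<Rightarrow> (real^3 \<Rightarrow> 'b::real_normed_vector) \<Rightarrow> real^3 \<Rightarrow> 'b" where
  "partial i f x = frechet_derivative f (at x) (axis i 1)"

primrec C_diff :: "nat \<Rightarrow> (real^3 \<Rightarrow> 'b::real_normed_vector) \<Rightarrow> bool" where
  "C_diff 0 f \<longleftrightarrow> continuous_on UNIV f"
| "C_diff (Suc k) f \<longleftrightarrow> (\<forall>x. f differentiable (at x)) \<and> (\<forall>i. C_diff k (partial i f))"

definition compact_support :: "(real^3 \<Rightarrow> 'b::real_normed_vector) \<Rightarrow> bool" where
  "compact_support f \<longleftrightarrow> compact (closure {x. f x \<noteq> 0})"

definition Cc :: "nat \<Rightarrow> (real^3 \<Rightarrow> 'b::real_normed_vector) set" where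
  "Cc k = {f. C_diff k f \<and> compact_support f}"

definition Cc_infinity :: "(real^3 \<Rightarrow> 'b::real_normed_vector) set" where
  "Cc_infinity = {f. (\<forall>k. C_diff k f) \<and> compact_support f}"

definition grad :: "(real^3 \<Rightarrow> real) \<Rightarrow> real^3 \<Rightarrow> real^3" where
  "grad f x = (\<chi> i. partial i f x)"

section \<open>Function spaces\<close>

definition Lspace :: "real \<Rightarrow> (real^3 \<Rightarrow> real) set" where
  "Lspace q = {f \<in> borel_measurable lebesgue. integrable lebesgue (\<lambda>x. \<bar>f x\<bar> powr q)}"

definition locally_integrable :: "(real^3 \<Rightarrow> 'b::euclidean_space) \<Rightarrow> bool" where
  "locally_integrable f \<longleftrightarrow> (\<forall>K. compact K \<longrightarrow> set_integrable lebesgue K f)"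

definition is_weak_grad :: "(real^3 \<Rightarrow> real) \<Rightarrow> (real^3 \<Rightarrow> real^3) \<Rightarrow> bool" where
  "is_weak_grad v g \<longleftrightarrow> locally_integrable v \<and> locally_integrable g \<and>
     (\<forall>\<phi> \<in> Cc_infinity.
        (LINT x|lebesgue. v x *\<^sub>R grad \<phi> x) = - (LINT x|lebesgue. \<phi> x *\<^sub>R g x))"

(* Weak gradients are unique up to null sets, so the representative chosen here is immaterial
   wherever it is used below. *)
definition weak_grad :: "(real^3 \<Rightarrow> real) \<Rightarrow> real^3 \<Rightarrow> real^3" where
  "weak_grad v = (SOME g. is_weak_grad v g)"

(* Row i is the gradient of the i-th component, matching the convention of jacobian. *)
definition weak_grad_vec :: "(real^3 \<Rightarrow> real^3) \<Rightarrow> real^3 \<Rightarrow> real^3^3" where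
  "weak_grad_vec u x = (\<chi> i. weak_grad (\<lambda>y. u y $ i) x)"

definition D_norm :: "real \<Rightarrow> (real^3 \<Rightarrow> real) \<Rightarrow> real" where
  "D_norm q v = (LINT x|lebesgue. norm (grad v x) powr q) powr (1 / q)"

(* The completion of Cc_infinity under D_norm q, realised as a space of functions: a Cauchy
   sequence is represented by its limit in the local L1 sense.  For 1 <= q < 3 this limit exists
   and determines the element of the completion, by Sobolev's inequality; its weak gradient is
   the limit in Lq of the gradients of the sequence.  For q >= 3 the completion is only a space
   of functions modulo constants, and the set below contains all representatives. *)
definition D0 :: "real \<Rightarrow> (real^3 \<Rightarrow> real) set" where
  "D0 q = {v. locally_integrable v \<and>
     (\<exists>\<phi> :: nat \<Rightarrow> real^3 \<Rightarrow> real.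
        (\<forall>n. \<phi> n \<in> Cc_infinity) \<and>
        (\<forall>e>0. \<exists>N. \<forall>m\<ge>N. \<forall>n\<ge>N. D_norm q (\<lambda>x. \<phi> m x - \<phi> n x) < e) \<and>
        (\<forall>K. compact K \<longrightarrow> (\<lambda>n. LINT x:K|lebesgue. \<bar>\<phi> n x - v x\<bar>) \<longlonglongrightarrow> 0))}"

definition D0_vec :: "real \<Rightarrow> (real^3 \<Rightarrow> real^3) set" where
  "D0_vec q = {u. \<forall>i. (\<lambda>x. u x $ i) \<in> D0 q}"

section \<open>The steady barotropic Navier--Stokes system\<close>

(* The product F:G of matrices is the library inner product on real^3^3. *)

definition outer_prod :: "real^3 \<Rightarrow> real^3 \<Rightarrow> real^3^3" where
  "outer_prod a b = (\<chi> i j. a $ i * b $ j)"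

definition stress :: "real \<Rightarrow> real \<Rightarrow> real^3^3 \<Rightarrow> real^3^3" where
  "stress \<mu> \<eta> F =
     \<mu> *\<^sub>R (F + transpose F - (2 / 3 * trace F) *\<^sub>R mat 1) + (\<eta> * trace F) *\<^sub>R mat 1"

(* The divergence of a vector field is the trace of its gradient matrix. *)
definition weak_solution ::
  "real \<Rightarrow> real \<Rightarrow> (real \<Rightarrow> real) \<Rightarrow> (real^3 \<Rightarrow> real) \<Rightarrow> (real^3 \<Rightarrow> real) \<Rightarrow> (real^3 \<Rightarrow> real^3) \<Rightarrow> bool"
where
  "weak_solution \<mu> \<eta> p G \<rho> u \<longleftrightarrow>
     \<rho> \<in> borel_measurable lebesgue \<and> u \<in> borel_measurable lebesgue \<and>
     (AE x in lebesgue. \<rho> x \<ge> 0) \<and>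
     locally_integrable (\<lambda>x. \<rho> x *\<^sub>R u x) \<and>
     (\<forall>\<phi> \<in> Cc_infinity. (LINT x|lebesgue. (\<rho> x *\<^sub>R u x) \<bullet> grad \<phi> x) = 0) \<and>
     locally_integrable \<rho> \<and>
     locally_integrable (\<lambda>x. \<rho> x * (norm (u x))\<^sup>2) \<and>
     locally_integrable (\<lambda>x. p (\<rho> x)) \<and>
     locally_integrable (\<lambda>x. \<rho> x *\<^sub>R weak_grad G x) \<and>
     u \<in> D0_vec 2 \<and>
     (\<forall>\<phi> \<in> Cc 1.
        (LINT x|lebesgue. (\<rho> x *\<^sub>R outer_prod (u x) (u x)) \<bullet> jacobian \<phi> (at x)
                          + p (\<rho> x) * trace (jacobian \<phi> (at x)))
        = (LINT x|lebesgue. stress \<mu> \<eta> (weak_grad_vec u x) \<bullet> jacobian \<phi> (at x))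
          - (LINT x|lebesgue. (\<rho> x *\<^sub>R weak_grad G x) \<bullet> \<phi> x))"

end

theory Submission
  imports Defs
begin

text \<open>
  Write \<open>D = div u\<close>.  Testing the momentum equation with a cut-off, regularised Newton gradient of
  \<open>min(\<rho>,k)\<^sup>\<gamma>\<close> bounds \<open>\<integral> \<rho>\<^sup>\<gamma> min(\<rho>,k)\<^sup>\<gamma>\<close> by a multiple of its own power \<open>2/3\<close>, uniformly in \<open>k\<close>.  Hence
  \<open>\<rho>\<close> lies in \<open>L\<^sup>2\<^sup>\<gamma>\<close> and, as \<open>\<gamma> \<le> 6 \<le> 2\<gamma>\<close>, in \<open>L\<^sup>6\<close>.  This integrability suffices to renormalise the
  continuity equation: mollifying \<open>\<rho>\<close> and testing with the mollified \<open>\<gamma> - 1\<close> power of the mollified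
  density gives \<open>\<integral> \<rho>\<^sup>\<gamma> D = 0\<close>.  It also makes \<open>u\<close> itself an admissible test function in the momentum
  equation, where the convective term and the force term vanish by the continuity equation.  What remains is
  \<open>\<mu> \<integral> |\<nabla>u|\<^sup>2 + (\<mu>/3 + \<eta>) \<integral> D\<^sup>2 = 0\<close>, so \<open>\<nabla>u = 0\<close> and \<open>u = 0\<close> by Sobolev's inequality.
\<close>
section \<open>Lebesgue spaces\<close>

text \<open>Truncation makes the functional \<open>energy k\<close> finite before it is known to be
  bounded, so no constant may depend on \<open>k\<close> or on the regularisation. The test field is
  curl free; its derivatives are controlled in L2 by its divergence alone, through an identity
  between gradient, divergence and curl, and singular integrals are avoided. With E for the
  functional, these derivatives have size E^(1/2), and by Sobolev the field has that size in L6. In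
  the convective term the density costs E^(1/6) in L6, the velocity is in L6 and its gradient in L2:
  the exponents 1/6 + 1/6 + 1/2 + 1/6 add up to 1, the powers of E to 2/3. Where the density exceeds
  \<open>k\<close>, the supremum of the field is used instead; the powers of \<open>k\<close>
  combine to 1 - \<gamma>/3, which is where \<gamma> \<ge> 3 enters. The weight in the
  renormalisation has power \<gamma> - 1 because differentiating the \<gamma>-th power of the
  mollified density produces it: one integral then appears in two limits, with factors 1 and
  1/\<gamma>, and must vanish.\<close>

definition Lp :: "real \<Rightarrow> ('a::euclidean_space \<Rightarrow> real) set" where
  "Lp s = {f \<in> borel_measurable lborel. integrable lborel (\<lambda>x. \<bar>f x\<bar> powr s)}"

text \<open>The integral is kept without its root: \<open>Lpow_add_le\<close>, with the factor
  \<open>2 powr s\<close>, stands in for Minkowski's inequality, and convergence to zero is the same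
  for both. Borel functions are used so that translates and functions on products stay
  measurable.\<close>

definition Lpow :: "real \<Rightarrow> ('a::euclidean_space \<Rightarrow> real) \<Rightarrow> real" where
  "Lpow s f = (LINT x|lborel. \<bar>f x\<bar> powr s)"

text \<open>Membership is part of the notion because the Bochner integral of a non-integrable
  function is 0 by default; the limit alone would say nothing about such functions.\<close>

definition Lconv :: "real \<Rightarrow> (nat \<Rightarrow> 'a::euclidean_space \<Rightarrow> real) \<Rightarrow> ('a \<Rightarrow> real) \<Rightarrow> bool" where
  "Lconv s F f \<longleftrightarrow> (\<forall>n. F n \<in> Lp s) \<and> f \<in> Lp s \<and> (\<lambda>n. Lpow s (\<lambda>x. F n x - f x)) \<longlonglongrightarrow> 0"

lemma LpI: "f \<in> borel_measurable borel \<Longrightarrow> integrable lborel (\<lambda>x. \<bar>f x\<bar> powr s) \<Longrightarrow> f \<in> Lp s"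
  by (simp add: Lp_def)

lemma Lp_measurable: "f \<in> Lp s \<Longrightarrow> f \<in> borel_measurable borel"
  by (simp add: Lp_def)

lemma Lp_integrable: "f \<in> Lp s \<Longrightarrow> integrable lborel (\<lambda>x. \<bar>f x\<bar> powr s)"
  by (simp add: Lp_def)

lemma Lp_1_iff: "f \<in> Lp 1 \<longleftrightarrow> integrable lborel f"
  using borel_measurable_integrable[of lborel f] integrable_abs_iff[of f lborel]
  by (auto simp: Lp_def)

lemma Lpow_nonneg [simp]: "0 \<le> Lpow s f"
  by (simp add: Lpow_def)

lemma Lpow_1: "Lpow 1 f = (LINT x|lborel. \<bar>f x\<bar>)"
  by (simp add: Lpow_def)

lemma Lpow_2: "Lpow 2 f = (LINT x|lborel. (f x)\<^sup>2)"
  by (simp add: Lpow_def)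

lemma Lp_2_iff: "f \<in> Lp 2 \<longleftrightarrow> f \<in> borel_measurable borel \<and> integrable lborel (\<lambda>x. (f x)\<^sup>2)"
  by (simp add: Lp_def)

lemma tendsto_zero_squeeze:
  fixes f g :: "nat \<Rightarrow> real"
  assumes "\<And>n. 0 \<le> f n" "\<And>n. f n \<le> g n" "g \<longlonglongrightarrow> 0"
  shows "f \<longlonglongrightarrow> 0"
  by (rule tendsto_sandwich[OF _ _ tendsto_const assms(3)]) (use assms in auto)

lemma powr_add_abs_le:
  fixes a b s :: real
  assumes "0 \<le> s"
  shows "\<bar>a + b\<bar> powr s \<le> 2 powr s * (\<bar>a\<bar> powr s + \<bar>b\<bar> powr s)"
proof -
  have "\<bar>a + b\<bar> powr s \<le> (2 * max \<bar>a\<bar> \<bar>b\<bar>) powr s"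
    using assms by (intro powr_mono2) auto
  also have "\<dots> = 2 powr s * (max \<bar>a\<bar> \<bar>b\<bar>) powr s"
    by (simp add: powr_mult)
  also have "\<dots> \<le> 2 powr s * (\<bar>a\<bar> powr s + \<bar>b\<bar> powr s)"
    by (intro mult_left_mono) (auto simp: max_def)
  finally show ?thesis .
qed

lemma Lp_mono:
  assumes "f \<in> borel_measurable borel" "g \<in> Lp s" "\<And>x. \<bar>f x\<bar> \<le> \<bar>g x\<bar>" "0 \<le> s"
  shows "f \<in> Lp s"
proof (rule LpI[OF assms(1)])
  show "integrable lborel (\<lambda>x. \<bar>f x\<bar> powr s)"
    by (rule Bochner_Integration.integrable_bound[OF Lp_integrable[OF assms(2)]])
       (use assms in \<open>auto intro!: AE_I2 powr_mono2\<close>)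
qed

lemma Lpow_mono:
  assumes "f \<in> borel_measurable borel" "g \<in> Lp s" "\<And>x. \<bar>f x\<bar> \<le> \<bar>g x\<bar>" "0 \<le> s"
  shows "Lpow s f \<le> Lpow s g"
  unfolding Lpow_def
  by (rule integral_mono[OF Lp_integrable[OF Lp_mono[OF assms]] Lp_integrable[OF assms(2)]])
     (use assms in \<open>auto intro!: powr_mono2\<close>)

lemma Lp_cmult: "f \<in> Lp s \<Longrightarrow> (\<lambda>x. c * f x) \<in> Lp s"
  using borel_measurable_times[of "\<lambda>x. c" borel f] by (simp add: Lp_def abs_mult powr_mult)

lemma Lpow_cmult: "Lpow s (\<lambda>x. c * f x) = \<bar>c\<bar> powr s * Lpow s f"
  by (simp add: Lpow_def abs_mult powr_mult)

lemma Lp_abs: "f \<in> Lp s \<Longrightarrow> (\<lambda>x. \<bar>f x\<bar>) \<in> Lp s"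
  using borel_measurable_abs[of f borel] by (simp add: Lp_def)

lemma Lpow_abs [simp]: "Lpow s (\<lambda>x. \<bar>f x\<bar>) = Lpow s f"
  by (simp add: Lpow_def)

lemma Lp_zero [simp]: "(\<lambda>x. 0) \<in> Lp s"
  by (simp add: Lp_def)

lemma Lp_uminus: "f \<in> Lp s \<Longrightarrow> (\<lambda>x. - f x) \<in> Lp s"
  using Lp_cmult[of f s "-1"] by simp

lemma Lp_add:
  assumes "f \<in> Lp s" "g \<in> Lp s" "0 \<le> s"
  shows "(\<lambda>x. f x + g x) \<in> Lp s"
proof (rule LpI)
  note [measurable] = Lp_measurable[OF assms(1)] Lp_measurable[OF assms(2)]
  show "(\<lambda>x. f x + g x) \<in> borel_measurable borel" by measurable
  show "integrable lborel (\<lambda>x. \<bar>f x + g x\<bar> powr s)"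
    by (rule Bochner_Integration.integrable_bound
        [where f = "\<lambda>x. 2 powr s * (\<bar>f x\<bar> powr s + \<bar>g x\<bar> powr s)"])
       (use assms powr_add_abs_le[OF assms(3)] in \<open>auto intro!: AE_I2 Lp_integrable\<close>)
qed

lemma Lpow_add_le:
  assumes "f \<in> Lp s" "g \<in> Lp s" "0 \<le> s"
  shows "Lpow s (\<lambda>x. f x + g x) \<le> 2 powr s * (Lpow s f + Lpow s g)"
proof -
  have "Lpow s (\<lambda>x. f x + g x) \<le> (LINT x|lborel. 2 powr s * (\<bar>f x\<bar> powr s + \<bar>g x\<bar> powr s))"
    unfolding Lpow_def
    by (rule integral_mono) (use assms powr_add_abs_le[OF assms(3)] Lp_add[OF assms] in \<open>auto intro!: Lp_integrable\<close>)
  also have "\<dots> = 2 powr s * (Lpow s f + Lpow s g)"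
    using assms by (simp add: Lpow_def Lp_integrable)
  finally show ?thesis .
qed

lemma Lp_diff:
  assumes "f \<in> Lp s" "g \<in> Lp s" "0 \<le> s"
  shows "(\<lambda>x. f x - g x) \<in> Lp s"
  using Lp_add[OF assms(1) Lp_uminus[OF assms(2)] assms(3)] by simp

lemma Lp_sum:
  assumes "\<And>i. i \<in> I \<Longrightarrow> f i \<in> Lp s" "0 \<le> s"
  shows "(\<lambda>x. \<Sum>i\<in>I. f i x) \<in> Lp s"
  using assms by (induction I rule: infinite_finite_induct) (auto intro: Lp_add)

lemma Lpow_minus_commute: "Lpow s (\<lambda>x. f x - g x) = Lpow s (\<lambda>x. g x - f x)"
  by (simp add: Lpow_def abs_minus_commute)

text \<open>Pointwise, the power \<open>c\<close> is at most the power \<open>b\<close> where the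
  modulus is at least 1, and at most the power \<open>a\<close> elsewhere.\<close>

lemma Lp_interpolate:
  assumes "f \<in> Lp a" "f \<in> Lp b" "a \<le> c" "c \<le> b"
  shows "f \<in> Lp c" "Lpow c f \<le> Lpow a f + Lpow b f"
proof -
  note [measurable] = Lp_measurable[OF assms(1)]
  have *: "\<bar>f x\<bar> powr c \<le> \<bar>f x\<bar> powr a + \<bar>f x\<bar> powr b" for x
  proof (cases "\<bar>f x\<bar> \<ge> 1")
    case True
    then have "\<bar>f x\<bar> powr c \<le> \<bar>f x\<bar> powr b" using assms by (intro powr_mono) auto
    then show ?thesis by (simp add: add_increasing)
  next
    case False
    then have "\<bar>f x\<bar> powr c \<le> \<bar>f x\<bar> powr a" using assms by (intro powr_mono') auto
    then show ?thesis by (simp add: add_increasing2)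
  qed
  have i: "integrable lborel (\<lambda>x. \<bar>f x\<bar> powr a + \<bar>f x\<bar> powr b)"
    using assms by (auto intro!: Lp_integrable)
  show "f \<in> Lp c"
    by (rule LpI, measurable) (rule Bochner_Integration.integrable_bound[OF i], use * in auto)
  then show "Lpow c f \<le> Lpow a f + Lpow b f"
    unfolding Lpow_def using integral_mono[OF _ i *] assms
    by (auto simp: Lp_integrable)
qed

lemma Young_powr:
  fixes a b x y :: real
  assumes "0 < a" "0 < b" "a + b = 1" "0 \<le> x" "0 \<le> y"
  shows "x powr a * y powr b \<le> a * x + b * y"
proof -
  have *: "1 < 1 / a" "1 < 1 / b" using assms by (auto simp: field_simps)
  show ?thesis
    using Youngs_inequality[OF *, of "x powr a" "y powr b"] assms by (simp add: powr_powr mult.commute)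
qed

text \<open>By homogeneity both integrals may be normalised to 1, and then Young's inequality is
  integrated pointwise. The weights \<open>a\<close> and \<open>b\<close> are the reciprocals of the
  usual exponents. If an integral is 0 the normalisation is impossible, but then the product
  vanishes almost everywhere.\<close>

lemma Holder_powr:
  fixes f g :: "'a::euclidean_space \<Rightarrow> real"
  assumes ab: "0 < a" "0 < b" "a + b = 1"
    and f: "integrable lborel f" "\<And>x. 0 \<le> f x" and g: "integrable lborel g" "\<And>x. 0 \<le> g x"
  shows "integrable lborel (\<lambda>x. f x powr a * g x powr b)"
    and "(LINT x|lborel. f x powr a * g x powr b) \<le> (LINT x|lborel. f x) powr a * (LINT x|lborel. g x) powr b"
proof -
  note [measurable] = borel_measurable_integrable[OF f(1)] borel_measurable_integrable[OF g(1)]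
  define F G where "F = (LINT x|lborel. f x)" and "G = (LINT x|lborel. g x)"
  have FG: "0 \<le> F" "0 \<le> G" using f g by (auto simp: F_def G_def)
  show int: "integrable lborel (\<lambda>x. f x powr a * g x powr b)"
    by (rule Bochner_Integration.integrable_bound[where f = "\<lambda>x. a * f x + b * g x"])
       (use f g ab Young_powr[OF ab] in auto)
  show "(LINT x|lborel. f x powr a * g x powr b) \<le> F powr a * G powr b"
  proof (cases "F = 0 \<or> G = 0")
    case True
    then have "AE x in lborel. f x = 0 \<or> g x = 0"
    proof
      assume "F = 0"
      then have "AE x in lborel. f x = 0"
        using integral_nonneg_eq_0_iff_AE[of lborel f] f unfolding F_def by auto
      then show ?thesis by eventually_elim auto
    next
      assume "G = 0"
      then have "AE x in lborel. g x = 0"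
        using integral_nonneg_eq_0_iff_AE[of lborel g] g unfolding G_def by auto
      then show ?thesis by eventually_elim auto
    qed
    then have "AE x in lborel. f x powr a * g x powr b = 0"
      by eventually_elim auto
    then have "(LINT x|lborel. f x powr a * g x powr b) = (LINT x::'a|lborel. 0)"
      by (intro integral_cong_AE) auto
    then show ?thesis by simp
  next
    case False
    then have FG: "0 < F" "0 < G" using FG by auto
    have "(f x powr a * g x powr b) \<le> F powr a * G powr b * (a * (f x / F) + b * (g x / G))" for x
    proof -
      have "f x powr a * g x powr b = F powr a * G powr b * ((f x / F) powr a * (g x / G) powr b)"
        using FG f g by (simp add: powr_divide)
      also have "\<dots> \<le> F powr a * G powr b * (a * (f x / F) + b * (g x / G))"
        using FG f g ab by (intro mult_left_mono Young_powr) auto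
      finally show ?thesis .
    qed
    then have "(LINT x|lborel. f x powr a * g x powr b)
        \<le> (LINT x|lborel. F powr a * G powr b * (a * (f x / F) + b * (g x / G)))"
      using f g by (intro integral_mono int) auto
    also have "\<dots> = F powr a * G powr b * (a * (F / F) + b * (G / G))"
      using f g by (simp add: F_def G_def)
    also have "\<dots> = F powr a * G powr b" using FG ab by simp
    finally show ?thesis .
  qed
qed

lemma Holder:
  assumes "0 < a" "0 < b" "0 < c" "1 / a + 1 / b = 1 / c" "f \<in> Lp a" "g \<in> Lp b"
  shows "(\<lambda>x. f x * g x) \<in> Lp c"
    and "Lpow c (\<lambda>x. f x * g x) \<le> Lpow a f powr (c / a) * Lpow b g powr (c / b)"
proof -
  note [measurable] = Lp_measurable[OF assms(5)] Lp_measurable[OF assms(6)]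
  have *: "0 < c / a" "0 < c / b" "c / a + c / b = 1"
    using assms by (auto simp: field_simps)
  have eq: "(\<bar>f x\<bar> powr a) powr (c / a) * (\<bar>g x\<bar> powr b) powr (c / b) = \<bar>f x * g x\<bar> powr c" for x
    using assms by (simp add: powr_powr abs_mult powr_mult)
  note H = Holder_powr[OF * Lp_integrable[OF assms(5)] _ Lp_integrable[OF assms(6)], simplified eq]
  show "(\<lambda>x. f x * g x) \<in> Lp c"
    by (rule LpI) (use H in auto)
  show "Lpow c (\<lambda>x. f x * g x) \<le> Lpow a f powr (c / a) * Lpow b g powr (c / b)"
    unfolding Lpow_def using H by auto
qed

lemma Holder_1:
  assumes "0 < a" "0 < b" "1 / a + 1 / b = 1" "f \<in> Lp a" "g \<in> Lp b"
  shows "integrable lborel (\<lambda>x. f x * g x)"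
    and "(LINT x|lborel. \<bar>f x * g x\<bar>) \<le> Lpow a f powr (1 / a) * Lpow b g powr (1 / b)"
    and "\<bar>LINT x|lborel. f x * g x\<bar> \<le> Lpow a f powr (1 / a) * Lpow b g powr (1 / b)"
proof -
  note H = Holder[of a b 1 f g]
  show 1: "integrable lborel (\<lambda>x. f x * g x)"
    using H(1) assms by (simp add: Lp_1_iff)
  show 2: "(LINT x|lborel. \<bar>f x * g x\<bar>) \<le> Lpow a f powr (1 / a) * Lpow b g powr (1 / b)"
    using H(2) assms by (simp add: Lpow_1)
  then show "\<bar>LINT x|lborel. f x * g x\<bar> \<le> Lpow a f powr (1 / a) * Lpow b g powr (1 / b)"
    using integral_abs_bound[of lborel "\<lambda>x. f x * g x"] by linarith
qed

lemma LconvD: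
  assumes "Lconv s F f"
  shows "F n \<in> Lp s" "f \<in> Lp s" "(\<lambda>n. Lpow s (\<lambda>x. F n x - f x)) \<longlonglongrightarrow> 0"
  using assms by (auto simp: Lconv_def)

lemma Lconv_const: "f \<in> Lp s \<Longrightarrow> Lconv s (\<lambda>n. f) f"
  by (auto simp: Lconv_def Lpow_def)

lemma Lconv_cmult: "Lconv s F f \<Longrightarrow> Lconv s (\<lambda>n x. c * F n x) (\<lambda>x. c * f x)"
  unfolding Lconv_def
  by (auto simp: Lp_cmult right_diff_distrib[symmetric] Lpow_cmult intro!: tendsto_mult_right_zero)

lemma Lconv_add:
  assumes "Lconv s F f" "Lconv s G g" "0 \<le> s"
  shows "Lconv s (\<lambda>n x. F n x + G n x) (\<lambda>x. f x + g x)"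
  unfolding Lconv_def
proof (intro conjI allI)
  note F = LconvD[OF assms(1)] and G = LconvD[OF assms(2)]
  show "(\<lambda>x. F n x + G n x) \<in> Lp s" "(\<lambda>x. f x + g x) \<in> Lp s" for n
    using F G assms(3) by (auto intro: Lp_add)
  note * = tendsto_mult_right_zero[OF tendsto_add_zero[OF F(3) G(3)], of "2 powr s"]
  have le: "Lpow s (\<lambda>x. F n x + G n x - (f x + g x))
     \<le> 2 powr s * (Lpow s (\<lambda>x. F n x - f x) + Lpow s (\<lambda>x. G n x - g x))" for n
    using Lpow_add_le[OF Lp_diff[OF F(1,2) assms(3)] Lp_diff[OF G(1,2) assms(3)] assms(3), of n n]
    by (simp add: algebra_simps)
  show "(\<lambda>n. Lpow s (\<lambda>x. F n x + G n x - (f x + g x))) \<longlonglongrightarrow> 0"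
    by (rule tendsto_zero_squeeze[OF Lpow_nonneg le *])
qed

lemma Lconv_sum:
  assumes "\<And>i. i \<in> I \<Longrightarrow> Lconv s (F i) (f i)" "0 \<le> s"
  shows "Lconv s (\<lambda>n x. \<Sum>i\<in>I. F i n x) (\<lambda>x. \<Sum>i\<in>I. f i x)"
  using assms
  by (induction I rule: infinite_finite_induct) (auto intro: Lconv_add simp: Lconv_const)

lemma Lconv_bounded:
  assumes "Lconv s F f" "0 \<le> s"
  obtains B where "0 \<le> B" "\<And>n. Lpow s (F n) \<le> B"
proof -
  note F = LconvD[OF assms(1)]
  have "Bseq (\<lambda>n. Lpow s (\<lambda>x. F n x - f x))"
    using F(3) by (metis convergent_def convergent_imp_Bseq)
  then obtain K where K: "\<And>n. \<bar>Lpow s (\<lambda>x. F n x - f x)\<bar> \<le> K"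
    by (auto simp: Bseq_def)
  have K0: "0 \<le> K" using order_trans[OF abs_ge_zero K[of 0]] .
  have "Lpow s (F n) \<le> 2 powr s * (K + Lpow s f)" for n
  proof -
    have "Lpow s (F n) = Lpow s (\<lambda>x. (F n x - f x) + f x)" by simp
    also have "\<dots> \<le> 2 powr s * (Lpow s (\<lambda>x. F n x - f x) + Lpow s f)"
      using F assms by (intro Lpow_add_le Lp_diff)
    also have "\<dots> \<le> 2 powr s * (K + Lpow s f)"
      using K[of n] by (intro mult_left_mono) auto
    finally show ?thesis .
  qed
  then show ?thesis using K0 by (intro that[of "2 powr s * (K + Lpow s f)"]) auto
qed

text \<open>The difference of products splits as (F - f) G + f (G - g), and \<open>G\<close> stays
  bounded along the sequence.\<close>

lemma Lconv_mult:
  assumes "Lconv a F f" "Lconv b G g" "0 < a" "0 < b" "0 < c" "1 / a + 1 / b = 1 / c"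
  shows "Lconv c (\<lambda>n x. F n x * G n x) (\<lambda>x. f x * g x)"
proof -
  note F = LconvD[OF assms(1)] and G = LconvD[OF assms(2)]
  obtain B where B: "0 \<le> B" "\<And>n. Lpow b (G n) \<le> B" using Lconv_bounded[OF assms(2)] assms by auto
  have ba: "1 / b + 1 / a = 1 / c" using assms by simp
  have d1: "(\<lambda>x. F n x - f x) \<in> Lp a" for n using F assms by (intro Lp_diff) auto
  have d2: "(\<lambda>x. G n x - g x) \<in> Lp b" for n using G assms by (intro Lp_diff) auto
  have le: "Lpow c (\<lambda>x. F n x * G n x - f x * g x) \<le>
     2 powr c * (Lpow a (\<lambda>x. F n x - f x) powr (c / a) * B powr (c / b)
              + Lpow a f powr (c / a) * Lpow b (\<lambda>x. G n x - g x) powr (c / b))" for n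
  proof -
    have "Lpow c (\<lambda>x. F n x * G n x - f x * g x)
       = Lpow c (\<lambda>x. (F n x - f x) * G n x + f x * (G n x - g x))"
      by (simp add: algebra_simps)
    also have "\<dots> \<le> 2 powr c * (Lpow c (\<lambda>x. (F n x - f x) * G n x) + Lpow c (\<lambda>x. f x * (G n x - g x)))"
      using assms d1 d2 F G by (intro Lpow_add_le Holder(1)[of a b]) auto
    also have "\<dots> \<le> 2 powr c * (Lpow a (\<lambda>x. F n x - f x) powr (c / a) * Lpow b (G n) powr (c / b)
              + Lpow a f powr (c / a) * Lpow b (\<lambda>x. G n x - g x) powr (c / b))"
      using assms d1 d2 F G by (intro mult_left_mono add_mono Holder(2)) auto
    also have "\<dots> \<le> 2 powr c * (Lpow a (\<lambda>x. F n x - f x) powr (c / a) * B powr (c / b)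
              + Lpow a f powr (c / a) * Lpow b (\<lambda>x. G n x - g x) powr (c / b))"
      using assms B by (intro mult_left_mono add_right_mono powr_mono2) auto
    finally show ?thesis .
  qed
  have z: "(\<lambda>n. h n powr e) \<longlonglongrightarrow> 0" if "h \<longlonglongrightarrow> 0" "0 < e" "\<And>n. 0 \<le> h n" for h :: "nat \<Rightarrow> real" and e
    using tendsto_powr2[OF that(1) tendsto_const[of e]] that by simp
  have "0 < c / a" "0 < c / b" using assms by auto
  then have "(\<lambda>n. Lpow c (\<lambda>x. F n x * G n x - f x * g x)) \<longlonglongrightarrow> 0"
    by (intro tendsto_zero_squeeze[OF Lpow_nonneg le] tendsto_mult_right_zero tendsto_add_zero
        tendsto_mult_left_zero z F(3) G(3) Lpow_nonneg)
  moreover have "(\<lambda>x. F n x * G n x) \<in> Lp c" "(\<lambda>x. f x * g x) \<in> Lp c" for n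
    using assms F G by (auto intro!: Holder(1)[of a b c])
  ultimately show ?thesis
    unfolding Lconv_def by blast
qed

lemma Lconv_1_integral:
  assumes "Lconv 1 F f"
  shows "(\<lambda>n. LINT x|lborel. F n x) \<longlonglongrightarrow> (LINT x|lborel. f x)"
proof -
  note F = LconvD[OF assms]
  have i: "integrable lborel (F n)" "integrable lborel f" for n
    using F by (auto simp: Lp_1_iff)
  have "\<bar>(LINT x|lborel. F n x) - (LINT x|lborel. f x)\<bar> \<le> Lpow 1 (\<lambda>x. F n x - f x)" for n
    using integral_abs_bound[of lborel "\<lambda>x. F n x - f x"] i by (simp add: Lpow_1)
  then have "(\<lambda>n. \<bar>(LINT x|lborel. F n x) - (LINT x|lborel. f x)\<bar>) \<longlonglongrightarrow> 0"
    by (rule tendsto_zero_squeeze[OF abs_ge_zero _ F(3)])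
  then show ?thesis by (simp add: LIM_zero_iff tendsto_rabs_zero_iff)
qed

lemma Lconv_integral_mult:
  assumes "Lconv a F f" "Lconv b G g" "0 < a" "0 < b" "1 / a + 1 / b = 1"
  shows "(\<lambda>n. LINT x|lborel. F n x * G n x) \<longlonglongrightarrow> (LINT x|lborel. f x * g x)"
  using assms by (intro Lconv_1_integral Lconv_mult[of a _ _ b]) auto

text \<open>Fatou's lemma in the form in which uniform bounds pass to a limit known only almost
  everywhere; integrability of the limit is part of the conclusion.\<close>

lemma Lpow_Fatou:
  assumes F: "\<And>n. F n \<in> Lp s" "\<And>n. Lpow s (F n) \<le> B"
    and f: "f \<in> borel_measurable borel" "AE x in lborel. (\<lambda>n. F n x) \<longlonglongrightarrow> f x" and "0 < s"
  shows "f \<in> Lp s" "Lpow s f \<le> B"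
proof -
  note [measurable] = Lp_measurable[OF F(1)] f(1)
  have B: "0 \<le> B" using F(2)[of 0] Lpow_nonneg[of s "F 0"] by linarith
  have "(\<integral>\<^sup>+x. ennreal (\<bar>f x\<bar> powr s) \<partial>lborel) = (\<integral>\<^sup>+x. liminf (\<lambda>n. ennreal (\<bar>F n x\<bar> powr s)) \<partial>lborel)"
  proof (rule nn_integral_cong_AE, use f(2) in eventually_elim)
    case (elim x)
    then have "(\<lambda>n. ennreal (\<bar>F n x\<bar> powr s)) \<longlonglongrightarrow> ennreal (\<bar>f x\<bar> powr s)"
      using \<open>0 < s\<close> by (intro tendsto_ennrealI tendsto_powr2 tendsto_intros) auto
    from lim_imp_Liminf[OF sequentially_bot this] show ?case by (rule sym)
  qed
  also have "\<dots> \<le> liminf (\<lambda>n. \<integral>\<^sup>+x. ennreal (\<bar>F n x\<bar> powr s) \<partial>lborel)"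
    by (rule nn_integral_liminf) measurable
  also have "\<dots> = liminf (\<lambda>n. ennreal (Lpow s (F n)))"
    using F(1) unfolding Lpow_def by (subst nn_integral_eq_integral) (auto simp: Lp_integrable)
  also have "\<dots> \<le> liminf (\<lambda>n. ennreal B)"
    using F(2) by (intro Liminf_mono always_eventually allI ennreal_leI)
  finally have le: "(\<integral>\<^sup>+x. ennreal (\<bar>f x\<bar> powr s) \<partial>lborel) \<le> ennreal B"
    by (simp add: Liminf_const)
  show "f \<in> Lp s"
    by (intro LpI integrableI_nonneg) (use le in \<open>auto intro: le_less_trans\<close>)
  show "Lpow s f \<le> B"
    unfolding Lpow_def using le B by (subst integral_eq_nn_integral) (auto intro: enn2real_leI)
qed

lemma Lconv_AE_subseq:
  assumes "Lconv s F f" "0 < s"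
  obtains r where "strict_mono r" "AE x in lborel. (\<lambda>n. F (r n) x) \<longlonglongrightarrow> f x"
proof -
  note F = LconvD[OF assms(1)]
  have i: "integrable lborel (\<lambda>x. \<bar>F n x - f x\<bar> powr s)" for n
    using F assms by (intro Lp_integrable Lp_diff) auto
  have "(\<lambda>n. LINT x|lborel. norm (\<bar>F n x - f x\<bar> powr s)) \<longlonglongrightarrow> 0"
    using F(3) by (simp add: Lpow_def)
  from tendsto_L1_AE_subseq[OF i this] obtain r where
    r: "strict_mono r" "AE x in lborel. (\<lambda>n. \<bar>F (r n) x - f x\<bar> powr s) \<longlonglongrightarrow> 0" by auto
  have "AE x in lborel. (\<lambda>n. F (r n) x) \<longlonglongrightarrow> f x"
    using r(2)
  proof eventually_elim
    case (elim x)
    then have "(\<lambda>n. (\<bar>F (r n) x - f x\<bar> powr s) powr (1 / s)) \<longlonglongrightarrow> 0 powr (1 / s)"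
      using assms by (intro tendsto_powr2 tendsto_intros) auto
    then have "(\<lambda>n. \<bar>F (r n) x - f x\<bar>) \<longlonglongrightarrow> 0"
      using assms by (simp add: powr_powr)
    then show ?case by (simp add: LIM_zero_iff tendsto_rabs_zero_iff)
  qed
  with r(1) show ?thesis by (rule that)
qed

section \<open>Translations and completeness\<close>

lemma lborel_integrable_translate:
  fixes f :: "'a::euclidean_space \<Rightarrow> 'b::{banach, second_countable_topology}"
  assumes "integrable lborel f"
  shows "integrable lborel (\<lambda>x. f (x + w))"
proof -
  have "integrable (distr lborel borel ((+) w)) f" using assms by (simp add: lborel_distr_plus)
  from integrable_distr[OF _ this] show ?thesis by (simp add: add.commute)
qed

lemma lborel_integral_translate:
  fixes f :: "'a::euclidean_space \<Rightarrow> 'b::{banach, second_countable_topology}"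
  assumes "f \<in> borel_measurable borel"
  shows "(LINT x|lborel. f (x + w)) = (LINT x|lborel. f x)"
proof -
  have "(LINT x|lborel. f x) = (LINT x|distr lborel borel ((+) w). f x)" by (simp add: lborel_distr_plus)
  also have "\<dots> = (LINT x|lborel. f (w + x))" using assms by (intro integral_distr) auto
  finally show ?thesis by (simp add: add.commute)
qed

lemma lborel_nn_integral_translate:
  fixes f :: "'a::euclidean_space \<Rightarrow> ennreal"
  assumes "f \<in> borel_measurable borel"
  shows "(\<integral>\<^sup>+x. f (x + w) \<partial>lborel) = (\<integral>\<^sup>+x. f x \<partial>lborel)"
proof -
  have "(\<integral>\<^sup>+x. f x \<partial>lborel) = (\<integral>\<^sup>+x. f x \<partial>distr lborel borel ((+) w))" by (simp add: lborel_distr_plus)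
  also have "\<dots> = (\<integral>\<^sup>+x. f (w + x) \<partial>lborel)" using assms by (intro nn_integral_distr) auto
  finally show ?thesis by (simp add: add.commute)
qed

lemma Lp_translate: "f \<in> Lp s \<Longrightarrow> (\<lambda>x. f (x + w)) \<in> Lp s"
  unfolding Lp_def using lborel_integrable_translate[of "\<lambda>x. \<bar>f x\<bar> powr s" w] by auto

lemma Lpow_translate: "f \<in> borel_measurable borel \<Longrightarrow> Lpow s (\<lambda>x. f (x + w)) = Lpow s f"
  unfolding Lpow_def by (rule lborel_integral_translate[of "\<lambda>x. \<bar>f x\<bar> powr s"]) measurable

text \<open>Riesz--Fischer for every positive exponent: along a subsequence the increments decrease
  geometrically at almost every point, and Fatou's lemma upgrades the pointwise limit to a limit of
  the whole sequence.\<close>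

lemma Lp_complete:
  fixes F :: "nat \<Rightarrow> 'a::euclidean_space \<Rightarrow> real"
  assumes F: "\<And>n. F n \<in> Lp s" and s: "0 < s"
    and cauchy: "\<And>e. 0 < e \<Longrightarrow> \<exists>N. \<forall>m\<ge>N. \<forall>n\<ge>N. Lpow s (\<lambda>x. F m x - F n x) < e"
  obtains f where "Lconv s F f"
proof -
  define a where "a k = (1/2::real) ^ k" for k :: nat
  have a: "0 < a k" "a k \<le> 1" for k by (auto simp: a_def power_le_one)
  \<comment> \<open>The exponent \<open>s + 1\<close> leaves room for a weight
    \<open>(1 / a k) powr s\<close>: the weighted integrals are still bounded by the summable
    \<open>a k\<close>, and the s-th root of a weighted pointwise bound is a multiple of
    \<open>a k\<close>.\<close>
  define e where "e k = a k powr (s + 1)" for k :: nat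
  have e0: "0 < e k" for k using a[of k] by (simp add: e_def)
  have "\<forall>k. \<exists>N. \<forall>m\<ge>N. \<forall>n\<ge>N. Lpow s (\<lambda>x. F m x - F n x) < e k"
    using cauchy e0 by blast
  then obtain N where N: "\<And>k m n. m \<ge> N k \<Longrightarrow> n \<ge> N k \<Longrightarrow> Lpow s (\<lambda>x. F m x - F n x) < e k"
    by metis
  \<comment> \<open>Adding up all earlier thresholds makes the indices increase with
    \<open>k\<close>.\<close>
  define r where "r k = (\<Sum>j\<le>k. N j) + k" for k
  have rN: "r k \<ge> N k" for k
    unfolding r_def by (rule trans_le_add1, rule member_le_sum) auto
  have rm: "r k \<le> r (Suc k)" for k by (simp add: r_def)
  have r_ge: "k \<le> r k" for k by (simp add: r_def)
  define d where "d k x = \<bar>F (r (Suc k)) x - F (r k) x\<bar> powr s" for k x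
  note [measurable] = Lp_measurable[OF F]
  have d_le: "(\<integral>\<^sup>+x. ennreal (d k x) \<partial>lborel) \<le> ennreal (e k)" for k
  proof -
    have "(\<integral>\<^sup>+x. ennreal (d k x) \<partial>lborel) = ennreal (Lpow s (\<lambda>x. F (r (Suc k)) x - F (r k) x))"
      unfolding d_def Lpow_def using F s
      by (intro nn_integral_eq_integral Lp_integrable Lp_diff) auto
    also have "\<dots> \<le> ennreal (e k)"
      using N[of k "r (Suc k)" "r k"] rN[of k] rm[of k] by (intro ennreal_leI) auto
    finally show ?thesis .
  qed
  define w where "w k = (1 / a k) powr s" for k
  have w: "0 < w k" for k using a[of k] by (simp add: w_def)
  have we: "w k * e k = a k" for k
    using a[of k] s by (simp add: w_def e_def powr_add powr_divide)
  have "(\<integral>\<^sup>+x. (\<Sum>k. ennreal (w k * d k x)) \<partial>lborel)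
      = (\<Sum>k. \<integral>\<^sup>+x. ennreal (w k * d k x) \<partial>lborel)"
    by (rule nn_integral_suminf) (simp add: d_def)
  also have "\<dots> \<le> (\<Sum>k. ennreal (a k))"
  proof (intro suminf_le summableI)
    fix k
    have "(\<integral>\<^sup>+x. ennreal (w k * d k x) \<partial>lborel) = ennreal (w k) * (\<integral>\<^sup>+x. ennreal (d k x) \<partial>lborel)"
      using w[of k] by (subst nn_integral_cmult[symmetric]) (simp_all add: d_def ennreal_mult)
    also have "\<dots> \<le> ennreal (w k) * ennreal (e k)"
      by (intro mult_left_mono d_le) auto
    also have "\<dots> = ennreal (a k)"
      using w[of k] by (simp add: ennreal_mult'[symmetric] we)
    finally show "(\<integral>\<^sup>+x. ennreal (w k * d k x) \<partial>lborel) \<le> ennreal (a k)" .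
  qed
  also have "\<dots> < \<infinity>"
    unfolding a_def by (subst suminf_ennreal2) (auto intro: summable_geometric)
  finally have "AE x in lborel. (\<Sum>k. ennreal (w k * d k x)) \<noteq> \<infinity>"
    by (intro nn_integral_PInf_AE) (simp_all add: d_def)
  then have conv: "AE x in lborel. convergent (\<lambda>k. F (r k) x)"
  proof eventually_elim
    case (elim x)
    have d0: "0 \<le> w k * d k x" for k using w[of k] by (simp add: d_def)
    have "summable (\<lambda>k. w k * d k x)"
      by (rule summable_suminf_not_top[OF d0]) (use elim in simp)
    then have "Bseq (\<lambda>k. w k * d k x)"
      using summable_imp_Bseq by blast
    then obtain K where K: "0 < K" "\<And>k. norm (w k * d k x) \<le> K"
      by (rule BseqE) blast
    have dl: "norm (F (r (Suc k)) x - F (r k) x) \<le> K powr (1 / s) * a k" for k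
    proof -
      have "w k * d k x \<le> K" using K(2)[of k] d0[of k] by simp
      then have "d k x \<le> K / w k" using w[of k] by (simp add: mult.commute pos_le_divide_eq)
      also have "\<dots> = K * a k powr s" using a[of k] by (simp add: w_def powr_divide)
      finally have "d k x powr (1/s) \<le> (K * a k powr s) powr (1 / s)"
        using s by (intro powr_mono2) (simp_all add: d_def)
      also have "\<dots> = K powr (1 / s) * a k"
        using s K a[of k] by (simp add: powr_mult powr_powr)
      finally show ?thesis
        using s by (simp add: d_def powr_powr)
    qed
    have su: "summable (\<lambda>k. K powr (1 / s) * a k)"
      unfolding a_def by (intro summable_mult summable_geometric) simp
    have "summable (\<lambda>k. F (r (Suc k)) x - F (r k) x)"
      by (rule summable_comparison_test'[OF su dl])
    then have "convergent (\<lambda>n. \<Sum>k<n. F (r (Suc k)) x - F (r k) x)"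
      by (simp only: summable_iff_convergent)
    then have "convergent (\<lambda>n. F (r n) x - F (r 0) x)"
      by (simp only: sum_lessThan_telescope[of "\<lambda>k. F (r k) x"])
    then have "convergent (\<lambda>n. F (r n) x - F (r 0) x + F (r 0) x)"
      by (intro convergent_add convergent_const)
    then show ?case by simp
  qed
  define f where "f x = lim (\<lambda>k. F (r k) x)" for x
  have fm[measurable]: "f \<in> borel_measurable borel"
    unfolding f_def by (intro borel_measurable_lim_metric) measurable
  have ae: "AE x in lborel. (\<lambda>k. F (r k) x) \<longlonglongrightarrow> f x"
    using conv by eventually_elim (simp add: f_def convergent_LIMSEQ_iff)
  \<comment> \<open>Here \<open>n\<close> is fixed while the subsequence tends to \<open>f\<close>,
    so the Cauchy bound becomes a bound for the distance to the limit.\<close>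
  have *: "(\<lambda>x. F n x - f x) \<in> Lp s \<and> Lpow s (\<lambda>x. F n x - f x) \<le> e k" if n: "n \<ge> N k" for n k
  proof -
    have "AE x in lborel. (\<lambda>j. F n x - F (r (k + j)) x) \<longlonglongrightarrow> F n x - f x"
      using ae
    proof eventually_elim
      case (elim x)
      from LIMSEQ_ignore_initial_segment[OF this, of k] have "(\<lambda>j. F (r (k + j)) x) \<longlonglongrightarrow> f x"
        by (simp add: add.commute)
      then show ?case by (intro tendsto_diff tendsto_const)
    qed
    moreover have "r (k + j) \<ge> N k" for j
      using rN[of k] lift_Suc_mono_le[of r k "k + j", OF rm] by simp
    then have "Lpow s (\<lambda>x. F n x - F (r (k + j)) x) \<le> e k" for j
      using N[OF n] by (simp add: less_imp_le)
    moreover have "(\<lambda>x. F n x - F (r (k + j)) x) \<in> Lp s" for j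
      using F s by (intro Lp_diff) auto
    ultimately show ?thesis
      using s Lpow_Fatou[of "\<lambda>j x. F n x - F (r (k + j)) x" s "e k" "\<lambda>x. F n x - f x"] by auto
  qed
  have "f \<in> Lp s"
    using Lp_diff[OF F conjunct1[OF *[of 0 "N 0"]], of "N 0"] s by simp
  moreover have "(\<lambda>n. Lpow s (\<lambda>x. F n x - f x)) \<longlonglongrightarrow> 0"
  proof (rule LIMSEQ_I)
    fix \<epsilon> :: real assume "0 < \<epsilon>"
    have "a \<longlonglongrightarrow> 0"
      unfolding a_def by (intro LIMSEQ_realpow_zero) auto
    then obtain k where "a k < \<epsilon>"
      using \<open>0 < \<epsilon>\<close> order_tendstoD(2)[of a 0 sequentially \<epsilon>] eventually_happens'[OF sequentially_bot] by blast
    moreover have "e k \<le> a k powr 1"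
      unfolding e_def using a[of k] s by (intro powr_mono') auto
    ultimately have "e k < \<epsilon>" using a[of k] by simp
    then show "\<exists>no. \<forall>n\<ge>no. norm (Lpow s (\<lambda>x. F n x - f x) - 0) < \<epsilon>"
      using * by (intro exI[of _ "N k"]) (auto intro: le_less_trans)
  qed
  ultimately show ?thesis
    using F by (intro that[of f]) (auto simp: Lconv_def)
qed

section \<open>Test functions\<close>

lemma compact_support_iff:
  "compact_support f \<longleftrightarrow> (\<exists>R>0. \<forall>x. R < norm x \<longrightarrow> f x = 0)"
proof
  assume "compact_support f"
  then have "bounded (closure {x. f x \<noteq> 0})"
    by (simp add: compact_support_def compact_imp_bounded)
  then have "bounded {x. f x \<noteq> 0}" using bounded_subset closure_subset by blast
  then obtain R where R: "0 < R" "\<And>x. x \<in> {x. f x \<noteq> 0} \<Longrightarrow> norm x \<le> R"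
    unfolding bounded_pos by auto
  show "\<exists>R>0. \<forall>x. R < norm x \<longrightarrow> f x = 0"
    using R by (intro exI[of _ R]) force
next
  assume "\<exists>R>0. \<forall>x. R < norm x \<longrightarrow> f x = 0"
  then obtain R where "\<forall>x. R < norm x \<longrightarrow> f x = 0" by auto
  then have "bounded {x. f x \<noteq> 0}"
    by (intro boundedI[of _ R]) (auto simp: not_less[symmetric])
  then show "compact_support f"
    by (simp add: compact_support_def compact_closure)
qed

lemma compact_supportE:
  assumes "compact_support f"
  obtains R where "0 < R" "\<And>x. R < norm x \<Longrightarrow> f x = 0"
  using assms unfolding compact_support_iff by blast

lemma compact_supportI: "(\<And>x. R < norm x \<Longrightarrow> f x = 0) \<Longrightarrow> compact_support f"
  unfolding compact_support_iff by (intro exI[of _ "max R 1"]) auto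

lemma compact_support_mult:
  fixes f g :: "real^3 \<Rightarrow> real"
  shows "compact_support f \<Longrightarrow> compact_support (\<lambda>x. f x * g x)"
  by (elim compact_supportE, rule compact_supportI) auto

lemma compact_support_partial:
  fixes f :: "real^3 \<Rightarrow> real"
  assumes "compact_support f"
  shows "compact_support (partial i f)"
proof -
  obtain R where R: "0 < R" "\<And>x. R < norm x \<Longrightarrow> f x = 0" using assms unfolding compact_support_iff by blast
  show ?thesis
  proof (rule compact_supportI)
    fix x :: "real^3" assume x: "R < norm x"
    have "open {y. R < norm (y::real^3)}" by (intro open_Collect_less continuous_intros)
    then have "(f has_derivative (\<lambda>h. 0)) (at x)"
      using R x by (intro has_derivative_transform_within_open[OF has_derivative_const, of "{y. R < norm y}" x 0 f]) auto
    from frechet_derivative_at[OF this, symmetric] show "partial i f x = 0" by (simp add: partial_def)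
  qed
qed

section \<open>Calculus of partial derivatives\<close>

lemma partial_eqI: "(f has_derivative D) (at x) \<Longrightarrow> partial i f x = D (axis i 1)"
  using frechet_derivative_at[of f D x] by (simp add: partial_def)

lemma has_derivative_partial:
  fixes f :: "real^3 \<Rightarrow> real"
  assumes "f differentiable (at x)"
  shows "(f has_derivative (\<lambda>h. \<Sum>j\<in>UNIV. h $ j * partial j f x)) (at x)"
proof -
  have D: "(f has_derivative frechet_derivative f (at x)) (at x)"
    using assms frechet_derivative_works by blast
  interpret linear "frechet_derivative f (at x)" using D by (rule has_derivative_linear)
  have "frechet_derivative f (at x) h = (\<Sum>j\<in>UNIV. h $ j * partial j f x)" for h
  proof -
    have "frechet_derivative f (at x) h = frechet_derivative f (at x) (\<Sum>j\<in>UNIV. h $ j *\<^sub>R axis j 1)"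
      by (simp add: basis_expansion scalar_mult_eq_scaleR[symmetric])
    also have "\<dots> = (\<Sum>j\<in>UNIV. h $ j * partial j f x)"
      by (simp add: sum scale partial_def)
    finally show ?thesis .
  qed
  then have "frechet_derivative f (at x) = (\<lambda>h. \<Sum>j\<in>UNIV. h $ j * partial j f x)" by blast
  with D show ?thesis by simp
qed

lemma has_derivative_imp_partial:
  fixes f :: "real^3 \<Rightarrow> real"
  assumes "(f has_derivative (\<lambda>h. \<Sum>j\<in>UNIV. h $ j * g j)) (at x)"
  shows "partial i f x = g i"
proof -
  have "(\<Sum>j\<in>UNIV. axis i (1::real) $ j * g j) = (\<Sum>j\<in>UNIV. if j = i then g j else 0)"
    by (intro sum.cong) (auto simp: axis_def)
  then show ?thesis using partial_eqI[OF assms, of i] by simp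
qed

lemma C_diff_Suc_imp: "C_diff (Suc k) f \<Longrightarrow> C_diff k f"
proof (induction k arbitrary: f)
  case 0
  then show ?case
    by (auto intro!: continuous_at_imp_continuous_on differentiable_imp_continuous_within)
next
  case (Suc k)
  then show ?case unfolding C_diff.simps(2)[of "Suc k" f] C_diff.simps(2)[of k f] by blast
qed

lemma C_diff_le: "C_diff n f \<Longrightarrow> k \<le> n \<Longrightarrow> C_diff k f"
  by (induction n) (auto simp: le_Suc_eq simp del: C_diff.simps dest: C_diff_Suc_imp)

lemma C_diff_continuous: "C_diff k f \<Longrightarrow> continuous_on UNIV f"
  using C_diff_le[of k f 0] by simp

lemma partial_const [simp]: "partial i (\<lambda>x. c) = (\<lambda>x. 0)"
  by (rule ext) (rule partial_eqI[OF has_derivative_const])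

lemma C_diff_const: "C_diff k (\<lambda>x. c)"
  by (induction k arbitrary: c) (auto simp: continuous_on_const)

lemma partial_add:
  assumes "f differentiable (at x)" "g differentiable (at x)"
  shows "partial i (\<lambda>x. f x + g x) x = partial i f x + partial i g x"
proof -
  have "((\<lambda>x. f x + g x) has_derivative (\<lambda>h. frechet_derivative f (at x) h + frechet_derivative g (at x) h)) (at x)"
    using assms by (intro has_derivative_add) (auto simp: frechet_derivative_works[symmetric])
  from partial_eqI[OF this, of i] show ?thesis by (simp add: partial_def)
qed

lemma C_diff_add: "C_diff k f \<Longrightarrow> C_diff k g \<Longrightarrow> C_diff k (\<lambda>x. f x + g x)"
proof (induction k arbitrary: f g)
  case (Suc k)
  then have "partial i (\<lambda>x. f x + g x) = (\<lambda>x. partial i f x + partial i g x)" for i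
    by (intro ext partial_add) auto
  with Suc show ?case by (auto intro: differentiable_add)
qed (auto intro: continuous_on_add)

lemma partial_mult:
  fixes f g :: "real^3 \<Rightarrow> real"
  assumes "f differentiable (at x)" "g differentiable (at x)"
  shows "partial i (\<lambda>x. f x * g x) x = partial i f x * g x + f x * partial i g x"
proof -
  have "((\<lambda>x. f x * g x) has_derivative (\<lambda>h. f x * frechet_derivative g (at x) h + frechet_derivative f (at x) h * g x)) (at x)"
    using assms by (intro has_derivative_mult) (auto simp: frechet_derivative_works[symmetric])
  from partial_eqI[OF this, of i] show ?thesis by (simp add: partial_def)
qed

lemma C_diff_mult:
  fixes f g :: "real^3 \<Rightarrow> real"
  shows "C_diff k f \<Longrightarrow> C_diff k g \<Longrightarrow> C_diff k (\<lambda>x. f x * g x)"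
proof (induction k arbitrary: f g)
  case (Suc k)
  then have "partial i (\<lambda>x. f x * g x) = (\<lambda>x. partial i f x * g x + f x * partial i g x)" for i
    by (intro ext partial_mult) auto
  moreover have "C_diff k f" "C_diff k g" using Suc.prems C_diff_Suc_imp by blast+
  ultimately show ?case using Suc by (auto intro!: differentiable_mult C_diff_add)
qed (auto intro: continuous_on_mult)

lemma C_diff_prod:
  fixes f :: "'i \<Rightarrow> real^3 \<Rightarrow> real"
  shows "(\<And>i. i \<in> I \<Longrightarrow> C_diff k (f i)) \<Longrightarrow> C_diff k (\<lambda>x. \<Prod>i\<in>I. f i x)"
  by (induction I rule: infinite_finite_induct) (auto intro: C_diff_mult simp: C_diff_const)

lemma C_diff_cmult:
  fixes f :: "real^3 \<Rightarrow> real"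
  shows "C_diff k f \<Longrightarrow> C_diff k (\<lambda>x. c * f x)"
  by (intro C_diff_mult C_diff_const)

lemma partial_cmult:
  fixes f :: "real^3 \<Rightarrow> real"
  assumes "f differentiable (at x)"
  shows "partial i (\<lambda>x. c * f x) x = c * partial i f x"
  using partial_mult[of "\<lambda>x. c" x f i] assms by simp

lemma affine_has_derivative:
  fixes f :: "real^3 \<Rightarrow> real"
  assumes "f differentiable (at (a + c *\<^sub>R x))"
  shows "((\<lambda>x. f (a + c *\<^sub>R x)) has_derivative (\<lambda>h. \<Sum>j\<in>UNIV. h $ j * (c * partial j f (a + c *\<^sub>R x)))) (at x)"
proof -
  have "((\<lambda>x. f (a + c *\<^sub>R x)) has_derivative (\<lambda>h. \<Sum>j\<in>UNIV. (c *\<^sub>R h) $ j * partial j f (a + c *\<^sub>R x))) (at x)"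
    by (rule has_derivative_compose[of "\<lambda>x. a + c *\<^sub>R x" "\<lambda>h. c *\<^sub>R h" x UNIV f, OF _ has_derivative_partial[OF assms]])
       (auto intro!: derivative_eq_intros)
  then show ?thesis by (simp add: mult.assoc mult.left_commute)
qed

lemma partial_affine:
  fixes f :: "real^3 \<Rightarrow> real"
  assumes "f differentiable (at (a + c *\<^sub>R x))"
  shows "partial i (\<lambda>x. f (a + c *\<^sub>R x)) x = c * partial i f (a + c *\<^sub>R x)"
  by (rule has_derivative_imp_partial[OF affine_has_derivative[OF assms]])

lemma C_diff_affine:
  fixes f :: "real^3 \<Rightarrow> real"
  shows "C_diff k f \<Longrightarrow> C_diff k (\<lambda>x. f (a + c *\<^sub>R x))"
proof (induction k arbitrary: f)
  case 0
  then show ?case by (auto intro!: continuous_on_compose2[of UNIV f] continuous_intros)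
next
  case (Suc k)
  then have "partial i (\<lambda>x. f (a + c *\<^sub>R x)) = (\<lambda>x. c * partial i f (a + c *\<^sub>R x))" for i
    by (intro ext partial_affine) auto
  moreover have "(\<lambda>x. f (a + c *\<^sub>R x)) differentiable (at x)" for x
    using affine_has_derivative[of f a c x] Suc.prems by (auto simp: differentiable_def)
  ultimately show ?case using Suc by (auto intro!: C_diff_cmult)
qed

lemma compact_support_affine:
  assumes "compact_support f" "c \<noteq> 0"
  shows "compact_support (\<lambda>x. f (a + c *\<^sub>R x))"
proof -
  obtain R where R: "0 < R" "\<And>x. R < norm x \<Longrightarrow> f x = 0" using assms(1) unfolding compact_support_iff by blast
  show ?thesis
  proof (rule compact_supportI)
    fix x :: "real^3" assume "(R + norm a) / \<bar>c\<bar> < norm x"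
    then have "R + norm a < norm (c *\<^sub>R x)" using assms(2) by (simp add: field_simps)
    also have "norm (c *\<^sub>R x) \<le> norm (a + c *\<^sub>R x) + norm a"
      using norm_triangle_ineq4[of "a + c *\<^sub>R x" a] by simp
    finally show "f (a + c *\<^sub>R x) = 0" by (intro R) simp
  qed
qed

text \<open>Derivatives of \<open>exp (- 1 / t)\<close> stay in this family, which is what makes \<open>bump\<close> smooth.\<close>

definition exp_flat :: "real poly \<Rightarrow> real \<Rightarrow> real" where
  "exp_flat p t = (if 0 < t then poly p (1 / t) * exp (- (1 / t)) else 0)"

lemma poly_exp_tendsto_0:
  fixes p :: "real poly"
  shows "((\<lambda>s. poly p s * exp (- s)) \<longlongrightarrow> 0) at_top"
proof -
  have "((\<lambda>s. \<Sum>i\<le>degree p. coeff p i * (s ^ i / exp s)) \<longlongrightarrow> (\<Sum>i\<le>degree p. coeff p i * 0)) at_top"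
    by (intro tendsto_sum tendsto_mult tendsto_const tendsto_power_div_exp_0)
  moreover have "(\<Sum>i\<le>degree p. coeff p i * (s ^ i / exp s)) = poly p s * exp (- s)" for s
    by (simp add: poly_altdef sum_distrib_right exp_minus divide_inverse mult.assoc)
  ultimately show ?thesis by simp
qed

text \<open>With s = 1 / t the derivative in t is - s^2 times the derivative in s, so p(s) exp (- s)
  turns into s^2 (p(s) - p'(s)) exp (- s). At the origin both one-sided difference quotients tend to
  0.\<close>

lemma exp_flat_DERIV:
  "(exp_flat p has_real_derivative exp_flat ([:0, 0, 1:] * (p - pderiv p)) t) (at t)"
proof -
  consider "t < 0" | "t = 0" | "0 < t" by linarith
  then show ?thesis
  proof cases
    case 1
    have "exp_flat q t = 0" for q using 1 by (simp add: exp_flat_def)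
    moreover have "((\<lambda>t. 0) has_real_derivative 0) (at t)" by (rule DERIV_const)
    then have "(exp_flat p has_real_derivative 0) (at t)"
      by (rule has_field_derivative_transform_within_open[of _ _ t "{..<0}"]) (use 1 in \<open>auto simp: exp_flat_def\<close>)
    ultimately show ?thesis by (simp only:)
  next
    case 3
    have inv: "((\<lambda>t. 1 / t) has_real_derivative - (1 / t * (1 / t))) (at t)"
      using DERIV_inverse[of t UNIV] 3 by (simp add: inverse_eq_divide power2_eq_square)
    note D = DERIV_mult[OF DERIV_chain2[OF poly_DERIV inv] DERIV_chain2[OF DERIV_exp DERIV_minus[OF inv]], of p]
    have "poly (pderiv p) (1 / t) * - (1 / t * (1 / t)) * exp (- (1 / t))
        + exp (- (1 / t)) * - (- (1 / t * (1 / t))) * poly p (1 / t) = exp_flat ([:0, 0, 1:] * (p - pderiv p)) t"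
      using 3 by (simp add: exp_flat_def) (simp add: algebra_simps diff_divide_distrib)
    from DERIV_cong[OF D this] show ?thesis
      by (rule has_field_derivative_transform_within_open[of _ _ t "{0<..}"]) (use 3 in \<open>auto simp: exp_flat_def\<close>)
  next
    case 2
    have r: "((\<lambda>h. exp_flat p h / h) \<longlongrightarrow> 0) (at_right 0)"
    proof -
      \<comment> \<open>Dividing by h multiplies by s = 1 / h, and \<open>pCons 0 p\<close> is the
        polynomial s p(s); exponential decay beats it.\<close>
      have "((\<lambda>h. poly (pCons 0 p) (inverse h) * exp (- inverse h)) \<longlongrightarrow> 0) (at_right (0::real))"
        by (rule filterlim_compose[OF poly_exp_tendsto_0 filterlim_inverse_at_top_right])
      moreover have "poly (pCons 0 p) (inverse h) * exp (- inverse h) = exp_flat p h / h" if "h \<in> {0<..<1}" for h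
        using that by (simp add: exp_flat_def inverse_eq_divide)
      ultimately show ?thesis
        using Lim_transform_eventually eventually_at_rightI[of 0 1] by (metis (mono_tags, lifting) zero_less_one)
    qed
    have "exp_flat p h / h = 0" if "h \<in> {-1<..<0}" for h
      using that by (simp add: exp_flat_def)
    then have "\<forall>\<^sub>F h in at_left 0. 0 = exp_flat p h / h"
      by (intro eventually_at_leftI[of "-1" 0]) auto
    then have l: "((\<lambda>h. exp_flat p h / h) \<longlongrightarrow> 0) (at_left 0)"
      by (rule Lim_transform_eventually[OF tendsto_const])
    have "((\<lambda>h. exp_flat p h / h) \<longlongrightarrow> 0) (at 0)"
      by (rule filterlim_split_at_real[OF l r])
    moreover have "exp_flat q 0 = 0" for q by (simp add: exp_flat_def)
    ultimately show ?thesis unfolding 2 DERIV_def by (simp only: add_0 diff_zero)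
  qed
qed

lemma C_diff_exp_flat: "C_diff k (\<lambda>x. exp_flat p (a + c * x $ i))"
proof (induction k arbitrary: p)
  case 0
  have "continuous_on UNIV (exp_flat p)"
    by (intro continuous_at_imp_continuous_on ballI DERIV_isCont[OF exp_flat_DERIV])
  then show ?case by (auto intro!: continuous_on_compose2[of UNIV "exp_flat p"] continuous_intros)
next
  case (Suc k)
  let ?q = "[:0, 0, 1:] * (p - pderiv p)"
  have D: "((\<lambda>x. exp_flat p (a + c * x $ i)) has_derivative (\<lambda>h. exp_flat ?q (a + c * x $ i) * (c * h $ i))) (at x)" for x :: "real^3"
    by (rule has_derivative_compose[of "\<lambda>x. a + c * x $ i" "\<lambda>h. c * h $ i" x UNIV "exp_flat p",
          OF _ exp_flat_DERIV[unfolded has_field_derivative_def]])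
       (rule has_derivative_add[OF has_derivative_const has_derivative_mult_right[OF
          bounded_linear_imp_has_derivative[OF bounded_linear_vec_nth]], simplified])
  have P: "partial j (\<lambda>x. exp_flat p (a + c * x $ i)) = (\<lambda>x. (c * axis j 1 $ i) * exp_flat ?q (a + c * x $ i))" for j
    by (rule ext) (simp only: partial_eqI[OF D] mult.commute)
  show ?case
    unfolding C_diff.simps(2) P
  proof (intro conjI allI C_diff_cmult Suc.IH)
    show "(\<lambda>x. exp_flat p (a + c * x $ i)) differentiable (at x)" for x :: "real^3"
      using D[of x] unfolding differentiable_def by blast
  qed
qed

text \<open>A product over the coordinates, supported in the cube of side 2 around the origin, so
  that smoothness follows from one real variable. The factors \<open>1 *\<close> and
  \<open>(-1) *\<close> match the affine form in \<open>C_diff_exp_flat\<close>.\<close>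

definition bump :: "real^3 \<Rightarrow> real" where
  "bump x = (\<Prod>i\<in>UNIV. exp_flat 1 (1 + 1 * x $ i) * exp_flat 1 (1 + (-1) * x $ i))"

lemma norm_le_3:
  fixes x :: "real^3"
  assumes "\<And>i. \<bar>x $ i\<bar> \<le> 1"
  shows "norm x \<le> 3"
proof -
  have "norm x \<le> (\<Sum>i\<in>UNIV. \<bar>x $ i\<bar>)" by (rule norm_le_l1_cart)
  also have "\<dots> \<le> (\<Sum>i\<in>(UNIV::3 set). 1)" using assms by (intro sum_mono) auto
  finally show ?thesis by simp
qed

lemma bump_Cc_infinity: "bump \<in> Cc_infinity"
  unfolding Cc_infinity_def
proof (safe)
  show "C_diff k bump" for k
    unfolding bump_def[abs_def] by (intro C_diff_prod C_diff_mult C_diff_exp_flat)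
  show "compact_support bump"
  proof (rule compact_supportI)
    fix x :: "real^3" assume "3 < norm x"
    then obtain i where "1 < \<bar>x $ i\<bar>" using norm_le_3[of x] by (meson not_le)
    then show "bump x = 0" unfolding bump_def
      by (intro prod_zero[OF _ bexI[of _ i]]) (auto simp: exp_flat_def)
  qed
qed

lemma bump_nonneg: "0 \<le> bump x"
  unfolding bump_def by (intro prod_nonneg) (auto simp: exp_flat_def)

lemma bump_0: "0 < bump 0"
  unfolding bump_def by (intro prod_pos) (auto simp: exp_flat_def)

lemma compact_support_bounded:
  fixes f :: "real^3 \<Rightarrow> real"
  assumes "continuous_on UNIV f" "compact_support f"
  obtains B where "0 \<le> B" "\<And>x. \<bar>f x\<bar> \<le> B"
proof -
  obtain R where R: "0 < R" "\<And>x. R < norm x \<Longrightarrow> f x = 0"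
    using assms(2) unfolding compact_support_iff by blast
  have "compact (f ` cball 0 R)"
    by (intro compact_continuous_image continuous_on_subset[OF assms(1)]) auto
  then obtain B where B: "0 < B" "\<And>y. y \<in> f ` cball 0 R \<Longrightarrow> norm y \<le> B"
    using compact_imp_bounded bounded_pos by metis
  have "\<bar>f x\<bar> \<le> B" for x
  proof (cases "R < norm x")
    case False
    then have "f x \<in> f ` cball 0 R" by auto
    from B(2)[OF this] show ?thesis by simp
  qed (use R B in auto)
  with B show ?thesis by (intro that[of B]) auto
qed

lemma Lp_bounded_support:
  fixes f :: "'a::euclidean_space \<Rightarrow> real"
  assumes [measurable]: "f \<in> borel_measurable borel"
    and "\<And>x. \<bar>f x\<bar> \<le> B" "\<And>x. R < norm x \<Longrightarrow> f x = 0" "0 < s"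
  shows "f \<in> Lp s"
proof (rule LpI[OF assms(1)])
  have i: "integrable lborel (\<lambda>x::'a. B powr s * indicator (cball 0 R) x)"
    using emeasure_bounded_finite[of "cball (0::'a) R"]
    by (intro integrable_mult_right integrable_real_indicator) auto
  have "\<bar>f x\<bar> powr s \<le> B powr s * indicator (cball 0 R) x" for x
    using assms(2)[of x] assms(3)[of x] \<open>0 < s\<close> by (auto simp: indicator_def intro!: powr_mono2)
  then show "integrable lborel (\<lambda>x. \<bar>f x\<bar> powr s)"
    by (intro Bochner_Integration.integrable_bound[OF i]) auto
qed

lemma Lp_compact_support:
  fixes f :: "real^3 \<Rightarrow> real"
  assumes "continuous_on UNIV f" "compact_support f" "0 < s"
  shows "f \<in> Lp s"
proof -
  obtain R where "\<And>x. R < norm x \<Longrightarrow> f x = 0"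
    using assms(2) unfolding compact_support_iff by blast
  moreover obtain B where "\<And>x. \<bar>f x\<bar> \<le> B"
    using compact_support_bounded[OF assms(1,2)] by blast
  ultimately show ?thesis
    using assms by (intro Lp_bounded_support[of f B R]) (auto intro: borel_measurable_continuous_onI)
qed

section \<open>Continuously differentiable functions of compact support\<close>

lemma Cc_1_iff:
  "f \<in> Cc 1 \<longleftrightarrow> (\<forall>x. f differentiable (at x)) \<and> (\<forall>i. continuous_on UNIV (partial i f)) \<and> compact_support f"
  by (auto simp: Cc_def)

lemma Cc_1D:
  fixes f :: "real^3 \<Rightarrow> real"
  assumes "f \<in> Cc 1"
  shows "f differentiable (at x)" "continuous_on UNIV f" "continuous_on UNIV (partial i f)"
    "compact_support f" "compact_support (partial i f)"
    "(f has_derivative (\<lambda>h. \<Sum>j\<in>UNIV. h $ j * partial j f x)) (at x)"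
proof -
  show d: "f differentiable (at x)" for x using assms unfolding Cc_1_iff by blast
  then show "continuous_on UNIV f"
    by (auto intro!: continuous_at_imp_continuous_on differentiable_imp_continuous_within)
  show "continuous_on UNIV (partial i f)" "compact_support f"
    using assms unfolding Cc_1_iff by blast+
  then show "compact_support (partial i f)" by (intro compact_support_partial)
  show "(f has_derivative (\<lambda>h. \<Sum>j\<in>UNIV. h $ j * partial j f x)) (at x)"
    by (rule has_derivative_partial[OF d])
qed

lemma Cc_infinity_imp_Cc: "f \<in> Cc_infinity \<Longrightarrow> f \<in> Cc k"
  by (auto simp: Cc_infinity_def Cc_def)

lemma Cc_1_Lp:
  fixes f :: "real^3 \<Rightarrow> real"
  assumes "f \<in> Cc 1" "0 < s"
  shows "f \<in> Lp s" "partial i f \<in> Lp s"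
  using Lp_compact_support[OF Cc_1D(2,4)[OF assms(1)] assms(2)]
    Lp_compact_support[OF Cc_1D(3,5)[OF assms(1)] assms(2)] by auto

lemma Cc_1_integrable:
  fixes f :: "real^3 \<Rightarrow> real"
  assumes "f \<in> Cc 1"
  shows "integrable lborel f" "integrable lborel (partial i f)"
  using Cc_1_Lp[OF assms, of 1] by (auto simp: Lp_1_iff)

lemma Cc_1_measurable:
  fixes f :: "real^3 \<Rightarrow> real"
  assumes "f \<in> Cc 1"
  shows "f \<in> borel_measurable borel" "partial i f \<in> borel_measurable borel"
  using Cc_1D(2,3)[OF assms] by (auto intro: borel_measurable_continuous_onI)

lemma Cc_1_mult:
  fixes f g :: "real^3 \<Rightarrow> real"
  assumes "f \<in> Cc 1" "C_diff 1 g"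
  shows "(\<lambda>x. f x * g x) \<in> Cc 1"
    "partial i (\<lambda>x. f x * g x) x = partial i f x * g x + f x * partial i g x"
  using assms partial_mult[of f x g i] by (auto simp: Cc_def intro!: C_diff_mult compact_support_mult simp del: C_diff.simps(2)) (auto simp: Cc_def)

lemma Cc_1_add:
  fixes f g :: "real^3 \<Rightarrow> real"
  assumes "f \<in> Cc 1" "g \<in> Cc 1"
  shows "(\<lambda>x. f x + g x) \<in> Cc 1" "partial i (\<lambda>x. f x + g x) x = partial i f x + partial i g x"
proof -
  obtain R where R: "\<And>x. R < norm x \<Longrightarrow> f x = 0"
    using Cc_1D(4)[OF assms(1)] unfolding compact_support_iff by blast
  obtain R' where R': "\<And>x. R' < norm x \<Longrightarrow> g x = 0"
    using Cc_1D(4)[OF assms(2)] unfolding compact_support_iff by blast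
  have "compact_support (\<lambda>x. f x + g x)"
    by (rule compact_supportI[of "max R R'"]) (use R R' in auto)
  then show "(\<lambda>x. f x + g x) \<in> Cc 1"
    using assms C_diff_add[of 1 f g] by (auto simp: Cc_def)
  show "partial i (\<lambda>x. f x + g x) x = partial i f x + partial i g x"
    using Cc_1D(1) assms by (intro partial_add) auto
qed

lemma Cc_1_cmult:
  fixes f :: "real^3 \<Rightarrow> real"
  assumes "f \<in> Cc 1"
  shows "(\<lambda>x. c * f x) \<in> Cc 1" "partial i (\<lambda>x. c * f x) x = c * partial i f x"
  using Cc_1_mult(1)[OF assms C_diff_const, of c] Cc_1_mult(2)[OF assms C_diff_const, of i c x]
  by (simp_all add: mult.commute)

lemma Cc_1_diff:
  fixes f g :: "real^3 \<Rightarrow> real"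
  assumes "f \<in> Cc 1" "g \<in> Cc 1"
  shows "(\<lambda>x. f x - g x) \<in> Cc 1" "partial i (\<lambda>x. f x - g x) x = partial i f x - partial i g x"
  using Cc_1_add[OF assms(1) Cc_1_cmult(1)[OF assms(2), of "-1"]] Cc_1_cmult(2)[OF assms(2), of i "-1"]
  by simp_all

lemma Cc_1_affine:
  fixes f :: "real^3 \<Rightarrow> real"
  assumes "f \<in> Cc 1" "c \<noteq> 0"
  shows "(\<lambda>x. f (a + c *\<^sub>R x)) \<in> Cc 1" "partial i (\<lambda>x. f (a + c *\<^sub>R x)) x = c * partial i f (a + c *\<^sub>R x)"
  using assms partial_affine[OF Cc_1D(1)[OF assms(1)], of i a c x]
  by (auto simp: Cc_def intro!: C_diff_affine compact_support_affine simp del: C_diff.simps(2))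

lemma Cc_1_translate:
  fixes f :: "real^3 \<Rightarrow> real"
  assumes "f \<in> Cc 1"
  shows "(\<lambda>x. f (x + a)) \<in> Cc 1" "partial i (\<lambda>x. f (x + a)) x = partial i f (x + a)"
  using Cc_1_affine(1)[OF assms, of 1 a] Cc_1_affine(2)[OF assms, of 1 i a] by (simp_all add: add.commute)

section \<open>Difference quotients and integration by parts\<close>

lemma Cc_1_line_DERIV:
  fixes f :: "real^3 \<Rightarrow> real"
  assumes "f differentiable (at (x + t *\<^sub>R w))"
  shows "((\<lambda>t. f (x + t *\<^sub>R w)) has_real_derivative (\<Sum>j\<in>UNIV. w $ j * partial j f (x + t *\<^sub>R w))) (at t)"
proof -
  have "((\<lambda>t. f (x + t *\<^sub>R w)) has_derivative (\<lambda>h. \<Sum>j\<in>UNIV. (h *\<^sub>R w) $ j * partial j f (x + t *\<^sub>R w))) (at t)"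
    by (rule has_derivative_compose[of "\<lambda>t. x + t *\<^sub>R w" "\<lambda>h. h *\<^sub>R w" t UNIV f, OF _ has_derivative_partial[OF assms]])
       (auto intro!: derivative_eq_intros)
  then show ?thesis
    by (simp add: has_field_derivative_def mult.assoc sum_distrib_left[symmetric] mult.commute[of _ "sum _ _"])
qed

lemma partial_MVT:
  fixes f :: "real^3 \<Rightarrow> real"
  assumes "\<And>x. f differentiable (at x)"
  obtains t where "0 < t" "t < 1" "f (x + w) - f x = (\<Sum>j\<in>UNIV. w $ j * partial j f (x + t *\<^sub>R w))"
  using MVT2[of 0 1 "\<lambda>t. f (x + t *\<^sub>R w)", OF _ Cc_1_line_DERIV[OF assms]] by auto

lemma partial_bound_diff:
  fixes f :: "real^3 \<Rightarrow> real"
  assumes "\<And>x. f differentiable (at x)" "\<And>j t. 0 < t \<Longrightarrow> t < 1 \<Longrightarrow> \<bar>partial j f (x + t *\<^sub>R w)\<bar> \<le> B"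
  shows "\<bar>f (x + w) - f x\<bar> \<le> 3 * B * norm w"
proof -
  obtain t where t: "0 < t" "t < 1" "f (x + w) - f x = (\<Sum>j\<in>UNIV. w $ j * partial j f (x + t *\<^sub>R w))"
    using partial_MVT[OF assms(1)] by blast
  have "\<bar>f (x + w) - f x\<bar> \<le> (\<Sum>j\<in>UNIV. \<bar>w $ j * partial j f (x + t *\<^sub>R w)\<bar>)"
    unfolding t(3) by (rule sum_abs)
  also have "\<dots> \<le> (\<Sum>j\<in>(UNIV::3 set). norm w * B)"
    unfolding abs_mult using assms(2)[OF t(1,2)] by (intro sum_mono mult_mono component_le_norm_cart) auto
  finally show ?thesis by (simp add: mult.commute mult.left_commute)
qed

lemma Lconv_dominated:
  assumes F: "\<And>n. F n \<in> borel_measurable borel" and W: "W \<in> Lp s" "0 < s"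
    and lim: "AE x in lborel. (\<lambda>n. F n x) \<longlonglongrightarrow> f x" and f: "f \<in> borel_measurable borel"
    and bd: "\<And>n x. \<bar>F n x\<bar> \<le> W x"
  shows "Lconv s F f"
proof -
  note [measurable] = F f Lp_measurable[OF W(1)]
  have W0: "0 \<le> W x" for x using bd[of 0 x] by linarith
  have FL: "F n \<in> Lp s" for n
    by (rule Lp_mono[OF F W(1)]) (use bd W0 W in auto)
  have fL: "f \<in> Lp s"
  proof (rule Lpow_Fatou[OF FL _ f lim W(2)])
    show "Lpow s (F n) \<le> Lpow s W" for n
      by (rule Lpow_mono[OF F W(1)]) (use bd W0 W in auto)
  qed
  have "(\<lambda>n. Lpow s (\<lambda>x. F n x - f x)) \<longlonglongrightarrow> (LINT x::'a|lborel. 0)"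
    unfolding Lpow_def
  proof (rule integral_dominated_convergence[where w = "\<lambda>x. 2 powr s * (\<bar>W x\<bar> powr s + \<bar>f x\<bar> powr s)"])
    show "integrable lborel (\<lambda>x. 2 powr s * (\<bar>W x\<bar> powr s + \<bar>f x\<bar> powr s))"
      using W fL by (auto intro!: Lp_integrable)
    show "AE x in lborel. (\<lambda>n. \<bar>F n x - f x\<bar> powr s) \<longlonglongrightarrow> 0"
      using lim
    proof eventually_elim
      case (elim x)
      then have "(\<lambda>n. \<bar>F n x - f x\<bar>) \<longlonglongrightarrow> 0"
        by (simp add: LIM_zero_iff tendsto_rabs_zero_iff)
      from tendsto_powr2[OF this tendsto_const[of s]] show ?case using W(2) by simp
    qed
    show "AE x in lborel. norm (\<bar>F n x - f x\<bar> powr s) \<le> 2 powr s * (\<bar>W x\<bar> powr s + \<bar>f x\<bar> powr s)" for n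
    proof (rule AE_I2)
      fix x
      have "\<bar>F n x - f x\<bar> powr s \<le> 2 powr s * (\<bar>F n x\<bar> powr s + \<bar>- f x\<bar> powr s)"
        using powr_add_abs_le[of s "F n x" "- f x"] W(2) by simp
      also have "\<dots> \<le> 2 powr s * (\<bar>W x\<bar> powr s + \<bar>f x\<bar> powr s)"
        using bd[of n x] W0[of x] W(2) by (intro mult_left_mono add_mono powr_mono2) auto
      finally show "norm (\<bar>F n x - f x\<bar> powr s) \<le> 2 powr s * (\<bar>W x\<bar> powr s + \<bar>f x\<bar> powr s)" by simp
    qed
  qed measurable
  then show ?thesis using FL fL by (simp add: Lconv_def)
qed

text \<open>Dominated convergence: the quotients are bounded by a Lipschitz constant, and all
  translates involved have their support in one ball, since a convergent sequence of step sizes is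
  bounded.\<close>

lemma diffquot_Lconv:
  fixes f :: "real^3 \<Rightarrow> real"
  assumes f: "f \<in> Cc 1" and t: "t \<longlonglongrightarrow> 0" "\<And>n. t n \<noteq> 0" and "0 < s"
  shows "Lconv s (\<lambda>n x. (f (x + t n *\<^sub>R w) - f x) / t n) (\<lambda>x. \<Sum>j\<in>UNIV. w $ j * partial j f x)"
proof -
  obtain R where R: "\<And>x. R < norm x \<Longrightarrow> f x = 0"
    using Cc_1D(4)[OF f] unfolding compact_support_iff by blast
  have "\<exists>B. 0 \<le> B \<and> (\<forall>x. \<bar>partial j f x\<bar> \<le> B)" for j
    by (meson compact_support_bounded Cc_1D(3,5)[OF f])
  then obtain B where B: "\<And>j. 0 \<le> B j" "\<And>j x. \<bar>partial j f x\<bar> \<le> B j" by metis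
  define C where "C = 3 * (\<Sum>j\<in>UNIV. B j)"
  have "Bseq t" using t(1) convergent_def convergent_imp_Bseq by blast
  then obtain T where T: "\<And>n. norm (t n) \<le> T" using BseqE by blast
  define R' where "R' = R + T * norm w"
  note [measurable] = Cc_1_measurable[OF f]
  have C0: "0 \<le> C" using B by (auto simp: C_def intro!: sum_nonneg)
  have lip: "\<bar>f (x + h) - f x\<bar> \<le> C * norm h" for x h
    unfolding C_def
  proof (rule partial_bound_diff[OF Cc_1D(1)[OF f]])
    fix j t
    have "\<bar>partial j f (x + t *\<^sub>R h)\<bar> \<le> B j" by (rule B)
    also have "\<dots> \<le> (\<Sum>j\<in>UNIV. B j)" by (rule member_le_sum) (use B in auto)
    finally show "\<bar>partial j f (x + t *\<^sub>R h)\<bar> \<le> (\<Sum>j\<in>UNIV. B j)" .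
  qed
  have bd: "\<bar>(f (x + t n *\<^sub>R w) - f x) / t n\<bar> \<le> C * norm w * indicator (cball 0 R') x" for n x
  proof (cases "norm x \<le> R'")
    case True
    have "\<bar>f (x + t n *\<^sub>R w) - f x\<bar> \<le> C * norm w * \<bar>t n\<bar>"
      using lip[of x "t n *\<^sub>R w"] by (simp add: mult_ac)
    then show ?thesis using True t(2)[of n] by (simp add: field_simps)
  next
    case False
    have tw: "norm (t n *\<^sub>R w) \<le> T * norm w" using T[of n] by (simp add: mult_right_mono)
    have "norm x \<le> norm (x + t n *\<^sub>R w) + norm (t n *\<^sub>R w)"
      using norm_triangle_ineq4[of "x + t n *\<^sub>R w" "t n *\<^sub>R w"] by simp
    then have "R < norm (x + t n *\<^sub>R w)" "R < norm x"
      using False tw norm_ge_zero[of "t n *\<^sub>R w"] unfolding R'_def by linarith+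
    then show ?thesis using R False by simp
  qed
  show ?thesis
  proof (rule Lconv_dominated)
    show "(\<lambda>x. C * norm w * indicator (cball 0 R') x) \<in> Lp s"
      using C0 \<open>0 < s\<close> by (intro Lp_bounded_support[of _ "C * norm w" R']) (auto simp: indicator_def)
    show "AE x in lborel. (\<lambda>n. (f (x + t n *\<^sub>R w) - f x) / t n) \<longlonglongrightarrow> (\<Sum>j\<in>UNIV. w $ j * partial j f x)"
    proof (rule AE_I2)
      fix x
      have "((\<lambda>t. f (x + t *\<^sub>R w)) has_real_derivative (\<Sum>j\<in>UNIV. w $ j * partial j f (x + 0 *\<^sub>R w))) (at 0)"
        by (rule Cc_1_line_DERIV[OF Cc_1D(1)[OF f]])
      then have "((\<lambda>h. (f (x + h *\<^sub>R w) - f x) / h) \<longlongrightarrow> (\<Sum>j\<in>UNIV. w $ j * partial j f x)) (at 0)"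
        by (simp add: DERIV_def)
      moreover have "filterlim t (at 0) sequentially"
        using t by (intro filterlim_atI) auto
      ultimately show "(\<lambda>n. (f (x + t n *\<^sub>R w) - f x) / t n) \<longlonglongrightarrow> (\<Sum>j\<in>UNIV. w $ j * partial j f x)"
        by (rule filterlim_compose)
    qed
  qed (use bd \<open>0 < s\<close> in \<open>auto\<close>)
qed

lemma sum_axis: "(\<Sum>j\<in>UNIV. axis i (1::real) $ j * g j) = g i"
proof -
  have "(\<Sum>j\<in>UNIV. axis i (1::real) $ j * g j) = (\<Sum>j\<in>UNIV. if j = i then g j else 0)"
    by (intro sum.cong) (auto simp: axis_def)
  then show ?thesis by simp
qed

lemma inverse_Suc_LIMSEQ: "(\<lambda>n. 1 / real (Suc n)) \<longlonglongrightarrow> 0"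
  using LIMSEQ_inverse_real_of_nat by (simp add: inverse_eq_divide)

text \<open>Every difference quotient integrates to 0 by translation invariance, and the quotients
  converge in L1.\<close>

lemma integral_partial_eq_0:
  fixes f :: "real^3 \<Rightarrow> real"
  assumes f: "f \<in> Cc 1"
  shows "(LINT x|lborel. partial i f x) = 0"
proof -
  define t where "t n = 1 / real (Suc n)" for n
  have t: "t \<longlonglongrightarrow> 0" "\<And>n. t n \<noteq> 0"
    using inverse_Suc_LIMSEQ unfolding t_def by auto
  note [measurable] = Cc_1_measurable[OF f]
  have "Lconv 1 (\<lambda>n x. (f (x + t n *\<^sub>R axis i 1) - f x) / t n) (partial i f)"
    using diffquot_Lconv[OF f t, of 1 "axis i 1"] by (simp add: sum_axis)
  note L = Lconv_1_integral[OF this]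
  have "(LINT x|lborel. (f (x + t n *\<^sub>R axis i 1) - f x) / t n) = 0" for n
    using Cc_1_integrable(1)[OF f] Cc_1_integrable(1)[OF Cc_1_translate(1)[OF f, of "t n *\<^sub>R axis i 1"]]
    by (simp add: lborel_integral_translate[of f])
  with L have "(\<lambda>n. 0) \<longlonglongrightarrow> (LINT x|lborel. partial i f x)" by (simp only:)
  then show ?thesis by (simp add: LIMSEQ_const_iff)
qed

lemma integral_by_parts:
  fixes f g :: "real^3 \<Rightarrow> real"
  assumes f: "f \<in> Cc 1" and g: "C_diff 1 g"
  shows "(LINT x|lborel. partial i f x * g x) = - (LINT x|lborel. f x * partial i g x)"
proof -
  have c: "continuous_on UNIV g" "continuous_on UNIV (partial i g)"
    using g C_diff_continuous[OF g] by auto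
  have "(\<lambda>x. partial i f x * g x) \<in> Lp 1" "(\<lambda>x. f x * partial i g x) \<in> Lp 1"
    using Cc_1D[OF f] c by (auto intro!: Lp_compact_support continuous_on_mult compact_support_mult)
  then have "(LINT x|lborel. partial i f x * g x) + (LINT x|lborel. f x * partial i g x)
      = (LINT x|lborel. partial i (\<lambda>x. f x * g x) x)"
    unfolding Cc_1_mult(2)[OF f g] by (simp add: Lp_1_iff)
  also have "\<dots> = 0" by (rule integral_partial_eq_0[OF Cc_1_mult(1)[OF f g]])
  finally show ?thesis by simp
qed

text \<open>Second derivatives need not exist. One derivative is therefore replaced by a difference
  quotient, the other is integrated by parts, and a shift of variables moves the quotient to the
  other factor with step - t.\<close>

lemma integral_partial_swap:
  fixes f g :: "real^3 \<Rightarrow> real"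
  assumes f: "f \<in> Cc 1" and g: "g \<in> Cc 1"
  shows "(LINT x|lborel. partial i f x * partial j g x) = (LINT x|lborel. partial j f x * partial i g x)"
proof -
  define t where "t n = 1 / real (Suc n)" for n
  have t: "t \<longlonglongrightarrow> 0" "\<And>n. t n \<noteq> 0"
    using inverse_Suc_LIMSEQ unfolding t_def by auto
  have mt: "(\<lambda>n. - t n) \<longlonglongrightarrow> 0" "\<And>n. - t n \<noteq> 0" using t tendsto_minus[OF t(1)] by auto
  define G where "G n x = (g (x + t n *\<^sub>R axis j 1) - g x) / t n" for n x
  note [measurable] = Cc_1_measurable[OF f] Cc_1_measurable[OF g]
  have "Lconv 2 G (partial j g)"
    unfolding G_def[abs_def] using diffquot_Lconv[OF g t, of 2 "axis j 1"] by (simp add: sum_axis)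
  from Lconv_integral_mult[OF Lconv_const[OF Cc_1_Lp(2)[OF f, of 2]] this, of i]
  have 1: "(\<lambda>n. LINT x|lborel. partial i f x * G n x) \<longlonglongrightarrow> (LINT x|lborel. partial i f x * partial j g x)" by simp
  have "Lconv 2 (\<lambda>n x. (f (x + (- t n) *\<^sub>R axis j 1) - f x) / (- t n)) (partial j f)"
    using diffquot_Lconv[OF f mt, of 2 "axis j 1"] by (simp add: sum_axis)
  from Lconv_integral_mult[OF this Lconv_const[OF Cc_1_Lp(2)[OF g, of 2]], of i]
  have 2: "(\<lambda>n. LINT x|lborel. (f (x + (- t n) *\<^sub>R axis j 1) - f x) / (- t n) * partial i g x)
     \<longlonglongrightarrow> (LINT x|lborel. partial j f x * partial i g x)" by simp
  have "(LINT x|lborel. partial i f x * G n x)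
      = (LINT x|lborel. (f (x + (- t n) *\<^sub>R axis j 1) - f x) / (- t n) * partial i g x)" for n
  proof -
    let ?a = "t n *\<^sub>R axis j (1::real) :: real^3"
    have gt: "(\<lambda>x. g (x + ?a)) \<in> Cc 1" by (rule Cc_1_translate[OF g])
    have Geq: "G n = (\<lambda>x. (1 / t n) * (g (x + ?a) - g x))" by (simp add: G_def fun_eq_iff)
    have G: "G n \<in> Cc 1" unfolding Geq by (intro Cc_1_cmult(1) Cc_1_diff(1) gt g)
    have pG: "partial i (G n) x = (1 / t n) * (partial i g (x + ?a) - partial i g x)" for x
      unfolding Geq by (simp only: Cc_1_cmult(2)[OF Cc_1_diff(1)[OF gt g]] Cc_1_diff(2)[OF gt g] Cc_1_translate(2)[OF g])
    have f2: "f \<in> Lp 2" "(\<lambda>x. partial i g (x + ?a)) \<in> Lp 2" "partial i g \<in> Lp 2" "(\<lambda>x. f (x + - ?a)) \<in> Lp 2"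
      by (intro Cc_1_Lp f g Lp_translate; simp)+
    have i1: "integrable lborel (\<lambda>x. f x * partial i g (x + ?a))" "integrable lborel (\<lambda>x. f x * partial i g x)"
      "integrable lborel (\<lambda>x. f (x + - ?a) * partial i g x)"
      by (intro Holder_1(1)[of 2 2] f2; simp)+
    have "(LINT x|lborel. partial i f x * G n x) = - (LINT x|lborel. f x * partial i (G n) x)"
      using integral_by_parts[OF f, of "G n" i] G by (simp add: Cc_def)
    also have "\<dots> = - ((1 / t n) * ((LINT x|lborel. f x * partial i g (x + ?a)) - (LINT x|lborel. f x * partial i g x)))"
      unfolding pG using i1 by (simp add: right_diff_distrib diff_divide_distrib)
    also have "(LINT x|lborel. f x * partial i g (x + ?a)) = (LINT x|lborel. f (x + - ?a) * partial i g x)"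
      using lborel_integral_translate[of "\<lambda>x. f (x + - ?a) * partial i g x" ?a] by simp
    also have "- ((1 / t n) * ((LINT x|lborel. f (x + - ?a) * partial i g x) - (LINT x|lborel. f x * partial i g x)))
        = (LINT x|lborel. (f (x + (- t n) *\<^sub>R axis j 1) - f x) / (- t n) * partial i g x)"
      using i1 by (simp add: left_diff_distrib diff_divide_distrib)
    finally show ?thesis .
  qed
  with 1 2 show ?thesis using LIMSEQ_unique by simp
qed

section \<open>Sobolev's inequality\<close>

definition v3 :: "real \<Rightarrow> real \<Rightarrow> real \<Rightarrow> real^3" where
  "v3 x y z = x *\<^sub>R axis 1 1 + y *\<^sub>R axis 2 1 + z *\<^sub>R axis 3 1"

lemma v3_nth [simp]: "v3 x y z $ 1 = x" "v3 x y z $ 2 = y" "v3 x y z $ 3 = z"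
  by (simp_all add: v3_def axis_def)

lemma v3_measurable [measurable]: "(\<lambda>p. v3 (fst p) (fst (snd p)) (snd (snd p))) \<in> borel_measurable borel"
  unfolding v3_def by (intro borel_measurable_continuous_onI continuous_intros)

lemma v3_measurable' [measurable (raw)]:
  "f \<in> borel_measurable M \<Longrightarrow> g \<in> borel_measurable M \<Longrightarrow> h \<in> borel_measurable M \<Longrightarrow>
   (\<lambda>p. v3 (f p) (g p) (h p)) \<in> borel_measurable M"
  unfolding v3_def by (intro borel_measurable_add borel_measurable_scaleR borel_measurable_const)

lemma prod_Basis_cart: "(\<Prod>b\<in>Basis. g b) = (\<Prod>i\<in>UNIV. g (axis i 1 :: real^'n))"
proof -
  have B: "(Basis :: (real^'n) set) = (\<lambda>i. axis i 1) ` UNIV"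
    by (auto simp: Basis_vec_def)
  have i: "inj (\<lambda>i. axis i (1::real) :: real^'n)"
    by (auto simp: inj_on_def axis_eq_axis)
  show ?thesis unfolding B prod.reindex[OF i] by simp
qed

lemma prod_3: "(\<Prod>i\<in>UNIV. f (i::3)) = f 1 * (f 2 * f 3)"
proof -
  have "(1::3) \<noteq> 2" "(1::3) \<noteq> 3" "(2::3) \<noteq> 3" by simp_all
  then show ?thesis unfolding UNIV_3 by simp
qed

text \<open>Lebesgue measure is determined by its values on boxes, and the preimage of a box is a
  product of three intervals.\<close>

lemma lborel_v3: "(lborel :: (real^3) measure) = distr lborel borel (\<lambda>p. v3 (fst p) (fst (snd p)) (snd (snd p)))"
proof (rule lborel_eqI)
  fix l u :: "real^3"
  assume lu: "\<And>b. b \<in> Basis \<Longrightarrow> l \<bullet> b \<le> u \<bullet> b"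
  have le: "l $ i \<le> u $ i" for i
    using lu[of "axis i 1"] by (simp add: inner_axis axis_in_Basis_iff)
  have "emeasure (distr lborel borel (\<lambda>p. v3 (fst p) (fst (snd p)) (snd (snd p)))) (box l u)
     = emeasure (lborel :: (real \<times> real \<times> real) measure) ((\<lambda>p. v3 (fst p) (fst (snd p)) (snd (snd p))) -` box l u \<inter> space lborel)"
    by (rule emeasure_distr) auto
  also have "(\<lambda>p. v3 (fst p) (fst (snd p)) (snd (snd p))) -` box l u \<inter> space lborel
     = {l $ 1<..<u $ 1} \<times> ({l $ 2<..<u $ 2} \<times> {l $ 3<..<u $ 3})"
    by (auto simp: mem_box_cart forall_3)
  also have "emeasure lborel \<dots> = emeasure (lborel \<Otimes>\<^sub>M lborel) \<dots>"
    by (simp only: lborel_prod)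
  also have "\<dots> = emeasure lborel {l $ 1<..<u $ 1} * emeasure lborel ({l $ 2<..<u $ 2} \<times> {l $ 3<..<u $ 3})"
    by (rule lborel.emeasure_pair_measure_Times) (auto intro!: borel_open open_Times)
  also have "emeasure lborel ({l $ 2<..<u $ 2} \<times> {l $ 3<..<u $ 3})
      = emeasure (lborel \<Otimes>\<^sub>M lborel) ({l $ 2<..<u $ 2} \<times> {l $ 3<..<u $ 3})"
    by (simp only: lborel_prod)
  also have "\<dots> = emeasure lborel {l $ 2<..<u $ 2} * emeasure lborel {l $ 3<..<u $ 3}"
    by (rule lborel.emeasure_pair_measure_Times) auto
  also have "emeasure lborel {l $ 1<..<u $ 1} * (emeasure lborel {l $ 2<..<u $ 2} * emeasure lborel {l $ 3<..<u $ 3})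
      = ennreal (u $ 1 - l $ 1) * (ennreal (u $ 2 - l $ 2) * ennreal (u $ 3 - l $ 3))"
    using le by simp
  also have "\<dots> = ennreal (prod ((\<bullet>) (u - l)) Basis)"
  proof -
    have "prod ((\<bullet>) (u - l)) Basis = (u $ 1 - l $ 1) * ((u $ 2 - l $ 2) * (u $ 3 - l $ 3))"
      unfolding prod_Basis_cart prod_3 by (simp add: inner_axis)
    moreover have "0 \<le> u $ 1 - l $ 1" "0 \<le> u $ 2 - l $ 2" "0 \<le> u $ 3 - l $ 3" using le by simp_all
    ultimately show ?thesis by (simp only: ennreal_mult mult_nonneg_nonneg)
  qed
  finally show "emeasure (distr lborel borel (\<lambda>p. v3 (fst p) (fst (snd p)) (snd (snd p)))) (box l u) = ennreal (prod ((\<bullet>) (u - l)) Basis)" .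
qed simp

lemma nn_integral_v3:
  assumes [measurable]: "F \<in> borel_measurable borel"
  shows "(\<integral>\<^sup>+p. F p \<partial>lborel) = (\<integral>\<^sup>+x. \<integral>\<^sup>+y. \<integral>\<^sup>+z. F (v3 x y z) \<partial>lborel \<partial>lborel \<partial>lborel)"
proof -
  have [measurable]: "(\<lambda>p. F (v3 (fst p) (fst (snd p)) (snd (snd p)))) \<in> borel_measurable (lborel \<Otimes>\<^sub>M (lborel \<Otimes>\<^sub>M lborel))"
    using measurable_compose[OF v3_measurable assms] by (simp add: lborel_prod)
  have m2[measurable]: "(\<lambda>q. F (v3 x (fst q) (snd q))) \<in> borel_measurable (lborel \<Otimes>\<^sub>M lborel)" for x
    by measurable
  have "(\<integral>\<^sup>+p. F p \<partial>lborel) = (\<integral>\<^sup>+p. F (v3 (fst p) (fst (snd p)) (snd (snd p))) \<partial>lborel)"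
    by (subst lborel_v3) (simp add: nn_integral_distr)
  also have "\<dots> = (\<integral>\<^sup>+p. F (v3 (fst p) (fst (snd p)) (snd (snd p))) \<partial>(lborel \<Otimes>\<^sub>M lborel))"
    by (simp only: lborel_prod)
  also have "\<dots> = (\<integral>\<^sup>+x. \<integral>\<^sup>+q. F (v3 x (fst q) (snd q)) \<partial>lborel \<partial>lborel)"
    by (subst lborel.nn_integral_fst[symmetric]) (use measurable_compose[OF v3_measurable assms] in \<open>simp_all add: lborel_prod\<close>)
  also have "\<dots> = (\<integral>\<^sup>+x. \<integral>\<^sup>+q. F (v3 x (fst q) (snd q)) \<partial>(lborel \<Otimes>\<^sub>M lborel) \<partial>lborel)"
    by (simp only: lborel_prod)
  also have "\<dots> = (\<integral>\<^sup>+x. \<integral>\<^sup>+y. \<integral>\<^sup>+z. F (v3 x y z) \<partial>lborel \<partial>lborel \<partial>lborel)"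
    by (intro nn_integral_cong, subst lborel.nn_integral_fst[symmetric]) (use m2 in simp_all)
  finally show ?thesis .
qed

text \<open>Square roots of possibly infinite integrals, for the Cauchy--Schwarz steps in the Loomis--Whitney inequality.\<close>

definition esqrt :: "ennreal \<Rightarrow> ennreal" where
  "esqrt x = (if x = top then top else ennreal (sqrt (enn2real x)))"

lemma esqrt_measurable [measurable]: "esqrt \<in> borel_measurable borel"
  unfolding esqrt_def by measurable

lemma esqrt_ennreal: "0 \<le> r \<Longrightarrow> esqrt (ennreal r) = ennreal (sqrt r)"
  by (simp add: esqrt_def)

lemma esqrt_top: "esqrt top = top"
  by (simp add: esqrt_def)

lemma esqrt_square: "(esqrt x)\<^sup>2 = x"
proof (cases x rule: ennreal_cases)
  case (real r)
  then show ?thesis by (simp add: esqrt_ennreal ennreal_power)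
next
  case top
  then show ?thesis by (simp add: esqrt_def power2_eq_square ennreal_top_mult)
qed

text \<open>The convention 0 * top = 0 forces the case distinction: a zero factor makes
  \<open>g\<close> zero, whereas an infinite factor makes the right side infinite only next to a
  nonzero one.\<close>

lemma le_esqrt_mult:
  assumes "g\<^sup>2 \<le> b * k"
  shows "g \<le> esqrt b * esqrt k"
proof (cases "b = 0 \<or> k = 0")
  case True
  then have bk: "b * k = 0" by auto
  have "g * g \<le> 0" using assms unfolding bk power2_eq_square .
  then have "g = 0" by simp
  then show ?thesis by simp
next
  case False
  have nz: "esqrt x \<noteq> 0" if "x \<noteq> 0" for x
  proof
    assume "esqrt x = 0"
    with esqrt_square[of x] that show False by simp
  qed
  show ?thesis
  proof (cases "b = top \<or> k = top")
    case True
    then have "esqrt b * esqrt k = top"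
    proof
      assume "b = top"
      then show ?thesis using nz[of k] False by (simp add: esqrt_top ennreal_top_mult)
    next
      assume "k = top"
      then show ?thesis using nz[of b] False by (simp add: esqrt_top ennreal_mult_top)
    qed
    then show ?thesis by simp
  next
    case fin: False
    obtain b' where b: "b = ennreal b'" "0 \<le> b'" using fin by (cases b rule: ennreal_cases) auto
    obtain k' where k: "k = ennreal k'" "0 \<le> k'" using fin by (cases k rule: ennreal_cases) auto
    show ?thesis
    proof (cases g rule: ennreal_cases)
      case (real g')
      have "g'\<^sup>2 \<le> b' * k'"
        using assms b k real by (simp add: ennreal_power ennreal_mult'[symmetric] ennreal_le_iff)
      then have "g' \<le> sqrt (b' * k')" by (rule real_le_rsqrt)
      then show ?thesis
        using b k real by (simp add: esqrt_ennreal ennreal_mult'[symmetric] ennreal_leI real_sqrt_mult)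
    next
      case top
      then have "b * k = top" using assms by (simp add: power2_eq_square ennreal_top_mult top_unique)
      then show ?thesis using b k by (simp add: ennreal_mult'[symmetric])
    qed
  qed
qed

lemma Cauchy_Schwarz_esqrt:
  assumes [measurable]: "g \<in> borel_measurable M" "b \<in> borel_measurable M" "k \<in> borel_measurable M"
    and le: "\<And>x. (g x)\<^sup>2 \<le> b x * k x"
  shows "(\<integral>\<^sup>+x. g x \<partial>M)\<^sup>2 \<le> (\<integral>\<^sup>+x. b x \<partial>M) * (\<integral>\<^sup>+x. k x \<partial>M)"
proof -
  have "(\<integral>\<^sup>+x. g x \<partial>M)\<^sup>2 \<le> (\<integral>\<^sup>+x. esqrt (b x) * esqrt (k x) \<partial>M)\<^sup>2"
    by (intro power_mono nn_integral_mono le_esqrt_mult le) simp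
  also have "\<dots> \<le> (\<integral>\<^sup>+x. (esqrt (b x))\<^sup>2 \<partial>M) * (\<integral>\<^sup>+x. (esqrt (k x))\<^sup>2 \<partial>M)"
    by (rule Cauchy_Schwarz_nn_integral) measurable
  finally show ?thesis by (simp add: esqrt_square)
qed

text \<open>Cauchy--Schwarz in the pair (y, z) for fixed x separates \<open>a\<close> from the
  product of \<open>b\<close> and \<open>c\<close>, which is a product of integrals in separate
  variables; a second Cauchy--Schwarz in x separates those two.\<close>

lemma Loomis_Whitney:
  fixes a b c :: "real \<Rightarrow> real \<Rightarrow> ennreal" and g :: "real \<Rightarrow> real \<Rightarrow> real \<Rightarrow> ennreal"
  assumes [measurable]: "case_prod a \<in> borel_measurable (lborel \<Otimes>\<^sub>M lborel)"
      "case_prod b \<in> borel_measurable (lborel \<Otimes>\<^sub>M lborel)" "case_prod c \<in> borel_measurable (lborel \<Otimes>\<^sub>M lborel)"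
      "(\<lambda>p. g (fst p) (fst (snd p)) (snd (snd p))) \<in> borel_measurable (lborel \<Otimes>\<^sub>M (lborel \<Otimes>\<^sub>M lborel))"
    and le: "\<And>x y z. (g x y z)\<^sup>2 \<le> a y z * (b x z * c x y)"
  shows "(\<integral>\<^sup>+x. \<integral>\<^sup>+y. \<integral>\<^sup>+z. g x y z \<partial>lborel \<partial>lborel \<partial>lborel)\<^sup>2
     \<le> (\<integral>\<^sup>+y. \<integral>\<^sup>+z. a y z \<partial>lborel \<partial>lborel)
      * ((\<integral>\<^sup>+x. \<integral>\<^sup>+z. b x z \<partial>lborel \<partial>lborel) * (\<integral>\<^sup>+x. \<integral>\<^sup>+y. c x y \<partial>lborel \<partial>lborel))"
proof -
  define A where "A = (\<integral>\<^sup>+y. \<integral>\<^sup>+z. a y z \<partial>lborel \<partial>lborel)"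
  define G where "G x = (\<integral>\<^sup>+y. \<integral>\<^sup>+z. g x y z \<partial>lborel \<partial>lborel)" for x
  define B where "B x = (\<integral>\<^sup>+z. b x z \<partial>lborel)" for x
  define C where "C x = (\<integral>\<^sup>+y. c x y \<partial>lborel)" for x
  have g': "(\<lambda>q. g (fst (fst q)) (snd (fst q)) (snd q)) \<in> borel_measurable ((lborel \<Otimes>\<^sub>M lborel) \<Otimes>\<^sub>M lborel)"
    using measurable_compose[OF _ assms(4), of "\<lambda>q. (fst (fst q), snd (fst q), snd q)" "(lborel \<Otimes>\<^sub>M lborel) \<Otimes>\<^sub>M lborel"]
    by simp
  have [measurable]: "G \<in> borel_measurable lborel"
    unfolding G_def[abs_def]
    by (intro lborel.borel_measurable_nn_integral) (use g' in \<open>simp add: case_prod_beta\<close>)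
  have [measurable]: "B \<in> borel_measurable lborel" "C \<in> borel_measurable lborel"
    unfolding B_def[abs_def] C_def[abs_def]
    by (rule lborel.borel_measurable_nn_integral, fact)+
  have "(G x)\<^sup>2 \<le> (A * B x) * C x" for x
  proof -
    have [measurable]: "(\<lambda>q. g x (fst q) (snd q)) \<in> borel_measurable (lborel \<Otimes>\<^sub>M lborel)"
      using measurable_compose[OF _ assms(4), of "\<lambda>q. (x, fst q, snd q)" "lborel \<Otimes>\<^sub>M lborel"] by simp
    have [measurable]: "(\<lambda>q. a (fst q) (snd q)) \<in> borel_measurable (lborel \<Otimes>\<^sub>M lborel)"
      using assms(1) by (simp add: case_prod_beta')
    have "G x = (\<integral>\<^sup>+q. g x (fst q) (snd q) \<partial>(lborel \<Otimes>\<^sub>M lborel))"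
      unfolding G_def by (subst lborel.nn_integral_fst[symmetric]) simp_all
    then have "(G x)\<^sup>2 \<le> (\<integral>\<^sup>+q. a (fst q) (snd q) \<partial>(lborel \<Otimes>\<^sub>M lborel)) *
        (\<integral>\<^sup>+q. b x (snd q) * c x (fst q) \<partial>(lborel \<Otimes>\<^sub>M lborel))"
      using le by (simp only:) (rule Cauchy_Schwarz_esqrt, measurable)
    also have "(\<integral>\<^sup>+q. a (fst q) (snd q) \<partial>(lborel \<Otimes>\<^sub>M lborel)) = A"
      unfolding A_def by (subst lborel.nn_integral_fst[symmetric]) simp_all
    also have "(\<integral>\<^sup>+q. b x (snd q) * c x (fst q) \<partial>(lborel \<Otimes>\<^sub>M lborel))
       = (\<integral>\<^sup>+y. \<integral>\<^sup>+z. b x z * c x y \<partial>lborel \<partial>lborel)"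
      by (subst lborel.nn_integral_fst[symmetric]) simp_all
    also have "\<dots> = B x * C x"
      unfolding B_def C_def by (simp add: nn_integral_multc nn_integral_cmult)
    finally show ?thesis by (simp add: mult.assoc)
  qed
  then have "(\<integral>\<^sup>+x. G x \<partial>lborel)\<^sup>2 \<le> (\<integral>\<^sup>+x. A * B x \<partial>lborel) * (\<integral>\<^sup>+x. C x \<partial>lborel)"
    by (intro Cauchy_Schwarz_esqrt) measurable
  also have "(\<integral>\<^sup>+x. A * B x \<partial>lborel) = A * (\<integral>\<^sup>+x. B x \<partial>lborel)"
    by (rule nn_integral_cmult) measurable
  finally show ?thesis by (simp add: A_def B_def C_def G_def mult.assoc)
qed

text \<open>The fundamental theorem of calculus on a segment that ends at \<open>x\<close> and
  starts outside the support; the choice of \<open>T\<close> puts its starting point beyond the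
  radius \<open>R\<close>.\<close>

lemma line_integral_bound:
  fixes f :: "real^3 \<Rightarrow> real"
  assumes f: "f \<in> Cc 1"
  shows "ennreal \<bar>f x\<bar> \<le> (\<integral>\<^sup>+s. ennreal \<bar>partial i f (x + s *\<^sub>R axis i 1)\<bar> \<partial>lborel)"
proof -
  obtain R where R: "0 < R" "\<And>x. R < norm x \<Longrightarrow> f x = 0"
    using Cc_1D(4)[OF f] unfolding compact_support_iff by blast
  define T where "T = R + norm x + 1"
  have T: "0 \<le> T" using R(1) by (simp add: T_def add_nonneg_nonneg)
  have 0: "f (x + (- T) *\<^sub>R axis i 1) = 0"
  proof (rule R(2))
    have "norm ((- T) *\<^sub>R axis i 1 :: real^3) \<le> norm (x + (- T) *\<^sub>R axis i 1) + norm x"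
      using norm_triangle_ineq4[of "x + (- T) *\<^sub>R axis i 1" x] by simp
    then show "R < norm (x + (- T) *\<^sub>R axis i 1)" using T by (simp add: T_def)
  qed
  have D: "((\<lambda>t. f (x + t *\<^sub>R axis i 1)) has_real_derivative partial i f (x + t *\<^sub>R axis i 1)) (at t)" for t
    using Cc_1_line_DERIV[OF Cc_1D(1)[OF f], where x = x and t = t and w = "axis i 1"] by (simp add: sum_axis)
  have c: "continuous_on {- T..0} (\<lambda>t. partial i f (x + t *\<^sub>R axis i 1))"
    by (intro continuous_on_compose2[OF Cc_1D(3)[OF f]] continuous_intros) auto
  have "has_bochner_integral lborel (\<lambda>t. indicator {- T..0} t *\<^sub>R partial i f (x + t *\<^sub>R axis i 1))
     (f (x + 0 *\<^sub>R axis i 1) - f (x + (- T) *\<^sub>R axis i 1))"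
    by (rule has_bochner_integral_FTC_Icc[OF _ _ c])
       (use T D in \<open>auto simp: has_real_derivative_iff_has_vector_derivative[symmetric] intro: has_field_derivative_at_within\<close>)
  then have "integrable lborel (\<lambda>t. indicator {- T..0} t *\<^sub>R partial i f (x + t *\<^sub>R axis i 1))"
     and e: "(LINT t|lborel. indicator {- T..0} t *\<^sub>R partial i f (x + t *\<^sub>R axis i 1)) = f x"
    using 0 by (auto simp: has_bochner_integral_iff)
  from integral_norm_bound_ennreal[OF this(1)]
  have "ennreal \<bar>f x\<bar> \<le> (\<integral>\<^sup>+t. ennreal (norm (indicator {- T..0} t *\<^sub>R partial i f (x + t *\<^sub>R axis i 1))) \<partial>lborel)"
    unfolding e by simp
  also have "\<dots> \<le> (\<integral>\<^sup>+s. ennreal \<bar>partial i f (x + s *\<^sub>R axis i 1)\<bar> \<partial>lborel)"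
    by (intro nn_integral_mono) (auto simp: indicator_def)
  finally show ?thesis .
qed

text \<open>The function \<open>f\<close> is |w|^(3/2). At each point |w| is at most each of three
  line integrals, and each of these is independent of one coordinate. Multiplying the three bounds
  gives |w|^3, that is the square of \<open>f\<close>, which is what \<open>Loomis_Whitney\<close>
  asks for.\<close>

lemma Sobolev_aux:
  fixes f :: "real^3 \<Rightarrow> real"
  assumes w: "w \<in> Cc 1" and f[measurable]: "f \<in> borel_measurable borel" and fw: "\<And>x. (f x)\<^sup>2 = \<bar>w x\<bar> ^ 3" "\<And>x. 0 \<le> f x"
  shows "(\<integral>\<^sup>+x. ennreal (f x) \<partial>lborel)\<^sup>2 \<le> (\<Prod>i\<in>UNIV. \<integral>\<^sup>+x. ennreal \<bar>partial i w x\<bar> \<partial>lborel)"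
proof -
  note [measurable] = Cc_1_measurable[OF w]
  define D where "D i x y z = ennreal \<bar>partial i w (v3 x y z)\<bar>" for i x y z
  have N: "(\<integral>\<^sup>+x. ennreal \<bar>partial i w x\<bar> \<partial>lborel) = (\<integral>\<^sup>+x. \<integral>\<^sup>+y. \<integral>\<^sup>+z. D i x y z \<partial>lborel \<partial>lborel \<partial>lborel)" for i
    unfolding D_def by (rule nn_integral_v3) measurable
  have [measurable (raw)]: "(\<lambda>p. D i (h p) (k p) (l p)) \<in> borel_measurable M"
    if "h \<in> borel_measurable M" "k \<in> borel_measurable M" "l \<in> borel_measurable M" for i h k l and M :: "'m measure"
    using that unfolding D_def by measurable
  define a where "a y z = (\<integral>\<^sup>+s. D 1 s y z \<partial>lborel)" for y z
  define b where "b x z = (\<integral>\<^sup>+s. D 2 x s z \<partial>lborel)" for x z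
  define c where "c x y = (\<integral>\<^sup>+s. D 3 x y s \<partial>lborel)" for x y
  have wa: "ennreal \<bar>w (v3 x y z)\<bar> \<le> a y z" "ennreal \<bar>w (v3 x y z)\<bar> \<le> b x z" "ennreal \<bar>w (v3 x y z)\<bar> \<le> c x y" for x y z
  proof -
    have "v3 x y z + s *\<^sub>R axis 1 1 = v3 (s + x) y z" "v3 x y z + s *\<^sub>R axis 2 1 = v3 x (s + y) z"
      "v3 x y z + s *\<^sub>R axis 3 1 = v3 x y (s + z)" for s
      by (simp_all add: v3_def algebra_simps)
    then show "ennreal \<bar>w (v3 x y z)\<bar> \<le> a y z" "ennreal \<bar>w (v3 x y z)\<bar> \<le> b x z" "ennreal \<bar>w (v3 x y z)\<bar> \<le> c x y"
      using line_integral_bound[OF w, of "v3 x y z" 1] line_integral_bound[OF w, of "v3 x y z" 2]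
        line_integral_bound[OF w, of "v3 x y z" 3]
        lborel_nn_integral_translate[of "\<lambda>s. D 1 s y z" x] lborel_nn_integral_translate[of "\<lambda>s. D 2 x s z" y]
        lborel_nn_integral_translate[of "\<lambda>s. D 3 x y s" z]
      by (simp_all add: a_def b_def c_def D_def)
  qed
  have "(\<integral>\<^sup>+x. ennreal (f x) \<partial>lborel)\<^sup>2 = (\<integral>\<^sup>+x. \<integral>\<^sup>+y. \<integral>\<^sup>+z. ennreal (f (v3 x y z)) \<partial>lborel \<partial>lborel \<partial>lborel)\<^sup>2"
    by (subst nn_integral_v3) auto
  also have "\<dots> \<le> (\<integral>\<^sup>+y. \<integral>\<^sup>+z. a y z \<partial>lborel \<partial>lborel)
      * ((\<integral>\<^sup>+x. \<integral>\<^sup>+z. b x z \<partial>lborel \<partial>lborel) * (\<integral>\<^sup>+x. \<integral>\<^sup>+y. c x y \<partial>lborel \<partial>lborel))"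
  proof (rule Loomis_Whitney)
    show "(\<lambda>p. ennreal (f (v3 (fst p) (fst (snd p)) (snd (snd p))))) \<in> borel_measurable (lborel \<Otimes>\<^sub>M (lborel \<Otimes>\<^sub>M lborel))"
      by measurable
    show "(ennreal (f (v3 x y z)))\<^sup>2 \<le> a y z * (b x z * c x y)" for x y z
    proof -
      have "(ennreal (f (v3 x y z)))\<^sup>2 = ennreal \<bar>w (v3 x y z)\<bar> * (ennreal \<bar>w (v3 x y z)\<bar> * ennreal \<bar>w (v3 x y z)\<bar>)"
        using fw by (simp add: ennreal_power ennreal_mult'[symmetric] power3_eq_cube mult_ac)
      also have "\<dots> \<le> a y z * (b x z * c x y)"
        by (intro mult_mono wa) auto
      finally show ?thesis .
    qed
  qed (unfold a_def b_def c_def, measurable)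
  also have "(\<integral>\<^sup>+y. \<integral>\<^sup>+z. a y z \<partial>lborel \<partial>lborel) = (\<integral>\<^sup>+x. \<integral>\<^sup>+y. \<integral>\<^sup>+z. D 1 x y z \<partial>lborel \<partial>lborel \<partial>lborel)"
  proof -
    have "(\<integral>\<^sup>+y. \<integral>\<^sup>+z. a y z \<partial>lborel \<partial>lborel) = (\<integral>\<^sup>+y. \<integral>\<^sup>+s. \<integral>\<^sup>+z. D 1 s y z \<partial>lborel \<partial>lborel \<partial>lborel)"
      unfolding a_def by (intro nn_integral_cong lborel_pair.Fubini') measurable
    also have "\<dots> = (\<integral>\<^sup>+x. \<integral>\<^sup>+y. \<integral>\<^sup>+z. D 1 x y z \<partial>lborel \<partial>lborel \<partial>lborel)"
      by (rule lborel_pair.Fubini') measurable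
    finally show ?thesis .
  qed
  also have "(\<integral>\<^sup>+x. \<integral>\<^sup>+z. b x z \<partial>lborel \<partial>lborel) = (\<integral>\<^sup>+x. \<integral>\<^sup>+y. \<integral>\<^sup>+z. D 2 x y z \<partial>lborel \<partial>lborel \<partial>lborel)"
    unfolding b_def by (intro nn_integral_cong lborel_pair.Fubini') measurable
  finally show ?thesis
    unfolding prod_3 N c_def .
qed

text \<open>The choice w = f^4 makes |w|^(3/2) equal to f^6, and Cauchy--Schwarz bounds the integral
  of 4 |f|^3 |\<partial>f| by the root of \<open>J\<close>. This gives J^2 \<le> 64 J^(3/2) K, so J
  \<le> 64^2 K^2, and 4096 = 64^2. Dividing by J^(3/2) is possible because \<open>J\<close> is
  finite for a test function.\<close>

lemma Sobolev:
  fixes f :: "real^3 \<Rightarrow> real"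
  assumes f: "f \<in> Cc 1"
  shows "Lpow 6 f \<le> 4096 * (\<Prod>i\<in>UNIV. Lpow 2 (partial i f))"
proof -
  note [measurable] = Cc_1_measurable[OF f]
  have w2: "(\<lambda>x. f x * f x) \<in> Cc 1" "C_diff 1 (\<lambda>x. f x * f x)"
    using f by (auto simp: Cc_def intro!: C_diff_mult compact_support_mult simp del: C_diff.simps(2))
  define w where "w x = (f x * f x) * (f x * f x)" for x
  have w: "w \<in> Cc 1" unfolding w_def[abs_def] by (rule Cc_1_mult(1)[OF w2])
  have pw: "partial i w x = 4 * (f x)^3 * partial i f x" for i x
    unfolding w_def[abs_def] using Cc_1_mult(2)[OF w2] Cc_1_mult(2)[OF f, of f] f
    by (simp add: Cc_def algebra_simps power3_eq_cube del: C_diff.simps(2))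
  define J where "J = Lpow 6 f"
  have f6: "f \<in> Lp 6" by (rule Cc_1_Lp[OF f]) simp
  have J: "0 \<le> J" by (simp add: J_def)
  have nJ: "(\<integral>\<^sup>+x. ennreal (\<bar>f x\<bar> ^ 6) \<partial>lborel) = ennreal J"
    unfolding J_def Lpow_def using Lp_integrable[OF f6] by (subst nn_integral_eq_integral[symmetric]) auto
  have pi: "(\<integral>\<^sup>+x. ennreal \<bar>partial i w x\<bar> \<partial>lborel) \<le> ennreal (4 * (sqrt J * sqrt (Lpow 2 (partial i f))))" for i
  proof -
    have f3: "(\<lambda>x. (f x)^3) \<in> Lp 2"
      using f6 by (auto simp: Lp_def power_abs[symmetric] power_mult[symmetric])
    have L3: "Lpow 2 (\<lambda>x. (f x)^3) = J" by (simp add: J_def Lpow_def power_abs power_mult[symmetric])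
    have i3: "integrable lborel (\<lambda>x. (f x)^3 * partial i f x)"
      and "(LINT x|lborel. \<bar>(f x)^3 * partial i f x\<bar>) \<le> sqrt J * sqrt (Lpow 2 (partial i f))"
      using Holder_1(1,2)[OF _ _ _ f3 Cc_1_Lp(2)[OF f, of 2], of i] J L3 by (auto simp: powr_half_sqrt)
    then show ?thesis
      unfolding pw using integrable_abs[OF i3]
      by (subst nn_integral_eq_integral) (auto simp: abs_mult mult.assoc intro!: ennreal_leI)
  qed
  have "ennreal J ^ 2 \<le> (\<Prod>i\<in>UNIV. \<integral>\<^sup>+x. ennreal \<bar>partial i w x\<bar> \<partial>lborel)"
    unfolding nJ[symmetric] by (rule Sobolev_aux[OF w]) (auto simp: w_def abs_mult eval_nat_numeral)
  also have "\<dots> \<le> (\<Prod>i\<in>UNIV. ennreal (4 * (sqrt J * sqrt (Lpow 2 (partial i f)))))"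
    unfolding prod_3 by (intro mult_mono pi) simp_all
  also have "\<dots> = ennreal (\<Prod>i\<in>UNIV. 4 * (sqrt J * sqrt (Lpow 2 (partial i f))))"
    by (rule prod_ennreal) (use J in auto)
  finally have "J ^ 2 \<le> (\<Prod>i\<in>UNIV. 4 * (sqrt J * sqrt (Lpow 2 (partial i f))))"
    using J by (simp add: ennreal_power ennreal_le_iff prod_nonneg)
  also have "\<dots> = 64 * sqrt J ^ 3 * sqrt (\<Prod>i\<in>UNIV. Lpow 2 (partial i f))"
    by (simp only: prod_3 real_sqrt_mult) (simp add: power3_eq_cube algebra_simps)
  finally have *: "J ^ 2 \<le> 64 * sqrt J ^ 3 * sqrt (\<Prod>i\<in>UNIV. Lpow 2 (partial i f))" .
  define K where "K = sqrt (\<Prod>i\<in>UNIV. Lpow 2 (partial i f))"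
  have K: "0 \<le> K" "K\<^sup>2 = (\<Prod>i\<in>UNIV. Lpow 2 (partial i f))"
    by (simp_all add: K_def prod_nonneg)
  define r where "r = sqrt J"
  have r: "0 \<le> r" "J = r^2" using J by (auto simp: r_def)
  have "r ^ 3 * r \<le> r ^ 3 * (64 * K)"
    using * r(1) unfolding K_def[symmetric] r_def[symmetric] r(2) by (simp add: eval_nat_numeral mult_ac)
  then have "r \<le> 64 * K" if "r \<noteq> 0" using r that by (simp add: mult_le_cancel_left)
  then have "r \<le> 64 * K" using K by (cases "r = 0") auto
  then have "r^2 \<le> (64 * K)^2" using r by (intro power_mono) auto
  then show ?thesis unfolding J_def[symmetric] r(2) using K(2) by (simp add: power_mult_distrib)
qed

section \<open>Convolution and mollification\<close>

lemma Lp_truncate: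
  fixes f :: "real^3 \<Rightarrow> real"
  assumes f: "f \<in> Lp s" and s: "0 < s"
  shows "Lconv s (\<lambda>N x. indicator (cball 0 (real N)) x * max (- real N) (min (real N) (f x))) f"
proof (rule Lconv_dominated[where W = "\<lambda>x. \<bar>f x\<bar>"])
  note [measurable] = Lp_measurable[OF f]
  show "(\<lambda>x. indicator (cball 0 (real N)) x * max (- real N) (min (real N) (f x))) \<in> borel_measurable borel" for N
    by (intro borel_measurable_times borel_measurable_indicator borel_measurable_max borel_measurable_min)
       (use Lp_measurable[OF f] in auto)
  show "AE x in lborel. (\<lambda>N. indicator (cball 0 (real N)) x * max (- real N) (min (real N) (f x))) \<longlonglongrightarrow> f x"
  proof (rule AE_I2)
    fix x
    obtain N where N: "norm x \<le> real N" "\<bar>f x\<bar> \<le> real N"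
      using real_arch_simple[of "max (norm x) \<bar>f x\<bar>"] by auto
    have "\<forall>n\<ge>N. indicator (cball 0 (real n)) x * max (- real n) (min (real n) (f x)) = f x"
      using N by (auto simp: indicator_def max_def min_def)
    then show "(\<lambda>N. indicator (cball 0 (real N)) x * max (- real N) (min (real N) (f x))) \<longlonglongrightarrow> f x"
      by (intro tendsto_eventually) (auto simp: eventually_sequentially)
  qed
qed (use f s in \<open>auto simp: Lp_abs indicator_def max_def min_def intro: Lp_measurable\<close>)

text \<open>Measurability in the sense of \<open>measurable_on\<close> supplies continuous functions
  converging off a negligible set. Clipping them to [-B, B] and multiplying by a continuous cutoff
  leaves the limit unchanged and provides a majorant.\<close>

lemma Lp_dense_bounded:
  fixes f :: "real^3 \<Rightarrow> real"
  assumes f[measurable]: "f \<in> borel_measurable borel" and B: "\<And>x. \<bar>f x\<bar> \<le> B" and R: "\<And>x. R < norm x \<Longrightarrow> f x = 0"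
    and s: "0 < s" and e: "0 < e"
  obtains g where "continuous_on UNIV g" "compact_support g" "Lpow s (\<lambda>x. g x - f x) < e"
proof -
  have B0: "0 \<le> B" using B[of 0] by linarith
  have "f measurable_on UNIV"
    using lebesgue_measurable_imp_measurable_on_real[of f UNIV] by (simp add: measurable_completion)
  then obtain N h where N: "negligible N" and h: "\<And>n. continuous_on UNIV (h n)"
    and lim: "\<And>x. x \<notin> N \<Longrightarrow> (\<lambda>n. h n x) \<longlonglongrightarrow> f x"
    unfolding measurable_on_def by auto
  define c where "c x = max 0 (min 1 (R + 1 - norm x))" for x :: "real^3"
  define g where "g n x = c x * max (- B) (min B (h n x))" for n x
  have c: "0 \<le> c x" "c x \<le> 1" for x by (auto simp: c_def)
  have g_cont: "continuous_on UNIV (g n)" for n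
    unfolding g_def c_def by (intro continuous_intros continuous_on_max continuous_on_min h)
  have g_supp: "compact_support (g n)" for n
    by (rule compact_supportI[of "R + 1"]) (simp add: g_def c_def)
  have gB: "\<bar>g n x\<bar> \<le> B" for n x
  proof -
    have "\<bar>g n x\<bar> = c x * \<bar>max (- B) (min B (h n x))\<bar>" using c[of x] by (simp add: g_def abs_mult)
    also have "\<dots> \<le> 1 * B" using c[of x] B0 by (intro mult_mono) auto
    finally show ?thesis by simp
  qed
  have "AE x in lebesgue. x \<notin> N"
    using N AE_not_in by (auto simp: negligible_iff_null_sets)
  have "AE x in lebesgue. (\<lambda>n. g n x) \<longlonglongrightarrow> f x"
    using \<open>AE x in lebesgue. x \<notin> N\<close>
  proof eventually_elim
    case (elim x)
    have "(\<lambda>n. g n x) \<longlonglongrightarrow> c x * max (- B) (min B (f x))"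
      unfolding g_def by (intro tendsto_intros lim elim)
    moreover have "c x * max (- B) (min B (f x)) = f x"
      using B[of x] R[of x] by (cases "R < norm x") (auto simp: c_def max_def min_def)
    ultimately show ?case by simp
  qed
  then have "AE x in lborel. (\<lambda>n. g n x) \<longlonglongrightarrow> f x" by (simp add: AE_completion_iff)
  then have "Lconv s g f"
  proof (rule Lconv_dominated[where W = "\<lambda>x. B * indicator (cball 0 (R + 1)) x", rotated 3])
    show "g n \<in> borel_measurable borel" for n
      using g_cont by (rule borel_measurable_continuous_onI)
    show "(\<lambda>x. B * indicator (cball 0 (R + 1)) x) \<in> Lp s"
      using B0 s by (intro Lp_bounded_support[of _ B "R + 1"]) (auto simp: indicator_def)
    show "\<bar>g n x\<bar> \<le> B * indicator (cball 0 (R + 1)) x" for n x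
      using gB[of n x] by (auto simp: indicator_def g_def c_def)
  qed (use s in auto)
  then have "\<exists>n. Lpow s (\<lambda>x. g n x - f x) < e"
    using order_tendstoD(2)[OF LconvD(3) e] eventually_happens'[OF sequentially_bot] by blast
  then show ?thesis using g_cont g_supp that by blast
qed

lemma Lp_dense:
  fixes f :: "real^3 \<Rightarrow> real"
  assumes f: "f \<in> Lp s" and s: "0 < s" and e: "0 < e"
  obtains g where "continuous_on UNIV g" "compact_support g" "Lpow s (\<lambda>x. g x - f x) < e"
proof -
  note [measurable] = Lp_measurable[OF f]
  define F where "F N x = indicator (cball 0 (real N)) x * max (- real N) (min (real N) (f x))" for N x
  have F: "Lconv s F f" unfolding F_def[abs_def] by (rule Lp_truncate[OF f s])
  define d where "d = e / (2 * 2 powr s)"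
  have d: "0 < d" using e by (simp add: d_def)
  obtain N where N: "Lpow s (\<lambda>x. F N x - f x) < d"
    using order_tendstoD(2)[OF LconvD(3)[OF F] d] eventually_happens'[OF sequentially_bot] by blast
  obtain g where g: "continuous_on UNIV g" "compact_support g" "Lpow s (\<lambda>x. g x - F N x) < d"
  proof (rule Lp_dense_bounded[of "F N" "real N" "real N" s d])
    show "F N \<in> borel_measurable borel" using LconvD(1)[OF F] by (rule Lp_measurable)
    show "\<bar>F N x\<bar> \<le> real N" for x by (auto simp: F_def indicator_def)
    show "F N x = 0" if "real N < norm x" for x using that by (auto simp: F_def indicator_def)
  qed (use s d that in blast)+
  have "Lpow s (\<lambda>x. g x - f x) = Lpow s (\<lambda>x. (g x - F N x) + (F N x - f x))" by simp
  also have "\<dots> \<le> 2 powr s * (Lpow s (\<lambda>x. g x - F N x) + Lpow s (\<lambda>x. F N x - f x))"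
    using s Lp_compact_support[OF g(1,2) s] LconvD[OF F]
    by (intro Lpow_add_le Lp_diff) auto
  also have "\<dots> < 2 powr s * (d + d)"
    using N g(3) by (intro mult_strict_left_mono add_strict_mono) auto
  also have "\<dots> = e" by (simp add: d_def)
  finally show ?thesis using g that by blast
qed

text \<open>For a continuous function of compact support this is dominated convergence; a general
  function is compared with such a \<open>g\<close>, and the error is the same before and after
  translation.\<close>

lemma Lconv_translate:
  fixes f :: "real^3 \<Rightarrow> real"
  assumes f: "f \<in> Lp s" and s: "0 < s" and w: "w \<longlonglongrightarrow> 0"
  shows "Lconv s (\<lambda>n x. f (x + w n)) f"
  unfolding Lconv_def
proof (intro conjI allI f Lp_translate LIMSEQ_I)
  fix e :: real assume e: "0 < e"
  \<comment> \<open>Three terms and two uses of the quasi-triangle inequality give 3 * 2 powr s * 2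
    powr s * d, which is 3/4 of \<open>e\<close>.\<close>
  define d where "d = e / (4 * 2 powr s * 2 powr s)"
  have d: "0 < d" using e by (simp add: d_def)
  have one: "1 \<le> 2 powr s" using s by (simp add: ge_one_powr_ge_zero)
  obtain g where g: "continuous_on UNIV g" "compact_support g" "Lpow s (\<lambda>x. g x - f x) < d"
    using Lp_dense[OF f s d] .
  have gL: "g \<in> Lp s" by (rule Lp_compact_support[OF g(1,2) s])
  note [measurable] = Lp_measurable[OF f] Lp_measurable[OF gL]
  obtain R where R: "\<And>x. R < norm x \<Longrightarrow> g x = 0" using g(2) unfolding compact_support_iff by blast
  obtain B where B: "0 \<le> B" "\<And>x. \<bar>g x\<bar> \<le> B" using compact_support_bounded[OF g(1,2)] by blast
  have "Bseq w" using w convergent_def convergent_imp_Bseq by blast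
  then obtain T where T: "\<And>n. norm (w n) \<le> T" using BseqE by blast
  have "Lconv s (\<lambda>n x. g (x + w n)) g"
  proof (rule Lconv_dominated[where W = "\<lambda>x. B * indicator (cball 0 (R + T)) x"])
    show "(\<lambda>x. B * indicator (cball 0 (R + T)) x) \<in> Lp s"
      using B(1) s by (intro Lp_bounded_support[of _ B "R + T"]) (auto simp: indicator_def)
    show "AE x in lborel. (\<lambda>n. g (x + w n)) \<longlonglongrightarrow> g x"
    proof (rule AE_I2)
      fix x
      have "(\<lambda>n. x + w n) \<longlonglongrightarrow> x + 0" by (intro tendsto_intros w)
      then show "(\<lambda>n. g (x + w n)) \<longlonglongrightarrow> g x"
        using g(1) by (simp add: continuous_on_tendsto_compose[of UNIV g])
    qed
    show "\<bar>g (x + w n)\<bar> \<le> B * indicator (cball 0 (R + T)) x" for n x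
    proof (cases "norm x \<le> R + T")
      case False
      have "norm x \<le> norm (x + w n) + norm (w n)" using norm_triangle_ineq4[of "x + w n" "w n"] by simp
      then have "R < norm (x + w n)" using False T[of n] by linarith
      then show ?thesis using R B(1) by simp
    qed (use B in simp)
  qed (use s in auto)
  from order_tendstoD(2)[OF LconvD(3)[OF this] d]
  obtain n0 where n0: "\<And>n. n \<ge> n0 \<Longrightarrow> Lpow s (\<lambda>x. g (x + w n) - g x) < d"
    unfolding eventually_sequentially by blast
  show "\<exists>no. \<forall>n\<ge>no. norm (Lpow s (\<lambda>x. f (x + w n) - f x) - 0) < e"
  proof (intro exI allI impI)
    fix n assume "n0 \<le> n"
    have a: "(\<lambda>x. g x - f x) \<in> Lp s" "(\<lambda>x. f x - g x) \<in> Lp s" using f gL s by (auto intro: Lp_diff)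
    have b: "(\<lambda>x. f (x + w n) - g (x + w n)) \<in> Lp s" "(\<lambda>x. g (x + w n) - g x) \<in> Lp s"
      using f gL s by (auto intro!: Lp_diff Lp_translate)
    have c: "Lpow s (\<lambda>x. f (x + w n) - g (x + w n)) < d"
      using Lpow_translate[of "\<lambda>x. f x - g x" s "w n"] g(3) Lpow_minus_commute[of s f g] by simp
    have "Lpow s (\<lambda>x. f (x + w n) - f x)
       = Lpow s (\<lambda>x. (f (x + w n) - g (x + w n)) + ((g (x + w n) - g x) + (g x - f x)))" by simp
    also have "\<dots> \<le> 2 powr s * (Lpow s (\<lambda>x. f (x + w n) - g (x + w n)) + Lpow s (\<lambda>x. (g (x + w n) - g x) + (g x - f x)))"
      using s a b by (intro Lpow_add_le Lp_add) auto
    also have "\<dots> \<le> 2 powr s * (Lpow s (\<lambda>x. f (x + w n) - g (x + w n))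
        + 2 powr s * (Lpow s (\<lambda>x. g (x + w n) - g x) + Lpow s (\<lambda>x. g x - f x)))"
      using s a b by (intro mult_left_mono add_left_mono Lpow_add_le) auto
    also have "\<dots> \<le> 2 powr s * (2 powr s * d + 2 powr s * (d + d))"
    proof (intro mult_left_mono add_mono)
      have "1 * d \<le> 2 powr s * d" using one d by (intro mult_right_mono) auto
      then show "Lpow s (\<lambda>x. f (x + w n) - g (x + w n)) \<le> 2 powr s * d" using c by linarith
    qed (use n0[OF \<open>n0 \<le> n\<close>] g(3) in auto)
    also have "\<dots> = 3 / 4 * e" by (simp add: d_def)
    also have "\<dots> < e" using e by simp
    finally show "norm (Lpow s (\<lambda>x. f (x + w n) - f x) - 0) < e" by simp
  qed
qed

text \<open>The kernel variable is left unscaled, so no power of \<open>t\<close> appears and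
  negative \<open>t\<close> are allowed: changing the sign of \<open>t\<close> gives the adjoint
  operator. Kernels need be neither positive nor of integral 1, since derivatives of mollifiers are
  inserted later.\<close>

definition moll :: "('a::euclidean_space \<Rightarrow> real) \<Rightarrow> real \<Rightarrow> ('a \<Rightarrow> real) \<Rightarrow> 'a \<Rightarrow> real" where
  "moll \<eta> t f x = (LINT z|lborel. \<eta> z * f (x + t *\<^sub>R z))"

lemma moll_measurable [measurable]:
  assumes [measurable]: "\<eta> \<in> borel_measurable borel" "f \<in> borel_measurable borel"
  shows "moll \<eta> t f \<in> borel_measurable borel"
proof -
  have "(\<lambda>x. LINT z|lborel. \<eta> z * f (x + t *\<^sub>R z)) \<in> borel_measurable lborel"
    by (rule lborel.borel_measurable_lebesgue_integral) measurable
  then show ?thesis unfolding moll_def[abs_def] by simp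
qed

text \<open>Hoelder's inequality with weights 1/s and 1 - 1/s, applied to
  \<open>\<eta> z * \<bar>g z\<bar> powr s\<close> and \<open>\<eta> z\<close>, the latter of
  integral 1.\<close>

lemma Jensen_powr:
  fixes \<eta> g :: "'a::euclidean_space \<Rightarrow> real"
  assumes \<eta>: "integrable lborel \<eta>" "\<And>z. 0 \<le> \<eta> z" "(LINT z|lborel. \<eta> z) = 1"
    and g[measurable]: "g \<in> borel_measurable borel" and s: "1 \<le> s"
    and i: "integrable lborel (\<lambda>z. \<eta> z * \<bar>g z\<bar> powr s)"
  shows "integrable lborel (\<lambda>z. \<eta> z * g z)"
    "\<bar>LINT z|lborel. \<eta> z * g z\<bar> powr s \<le> (LINT z|lborel. \<eta> z * \<bar>g z\<bar> powr s)"
proof -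
  note [measurable] = borel_measurable_integrable[OF \<eta>(1)]
  have *: "integrable lborel (\<lambda>z. \<eta> z * \<bar>g z\<bar>) \<and>
     (LINT z|lborel. \<eta> z * \<bar>g z\<bar>) powr s \<le> (LINT z|lborel. \<eta> z * \<bar>g z\<bar> powr s)"
  proof (cases "s = 1")
    case True
    then show ?thesis using i \<eta> by simp
  next
    case False
    then have s1: "1 < s" using s by simp
    have eq: "(\<eta> z * \<bar>g z\<bar> powr s) powr (1 / s) * \<eta> z powr (1 - 1 / s) = \<eta> z * \<bar>g z\<bar>" for z
    proof -
      have "(\<eta> z * \<bar>g z\<bar> powr s) powr (1 / s) * \<eta> z powr (1 - 1 / s)
         = (\<eta> z powr (1 / s) * \<eta> z powr (1 - 1 / s)) * \<bar>g z\<bar>"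
        using s1 \<eta>(2)[of z] by (simp add: powr_mult powr_powr)
      also have "\<eta> z powr (1 / s) * \<eta> z powr (1 - 1 / s) = \<eta> z"
        using s1 \<eta>(2)[of z] by (simp add: powr_add[symmetric])
      finally show ?thesis .
    qed
    have ab: "0 < 1 / s" "0 < 1 - 1 / s" "1 / s + (1 - 1 / s) = 1" using s1 by (auto simp: field_simps)
    note H = Holder_powr[OF ab i _ \<eta>(1) \<eta>(2), unfolded eq \<eta>(3)]
    have 1: "integrable lborel (\<lambda>z. \<eta> z * \<bar>g z\<bar>)"
      by (rule H(1)) (use \<eta> in auto)
    have "(LINT z|lborel. \<eta> z * \<bar>g z\<bar>) \<le> (LINT z|lborel. \<eta> z * \<bar>g z\<bar> powr s) powr (1 / s) * 1 powr (1 - 1 / s)"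
      by (rule H(2)) (use \<eta> in auto)
    then have "(LINT z|lborel. \<eta> z * \<bar>g z\<bar>) powr s \<le> ((LINT z|lborel. \<eta> z * \<bar>g z\<bar> powr s) powr (1 / s)) powr s"
      using s1 \<eta> by (intro powr_mono2) auto
    also have "\<dots> = (LINT z|lborel. \<eta> z * \<bar>g z\<bar> powr s)"
      using s1 \<eta> by (simp add: powr_powr)
    finally show ?thesis using 1 by simp
  qed
  show "integrable lborel (\<lambda>z. \<eta> z * g z)"
    by (rule Bochner_Integration.integrable_bound[OF conjunct1[OF *]]) (use \<eta> in \<open>auto simp: abs_mult\<close>)
  have "\<bar>LINT z|lborel. \<eta> z * g z\<bar> \<le> (LINT z|lborel. \<eta> z * \<bar>g z\<bar>)"
    using integral_abs_bound[of lborel "\<lambda>z. \<eta> z * g z"] \<eta> by (simp add: abs_mult)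
  then have "\<bar>LINT z|lborel. \<eta> z * g z\<bar> powr s \<le> (LINT z|lborel. \<eta> z * \<bar>g z\<bar>) powr s"
    using s by (intro powr_mono2) auto
  with * show "\<bar>LINT z|lborel. \<eta> z * g z\<bar> powr s \<le> (LINT z|lborel. \<eta> z * \<bar>g z\<bar> powr s)" by simp
qed

text \<open>Jensen's inequality at each point, followed by Tonelli. Nonnegative integrals are used
  because integrability in z is not known at every x; where the right side is infinite the bound is
  trivial.\<close>

lemma moll_diff_nn_bound:
  fixes \<eta> f :: "'a::euclidean_space \<Rightarrow> real"
  assumes \<eta>: "integrable lborel \<eta>" "\<And>z. 0 \<le> \<eta> z" "(LINT z|lborel. \<eta> z) = 1"
    and f: "f \<in> Lp s" and s: "1 \<le> s"
  shows "(\<integral>\<^sup>+x. ennreal (\<bar>moll \<eta> t f x - f x\<bar> powr s) \<partial>lborel)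
     \<le> (\<integral>\<^sup>+z. ennreal (\<eta> z * Lpow s (\<lambda>x. f (x + t *\<^sub>R z) - f x)) \<partial>lborel)"
proof -
  note [measurable] = borel_measurable_integrable[OF \<eta>(1)] Lp_measurable[OF f]
  have "ennreal (\<bar>moll \<eta> t f x - f x\<bar> powr s) \<le> (\<integral>\<^sup>+z. ennreal (\<eta> z * \<bar>f (x + t *\<^sub>R z) - f x\<bar> powr s) \<partial>lborel)" for x
  proof (cases "(\<integral>\<^sup>+z. ennreal (\<eta> z * \<bar>f (x + t *\<^sub>R z) - f x\<bar> powr s) \<partial>lborel) < \<infinity>")
    case True
    then have i: "integrable lborel (\<lambda>z. \<eta> z * \<bar>f (x + t *\<^sub>R z) - f x\<bar> powr s)"
      by (intro integrableI_nonneg) (use \<eta> in auto)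
    note J = Jensen_powr[OF \<eta> _ s i]
    have "integrable lborel (\<lambda>z. \<eta> z * (f (x + t *\<^sub>R z) - f x) + \<eta> z * f x)"
      by (intro Bochner_Integration.integrable_add J(1)) (use \<eta> in auto)
    then have i2: "integrable lborel (\<lambda>z. \<eta> z * f (x + t *\<^sub>R z))" by (simp add: algebra_simps)
    have "moll \<eta> t f x - f x = (LINT z|lborel. \<eta> z * (f (x + t *\<^sub>R z) - f x))"
      using i2 \<eta> by (simp add: moll_def right_diff_distrib)
    then have "\<bar>moll \<eta> t f x - f x\<bar> powr s \<le> (LINT z|lborel. \<eta> z * \<bar>f (x + t *\<^sub>R z) - f x\<bar> powr s)"
      using J(2) by simp
    also have "ennreal \<dots> = (\<integral>\<^sup>+z. ennreal (\<eta> z * \<bar>f (x + t *\<^sub>R z) - f x\<bar> powr s) \<partial>lborel)"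
      using i \<eta> by (intro nn_integral_eq_integral[symmetric]) auto
    finally show ?thesis by (simp add: ennreal_leI)
  next
    case False
    then show ?thesis by (simp add: not_less top_unique)
  qed
  then have "(\<integral>\<^sup>+x. ennreal (\<bar>moll \<eta> t f x - f x\<bar> powr s) \<partial>lborel)
    \<le> (\<integral>\<^sup>+x. \<integral>\<^sup>+z. ennreal (\<eta> z * \<bar>f (x + t *\<^sub>R z) - f x\<bar> powr s) \<partial>lborel \<partial>lborel)"
    by (intro nn_integral_mono)
  also have "\<dots> = (\<integral>\<^sup>+z. \<integral>\<^sup>+x. ennreal (\<eta> z * \<bar>f (x + t *\<^sub>R z) - f x\<bar> powr s) \<partial>lborel \<partial>lborel)"
    by (rule lborel_pair.Fubini') measurable
  also have "\<dots> = (\<integral>\<^sup>+z. ennreal (\<eta> z * Lpow s (\<lambda>x. f (x + t *\<^sub>R z) - f x)) \<partial>lborel)"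
  proof (intro nn_integral_cong)
    fix z
    have "(\<lambda>x. f (x + t *\<^sub>R z) - f x) \<in> Lp s" using f s by (intro Lp_diff Lp_translate) auto
    from Lp_integrable[OF this]
    show "(\<integral>\<^sup>+x. ennreal (\<eta> z * \<bar>f (x + t *\<^sub>R z) - f x\<bar> powr s) \<partial>lborel) = ennreal (\<eta> z * Lpow s (\<lambda>x. f (x + t *\<^sub>R z) - f x))"
      using \<eta>(2)[of z] unfolding Lpow_def
      by (subst nn_integral_eq_integral) auto
  qed
  finally show ?thesis .
qed

text \<open>By \<open>moll_diff_nn_bound\<close> the error is an average over the kernel of
  translation errors, which tend to 0 for each \<open>z\<close> and are bounded by the constant
  \<open>C\<close>.\<close>

lemma moll_Lconv:
  fixes \<eta> f :: "real^3 \<Rightarrow> real" and t :: "nat \<Rightarrow> real"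
  assumes \<eta>: "integrable lborel \<eta>" "\<And>z. 0 \<le> \<eta> z" "(LINT z|lborel. \<eta> z) = 1"
    and f: "f \<in> Lp s" and s: "1 \<le> s" and t: "t \<longlonglongrightarrow> 0"
  shows "Lconv s (\<lambda>n. moll \<eta> (t n) f) f"
proof -
  note [measurable] = borel_measurable_integrable[OF \<eta>(1)] Lp_measurable[OF f]
  define C where "C = 2 powr s * (Lpow s f + Lpow s f)"
  define \<Phi> where "\<Phi> n z = Lpow s (\<lambda>x. f (x + t n *\<^sub>R z) - f x)" for n z
  have \<Phi>C: "0 \<le> \<Phi> n z" "\<Phi> n z \<le> C" for n z
  proof -
    show "0 \<le> \<Phi> n z" by (simp add: \<Phi>_def)
    have "\<Phi> n z = Lpow s (\<lambda>x. f (x + t n *\<^sub>R z) + - f x)" by (simp add: \<Phi>_def)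
    also have "\<dots> \<le> 2 powr s * (Lpow s (\<lambda>x. f (x + t n *\<^sub>R z)) + Lpow s (\<lambda>x. - f x))"
      using f s by (intro Lpow_add_le Lp_translate Lp_uminus) auto
    also have "\<dots> = C" by (simp add: C_def Lpow_translate) (simp add: Lpow_def)
    finally show "\<Phi> n z \<le> C" .
  qed
  have [measurable]: "\<Phi> n \<in> borel_measurable borel" for n
  proof -
    have "(\<lambda>z. LINT x|lborel. \<bar>f (x + t n *\<^sub>R z) - f x\<bar> powr s) \<in> borel_measurable lborel"
      by (rule lborel.borel_measurable_lebesgue_integral) measurable
    then show ?thesis unfolding \<Phi>_def[abs_def] Lpow_def by simp
  qed
  have iC: "integrable lborel (\<lambda>z. \<eta> z * C)" using \<eta> by simp
  have i\<Phi>: "integrable lborel (\<lambda>z. \<eta> z * \<Phi> n z)" for n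
    by (rule Bochner_Integration.integrable_bound[OF iC])
       (use \<eta> \<Phi>C in \<open>auto simp: abs_mult intro!: AE_I2 mult_left_mono order_trans[OF \<Phi>C(2) abs_ge_self]\<close>)
  have lim: "(\<lambda>n. LINT z|lborel. \<eta> z * \<Phi> n z) \<longlonglongrightarrow> (LINT z::real^3|lborel. 0)"
  proof (rule integral_dominated_convergence[OF _ _ iC])
    show "AE z in lborel. (\<lambda>n. \<eta> z * \<Phi> n z) \<longlonglongrightarrow> 0"
    proof (rule AE_I2)
      fix z :: "real^3"
      have "(\<lambda>n. t n *\<^sub>R z) \<longlonglongrightarrow> 0 *\<^sub>R z" by (intro tendsto_intros t)
      then have "(\<lambda>n. t n *\<^sub>R z) \<longlonglongrightarrow> 0" by simp
      from LconvD(3)[OF Lconv_translate[OF f _ this]] s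
      show "(\<lambda>n. \<eta> z * \<Phi> n z) \<longlonglongrightarrow> 0" unfolding \<Phi>_def by (intro tendsto_mult_right_zero) auto
    qed
    show "AE z in lborel. norm (\<eta> z * \<Phi> n z) \<le> \<eta> z * C" for n
      using \<eta> \<Phi>C by (auto simp: abs_mult intro!: AE_I2 mult_left_mono)
  qed measurable
  have nn: "(\<integral>\<^sup>+x. ennreal (\<bar>moll \<eta> (t n) f x - f x\<bar> powr s) \<partial>lborel) \<le> ennreal (LINT z|lborel. \<eta> z * \<Phi> n z)" for n
    using moll_diff_nn_bound[OF \<eta> f s, of "t n"] i\<Phi>[of n] \<eta> \<Phi>C
    unfolding \<Phi>_def[symmetric] by (subst (asm) (2) nn_integral_eq_integral) auto
  have d: "(\<lambda>x. moll \<eta> (t n) f x - f x) \<in> Lp s" for n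
    by (intro LpI integrableI_nonneg) (use nn[of n] in \<open>auto intro: le_less_trans\<close>)
  have le: "Lpow s (\<lambda>x. moll \<eta> (t n) f x - f x) \<le> (LINT z|lborel. \<eta> z * \<Phi> n z)" for n
  proof -
    have "ennreal (Lpow s (\<lambda>x. moll \<eta> (t n) f x - f x)) \<le> ennreal (LINT z|lborel. \<eta> z * \<Phi> n z)"
      using nn[of n] Lp_integrable[OF d[of n]] unfolding Lpow_def by (subst (asm) nn_integral_eq_integral) auto
    moreover have "0 \<le> (LINT z|lborel. \<eta> z * \<Phi> n z)"
      by (intro integral_nonneg_AE AE_I2 mult_nonneg_nonneg \<eta> \<Phi>C)
    ultimately show ?thesis by (simp add: ennreal_le_iff)
  qed
  have "moll \<eta> (t n) f \<in> Lp s" for n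
    using Lp_add[OF d[of n] f] s by simp
  moreover have "(\<lambda>n. Lpow s (\<lambda>x. moll \<eta> (t n) f x - f x)) \<longlonglongrightarrow> 0"
    by (rule tendsto_zero_squeeze[OF Lpow_nonneg le]) (use lim in simp)
  ultimately show ?thesis using f by (simp add: Lconv_def)
qed

section \<open>Convolutions and their derivatives\<close>

definition conv :: "('a::euclidean_space \<Rightarrow> real) \<Rightarrow> ('a \<Rightarrow> real) \<Rightarrow> 'a \<Rightarrow> real" where
  "conv k f x = (LINT y|lborel. k (x - y) * f y)"

text \<open>A locally uniform majorant, the hypothesis under which convolutions may be differentiated under the integral.\<close>

definition conv_dom :: "('a::euclidean_space \<Rightarrow> real) \<Rightarrow> ('a \<Rightarrow> real) \<Rightarrow> bool" where
  "conv_dom k f \<longleftrightarrow> (\<forall>x0. \<exists>W. integrable lborel W \<and> (\<forall>x\<in>cball x0 1. \<forall>y. \<bar>k (x - y) * f y\<bar> \<le> W y))"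



lemma conv_integrable:
  assumes [measurable]: "k \<in> borel_measurable borel" "f \<in> borel_measurable borel" and dom: "conv_dom k f"
  shows "integrable lborel (\<lambda>y. k (x - y) * f y)"
proof -
  obtain W where W: "integrable lborel W" "\<And>x' y. x' \<in> cball x 1 \<Longrightarrow> \<bar>k (x' - y) * f y\<bar> \<le> W y"
    using dom unfolding conv_dom_def by meson
  show ?thesis
  proof (rule Bochner_Integration.integrable_bound[OF W(1)])
    show "AE y in lborel. norm (k (x - y) * f y) \<le> norm (W y)"
      using W(2)[of x] by (auto intro!: AE_I2 order_trans[OF _ abs_ge_self])
  qed measurable
qed

lemma conv_continuous:
  fixes k f :: "'a::euclidean_space \<Rightarrow> real"
  assumes k: "continuous_on UNIV k" and f[measurable]: "f \<in> borel_measurable borel" and dom: "conv_dom k f"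
  shows "continuous_on UNIV (conv k f)"
proof (rule continuous_at_imp_continuous_on, rule ballI)
  fix x :: 'a
  have [measurable]: "k \<in> borel_measurable borel" using k by (rule borel_measurable_continuous_onI)
  obtain W where W: "integrable lborel W" "\<And>x' y. x' \<in> cball x 1 \<Longrightarrow> \<bar>k (x' - y) * f y\<bar> \<le> W y"
    using dom unfolding conv_dom_def by meson
  have "continuous (at x within cball x 1) (conv k f)"
    unfolding continuous_within_sequentially
  proof (intro allI impI, elim conjE)
    fix X assume X: "\<forall>n. X n \<in> cball x 1" "X \<longlonglongrightarrow> x"
    show "(conv k f \<circ> X) \<longlonglongrightarrow> conv k f x"
      unfolding comp_def conv_def
    proof (rule integral_dominated_convergence[OF _ _ W(1)])
      show "AE y in lborel. (\<lambda>n. k (X n - y) * f y) \<longlonglongrightarrow> k (x - y) * f y"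
        by (intro AE_I2 tendsto_intros continuous_on_tendsto_compose[OF k] X(2)) auto
      show "AE y in lborel. norm (k (X n - y) * f y) \<le> W y" for n
        using W(2) X(1) by auto
    qed measurable
  qed
  then show "isCont (conv k f) x"
    by (subst (asm) at_within_interior) (auto simp: interior_cball)
qed

text \<open>The remainder divided by the increment, \<open>Q h\<close>, is the integrand of the
  difference quotient error. The mean value theorem bounds it by twice the majorant of the
  differentiated kernel, uniformly for increments of length at most 1, so dominated convergence
  applies.\<close>

lemma conv_has_derivative:
  fixes k f :: "real^3 \<Rightarrow> real"
  assumes k: "C_diff 1 k" and f[measurable]: "f \<in> borel_measurable borel" and dom: "conv_dom k f"
    and dom': "\<And>j. conv_dom (partial j k) f"
  shows "(conv k f has_derivative (\<lambda>h. \<Sum>j\<in>UNIV. h $ j * conv (partial j k) f x)) (at x)"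
proof -
  have kd: "k differentiable (at z)" and kc: "continuous_on UNIV (partial j k)" for z j using k by auto
  have [measurable]: "k \<in> borel_measurable borel" "partial j k \<in> borel_measurable borel" for j
    using C_diff_continuous[OF k] kc by (auto intro: borel_measurable_continuous_onI)
  have "\<exists>W. integrable lborel W \<and> (\<forall>x'\<in>cball x 1. \<forall>y. \<bar>partial j k (x' - y) * f y\<bar> \<le> W y)" for j
    using dom' unfolding conv_dom_def by blast
  then obtain V where V: "\<And>j. integrable lborel (V j)"
     "\<And>j x' y. x' \<in> cball x 1 \<Longrightarrow> \<bar>partial j k (x' - y) * f y\<bar> \<le> V j y" by metis
  define W where "W y = (\<Sum>j\<in>UNIV. V j y)" for y
  have V0: "0 \<le> V j y" for j y using V(2)[of x j y] abs_ge_zero order_trans by fastforce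
  have W: "integrable lborel W" unfolding W_def using V by auto
  define Q where "Q h y = ((k (x + h - y) - k (x - y) - (\<Sum>j\<in>UNIV. h $ j * partial j k (x - y))) / norm h) * f y" for h y
  have Qm[measurable]: "Q h \<in> borel_measurable borel" for h unfolding Q_def by measurable
  have bd: "\<bar>Q h y\<bar> \<le> 2 * W y" if h: "h \<in> cball 0 1" "h \<noteq> 0" for h y
  proof -
    have S: "\<bar>(\<Sum>j\<in>UNIV. h $ j * partial j k (x' - y)) * f y\<bar> \<le> norm h * W y" if x': "x' \<in> cball x 1" for x'
    proof -
      have "\<bar>(\<Sum>j\<in>UNIV. h $ j * partial j k (x' - y)) * f y\<bar> = \<bar>\<Sum>j\<in>UNIV. h $ j * (partial j k (x' - y) * f y)\<bar>"
        by (simp add: sum_distrib_right mult.assoc)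
      also have "\<dots> \<le> (\<Sum>j\<in>UNIV. \<bar>h $ j * (partial j k (x' - y) * f y)\<bar>)" by (rule sum_abs)
      also have "\<dots> \<le> (\<Sum>j\<in>UNIV. norm h * V j y)"
        unfolding abs_mult[of "h $ _"] by (intro sum_mono mult_mono component_le_norm_cart V(2) x') auto
      finally show ?thesis by (simp add: W_def sum_distrib_left)
    qed
    obtain t where t: "0 < t" "t < 1" "k ((x - y) + h) - k (x - y) = (\<Sum>j\<in>UNIV. h $ j * partial j k ((x - y) + t *\<^sub>R h))"
      using partial_MVT[OF kd] by blast
    have "norm (t *\<^sub>R h) \<le> 1 * 1" using t h unfolding norm_scaleR by (intro mult_mono) auto
    then have xt: "x + t *\<^sub>R h \<in> cball x 1" by (simp add: dist_norm)
    have "(k (x + h - y) - k (x - y) - (\<Sum>j\<in>UNIV. h $ j * partial j k (x - y))) * f y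
       = (\<Sum>j\<in>UNIV. h $ j * partial j k ((x + t *\<^sub>R h) - y)) * f y - (\<Sum>j\<in>UNIV. h $ j * partial j k (x - y)) * f y"
      using t(3) by (simp add: algebra_simps)
    then have "\<bar>(k (x + h - y) - k (x - y) - (\<Sum>j\<in>UNIV. h $ j * partial j k (x - y))) * f y\<bar> \<le> norm h * W y + norm h * W y"
      using S[OF xt] S[of x] by simp
    then have "norm h * \<bar>Q h y\<bar> \<le> norm h * (2 * W y)"
      using h(2) unfolding Q_def by (simp add: abs_mult)
    then show ?thesis using h(2) by simp
  qed
  have lim: "((\<lambda>h. LINT y|lborel. Q h y) \<longlongrightarrow> 0) (at 0 within cball 0 1)"
    unfolding tendsto_at_iff_sequentially
  proof (intro allI impI)
    fix X :: "nat \<Rightarrow> real^3" assume X: "\<forall>i. X i \<in> cball 0 1 - {0}" "X \<longlonglongrightarrow> 0"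
    have "(\<lambda>i. LINT y|lborel. Q (X i) y) \<longlonglongrightarrow> (LINT y::real^3|lborel. 0)"
    proof (rule integral_dominated_convergence[where w = "\<lambda>y. 2 * W y"])
      show "AE y in lborel. (\<lambda>i. Q (X i) y) \<longlonglongrightarrow> 0"
      proof (rule AE_I2)
        fix y
        have "((\<lambda>h. (k ((x - y) + h) - k (x - y) - (\<Sum>j\<in>UNIV. h $ j * partial j k (x - y))) / norm h) \<longlongrightarrow> 0) (at 0)"
        proof -
          have "((\<lambda>h. norm (k ((x - y) + h) - k (x - y) - (\<Sum>j\<in>UNIV. h $ j * partial j k (x - y))) / norm h) \<longlongrightarrow> 0) (at 0)"
            using has_derivative_partial[OF kd, of "x - y"] unfolding has_derivative_at by blast
          then have "((\<lambda>h. \<bar>(k ((x - y) + h) - k (x - y) - (\<Sum>j\<in>UNIV. h $ j * partial j k (x - y))) / norm h\<bar>) \<longlongrightarrow> 0) (at 0)"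
            by (simp add: abs_divide)
          then show ?thesis by (simp only: tendsto_rabs_zero_iff)
        qed
        moreover have "filterlim X (at 0) sequentially" using X by (intro filterlim_atI) auto
        ultimately have "(\<lambda>i. (k ((x - y) + X i) - k (x - y) - (\<Sum>j\<in>UNIV. X i $ j * partial j k (x - y))) / norm (X i)) \<longlonglongrightarrow> 0"
          by (rule filterlim_compose)
        then show "(\<lambda>i. Q (X i) y) \<longlonglongrightarrow> 0"
          unfolding Q_def by (intro tendsto_mult_left_zero) (simp add: algebra_simps)
      qed
      show "AE y in lborel. norm (Q (X i) y) \<le> 2 * W y" for i
        using bd X(1) by auto
    qed (use W in auto)
    then show "((\<lambda>h. LINT y|lborel. Q h y) \<circ> X) \<longlonglongrightarrow> 0" by (simp add: comp_def)
  qed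
  have i: "integrable lborel (\<lambda>y. k (x' - y) * f y)" "integrable lborel (\<lambda>y. partial j k (x' - y) * f y)" for x' j
    by (intro conv_integrable dom dom'; measurable)+
  have Qi: "(conv k f (x + h) - conv k f x - (\<Sum>j\<in>UNIV. h $ j * conv (partial j k) f x)) / norm h = (LINT y|lborel. Q h y)" for h
  proof -
    have "(LINT y|lborel. Q h y) = (LINT y|lborel. (1 / norm h) * (k (x + h - y) * f y - k (x - y) * f y - (\<Sum>j\<in>UNIV. h $ j * (partial j k (x - y) * f y))))"
      by (intro Bochner_Integration.integral_cong refl)
         (simp add: Q_def left_diff_distrib sum_distrib_right mult.assoc diff_divide_distrib sum_divide_distrib)
    also have "\<dots> = (1 / norm h) * (conv k f (x + h) - conv k f x - (\<Sum>j\<in>UNIV. h $ j * conv (partial j k) f x))"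
      unfolding conv_def using i by (subst Bochner_Integration.integral_mult_right) auto
    finally show ?thesis by simp
  qed
  have "((\<lambda>h. (conv k f (x + h) - conv k f x - (\<Sum>j\<in>UNIV. h $ j * conv (partial j k) f x)) / norm h) \<longlongrightarrow> 0) (at 0)"
    unfolding Qi using lim by (subst (asm) at_within_interior) (auto simp: interior_cball)
  from tendsto_rabs_zero[OF this]
  have "((\<lambda>h. norm (conv k f (x + h) - conv k f x - (\<Sum>j\<in>UNIV. h $ j * conv (partial j k) f x)) / norm h) \<longlongrightarrow> 0) (at 0)"
    by (simp add: abs_divide)
  moreover have "bounded_linear (\<lambda>h::real^3. \<Sum>j\<in>UNIV. h $ j * conv (partial j k) f x)"
    by (intro bounded_linear_sum bounded_linear_mult_left[THEN bounded_linear_compose] bounded_linear_vec_nth)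
  ultimately show ?thesis unfolding has_derivative_at by blast
qed

lemma conv_partial:
  fixes k f :: "real^3 \<Rightarrow> real"
  assumes k: "C_diff 1 k" and f: "f \<in> borel_measurable borel" and dom: "conv_dom k f"
    and dom': "\<And>j. conv_dom (partial j k) f"
  shows "partial i (conv k f) = conv (partial i k) f" "C_diff 1 (conv k f)"
proof -
  note D = conv_has_derivative[OF assms]
  show p: "partial i (conv k f) = conv (partial i k) f" for i
    by (rule ext) (rule has_derivative_imp_partial[OF D])
  have "continuous_on UNIV (conv (partial i k) f)" for i
    by (rule conv_continuous[OF _ f dom']) (use k in auto)
  then show "C_diff 1 (conv k f)"
    using D by (auto simp: p differentiable_def)
qed

text \<open>The case of the regularised Newton kernels, which are bounded but not compactly
  supported.\<close>

lemma conv_dom_bounded: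
  assumes "\<And>x. \<bar>k x\<bar> \<le> B" and f: "integrable lborel f"
  shows "conv_dom k f"
  unfolding conv_dom_def
proof (intro allI exI conjI ballI)
  show "integrable lborel (\<lambda>y. B * \<bar>f y\<bar>)" using f by simp
  show "\<bar>k (x - y) * f y\<bar> \<le> B * \<bar>f y\<bar>" for x y
    using assms(1)[of "x - y"] by (simp add: abs_mult mult_right_mono)
qed

text \<open>The case of mollification, where the other factor is only locally integrable: for x
  within distance 1 of \<open>x0\<close> only its values on one ball matter.\<close>

lemma conv_dom_compact_support:
  fixes k f :: "real^3 \<Rightarrow> real"
  assumes k: "continuous_on UNIV k" "compact_support k"
    and f: "\<And>R. integrable lborel (\<lambda>y. indicator (cball 0 R) y * f y)"
  shows "conv_dom k f"
  unfolding conv_dom_def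
proof (intro allI)
  fix x0 :: "real^3"
  obtain R where R: "0 < R" "\<And>x. R < norm x \<Longrightarrow> k x = 0" using k(2) unfolding compact_support_iff by blast
  obtain B where B: "0 \<le> B" "\<And>x. \<bar>k x\<bar> \<le> B" using compact_support_bounded[OF k] by blast
  let ?W = "\<lambda>y. B * \<bar>indicator (cball 0 (norm x0 + 1 + R)) y * f y\<bar>"
  show "\<exists>W. integrable lborel W \<and> (\<forall>x\<in>cball x0 1. \<forall>y. \<bar>k (x - y) * f y\<bar> \<le> W y)"
  proof (intro exI[of _ ?W] conjI ballI allI)
    show "integrable lborel ?W" using f by (intro integrable_mult_right integrable_abs)
    fix x y :: "real^3" assume x: "x \<in> cball x0 1"
    show "\<bar>k (x - y) * f y\<bar> \<le> ?W y"
    proof (cases "norm y \<le> norm x0 + 1 + R")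
      case True
      then show ?thesis using B(2)[of "x - y"] by (simp add: abs_mult mult_right_mono)
    next
      case False
      have "norm (x - x0) \<le> 1" using x by (simp add: dist_norm norm_minus_commute)
      moreover have "norm y \<le> norm (x - y) + norm (x - x0) + norm x0"
        using norm_triangle_ineq4[of "x - x0" "x - y"] norm_triangle_ineq4[of "x0" "- y + x0"]
        by (smt (verit) norm_minus_commute norm_triangle_sub)
      ultimately have "R < norm (x - y)" using False by linarith
      then show ?thesis using R B(1) by simp
    qed
  qed
qed

lemma Cc_infinity_partial: "f \<in> Cc_infinity \<Longrightarrow> partial i f \<in> Cc_infinity" for f :: "real^3 \<Rightarrow> real"
  unfolding Cc_infinity_def using compact_support_partial[of f i] C_diff.simps(2) by (auto simp del: C_diff.simps)

lemma Cc_infinityD: "f \<in> Cc_infinity \<Longrightarrow> C_diff n f" "f \<in> Cc_infinity \<Longrightarrow> compact_support f"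
  by (auto simp: Cc_infinity_def)

text \<open>All derivatives fall on the kernel, so the induction generalises over the kernel and
  leaves \<open>f\<close> alone.\<close>

lemma C_diff_conv:
  fixes k f :: "real^3 \<Rightarrow> real"
  assumes "k \<in> Cc_infinity" and [measurable]: "f \<in> borel_measurable borel"
    and f: "\<And>R. integrable lborel (\<lambda>y. indicator (cball 0 R) y * f y)"
  shows "C_diff n (conv k f)"
  using assms(1)
proof (induction n arbitrary: k)
  case 0
  then show ?case
    using C_diff_continuous[OF Cc_infinityD(1)[OF 0, of 0]] Cc_infinityD(2)[OF 0]
    by (auto intro!: conv_continuous conv_dom_compact_support f)
next
  case (Suc n)
  have dom: "conv_dom h f" if "h \<in> Cc_infinity" for h
    using C_diff_continuous[OF Cc_infinityD(1)[OF that, of 0]] Cc_infinityD(2)[OF that]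
    by (auto intro!: conv_dom_compact_support f)
  note P = conv_partial[OF Cc_infinityD(1)[OF Suc.prems] assms(2) dom[OF Suc.prems] dom[OF Cc_infinity_partial[OF Suc.prems]]]
  show ?case
    unfolding C_diff.simps(2) P(1)
    using P(2) Suc.IH[OF Cc_infinity_partial[OF Suc.prems]] by auto
qed

lemma compact_support_conv:
  fixes k f :: "real^3 \<Rightarrow> real"
  assumes "compact_support k" "compact_support f"
  shows "compact_support (conv k f)"
proof -
  obtain R where R: "\<And>x. R < norm x \<Longrightarrow> k x = 0" using assms(1) unfolding compact_support_iff by blast
  obtain R' where R': "\<And>x. R' < norm x \<Longrightarrow> f x = 0" using assms(2) unfolding compact_support_iff by blast
  show ?thesis
  proof (rule compact_supportI)
    fix x :: "real^3" assume x: "R + R' < norm x"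
    have "k (x - y) * f y = 0" for y
    proof (cases "R' < norm y")
      case False
      have "norm x \<le> norm (x - y) + norm y" by (metis diff_add_cancel norm_triangle_ineq)
      then show ?thesis using R[of "x - y"] False x by simp
    qed (use R' in simp)
    then show "conv k f x = 0" unfolding conv_def by (simp only: integral_zero)
  qed
qed

lemma lborel_integral_affine:
  fixes g :: "'a::euclidean_space \<Rightarrow> real"
  assumes [measurable]: "g \<in> borel_measurable borel" and t: "t \<noteq> 0"
  shows "(LINT y|lborel. g y) = \<bar>t\<bar> ^ DIM('a) * (LINT z|lborel. g (x + t *\<^sub>R z))"
proof -
  have "(LINT y|lborel. g y) = (LINT y|density (distr lborel borel (\<lambda>z. x + t *\<^sub>R z)) (\<lambda>_. ennreal (\<bar>t\<bar> ^ DIM('a))). g y)"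
    using lborel_affine[OF t, of x] by simp
  also have "\<dots> = (LINT y|distr lborel borel (\<lambda>z. x + t *\<^sub>R z). \<bar>t\<bar> ^ DIM('a) *\<^sub>R g y)"
    by (rule integral_density) auto
  also have "\<dots> = \<bar>t\<bar> ^ DIM('a) * (LINT z|lborel. g (x + t *\<^sub>R z))"
    by (subst integral_distr) auto
  finally show ?thesis .
qed

lemma moll_eq_conv:
  fixes \<eta> f :: "real^3 \<Rightarrow> real"
  assumes [measurable]: "\<eta> \<in> borel_measurable borel" "f \<in> borel_measurable borel" and t: "t \<noteq> 0"
  shows "moll \<eta> t f x = conv (\<lambda>w. (1 / \<bar>t\<bar> ^ 3) * \<eta> (0 + (- 1 / t) *\<^sub>R w)) f x"
proof -
  have "conv (\<lambda>w. (1 / \<bar>t\<bar> ^ 3) * \<eta> (0 + (- 1 / t) *\<^sub>R w)) f x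
     = \<bar>t\<bar> ^ 3 * (LINT z|lborel. (1 / \<bar>t\<bar> ^ 3) * \<eta> (0 + (- 1 / t) *\<^sub>R (x - (x + t *\<^sub>R z))) * f (x + t *\<^sub>R z))"
    unfolding conv_def using t by (subst lborel_integral_affine[of _ t x]) auto
  also have "\<dots> = moll \<eta> t f x"
    unfolding moll_def using t by (simp add: mult.assoc)
  finally show ?thesis by simp
qed

section \<open>Cutoffs and the standard mollifier\<close>

lemma Cc_infinity_affine:
  fixes f :: "real^3 \<Rightarrow> real"
  assumes "f \<in> Cc_infinity" "c \<noteq> 0"
  shows "(\<lambda>x. f (a + c *\<^sub>R x)) \<in> Cc_infinity"
  using assms by (auto simp: Cc_infinity_def intro!: C_diff_affine compact_support_affine)

lemma Cc_infinity_cmult: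
  fixes f :: "real^3 \<Rightarrow> real"
  assumes "f \<in> Cc_infinity"
  shows "(\<lambda>x. c * f x) \<in> Cc_infinity"
  using assms compact_support_mult[of f "\<lambda>x. c"] by (auto simp: Cc_infinity_def mult.commute intro!: C_diff_cmult)

text \<open>Dilations of \<open>bump\<close> normalised to be 1 at the origin, though not on any
  ball; only pointwise convergence to 1 and the decay 1 / (n + 1) of the gradient are used.\<close>

definition cutoff :: "nat \<Rightarrow> real^3 \<Rightarrow> real" where
  "cutoff n x = (1 / bump 0) * bump (0 + (1 / real (Suc n)) *\<^sub>R x)"

lemma cutoff_Cc_infinity: "cutoff n \<in> Cc_infinity"
  unfolding cutoff_def[abs_def] by (intro Cc_infinity_cmult Cc_infinity_affine bump_Cc_infinity) simp

lemma bump_Cc_1: "bump \<in> Cc 1"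
  by (rule Cc_infinity_imp_Cc[OF bump_Cc_infinity])

lemma cutoff_bounds:
  obtains B where "0 \<le> B" "\<And>n x. \<bar>cutoff n x\<bar> \<le> B" "\<And>n i x. \<bar>partial i (cutoff n) x\<bar> \<le> B / real (Suc n)"
proof -
  obtain A where A: "0 \<le> A" "\<And>x. \<bar>bump x\<bar> \<le> A"
    using compact_support_bounded[OF Cc_1D(2,4)[OF bump_Cc_1]] by blast
  have "\<exists>B. 0 \<le> B \<and> (\<forall>x. \<bar>partial j bump x\<bar> \<le> B)" for j
    by (meson compact_support_bounded Cc_1D(3,5)[OF bump_Cc_1])
  then obtain D where D: "\<And>j. 0 \<le> D j" "\<And>j x. \<bar>partial j bump x\<bar> \<le> D j" by metis
  define S where "S = A + (\<Sum>j\<in>UNIV. D j)"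
  have DS: "D j \<le> S" for j
    using member_le_sum[of j UNIV D] D A unfolding S_def by (smt (verit) finite UNIV_I)
  have AS: "A \<le> S" using D by (simp add: S_def sum_nonneg)
  have S0: "0 \<le> S" using AS A by linarith
  show ?thesis
  proof (rule that[of "S / bump 0"])
    show "0 \<le> S / bump 0" using S0 bump_0 by simp
    show "\<bar>cutoff n x\<bar> \<le> S / bump 0" for n x
      using order_trans[OF A(2) AS] bump_0 by (simp add: cutoff_def divide_right_mono)
    show "\<bar>partial i (cutoff n) x\<bar> \<le> S / bump 0 / real (Suc n)" for n i x
    proof -
      have "partial i (cutoff n) x = (1 / bump 0) * ((1 / real (Suc n)) * partial i bump (0 + (1 / real (Suc n)) *\<^sub>R x))"
        unfolding cutoff_def[abs_def]
        by (subst Cc_1_cmult(2)[OF Cc_1_affine(1)[OF bump_Cc_1]], simp, subst Cc_1_affine(2)[OF bump_Cc_1]) simp_all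
      then have "\<bar>partial i (cutoff n) x\<bar> = \<bar>partial i bump (0 + (1 / real (Suc n)) *\<^sub>R x)\<bar> / bump 0 / real (Suc n)"
        using bump_0 by (simp add: abs_mult)
      also have "\<dots> \<le> S / bump 0 / real (Suc n)"
        using order_trans[OF D(2) DS] bump_0 by (intro divide_right_mono) auto
      finally show ?thesis .
    qed
  qed
qed

lemma cutoff_LIMSEQ: "(\<lambda>n. cutoff n x) \<longlonglongrightarrow> 1"
proof -
  have "(\<lambda>n. 0 + (1 / real (Suc n)) *\<^sub>R x) \<longlonglongrightarrow> 0 + 0 *\<^sub>R x"
    by (intro tendsto_intros inverse_Suc_LIMSEQ)
  then have "(\<lambda>n. 0 + (1 / real (Suc n)) *\<^sub>R x) \<longlonglongrightarrow> 0" by simp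
  from continuous_on_tendsto_compose[OF Cc_1D(2)[OF bump_Cc_1] this]
  have "(\<lambda>n. (1 / bump 0) * bump (0 + (1 / real (Suc n)) *\<^sub>R x)) \<longlonglongrightarrow> (1 / bump 0) * bump 0"
    by (intro tendsto_intros) auto
  then show ?thesis using bump_0 by (simp add: cutoff_def)
qed

definition std_moll :: "real^3 \<Rightarrow> real" where
  "std_moll x = (1 / (LINT x|lborel. bump x)) * bump x"

text \<open>A zero integral would make the nonempty open set where \<open>bump\<close> is positive
  negligible.\<close>

lemma bump_integral_pos: "0 < (LINT x|lborel. bump x)"
proof (rule ccontr)
  assume "\<not> ?thesis"
  moreover have "0 \<le> (LINT x|lborel. bump x)" using bump_nonneg by simp
  ultimately have "(LINT x|lborel. bump x) = 0" by linarith
  then have "AE x in lborel. bump x = 0"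
    using integral_nonneg_eq_0_iff_AE[OF Cc_1_integrable(1)[OF bump_Cc_1]] bump_nonneg by auto
  then have "AE x in lebesgue. bump x = 0" by (simp add: AE_completion_iff)
  have o: "open {x. 0 < bump x}"
    using Cc_1D(2)[OF bump_Cc_1] by (intro open_Collect_less continuous_intros)
  have "{x. 0 < bump x} \<in> sets lebesgue" using borel_open[OF o] by (simp add: sets_completionI_sets)
  moreover have "AE x in lebesgue. x \<notin> {x. 0 < bump x}"
    using \<open>AE x in lebesgue. bump x = 0\<close> by eventually_elim simp
  ultimately have "{x. 0 < bump x} \<in> null_sets lebesgue"
    by (simp only: AE_iff_null_sets)
  then have "negligible {x. 0 < bump x}" by (simp add: negligible_iff_null_sets)
  then have "{x. 0 < bump x} = {}" using o open_not_negligible by blast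
  then show False using bump_0 by auto
qed

lemma std_moll: "std_moll \<in> Cc_infinity" "\<And>z. 0 \<le> std_moll z" "integrable lborel std_moll"
  "(LINT z|lborel. std_moll z) = 1"
proof -
  show c: "std_moll \<in> Cc_infinity"
    unfolding std_moll_def[abs_def] by (intro Cc_infinity_cmult bump_Cc_infinity)
  show "\<And>z. 0 \<le> std_moll z" using bump_nonneg bump_integral_pos by (simp add: std_moll_def)
  show "integrable lborel std_moll" by (rule Cc_1_integrable(1)[OF Cc_infinity_imp_Cc[OF c]])
  show "(LINT z|lborel. std_moll z) = 1" using bump_integral_pos by (simp add: std_moll_def)
qed

lemma std_moll_Cc_1: "std_moll \<in> Cc 1"
  by (rule Cc_infinity_imp_Cc[OF std_moll(1)])

lemma std_moll_support:
  obtains R where "0 < R" "\<And>x. R < norm x \<Longrightarrow> std_moll x = 0"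
  using Cc_1D(4)[OF std_moll_Cc_1] unfolding compact_support_iff by blast

text \<open>The kernel that turns mollification into a convolution; the minus sign in its argument
  undoes the reflection inherent in \<open>conv\<close>.\<close>

definition moll_kernel :: "real \<Rightarrow> real^3 \<Rightarrow> real" where
  "moll_kernel t w = (1 / \<bar>t\<bar> ^ 3) * std_moll (0 + (- 1 / t) *\<^sub>R w)"

lemma moll_kernel_Cc_infinity: "t \<noteq> 0 \<Longrightarrow> moll_kernel t \<in> Cc_infinity"
  unfolding moll_kernel_def[abs_def] by (intro Cc_infinity_cmult Cc_infinity_affine std_moll(1)) simp

lemma moll_std_eq_conv:
  assumes "f \<in> borel_measurable borel" "t \<noteq> 0"
  shows "moll std_moll t f = conv (moll_kernel t) f"
  unfolding moll_kernel_def
  by (rule ext) (rule moll_eq_conv[OF Cc_1_measurable(1)[OF std_moll_Cc_1] assms])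

text \<open>Here the function, not the kernel, is the differentiable factor of the convolution. This
  form shows that derivatives of a mollified C1 function are the mollified derivatives.\<close>

lemma moll_eq_conv':
  fixes \<eta> f :: "real^3 \<Rightarrow> real"
  assumes [measurable]: "\<eta> \<in> borel_measurable borel" "f \<in> borel_measurable borel" and t: "t \<noteq> 0"
  shows "moll \<eta> t f x = conv f (\<lambda>w. (1 / \<bar>t\<bar> ^ 3) * \<eta> (0 + (- 1 / t) *\<^sub>R w)) x"
proof -
  have "conv f (\<lambda>w. (1 / \<bar>t\<bar> ^ 3) * \<eta> (0 + (- 1 / t) *\<^sub>R w)) x
     = \<bar>- t\<bar> ^ 3 * (LINT z|lborel. f (x - (0 + (- t) *\<^sub>R z)) * ((1 / \<bar>t\<bar> ^ 3) * \<eta> (0 + (- 1 / t) *\<^sub>R (0 + (- t) *\<^sub>R z))))"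
    unfolding conv_def using t by (subst lborel_integral_affine[of _ "- t" 0]) auto
  also have "\<dots> = moll \<eta> t f x"
    unfolding moll_def using t by (simp add: mult_ac)
  finally show ?thesis by simp
qed

lemma moll_pointwise:
  fixes g :: "real^3 \<Rightarrow> real" and t :: "nat \<Rightarrow> real"
  assumes \<eta>: "integrable lborel \<eta>" "(LINT z|lborel. \<eta> z) = 1"
    and g: "continuous_on UNIV g" "\<And>x. \<bar>g x\<bar> \<le> B" and t: "t \<longlonglongrightarrow> 0"
  shows "(\<lambda>n. moll \<eta> (t n) g x) \<longlonglongrightarrow> g x"
proof -
  have [measurable]: "g \<in> borel_measurable borel" using g(1) by (rule borel_measurable_continuous_onI)
  note [measurable] = borel_measurable_integrable[OF \<eta>(1)]
  have "(\<lambda>n. LINT z|lborel. \<eta> z * g (x + t n *\<^sub>R z)) \<longlonglongrightarrow> (LINT z|lborel. \<eta> z * g x)"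
  proof (rule integral_dominated_convergence[where w = "\<lambda>z. \<bar>\<eta> z\<bar> * B"])
    show "integrable lborel (\<lambda>z. \<bar>\<eta> z\<bar> * B)" using \<eta> by simp
    show "AE z in lborel. (\<lambda>n. \<eta> z * g (x + t n *\<^sub>R z)) \<longlonglongrightarrow> \<eta> z * g x"
    proof (rule AE_I2)
      fix z :: "real^3"
      have "(\<lambda>n. x + t n *\<^sub>R z) \<longlonglongrightarrow> x + 0 *\<^sub>R z" by (intro tendsto_intros t)
      then have "(\<lambda>n. x + t n *\<^sub>R z) \<longlonglongrightarrow> x" by simp
      then show "(\<lambda>n. \<eta> z * g (x + t n *\<^sub>R z)) \<longlonglongrightarrow> \<eta> z * g x"
        by (intro tendsto_intros continuous_on_tendsto_compose[OF g(1)]) auto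
    qed
    show "AE z in lborel. norm (\<eta> z * g (x + t n *\<^sub>R z)) \<le> \<bar>\<eta> z\<bar> * B" for n
      using g(2) by (auto simp: abs_mult mult_left_mono)
  qed measurable
  then show ?thesis using \<eta> by (simp add: moll_def)
qed

lemma moll_bound:
  fixes g :: "'a::euclidean_space \<Rightarrow> real"
  assumes \<eta>: "integrable lborel \<eta>" "(LINT z|lborel. \<eta> z) = 1" "\<And>z. 0 \<le> \<eta> z"
    and [measurable]: "g \<in> borel_measurable borel" and g: "\<And>x. \<bar>g x\<bar> \<le> B"
  shows "\<bar>moll \<eta> t g x\<bar> \<le> B"
proof -
  note [measurable] = borel_measurable_integrable[OF \<eta>(1)]
  have "\<bar>moll \<eta> t g x\<bar> \<le> (LINT z|lborel. \<bar>\<eta> z * g (x + t *\<^sub>R z)\<bar>)"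
    unfolding moll_def by (rule integral_abs_bound)
  also have "\<dots> \<le> (LINT z|lborel. \<eta> z * B)"
  proof (rule integral_mono)
    show b: "\<bar>\<eta> z * g (x + t *\<^sub>R z)\<bar> \<le> \<eta> z * B" for z using g \<eta>(3)[of z] by (simp add: abs_mult mult_left_mono)
    show i: "integrable lborel (\<lambda>z. \<eta> z * B)" using \<eta> by simp
    show "integrable lborel (\<lambda>z. \<bar>\<eta> z * g (x + t *\<^sub>R z)\<bar>)"
      by (rule Bochner_Integration.integrable_bound[OF i]) (use order_trans[OF b abs_ge_self] in \<open>auto simp: abs_mult\<close>)
  qed
  finally show ?thesis using \<eta> by simp
qed

text \<open>The continuity equation is given for smooth test functions, but later test functions are
  products that are only C1. Common bounds and a common support make the approximation suitable for
  dominated convergence.\<close>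

lemma Cc_1_approx:
  fixes f :: "real^3 \<Rightarrow> real"
  assumes f: "f \<in> Cc 1"
  obtains F R B where "\<And>n. F n \<in> Cc_infinity" "\<And>n x. R < norm x \<Longrightarrow> F n x = 0"
    "\<And>n j x. R < norm x \<Longrightarrow> partial j (F n) x = 0"
    "\<And>n x. \<bar>F n x\<bar> \<le> B" "\<And>n j x. \<bar>partial j (F n) x\<bar> \<le> B"
    "\<And>x. (\<lambda>n. F n x) \<longlonglongrightarrow> f x" "\<And>j x. (\<lambda>n. partial j (F n) x) \<longlonglongrightarrow> partial j f x"
proof -
  obtain S where S: "0 < S" "\<And>x. S < norm x \<Longrightarrow> std_moll x = 0" by (rule std_moll_support) blast
  obtain R where R: "\<And>x. R < norm x \<Longrightarrow> f x = 0"
    using Cc_1D(4)[OF f] unfolding compact_support_iff by blast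
  have "\<exists>R. \<forall>x. R < norm x \<longrightarrow> partial j f x = 0" for j
    using Cc_1D(5)[OF f] unfolding compact_support_iff by blast
  then obtain R' where R': "\<And>j x. R' j < norm x \<Longrightarrow> partial j f x = 0" by metis
  obtain A where A: "0 \<le> A" "\<And>x. \<bar>f x\<bar> \<le> A" using compact_support_bounded[OF Cc_1D(2,4)[OF f]] by blast
  have "\<exists>B. 0 \<le> B \<and> (\<forall>x. \<bar>partial j f x\<bar> \<le> B)" for j
    by (meson compact_support_bounded Cc_1D(3,5)[OF f])
  then obtain D where D: "\<And>j. 0 \<le> D j" "\<And>j x. \<bar>partial j f x\<bar> \<le> D j" by metis
  define t where "t n = 1 / real (Suc n)" for n
  have t: "t \<longlonglongrightarrow> 0" "\<And>n. t n \<noteq> 0" "\<And>n. \<bar>t n\<bar> \<le> 1"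
    using inverse_Suc_LIMSEQ unfolding t_def by auto
  note [measurable] = Cc_1_measurable[OF f] Cc_1_measurable[OF std_moll_Cc_1]
  define F where "F n = moll std_moll (t n) f" for n
  have Fc: "F n = conv (moll_kernel (t n)) f" for n
    unfolding F_def by (rule moll_std_eq_conv) (use t in auto)
  have FC: "F n \<in> Cc_infinity" for n
    unfolding Cc_infinity_def Fc
  proof (safe)
    show "C_diff k (conv (moll_kernel (t n)) f)" for k
      by (rule C_diff_conv[OF moll_kernel_Cc_infinity[OF t(2)]])
         (use Cc_1_integrable(1)[OF f] in \<open>auto intro!: integrable_mult_indicator[where 'b=real, simplified]\<close>)
    show "compact_support (conv (moll_kernel (t n)) f)"
      by (rule compact_support_conv[OF Cc_infinityD(2)[OF moll_kernel_Cc_infinity[OF t(2)]] Cc_1D(4)[OF f]])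
  qed
  have pF: "partial j (F n) = moll std_moll (t n) (partial j f)" for j n
  proof -
    let ?k = "\<lambda>w. (1 / \<bar>t n\<bar> ^ 3) * std_moll (0 + (- 1 / t n) *\<^sub>R w)"
    have ik: "integrable lborel ?k"
      by (intro Cc_1_integrable Cc_1_cmult Cc_1_affine std_moll_Cc_1) (use t in auto)
    have eq: "moll std_moll (t n) g = conv g ?k" if [measurable]: "g \<in> borel_measurable borel" for g
      by (rule ext, rule moll_eq_conv') (use t in auto)
    show ?thesis
      unfolding F_def using f ik A D
      by (subst (1 2) eq) (auto simp: Cc_def intro!: conv_partial(1) conv_dom_bounded simp del: C_diff.simps)
  qed
  have supp: "moll std_moll (t n) g x = 0" if g: "\<And>x. Q < norm x \<Longrightarrow> g x = 0" and x: "Q + S < norm x" for g Q x n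
  proof -
    have "std_moll z * g (x + t n *\<^sub>R z) = 0" for z
    proof (cases "S < norm z")
      case False
      have "norm (t n *\<^sub>R z) \<le> 1 * S" unfolding norm_scaleR using t False by (intro mult_mono) auto
      moreover have "norm x \<le> norm (x + t n *\<^sub>R z) + norm (t n *\<^sub>R z)"
        using norm_triangle_ineq4[of "x + t n *\<^sub>R z" "t n *\<^sub>R z"] by simp
      ultimately have "Q < norm (x + t n *\<^sub>R z)" using x by linarith
      then show ?thesis using g by simp
    qed (use S in simp)
    then show ?thesis by (simp only: moll_def integral_zero)
  qed
  define RR where "RR = max R (Max (range R')) + S"
  define BB where "BB = max A (Max (range D))"
  have RR: "R + S \<le> RR" "R' j + S \<le> RR" for j unfolding RR_def by (auto simp: le_max_iff_disj)
  have BB: "A \<le> BB" "D j \<le> BB" for j unfolding BB_def by (auto simp: le_max_iff_disj)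
  show ?thesis
  proof (rule that[of F RR BB])
    show "F n x = 0" if "RR < norm x" for n x
      unfolding F_def by (rule supp[of R]) (use R RR(1) that in auto)
    show "partial j (F n) x = 0" if "RR < norm x" for n j x
      unfolding pF by (rule supp[of "R' j"]) (use R' RR(2)[of j] that in auto)
    show "\<bar>F n x\<bar> \<le> BB" for n x
      unfolding F_def by (rule order_trans[OF moll_bound BB(1)]) (use std_moll A in auto)
    show "\<bar>partial j (F n) x\<bar> \<le> BB" for n j x
      unfolding pF by (rule order_trans[OF moll_bound BB(2)[of j]]) (use std_moll D in auto)
    show "(\<lambda>n. F n x) \<longlonglongrightarrow> f x" for x
      unfolding F_def by (rule moll_pointwise[OF std_moll(3,4) Cc_1D(2)[OF f] A(2) t(1)])
    show "(\<lambda>n. partial j (F n) x) \<longlonglongrightarrow> partial j f x" for j x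
      unfolding pF by (rule moll_pointwise[OF std_moll(3,4) Cc_1D(3)[OF f] D(2) t(1)])
  qed (rule FC)
qed

text \<open>On the ball of radius \<open>M\<close>, a mollification of \<open>h\<close> with step at
  most 1 sees only the ball of radius \<open>M + S\<close>. There it is the integral of
  \<open>h\<close> against a smooth test function, hence 0, while mollifications of the restriction
  converge almost everywhere along a subsequence.\<close>

lemma fundamental_lemma:
  fixes h :: "real^3 \<Rightarrow> real"
  assumes [measurable]: "h \<in> borel_measurable borel"
    and loc: "\<And>R. integrable lborel (\<lambda>y. indicator (cball 0 R) y * h y)"
    and zero: "\<And>\<phi>. \<phi> \<in> Cc_infinity \<Longrightarrow> (LINT x|lborel. \<phi> x * h x) = 0"
  shows "AE x in lborel. h x = 0"
proof -
  obtain S where S: "0 < S" "\<And>x. S < norm x \<Longrightarrow> std_moll x = 0" by (rule std_moll_support) blast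
  define t where "t n = 1 / real (Suc n)" for n
  have t: "t \<longlonglongrightarrow> 0" "\<And>n. t n \<noteq> 0" "\<And>n. \<bar>t n\<bar> \<le> 1"
    using inverse_Suc_LIMSEQ unfolding t_def by auto
  note [measurable] = Cc_1_measurable[OF std_moll_Cc_1]
  have "AE x in lborel. norm x \<le> real M \<longrightarrow> h x = 0" for M :: nat
  proof -
    define f where "f y = indicator (cball 0 (real M + S)) y * h y" for y
    have f1: "f \<in> Lp 1" unfolding f_def[abs_def] Lp_1_iff by (rule loc)
    note [measurable] = Lp_measurable[OF f1]
    have "Lconv 1 (\<lambda>n. moll std_moll (t n) f) f"
      by (rule moll_Lconv[OF std_moll(3,2,4) f1 _ t(1)]) simp
    then obtain r where r: "AE x in lborel. (\<lambda>n. moll std_moll (t (r n)) f x) \<longlonglongrightarrow> f x"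
      by (rule Lconv_AE_subseq) auto
    have z: "moll std_moll (t n) f x = 0" if x: "norm x \<le> real M" for n x
    proof -
      have "std_moll z * f (x + t n *\<^sub>R z) = std_moll z * h (x + t n *\<^sub>R z)" for z
      proof (cases "S < norm z")
        case False
        have "norm (t n *\<^sub>R z) \<le> 1 * S" unfolding norm_scaleR using t False by (intro mult_mono) auto
        then have "norm (x + t n *\<^sub>R z) \<le> real M + S"
          using x norm_triangle_ineq[of x "t n *\<^sub>R z"] by linarith
        then show ?thesis by (simp add: f_def)
      qed (use S in simp)
      then have "moll std_moll (t n) f x = moll std_moll (t n) h x" by (simp only: moll_def)
      also have "\<dots> = (LINT y|lborel. moll_kernel (t n) (x + (-1) *\<^sub>R y) * h y)"
        using t(2)[of n] by (simp add: moll_std_eq_conv conv_def)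
      also have "\<dots> = 0"
        by (rule zero[OF Cc_infinity_affine[OF moll_kernel_Cc_infinity[OF t(2)]]]) simp
      finally show ?thesis .
    qed
    show ?thesis
      using r
    proof eventually_elim
      case (elim x)
      show ?case
      proof
        assume x: "norm x \<le> real M"
        with z[OF x] elim have "f x = 0" by (simp add: LIMSEQ_const_iff)
        then show "h x = 0" using x S(1) by (auto simp: f_def indicator_def split: if_splits)
      qed
    qed
  qed
  then have "AE x in lborel. \<forall>M::nat. norm x \<le> real M \<longrightarrow> h x = 0" by (simp only: AE_all_countable simp_thms)
  then show ?thesis
    by eventually_elim (meson real_arch_simple)
qed

section \<open>Weak gradients\<close>

lemma lborel_AE_imp_lebesgue: "AE x in lborel. P x \<Longrightarrow> AE x in lebesgue. P x"
  by (rule AE_completion)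

lemma lebesgue_integral_eq_lborel:
  fixes f :: "'a::euclidean_space \<Rightarrow> 'b::{banach, second_countable_topology}"
  assumes "f \<in> borel_measurable borel"
  shows "(LINT x|lebesgue. f x) = (LINT x|lborel. f x)" "integrable lebesgue f \<longleftrightarrow> integrable lborel f"
  using assms integral_completion[of f lborel] integrable_completion[of f lborel] by auto

lemma lebesgue_borel_version:
  fixes f :: "'a::euclidean_space \<Rightarrow> real"
  assumes "f \<in> borel_measurable lebesgue"
  obtains g where "g \<in> borel_measurable borel" "AE x in lebesgue. f x = g x"
proof -
  from completion_ex_borel_measurable_real[OF assms] obtain g
    where "g \<in> borel_measurable lborel" "AE x in lborel. f x = g x" by blast
  then show ?thesis using AE_completion[of "\<lambda>x. f x = g x" lborel] by (intro that[of g]) simp_all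
qed

lemma indicator_cball_measurable:
  fixes h :: "'a::euclidean_space \<Rightarrow> real"
  assumes "h \<in> borel_measurable borel"
  shows "(\<lambda>y. indicator (cball a R) y * h y) \<in> borel_measurable borel"
  by (intro borel_measurable_times borel_measurable_indicator assms) auto

lemma integrable_vec_nth:
  fixes f :: "'a \<Rightarrow> real^'n"
  assumes "\<And>j. integrable M (\<lambda>x. f x $ j)"
  shows "integrable M f" "(LINT x|M. f x) $ j = (LINT x|M. f x $ j)"
proof -
  have "integrable M (\<lambda>x. \<Sum>j\<in>UNIV. f x $ j *\<^sub>R axis j (1::real))"
    by (intro Bochner_Integration.integrable_sum integrable_scaleR_left assms)
  then show i: "integrable M f"
    by (simp add: basis_expansion scalar_mult_eq_scaleR[symmetric])
  show "(LINT x|M. f x) $ j = (LINT x|M. f x $ j)"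
    using integral_bounded_linear[OF bounded_linear_vec_nth i, of j] by simp
qed

lemma integrable_nth:
  fixes f :: "'a \<Rightarrow> real^'n"
  assumes "integrable M f"
  shows "integrable M (\<lambda>x. f x $ j)"
  using integrable_bounded_linear[OF bounded_linear_vec_nth assms] .

lemma grad_nth [simp]: "grad f x $ i = partial i f x"
  by (simp add: grad_def)

lemma locally_integrable_cball: "locally_integrable f \<Longrightarrow> integrable lebesgue (\<lambda>y. indicator (cball 0 R) y *\<^sub>R f y)"
  unfolding locally_integrable_def set_integrable_def using compact_cball by blast

lemma locally_integrableI_cball:
  fixes f :: "real^3 \<Rightarrow> 'b::euclidean_space"
  assumes "\<And>R. integrable lebesgue (\<lambda>y. indicator (cball 0 R) y *\<^sub>R f y)"
  shows "locally_integrable f"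
  unfolding locally_integrable_def
proof (intro allI impI)
  fix K :: "(real^3) set" assume K: "compact K"
  then obtain R where R: "\<And>x. x \<in> K \<Longrightarrow> norm x \<le> R"
    using compact_imp_bounded bounded_iff by metis
  have "K \<in> sets lebesgue" using K by (simp add: borel_compact sets_completionI_sets)
  from integrable_mult_indicator[OF this assms[of R]]
  have "integrable lebesgue (\<lambda>x. indicator K x *\<^sub>R indicator (cball 0 R) x *\<^sub>R f x)" .
  moreover have "(\<lambda>x. indicator K x *\<^sub>R indicator (cball 0 R) x *\<^sub>R f x) = (\<lambda>x. indicator K x *\<^sub>R f x)"
    using R by (auto simp: indicator_def fun_eq_iff)
  ultimately show "set_integrable lebesgue K f" by (simp add: set_integrable_def)
qed

lemma integrable_locally_mult:
  fixes f :: "real^3 \<Rightarrow> 'b::euclidean_space"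
  assumes f: "locally_integrable f" and g: "continuous_on UNIV g" "compact_support (g :: real^3 \<Rightarrow> real)"
  shows "integrable lebesgue (\<lambda>x. g x *\<^sub>R f x)"
proof -
  obtain R where R: "\<And>x. R < norm x \<Longrightarrow> g x = 0" using g(2) unfolding compact_support_iff by blast
  obtain B where B: "0 \<le> B" "\<And>x. \<bar>g x\<bar> \<le> B" using compact_support_bounded[OF g] by blast
  have i: "integrable lebesgue (\<lambda>y. indicator (cball 0 R) y *\<^sub>R f y)" by (rule locally_integrable_cball[OF f])
  have gm: "g \<in> borel_measurable lebesgue"
    using borel_measurable_continuous_onI[OF g(1)] by (simp add: measurable_completion)
  have eq: "(\<lambda>x. g x *\<^sub>R f x) = (\<lambda>x. g x *\<^sub>R (indicator (cball 0 R) x *\<^sub>R f x))"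
  proof (rule ext)
    fix x
    show "g x *\<^sub>R f x = g x *\<^sub>R (indicator (cball 0 R) x *\<^sub>R f x)"
      using R[of x] by (cases "R < norm x") auto
  qed
  show ?thesis
    unfolding eq
  proof (rule Bochner_Integration.integrable_bound[where f = "\<lambda>x. B * norm (indicator (cball 0 R) x *\<^sub>R f x)"])
    show "integrable lebesgue (\<lambda>x. B * norm (indicator (cball 0 R) x *\<^sub>R f x))"
      by (intro integrable_mult_right integrable_norm i)
    show "AE x in lebesgue. norm (g x *\<^sub>R indicator (cball 0 R) x *\<^sub>R f x) \<le> norm (B * norm (indicator (cball 0 R) x *\<^sub>R f x))"
    proof (rule AE_I2)
      fix x
      have "norm (g x *\<^sub>R indicator (cball 0 R) x *\<^sub>R f x) = \<bar>g x\<bar> * norm (indicator (cball 0 R) x *\<^sub>R f x)"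
        by (rule norm_scaleR)
      also have "\<dots> \<le> B * norm (indicator (cball 0 R) x *\<^sub>R f x)"
        using B by (intro mult_right_mono) auto
      finally show "norm (g x *\<^sub>R indicator (cball 0 R) x *\<^sub>R f x) \<le> norm (B * norm (indicator (cball 0 R) x *\<^sub>R f x))"
        using B(1) by simp
    qed
    show "(\<lambda>x. g x *\<^sub>R (indicator (cball 0 R) x *\<^sub>R f x)) \<in> borel_measurable lebesgue"
      by (rule borel_measurable_scaleR[OF gm borel_measurable_integrable[OF i]])
  qed
qed

lemma is_weak_grad_nth:
  assumes "is_weak_grad v g" and \<phi>: "\<phi> \<in> Cc_infinity"
  shows "(LINT x|lebesgue. v x * partial j \<phi> x) = - (LINT x|lebesgue. \<phi> x * g x $ j)"
proof -
  have v: "locally_integrable v" and g: "locally_integrable g"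
    and eq: "(LINT x|lebesgue. v x *\<^sub>R grad \<phi> x) = - (LINT x|lebesgue. \<phi> x *\<^sub>R g x)"
    using assms by (auto simp: is_weak_grad_def)
  note \<phi>1 = Cc_1D[OF Cc_infinity_imp_Cc[OF \<phi>]]
  have 1: "integrable lebesgue (\<lambda>x. (v x *\<^sub>R grad \<phi> x) $ i)" for i
    using integrable_locally_mult[OF v \<phi>1(3,5), of i] by (simp add: mult.commute)
  have 2: "integrable lebesgue (\<lambda>x. \<phi> x *\<^sub>R g x)"
    by (rule integrable_locally_mult[OF g \<phi>1(2,4)])
  show ?thesis
    using arg_cong[OF eq, of "\<lambda>w. w $ j"] integrable_vec_nth(2)[OF 1, of j]
      integrable_vec_nth(2)[OF integrable_nth[OF 2], of j] by simp
qed

text \<open>In each component the difference of the two gradients annihilates all test functions;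
  the fundamental lemma applies to a Borel version of it.\<close>

lemma weak_grad_unique:
  assumes "is_weak_grad v g" "is_weak_grad v g'"
  shows "AE x in lebesgue. g x = g' x"
proof -
  have g: "locally_integrable g" "locally_integrable g'" using assms by (auto simp: is_weak_grad_def)
  have "AE x in lebesgue. g x $ j - g' x $ j = 0" for j
  proof -
    define h where "h x = g x $ j - g' x $ j" for x
    have hl: "integrable lebesgue (\<lambda>y. indicator (cball 0 R) y * h y)" for R
      using Bochner_Integration.integrable_diff[OF integrable_nth[OF locally_integrable_cball[OF g(1), of R], of j]
        integrable_nth[OF locally_integrable_cball[OF g(2), of R], of j]]
      by (simp add: h_def right_diff_distrib)
    \<comment> \<open>Local integrability gives measurability of the restrictions to balls, and
      \<open>h\<close> is their pointwise limit.\<close>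
    have "h \<in> borel_measurable lebesgue"
    proof (rule borel_measurable_LIMSEQ_real)
      show "(\<lambda>n. indicator (cball 0 (real n)) x * h x) \<longlonglongrightarrow> h x" for x
      proof -
        obtain N where "norm x \<le> real N" using real_arch_simple by blast
        then have "\<forall>n\<ge>N. indicator (cball 0 (real n)) x * h x = h x" by (auto simp: indicator_def)
        then show ?thesis by (intro tendsto_eventually) (auto simp: eventually_sequentially)
      qed
      show "(\<lambda>x. indicator (cball 0 (real n)) x * h x) \<in> borel_measurable lebesgue" for n
        by (rule borel_measurable_integrable[OF hl])
    qed
    then obtain h' where h': "h' \<in> borel_measurable borel" "AE x in lebesgue. h x = h' x"
      by (rule lebesgue_borel_version) blast
    have [measurable]: "h' \<in> borel_measurable lebesgue" "h \<in> borel_measurable lebesgue"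
      using h'(1) \<open>h \<in> borel_measurable lebesgue\<close> by (auto simp: measurable_completion)
    have "AE x in lborel. h' x = 0"
    proof (rule fundamental_lemma[OF h'(1)])
      fix R
      have c: "cball 0 R \<in> sets lebesgue" by (simp add: sets_completionI_sets)
      have "integrable lebesgue (\<lambda>y. indicator (cball 0 R) y * h' y)"
        using hl[of R]
      proof (rule integrable_cong_AE_imp)
        show "(\<lambda>y. indicator (cball 0 R) y * h' y) \<in> borel_measurable lebesgue"
          using c by (intro borel_measurable_times borel_measurable_indicator) auto
        show "AE y in lebesgue. indicator (cball 0 R) y * h y = indicator (cball 0 R) y * h' y"
          using h'(2) by eventually_elim simp
      qed
      then show "integrable lborel (\<lambda>y. indicator (cball 0 R) y * h' y)"
        using indicator_cball_measurable[OF h'(1)] by (subst (asm) lebesgue_integral_eq_lborel) auto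
    next
      fix \<phi> :: "real^3 \<Rightarrow> real" assume \<phi>: "\<phi> \<in> Cc_infinity"
      note \<phi>1 = Cc_1D[OF Cc_infinity_imp_Cc[OF \<phi>]] Cc_1_measurable[OF Cc_infinity_imp_Cc[OF \<phi>]]
      have [measurable]: "\<phi> \<in> borel_measurable lebesgue" using \<phi>1 by (simp add: measurable_completion)
      have i: "integrable lebesgue (\<lambda>x. \<phi> x * g x $ j)" "integrable lebesgue (\<lambda>x. \<phi> x * g' x $ j)"
        using integrable_nth[OF integrable_locally_mult[OF g(1) \<phi>1(2,4)], of j]
          integrable_nth[OF integrable_locally_mult[OF g(2) \<phi>1(2,4)], of j] by simp_all
      have "(LINT x|lborel. \<phi> x * h' x) = (LINT x|lebesgue. \<phi> x * h' x)"
        using h'(1) \<phi>1 by (subst lebesgue_integral_eq_lborel) auto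
      also have "\<dots> = (LINT x|lebesgue. \<phi> x * h x)"
      proof (rule integral_cong_AE)
        show "AE x in lebesgue. \<phi> x * h' x = \<phi> x * h x"
          using h'(2) by eventually_elim simp
      qed measurable
      also have "\<dots> = (LINT x|lebesgue. \<phi> x * g x $ j) - (LINT x|lebesgue. \<phi> x * g' x $ j)"
        using i by (simp add: h_def right_diff_distrib)
      also have "\<dots> = 0"
        using is_weak_grad_nth[OF assms(1) \<phi>, of j] is_weak_grad_nth[OF assms(2) \<phi>, of j] by simp
      finally show "(LINT x|lborel. \<phi> x * h' x) = 0" .
    qed
    then have "AE x in lebesgue. h' x = 0" by (rule lborel_AE_imp_lebesgue)
    with h'(2) show ?thesis unfolding h_def by eventually_elim simp
  qed
  then have "AE x in lebesgue. \<forall>j. g x $ j - g' x $ j = 0" by (simp only: AE_all_countable simp_thms)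
  then show ?thesis by eventually_elim (simp add: vec_eq_iff)
qed

text \<open>Completeness turns the Cauchy condition on gradients into limits \<open>g j\<close>;
  local L1 convergence of the functions passes the weak gradient identity to the limit. Uniqueness
  then identifies the chosen \<open>weak_grad v\<close> with these limits almost everywhere.\<close>

lemma D0_weak_grad:
  assumes v: "v \<in> D0 s" and s: "1 \<le> s"
  obtains \<phi> g where "\<And>n. \<phi> n \<in> Cc_infinity" "\<And>j. Lconv s (\<lambda>n. partial j (\<phi> n)) (g j)"
    "AE x in lebesgue. \<forall>j. weak_grad v x $ j = g j x"
    "\<And>K. compact K \<Longrightarrow> (\<lambda>n. LINT x:K|lebesgue. \<bar>\<phi> n x - v x\<bar>) \<longlonglongrightarrow> 0"
proof -
  from v obtain \<phi> :: "nat \<Rightarrow> real^3 \<Rightarrow> real" where vl: "locally_integrable v" and \<phi>: "\<And>n. \<phi> n \<in> Cc_infinity"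
    and cau: "\<And>e. 0 < e \<Longrightarrow> \<exists>N. \<forall>m\<ge>N. \<forall>n\<ge>N. D_norm s (\<lambda>x. \<phi> m x - \<phi> n x) < e"
    and L1: "\<And>K. compact K \<Longrightarrow> (\<lambda>n. LINT x:K|lebesgue. \<bar>\<phi> n x - v x\<bar>) \<longlonglongrightarrow> 0"
    unfolding D0_def by blast
  have \<phi>1: "\<phi> n \<in> Cc 1" for n by (rule Cc_infinity_imp_Cc[OF \<phi>])
  have pd: "partial j (\<lambda>x. \<phi> m x - \<phi> n x) = (\<lambda>x. partial j (\<phi> m) x - partial j (\<phi> n) x)" for j m n
    by (rule ext) (rule Cc_1_diff(2)[OF \<phi>1 \<phi>1])
  have le: "Lpow s (\<lambda>x. partial j (\<phi> m) x - partial j (\<phi> n) x) \<le> D_norm s (\<lambda>x. \<phi> m x - \<phi> n x) powr s" for j m n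
  proof -
    let ?f = "\<lambda>x. \<phi> m x - \<phi> n x"
    have f: "?f \<in> Cc 1" by (rule Cc_1_diff(1)[OF \<phi>1 \<phi>1])
    have c: "continuous_on UNIV (\<lambda>x. norm (grad ?f x))"
      unfolding grad_def by (intro continuous_intros Cc_1D(3)[OF f])
    have "compact_support (\<lambda>x. norm (grad ?f x))"
    proof -
      obtain R where R: "\<And>x. R < norm x \<Longrightarrow> ?f x = 0" using Cc_1D(4)[OF f] unfolding compact_support_iff by blast
      have "\<exists>R. \<forall>x. R < norm x \<longrightarrow> partial i ?f x = 0" for i
        using Cc_1D(5)[OF f, of i] unfolding compact_support_iff by blast
      then obtain S where S: "\<And>i x. S i < norm x \<Longrightarrow> partial i ?f x = 0" by metis
      show ?thesis
      proof (rule compact_supportI)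
        fix x :: "real^3" assume x: "Max (range S) < norm x"
        have "S i < norm x" for i using Max_ge[of "range S" "S i"] x by (auto intro: le_less_trans)
        then have "grad ?f x = 0" using S by (simp add: vec_eq_iff)
        then show "norm (grad ?f x) = 0" by simp
      qed
    qed
    then have L: "(\<lambda>x. norm (grad ?f x)) \<in> Lp s" using c s by (intro Lp_compact_support) auto
    have "Lpow s (partial j ?f) \<le> Lpow s (\<lambda>x. norm (grad ?f x))"
      using Cc_1_measurable(2)[OF f] L s component_le_norm_cart[of "grad ?f _" j] by (intro Lpow_mono) auto
    also have "\<dots> = (LINT x|lebesgue. norm (grad ?f x) powr s)"
      using Lp_measurable[OF L] by (subst lebesgue_integral_eq_lborel) (auto simp: Lpow_def)
    also have "\<dots> = D_norm s ?f powr s"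
      using s by (simp add: D_norm_def powr_powr)
    finally show ?thesis by (simp add: pd)
  qed
  have "\<exists>g. Lconv s (\<lambda>n. partial j (\<phi> n)) g" for j
  proof (rule Lp_complete)
    show "partial j (\<phi> n) \<in> Lp s" for n using Cc_1_Lp(2)[OF \<phi>1] s by simp
    show "\<exists>N. \<forall>m\<ge>N. \<forall>n\<ge>N. Lpow s (\<lambda>x. partial j (\<phi> m) x - partial j (\<phi> n) x) < e" if e: "0 < e" for e
    proof -
      obtain N where N: "\<And>m n. m \<ge> N \<Longrightarrow> n \<ge> N \<Longrightarrow> D_norm s (\<lambda>x. \<phi> m x - \<phi> n x) < e powr (1 / s)"
        using cau[of "e powr (1 / s)"] e by auto
      have "Lpow s (\<lambda>x. partial j (\<phi> m) x - partial j (\<phi> n) x) < e" if "m \<ge> N" "n \<ge> N" for m n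
      proof -
        have "D_norm s (\<lambda>x. \<phi> m x - \<phi> n x) powr s < (e powr (1 / s)) powr s"
          using N[OF that] s by (intro powr_less_mono2) (auto simp: D_norm_def)
        also have "\<dots> = e" using e s by (simp add: powr_powr)
        finally show ?thesis using le[of j m n] by linarith
      qed
      then show ?thesis by blast
    qed
  qed (use s in auto)
  then obtain g where g: "\<And>j. Lconv s (\<lambda>n. partial j (\<phi> n)) (g j)" by metis
  have gL: "g j \<in> Lp s" for j using LconvD(2)[OF g] .
  define G where "G x = (\<chi> j. g j x)" for x
  have "is_weak_grad v G"
    unfolding is_weak_grad_def
  proof (intro conjI ballI vl)
    have iR: "integrable lborel (\<lambda>y. indicator (cball 0 R) y * g j y)" for R j
    proof (cases "s = 1")
      case True
      then show ?thesis
        using gL[of j] integrable_mult_indicator[of "cball 0 R" lborel "g j"] by (simp add: Lp_1_iff)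
    next
      case False
      have "(\<lambda>y. indicator (cball (0::real^3) R) y) \<in> Lp (s / (s - 1))"
        using s False by (intro Lp_bounded_support[of _ 1 R]) (auto simp: indicator_def)
      from Holder_1(1)[OF _ _ _ this gL[of j]] show ?thesis using s False by (simp add: field_simps)
    qed
    show "locally_integrable G"
    proof (rule locally_integrableI_cball, rule integrable_vec_nth(1))
      fix R j
      have "(\<lambda>y. indicator (cball 0 R) y * g j y) \<in> borel_measurable borel"
        using borel_measurable_integrable[OF iR] by simp
      with iR[of R j] show "integrable lebesgue (\<lambda>x. (indicator (cball 0 R) x *\<^sub>R G x) $ j)"
        by (simp add: G_def lebesgue_integral_eq_lborel)
    qed
    then have Gl: "locally_integrable G" .
    fix \<psi> :: "real^3 \<Rightarrow> real" assume \<psi>: "\<psi> \<in> Cc_infinity"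
    have \<psi>1: "\<psi> \<in> Cc 1" by (rule Cc_infinity_imp_Cc[OF \<psi>])
    note \<psi>m = Cc_1_measurable[OF \<psi>1]
    have comp: "(LINT x|lebesgue. v x * partial j \<psi> x) = - (LINT x|lebesgue. \<psi> x * g j x)" for j
    proof -
      obtain R where R: "\<And>x. R < norm x \<Longrightarrow> partial j \<psi> x = 0"
        using Cc_1D(5)[OF \<psi>1] unfolding compact_support_iff by blast
      obtain B where B: "0 \<le> B" "\<And>x. \<bar>partial j \<psi> x\<bar> \<le> B"
        using compact_support_bounded[OF Cc_1D(3,5)[OF \<psi>1]] by blast
      have iv: "integrable lebesgue (\<lambda>x. v x * partial j \<psi> x)"
        using integrable_locally_mult[OF vl Cc_1D(3,5)[OF \<psi>1], of j] by (simp add: mult.commute)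
      have ip: "integrable lborel (\<lambda>x. \<phi> n x * partial j \<psi> x)" for n
        by (rule Holder_1(1)[OF _ _ _ Cc_1_Lp(1)[OF \<phi>1, of 2] Cc_1_Lp(2)[OF \<psi>1, of 2]]) auto
      then have ip': "integrable lebesgue (\<lambda>x. \<phi> n x * partial j \<psi> x)" for n
        using Cc_1_measurable(1)[OF \<phi>1] \<psi>m by (subst lebesgue_integral_eq_lborel) auto
      have lphi: "integrable lebesgue (\<lambda>x. indicator (cball 0 R) x * \<phi> n x)" for n
      proof -
        have "integrable lborel (\<lambda>x. indicator (cball 0 R) x * \<phi> n x)"
          using integrable_mult_indicator[of "cball 0 R" lborel "\<phi> n"] Cc_1_integrable(1)[OF \<phi>1] by simp
        from this borel_measurable_integrable[OF this] show ?thesis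
          by (subst lebesgue_integral_eq_lborel) auto
      qed
      have idiff: "integrable lebesgue (\<lambda>x. indicator (cball 0 R) x * \<bar>\<phi> n x - v x\<bar>)" for n
        using integrable_abs[OF Bochner_Integration.integrable_diff[OF lphi[of n] locally_integrable_cball[OF vl, of R, simplified]]]
        by (simp add: right_diff_distrib[symmetric] abs_mult)
      have "\<bar>(LINT x|lebesgue. \<phi> n x * partial j \<psi> x) - (LINT x|lebesgue. v x * partial j \<psi> x)\<bar>
          \<le> B * (LINT x:cball 0 R|lebesgue. \<bar>\<phi> n x - v x\<bar>)" for n
      proof -
        have "\<bar>(LINT x|lebesgue. \<phi> n x * partial j \<psi> x) - (LINT x|lebesgue. v x * partial j \<psi> x)\<bar>
            = \<bar>LINT x|lebesgue. \<phi> n x * partial j \<psi> x - v x * partial j \<psi> x\<bar>"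
          using ip'[of n] iv by simp
        also have "\<dots> \<le> (LINT x|lebesgue. \<bar>\<phi> n x * partial j \<psi> x - v x * partial j \<psi> x\<bar>)"
          by (rule integral_abs_bound)
        also have "\<dots> \<le> (LINT x|lebesgue. B * (indicator (cball 0 R) x * \<bar>\<phi> n x - v x\<bar>))"
        proof (rule integral_mono)
          show "integrable lebesgue (\<lambda>x. \<bar>\<phi> n x * partial j \<psi> x - v x * partial j \<psi> x\<bar>)"
            using ip'[of n] iv by (intro integrable_abs Bochner_Integration.integrable_diff)
          show "integrable lebesgue (\<lambda>x. B * (indicator (cball 0 R) x * \<bar>\<phi> n x - v x\<bar>))"
            using idiff by (rule integrable_mult_right)
          show "\<bar>\<phi> n x * partial j \<psi> x - v x * partial j \<psi> x\<bar> \<le> B * (indicator (cball 0 R) x * \<bar>\<phi> n x - v x\<bar>)" for x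
            using B(2)[of x] R[of x]
            by (cases "R < norm x") (auto simp: left_diff_distrib[symmetric] abs_mult mult.commute[of _ "\<bar>partial j \<psi> x\<bar>"] mult_right_mono)
        qed
        also have "\<dots> = B * (LINT x:cball 0 R|lebesgue. \<bar>\<phi> n x - v x\<bar>)"
          unfolding set_lebesgue_integral_def by (simp add: idiff)
        finally show ?thesis .
      qed
      then have "(\<lambda>n. \<bar>(LINT x|lebesgue. \<phi> n x * partial j \<psi> x) - (LINT x|lebesgue. v x * partial j \<psi> x)\<bar>) \<longlonglongrightarrow> 0"
        by (intro tendsto_zero_squeeze[OF abs_ge_zero _ tendsto_mult_right_zero[OF L1[OF compact_cball]]])
      then have l1: "(\<lambda>n. LINT x|lebesgue. \<phi> n x * partial j \<psi> x) \<longlonglongrightarrow> (LINT x|lebesgue. v x * partial j \<psi> x)"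
        by (simp add: LIM_zero_iff tendsto_rabs_zero_iff)
      have e: "(LINT x|lebesgue. \<phi> n x * partial j \<psi> x) = - (LINT x|lborel. \<psi> x * partial j (\<phi> n) x)" for n
      proof -
        have "(LINT x|lebesgue. \<phi> n x * partial j \<psi> x) = (LINT x|lborel. partial j \<psi> x * \<phi> n x)"
          using Cc_1_measurable(1)[OF \<phi>1] \<psi>m by (subst lebesgue_integral_eq_lborel) (auto simp: mult.commute)
        also have "\<dots> = - (LINT x|lborel. \<psi> x * partial j (\<phi> n) x)"
          by (rule integral_by_parts[OF \<psi>1]) (use \<phi>1[of n] in \<open>auto simp: Cc_def\<close>)
        finally show ?thesis .
      qed
      have "(\<lambda>n. LINT x|lborel. \<psi> x * partial j (\<phi> n) x) \<longlonglongrightarrow> (LINT x|lborel. \<psi> x * g j x)"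
      \<comment> \<open>For s = 1 the conjugate exponent is infinite; the test function then enters
        as a bounded multiplier instead of through Hoelder's inequality.\<close>
      proof (cases "s = 1")
        case False
        have "\<psi> \<in> Lp (s / (s - 1))" using s False by (intro Cc_1_Lp(1)[OF \<psi>1]) auto
        from Lconv_integral_mult[OF Lconv_const[OF this] g] show ?thesis using s False by (simp add: field_simps)
      next
        case True
        obtain C where C: "0 \<le> C" "\<And>x. \<bar>\<psi> x\<bar> \<le> C" using compact_support_bounded[OF Cc_1D(2,4)[OF \<psi>1]] by blast
        have p1: "(\<lambda>x. \<psi> x * h x) \<in> Lp 1" if h: "h \<in> Lp 1" for h
          by (rule Lp_mono[OF _ Lp_cmult[OF h, of C]]) (use C Lp_measurable[OF h] \<psi>m in \<open>auto simp: abs_mult mult_right_mono\<close>)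
        have le: "Lpow 1 (\<lambda>x. \<psi> x * partial j (\<phi> n) x - \<psi> x * g j x) \<le> C * Lpow 1 (\<lambda>x. partial j (\<phi> n) x - g j x)" for n
        proof -
          have d: "(\<lambda>x. partial j (\<phi> n) x - g j x) \<in> Lp 1" using LconvD[OF g[of j]] True by (intro Lp_diff) auto
          have "Lpow 1 (\<lambda>x. \<psi> x * (partial j (\<phi> n) x - g j x)) \<le> Lpow 1 (\<lambda>x. C * (partial j (\<phi> n) x - g j x))"
            by (rule Lpow_mono[OF Lp_measurable[OF p1[OF d]] Lp_cmult[OF d]])
               (use C in \<open>auto simp: abs_mult intro!: mult_right_mono\<close>)
          also have "\<dots> = C * Lpow 1 (\<lambda>x. partial j (\<phi> n) x - g j x)"
            using C by (simp only: Lpow_cmult) simp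
          finally show ?thesis by (simp only: right_diff_distrib)
        qed
        have "Lconv 1 (\<lambda>n x. \<psi> x * partial j (\<phi> n) x) (\<lambda>x. \<psi> x * g j x)"
          unfolding Lconv_def
          using p1 LconvD(1,2)[OF g[of j]] True
            tendsto_zero_squeeze[OF Lpow_nonneg le tendsto_mult_right_zero[OF LconvD(3)[OF g[of j], unfolded True]]]
          by auto
        then show ?thesis by (rule Lconv_1_integral)
      qed
      then have "(\<lambda>n. LINT x|lebesgue. \<phi> n x * partial j \<psi> x) \<longlonglongrightarrow> - (LINT x|lborel. \<psi> x * g j x)"
        unfolding e by (rule tendsto_minus)
      with l1 have "(LINT x|lebesgue. v x * partial j \<psi> x) = - (LINT x|lborel. \<psi> x * g j x)"
        by (rule LIMSEQ_unique)
      then show ?thesis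
        using \<psi>m Lp_measurable[OF gL] by (subst (2) lebesgue_integral_eq_lborel) auto
    qed
    have iv: "integrable lebesgue (\<lambda>x. (v x *\<^sub>R grad \<psi> x) $ j)" for j
      using integrable_locally_mult[OF vl Cc_1D(3,5)[OF \<psi>1], of j] by (simp add: mult.commute)
    have iG: "integrable lebesgue (\<lambda>x. \<psi> x *\<^sub>R G x)"
      by (rule integrable_locally_mult[OF Gl Cc_1D(2,4)[OF \<psi>1]])
    show "(LINT x|lebesgue. v x *\<^sub>R grad \<psi> x) = - (LINT x|lebesgue. \<psi> x *\<^sub>R G x)"
      using comp integrable_vec_nth(2)[OF iv] integrable_vec_nth(2)[OF integrable_nth[OF iG]]
      by (simp add: vec_eq_iff G_def)
  qed
  moreover from this have "is_weak_grad v (weak_grad v)"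
    unfolding weak_grad_def using someI[of "is_weak_grad v" G] by blast
  ultimately have "AE x in lebesgue. weak_grad v x = G x" using weak_grad_unique by blast
  then have "AE x in lebesgue. \<forall>j. weak_grad v x $ j = g j x" by eventually_elim (simp add: G_def)
  then show ?thesis using \<phi> g L1 by (intro that[of \<phi> g])
qed

section \<open>The regularised gradient of the Newton potential\<close>

text \<open>\<open>newton_grad \<delta>\<close> is the gradient of \<open>- (|x|\<^sup>2 + \<delta>\<^sup>2) powr (- 1 / 2)\<close>, the Newton potential up to a
  constant factor, and \<open>newton_hess \<delta>\<close> its Hessian.\<close>

definition nwt :: "real \<Rightarrow> real^3 \<Rightarrow> real" where
  "nwt \<delta> x = x \<bullet> x + \<delta>\<^sup>2"

definition newton_grad :: "real \<Rightarrow> 3 \<Rightarrow> real^3 \<Rightarrow> real" where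
  "newton_grad \<delta> i x = x $ i * nwt \<delta> x powr (- 3 / 2)"

definition newton_hess :: "real \<Rightarrow> 3 \<Rightarrow> 3 \<Rightarrow> real^3 \<Rightarrow> real" where
  "newton_hess \<delta> i j x = (if i = j then nwt \<delta> x powr (- 3 / 2) else 0) - 3 * (x $ i * x $ j) * nwt \<delta> x powr (- 5 / 2)"

lemma nwt_pos: "0 < \<delta> \<Longrightarrow> 0 < nwt \<delta> x"
  by (simp add: nwt_def add_nonneg_pos)

lemma nwt_ge: "\<delta>\<^sup>2 \<le> nwt \<delta> x" "x \<bullet> x \<le> nwt \<delta> x"
  by (simp_all add: nwt_def)

lemma nwt_continuous: "continuous_on S (nwt \<delta>)"
  unfolding nwt_def by (intro continuous_intros)

lemma nth_le_nwt: "0 < \<delta> \<Longrightarrow> \<bar>x $ i\<bar> \<le> nwt \<delta> x powr (1 / 2)"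
proof -
  assume d: "0 < \<delta>"
  have "(x $ i)\<^sup>2 \<le> x \<bullet> x"
    using component_le_norm_cart[of x i] by (metis abs_le_square_iff abs_norm_cancel power2_norm_eq_inner)
  then have "(x $ i)\<^sup>2 \<le> nwt \<delta> x" using nwt_ge(2)[of x \<delta>] by linarith
  then have "sqrt ((x $ i)\<^sup>2) \<le> sqrt (nwt \<delta> x)" by (rule real_sqrt_le_mono)
  then show ?thesis using nwt_pos[OF d, of x] by (simp add: powr_half_sqrt)
qed

lemma newton_grad_has_derivative:
  assumes d: "0 < \<delta>"
  shows "(newton_grad \<delta> i has_derivative (\<lambda>h. \<Sum>j\<in>UNIV. h $ j * newton_hess \<delta> i j x)) (at x)"
proof -
  have N: "(nwt \<delta> has_derivative (\<lambda>h. 2 * (x \<bullet> h))) (at x)"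
    unfolding nwt_def[abs_def] by (auto intro!: derivative_eq_intros simp: inner_commute)
  have P: "((\<lambda>x. nwt \<delta> x powr (- 3 / 2)) has_derivative (\<lambda>h. 2 * (x \<bullet> h) * ((- 3 / 2) * nwt \<delta> x powr (- 5 / 2)))) (at x)"
  proof -
    have "((\<lambda>z. z powr (- 3 / 2)) has_real_derivative (- 3 / 2) * nwt \<delta> x powr (- 3 / 2 - 1)) (at (nwt \<delta> x))"
      by (rule has_real_derivative_powr[OF nwt_pos[OF d]])
    from has_derivative_compose[OF N this[unfolded has_field_derivative_def]]
    show ?thesis by (simp add: mult_ac)
  qed
  have "(newton_grad \<delta> i has_derivative (\<lambda>h. x $ i * (2 * (x \<bullet> h) * ((- 3 / 2) * nwt \<delta> x powr (- 5 / 2))) + h $ i * nwt \<delta> x powr (- 3 / 2))) (at x)"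
    unfolding newton_grad_def[abs_def]
    by (rule has_derivative_mult[OF bounded_linear_imp_has_derivative[OF bounded_linear_vec_nth] P])
  moreover have "x $ i * (2 * (x \<bullet> h) * ((- 3 / 2) * nwt \<delta> x powr (- 5 / 2))) + h $ i * nwt \<delta> x powr (- 3 / 2)
      = (\<Sum>j\<in>UNIV. h $ j * newton_hess \<delta> i j x)" for h
  proof -
    have "(\<Sum>j\<in>UNIV. h $ j * newton_hess \<delta> i j x)
      = (\<Sum>j\<in>UNIV. (if j = i then h $ j * nwt \<delta> x powr (- 3 / 2) else 0) - 3 * x $ i * nwt \<delta> x powr (- 5 / 2) * (x $ j * h $ j))"
      by (intro sum.cong refl) (auto simp: newton_hess_def algebra_simps)
    also have "\<dots> = h $ i * nwt \<delta> x powr (- 3 / 2) - 3 * x $ i * nwt \<delta> x powr (- 5 / 2) * (x \<bullet> h)"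
      by (simp add: sum_subtractf sum_distrib_left[symmetric] inner_vec_def)
    finally show ?thesis by (simp add: algebra_simps)
  qed
  ultimately show ?thesis by simp
qed

lemma newton_hess_continuous: "0 < \<delta> \<Longrightarrow> continuous_on UNIV (newton_hess \<delta> i j)"
  unfolding newton_hess_def[abs_def] using nwt_pos[of \<delta>]
  by (cases "i = j") (auto intro!: continuous_intros nwt_continuous simp: less_imp_neq[symmetric])

lemma newton_grad_partial: "0 < \<delta> \<Longrightarrow> partial j (newton_grad \<delta> i) = newton_hess \<delta> i j"
  by (rule ext) (rule has_derivative_imp_partial[OF newton_grad_has_derivative])

lemma newton_grad_C_diff: "0 < \<delta> \<Longrightarrow> C_diff 1 (newton_grad \<delta> i)"
  using newton_grad_has_derivative[of \<delta> i] newton_hess_continuous[of \<delta> i]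
  by (auto simp: newton_grad_partial differentiable_def)

lemma newton_grad_continuous: "0 < \<delta> \<Longrightarrow> continuous_on UNIV (newton_grad \<delta> i)"
  using C_diff_continuous[OF newton_grad_C_diff] .

lemma newton_hess_sym: "newton_hess \<delta> i j x = newton_hess \<delta> j i x"
  by (simp add: newton_hess_def mult.commute)

text \<open>The regularisation spreads the point mass at the origin over a positive integrable
  function. As the computation shows, the part that survives is the excess of
  \<open>nwt \<delta> x\<close> over |x|^2.\<close>

lemma newton_hess_trace:
  assumes d: "0 < \<delta>"
  shows "(\<Sum>i\<in>UNIV. newton_hess \<delta> i i x) = 3 * \<delta>\<^sup>2 * nwt \<delta> x powr (- 5 / 2)"
proof -
  have e: "nwt \<delta> x powr (- 3 / 2) = nwt \<delta> x * nwt \<delta> x powr (- 5 / 2)"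
  proof -
    have "nwt \<delta> x powr (- 3 / 2) = nwt \<delta> x powr (1 + (- 5 / 2))" by simp
    also have "\<dots> = nwt \<delta> x * nwt \<delta> x powr (- 5 / 2)"
      using nwt_pos[OF d, of x] by (subst powr_add) simp
    finally show ?thesis .
  qed
  have "(\<Sum>i\<in>UNIV. newton_hess \<delta> i i x) = 3 * nwt \<delta> x powr (- 3 / 2) - 3 * (x \<bullet> x) * nwt \<delta> x powr (- 5 / 2)"
    by (simp add: newton_hess_def sum_subtractf inner_vec_def sum_distrib_left sum_distrib_right)
  also have "\<dots> = 3 * \<delta>\<^sup>2 * nwt \<delta> x powr (- 5 / 2)"
    unfolding e by (simp add: nwt_def algebra_simps)
  finally show ?thesis .
qed

lemma newton_grad_le:
  assumes d: "0 < \<delta>"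
  shows "\<bar>newton_grad \<delta> i x\<bar> \<le> nwt \<delta> x powr (- 1)"
proof -
  have "\<bar>newton_grad \<delta> i x\<bar> \<le> nwt \<delta> x powr (1 / 2) * nwt \<delta> x powr (- 3 / 2)"
    unfolding newton_grad_def abs_mult using nth_le_nwt[OF d, of x i] by (intro mult_mono) auto
  also have "\<dots> = nwt \<delta> x powr (- 1)" by (simp add: powr_add[symmetric])
  finally show ?thesis .
qed

lemma nwt_powr_le:
  assumes d: "0 < \<delta>" and a: "0 \<le> a"
  shows "nwt \<delta> x powr (- a) \<le> (\<delta>\<^sup>2) powr (- a)"
  using nwt_ge(1)[of \<delta> x] d a by (intro powr_mono2') auto

lemma newton_grad_bounded: "0 < \<delta> \<Longrightarrow> \<bar>newton_grad \<delta> i x\<bar> \<le> (\<delta>\<^sup>2) powr (- 1)"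
  using newton_grad_le[of \<delta> i x] nwt_powr_le[of \<delta> 1 x] by simp

lemma newton_hess_bounded:
  assumes d: "0 < \<delta>"
  shows "\<bar>newton_hess \<delta> i j x\<bar> \<le> 4 * (\<delta>\<^sup>2) powr (- 3 / 2)"
proof -
  have "\<bar>x $ i * x $ j\<bar> * nwt \<delta> x powr (- 5 / 2) \<le> (nwt \<delta> x powr (1 / 2) * nwt \<delta> x powr (1 / 2)) * nwt \<delta> x powr (- 5 / 2)"
    unfolding abs_mult using nth_le_nwt[OF d, of x] by (intro mult_right_mono mult_mono) auto
  also have "\<dots> = nwt \<delta> x powr (1 / 2 + 1 / 2 + (- 5 / 2))" by (simp only: powr_add)
  also have "1 / 2 + 1 / 2 + (- 5 / 2) = (- 3 / 2 :: real)" by simp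
  finally have 1: "\<bar>3 * (x $ i * x $ j) * nwt \<delta> x powr (- 5 / 2)\<bar> \<le> 3 * nwt \<delta> x powr (- 3 / 2)"
    by (simp add: abs_mult)
  have 2: "\<bar>if i = j then nwt \<delta> x powr (- 3 / 2) else 0\<bar> \<le> nwt \<delta> x powr (- 3 / 2)" by simp
  have "\<bar>newton_hess \<delta> i j x\<bar> \<le> 4 * nwt \<delta> x powr (- 3 / 2)"
    unfolding newton_hess_def using abs_triangle_ineq4[of "if i = j then nwt \<delta> x powr (- 3 / 2) else 0" "3 * (x $ i * x $ j) * nwt \<delta> x powr (- 5 / 2)"] 1 2
    by linarith
  also have "\<dots> \<le> 4 * (\<delta>\<^sup>2) powr (- 3 / 2)" using nwt_powr_le[OF d, of "3 / 2" x] by simp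
  finally show ?thesis .
qed

section \<open>Radial integrals by layers\<close>

lemma layer_cake:
  fixes q :: "real^3 \<Rightarrow> real" and m :: "real \<Rightarrow> ennreal"
  assumes [measurable]: "q \<in> borel_measurable borel" "m \<in> borel_measurable borel"
  shows "(\<integral>\<^sup>+y. ennreal (q y) * (\<integral>\<^sup>+s. m s * indicator {norm (x - y)<..} s \<partial>lborel) \<partial>lborel)
     = (\<integral>\<^sup>+s. m s * (\<integral>\<^sup>+y. ennreal (q y) * indicator (ball x s) y \<partial>lborel) \<partial>lborel)"
proof -
  have [measurable]: "(\<lambda>p. indicator {norm (x - snd p)<..} (fst p) :: ennreal) \<in> borel_measurable (lborel \<Otimes>\<^sub>M lborel)"
  proof -
    have "(\<lambda>p. indicator {norm (x - snd p)<..} (fst p) :: ennreal) = (\<lambda>p. if norm (x - snd p) < fst p then 1 else 0)"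
      by (auto simp: indicator_def)
    then show ?thesis by simp
  qed
  have [measurable]: "(\<lambda>y. indicator (ball x s) y :: ennreal) \<in> borel_measurable borel" for s
    by (intro borel_measurable_indicator) auto
  have ib: "indicator (ball x s) y = (indicator {norm (x - y)<..} s :: ennreal)" for s y
    by (auto simp: indicator_def dist_norm)
  have "(\<integral>\<^sup>+y. ennreal (q y) * (\<integral>\<^sup>+s. m s * indicator {norm (x - y)<..} s \<partial>lborel) \<partial>lborel)
     = (\<integral>\<^sup>+y. \<integral>\<^sup>+s. ennreal (q y) * (m s * indicator {norm (x - y)<..} s) \<partial>lborel \<partial>lborel)"
    by (intro nn_integral_cong nn_integral_cmult[symmetric]) measurable
  also have "\<dots> = (\<integral>\<^sup>+s. \<integral>\<^sup>+y. ennreal (q y) * (m s * indicator {norm (x - y)<..} s) \<partial>lborel \<partial>lborel)"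
    by (rule lborel_pair.Fubini') (simp add: case_prod_beta')
  also have "\<dots> = (\<integral>\<^sup>+s. m s * (\<integral>\<^sup>+y. ennreal (q y) * indicator (ball x s) y \<partial>lborel) \<partial>lborel)"
  proof (intro nn_integral_cong)
    fix s
    have "(\<integral>\<^sup>+y. ennreal (q y) * (m s * indicator {norm (x - y)<..} s) \<partial>lborel)
       = (\<integral>\<^sup>+y. m s * (ennreal (q y) * indicator (ball x s) y) \<partial>lborel)"
      by (simp add: ib mult_ac)
    also have "\<dots> = m s * (\<integral>\<^sup>+y. ennreal (q y) * indicator (ball x s) y \<partial>lborel)"
      by (rule nn_integral_cmult) measurable
    finally show "(\<integral>\<^sup>+y. ennreal (q y) * (m s * indicator {norm (x - y)<..} s) \<partial>lborel)
       = m s * (\<integral>\<^sup>+y. ennreal (q y) * indicator (ball x s) y \<partial>lborel)" .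
  qed
  finally show ?thesis .
qed

lemma nn_integral_tail:
  assumes F: "\<And>s. a \<le> s \<Longrightarrow> (F has_real_derivative f s) (at s)" "\<And>s. a \<le> s \<Longrightarrow> 0 \<le> f s" "(F \<longlongrightarrow> T) at_top"
    and [measurable]: "f \<in> borel_measurable borel"
  shows "(\<integral>\<^sup>+s. ennreal (f s) * indicator {a<..} s \<partial>lborel) = ennreal (T - F a)"
proof -
  have "(\<integral>\<^sup>+s. ennreal (f s) * indicator {a<..} s \<partial>lborel) = (\<integral>\<^sup>+s. ennreal (f s) * indicator {a..} s \<partial>lborel)"
  proof (rule nn_integral_cong_AE)
    have "AE s in lborel. s \<noteq> a" by (rule AE_lborel_singleton)
    then show "AE s in lborel. ennreal (f s) * indicator {a<..} s = ennreal (f s) * indicator {a..} s"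
      by eventually_elim (auto simp: indicator_def)
  qed
  also have "\<dots> = ennreal (T - F a)"
    by (rule nn_integral_FTC_atLeast[OF assms(4) F])
  finally show ?thesis .
qed

text \<open>Writes r^(-2) as an integral over all larger radii, so that the kernel becomes a
  superposition of indicators of balls in \<open>layer_cake\<close>.\<close>

lemma inverse_square_layer:
  assumes r: "0 < r"
  shows "(\<integral>\<^sup>+s. ennreal (2 * s powr (- 3)) * indicator {r<..} s \<partial>lborel) = ennreal (r powr (- 2))"
proof -
  have "((\<lambda>s::real. - (s powr (- 2))) \<longlongrightarrow> - 0) at_top"
    by (intro tendsto_minus tendsto_neg_powr filterlim_ident) simp
  then have "(\<integral>\<^sup>+s. ennreal (2 * s powr (- 3)) * indicator {r<..} s \<partial>lborel) = ennreal (- 0 - (- (r powr (- 2))))"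
    using r by (intro nn_integral_tail) (auto intro!: derivative_eq_intros)
  then show ?thesis by simp
qed

abbreviation "vball \<equiv> unit_ball_vol (real 3)"

lemma emeasure_ball_3: "0 \<le> s \<Longrightarrow> emeasure lborel (ball (x::real^3) s) = ennreal (vball * s ^ 3)"
  using emeasure_ball[of s x] by simp

text \<open>The potential is an integral over radii of the mass of \<open>q\<close> in balls. Up to
  radius \<open>T\<close> that mass is bounded by the supremum \<open>a\<close> times the volume,
  beyond \<open>T\<close> by Cauchy--Schwarz. The radius \<open>T\<close> stays free, to be chosen
  where the supremum and the L2 norm are known.\<close>

lemma Riesz_potential_bound:
  fixes q :: "real^3 \<Rightarrow> real"
  assumes [measurable]: "q \<in> borel_measurable borel" and q: "\<And>x. 0 \<le> q x" "\<And>x. q x \<le> a" "q \<in> Lp 2" and T: "0 < T"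
  shows "(\<integral>\<^sup>+y. ennreal (q y) * (\<integral>\<^sup>+s. ennreal (2 * s powr (- 3)) * indicator {0<..} s * indicator {norm (x - y)<..} s \<partial>lborel) \<partial>lborel)
     \<le> ennreal (2 * a * vball * T + 4 * sqrt (Lpow 2 q) * sqrt vball * T powr (- 1 / 2))"
proof -
  have a: "0 \<le> a" using q(1,2)[of 0] by linarith
  define Q where "Q s = (\<integral>\<^sup>+y. ennreal (q y) * indicator (ball x s) y \<partial>lborel)" for s
  have Q1: "Q s \<le> ennreal (a * vball * s ^ 3)" if "0 < s" for s
  proof -
    have "Q s \<le> (\<integral>\<^sup>+y. ennreal a * indicator (ball x s) y \<partial>lborel)"
      unfolding Q_def using q by (intro nn_integral_mono mult_right_mono ennreal_leI) auto
    also have "\<dots> = ennreal (a * vball * s ^ 3)"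
      using that a by (simp add: nn_integral_cmult_indicator emeasure_ball_3 ennreal_mult[symmetric] mult.assoc)
    finally show ?thesis .
  qed
  have Q2: "Q s \<le> ennreal (sqrt (Lpow 2 q) * sqrt vball * s powr (3 / 2))" if s: "0 < s" for s
  proof -
    have i: "(\<lambda>y. indicator (ball x s) y) \<in> Lp 2"
      by (rule Lp_bounded_support[of _ 1 "norm x + s"])
         (auto simp: indicator_def dist_norm, smt (verit) norm_triangle_ineq3)
    have L: "Lpow 2 (\<lambda>y. indicator (ball x s) y) = vball * s ^ 3"
    proof -
      have "Lpow 2 (\<lambda>y. indicator (ball x s) y :: real) = (LINT y|lborel. indicator (ball x s) y)"
        unfolding Lpow_def by (intro Bochner_Integration.integral_cong refl) (simp add: indicator_def)
      also have "\<dots> = measure lborel (ball x s)" by simp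
      also have "\<dots> = vball * s ^ 3"
        using s emeasure_ball_3[of s x] by (intro measure_eq_emeasure_eq_ennreal) auto
      finally show ?thesis .
    qed
    have "Q s = ennreal (LINT y|lborel. q y * indicator (ball x s) y)"
      unfolding Q_def using Holder_1(1)[OF _ _ _ q(3) i] q
      by (subst nn_integral_eq_integral[symmetric]) (auto intro!: nn_integral_cong simp: indicator_def)
    also have "\<dots> \<le> ennreal (sqrt (Lpow 2 q) * sqrt (vball * s ^ 3))"
    proof -
      have "0 \<le> vball * s ^ 3" using s by simp
      then show ?thesis
        using Holder_1(3)[OF _ _ _ q(3) i] unfolding L by (intro ennreal_leI) (simp add: powr_half_sqrt abs_le_iff)
    qed
    also have "sqrt (vball * s ^ 3) = sqrt vball * s powr (3 / 2)"
    proof -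
      have "s ^ 3 = s powr 3" using s by (simp add: powr_numeral)
      moreover have "sqrt (s powr 3) = (s powr 3) powr (1 / 2)" by (rule powr_half_sqrt[symmetric]) simp
      moreover have "(s powr 3) powr (1 / 2) = s powr (3 / 2)" by (simp add: powr_powr)
      ultimately show ?thesis by (simp only: real_sqrt_mult)
    qed
    finally show ?thesis by (simp add: mult.assoc)
  qed
  have "(\<integral>\<^sup>+y. ennreal (q y) * (\<integral>\<^sup>+s. ennreal (2 * s powr (- 3)) * indicator {0<..} s * indicator {norm (x - y)<..} s \<partial>lborel) \<partial>lborel)
     = (\<integral>\<^sup>+s. ennreal (2 * s powr (- 3)) * indicator {0<..} s * Q s \<partial>lborel)"
    unfolding Q_def by (rule layer_cake) measurable
  also have "\<dots> \<le> (\<integral>\<^sup>+s. ennreal (2 * a * vball) * indicator {0<..T} s + ennreal (2 * sqrt (Lpow 2 q) * sqrt vball * s powr (- 3 / 2)) * indicator {T<..} s \<partial>lborel)"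
  proof (rule nn_integral_mono)
    fix s :: real
    consider "s \<le> 0" | "0 < s" "s \<le> T" | "T < s" by linarith
    then show "ennreal (2 * s powr (- 3)) * indicator {0<..} s * Q s
      \<le> ennreal (2 * a * vball) * indicator {0<..T} s + ennreal (2 * sqrt (Lpow 2 q) * sqrt vball * s powr (- 3 / 2)) * indicator {T<..} s"
    proof cases
      case 1
      then show ?thesis by simp
    next
      case 2
      have "ennreal (2 * s powr (- 3)) * Q s \<le> ennreal (2 * s powr (- 3)) * ennreal (a * vball * s ^ 3)"
        using Q1[OF 2(1)] by (intro mult_left_mono) auto
      also have "\<dots> = ennreal (2 * a * vball)"
      proof -
        have "s powr (- 3) * s ^ 3 = 1"
          using 2 by (simp add: powr_minus powr_numeral)
        moreover have "2 * s powr (- 3) * (a * vball * s ^ 3) = 2 * a * vball * (s powr (- 3) * s ^ 3)" by (simp only: mult_ac)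
        ultimately have "2 * s powr (- 3) * (a * vball * s ^ 3) = 2 * a * vball" by (simp only: mult_1_right)
        then show ?thesis by (simp only: ennreal_mult'[symmetric] powr_ge_zero mult_nonneg_nonneg zero_le_numeral)
      qed
      finally show ?thesis using 2 by simp
    next
      case 3
      then have s: "0 < s" using T by simp
      have "ennreal (2 * s powr (- 3)) * Q s \<le> ennreal (2 * s powr (- 3)) * ennreal (sqrt (Lpow 2 q) * sqrt vball * s powr (3 / 2))"
        using Q2[OF s] by (intro mult_left_mono) auto
      also have "\<dots> = ennreal (2 * sqrt (Lpow 2 q) * sqrt vball * s powr (- 3 / 2))"
      proof -
        have "s powr (- 3) * s powr (3 / 2) = s powr (- 3 / 2)" by (simp add: powr_add[symmetric])
        moreover have "2 * s powr (- 3) * (sqrt (Lpow 2 q) * sqrt vball * s powr (3 / 2)) = 2 * sqrt (Lpow 2 q) * sqrt vball * (s powr (- 3) * s powr (3 / 2))"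
          by (simp only: mult_ac)
        ultimately have "2 * s powr (- 3) * (sqrt (Lpow 2 q) * sqrt vball * s powr (3 / 2)) = 2 * sqrt (Lpow 2 q) * sqrt vball * s powr (- 3 / 2)"
          by (simp only:)
        then show ?thesis by (simp only: ennreal_mult'[symmetric] powr_ge_zero mult_nonneg_nonneg zero_le_numeral)
      qed
      finally show ?thesis using 3 s by simp
    qed
  qed
  also have "\<dots> = (\<integral>\<^sup>+s. ennreal (2 * a * vball) * indicator {0<..T} s \<partial>lborel)
      + (\<integral>\<^sup>+s. ennreal (2 * sqrt (Lpow 2 q) * sqrt vball * s powr (- 3 / 2)) * indicator {T<..} s \<partial>lborel)"
    by (rule nn_integral_add) measurable
  also have "(\<integral>\<^sup>+s. ennreal (2 * a * vball) * indicator {0<..T} s \<partial>lborel) = ennreal (2 * a * vball * T)"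
    using T a by (simp add: nn_integral_cmult_indicator ennreal_mult'[symmetric] ennreal_mult''[symmetric])
  also have "(\<integral>\<^sup>+s. ennreal (2 * sqrt (Lpow 2 q) * sqrt vball * s powr (- 3 / 2)) * indicator {T<..} s \<partial>lborel)
     = ennreal (4 * sqrt (Lpow 2 q) * sqrt vball * T powr (- 1 / 2))"
  proof -
    let ?c = "sqrt (Lpow 2 q) * sqrt vball"
    have t: "((\<lambda>s::real. - 4 * ?c * s powr (- 1 / 2)) \<longlongrightarrow> - 4 * ?c * 0) at_top"
      by (intro tendsto_mult tendsto_const tendsto_neg_powr filterlim_ident) simp
    have "(\<integral>\<^sup>+s. ennreal (2 * sqrt (Lpow 2 q) * sqrt vball * s powr (- 3 / 2)) * indicator {T<..} s \<partial>lborel)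
       = ennreal (- 4 * ?c * 0 - (- 4 * ?c * T powr (- 1 / 2)))"
      using T by (intro nn_integral_tail[OF _ _ t]) (auto intro!: derivative_eq_intros)
    then show ?thesis by (simp add: mult_ac)
  qed
  finally show ?thesis
    using a T by (simp add: ennreal_plus[symmetric] del: ennreal_plus)
qed

text \<open>The regularised kernel is dominated by |z|^(-2) for every \<delta>, so the bound does
  not depend on \<delta>.\<close>

lemma conv_newton_grad_bound:
  fixes q :: "real^3 \<Rightarrow> real"
  assumes [measurable]: "q \<in> borel_measurable borel" and q: "\<And>x. 0 \<le> q x" "\<And>x. q x \<le> a" "q \<in> Lp 2" and T: "0 < T" and d: "0 < \<delta>"
  shows "\<bar>conv (newton_grad \<delta> i) q x\<bar> \<le> 2 * a * vball * T + 4 * sqrt (Lpow 2 q) * sqrt vball * T powr (- 1 / 2)"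
    (is "_ \<le> ?B")
proof -
  have a: "0 \<le> a" using q(1,2)[of 0] by linarith
  have [measurable]: "newton_grad \<delta> i \<in> borel_measurable borel"
    by (rule borel_measurable_continuous_onI[OF newton_grad_continuous[OF d]])
  have K: "ennreal \<bar>newton_grad \<delta> i z\<bar> \<le> (\<integral>\<^sup>+s. ennreal (2 * s powr (- 3)) * indicator {0<..} s * indicator {norm z<..} s \<partial>lborel)" for z
  proof (cases "z = 0")
    case True
    then show ?thesis by (simp add: newton_grad_def)
  next
    case False
    have "\<bar>newton_grad \<delta> i z\<bar> \<le> nwt \<delta> z powr (- 1)" by (rule newton_grad_le[OF d])
    also have "\<dots> \<le> (z \<bullet> z) powr (- 1)"
      using nwt_ge(2)[of z \<delta>] False by (intro powr_mono2') auto
    also have "(z \<bullet> z) powr (- 1) = norm z powr (- 2)"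
      using False by (simp add: power2_norm_eq_inner[symmetric] powr_minus powr_numeral)
    finally have "ennreal \<bar>newton_grad \<delta> i z\<bar> \<le> ennreal (norm z powr (- 2))" by (rule ennreal_leI)
    also have "\<dots> = (\<integral>\<^sup>+s. ennreal (2 * s powr (- 3)) * indicator {norm z<..} s \<partial>lborel)"
      using False by (intro inverse_square_layer[symmetric]) simp
    also have "\<dots> = (\<integral>\<^sup>+s. ennreal (2 * s powr (- 3)) * indicator {0<..} s * indicator {norm z<..} s \<partial>lborel)"
      by (intro nn_integral_cong) (auto simp: indicator_def intro: le_less_trans[OF norm_ge_zero])
    finally show ?thesis .
  qed
  have "(\<integral>\<^sup>+y. ennreal \<bar>newton_grad \<delta> i (x - y) * q y\<bar> \<partial>lborel)
     = (\<integral>\<^sup>+y. ennreal (q y) * ennreal \<bar>newton_grad \<delta> i (x - y)\<bar> \<partial>lborel)"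
    using q(1) by (intro nn_integral_cong) (simp add: abs_mult ennreal_mult'[symmetric] mult.commute)
  also have "\<dots> \<le> (\<integral>\<^sup>+y. ennreal (q y) * (\<integral>\<^sup>+s. ennreal (2 * s powr (- 3)) * indicator {0<..} s * indicator {norm (x - y)<..} s \<partial>lborel) \<partial>lborel)"
    by (intro nn_integral_mono mult_left_mono K) simp
  also have "\<dots> \<le> ennreal ?B" by (rule Riesz_potential_bound[OF _ q T]) measurable
  finally have nn: "(\<integral>\<^sup>+y. ennreal \<bar>newton_grad \<delta> i (x - y) * q y\<bar> \<partial>lborel) \<le> ennreal ?B" .
  have B: "0 \<le> ?B" using a T by simp
  have i: "integrable lborel (\<lambda>y. newton_grad \<delta> i (x - y) * q y)"
    by (rule integrableI_bounded) (use nn in \<open>auto intro: le_less_trans\<close>)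
  have "ennreal \<bar>conv (newton_grad \<delta> i) q x\<bar> \<le> ennreal ?B"
    unfolding conv_def using integral_norm_bound_ennreal[OF i] nn by simp
  then show ?thesis using B by (simp add: ennreal_le_iff)
qed

text \<open>Only \<delta> = 1 and power 2 are integrated; the other cases are bounded by a multiple
  of that one, because \<open>nwt \<delta>\<close> is bounded below both by \<delta>^2 and by a
  multiple of \<open>nwt 1\<close>.\<close>

lemma nwt_powr_integrable:
  assumes d: "0 < \<delta>" and p: "2 \<le> p"
  shows "integrable lborel (\<lambda>x. nwt \<delta> x powr (- p))"
proof -
  have [measurable]: "(\<lambda>x. nwt \<delta> x powr (- p)) \<in> borel_measurable borel" for \<delta> p
    unfolding nwt_def by measurable
  have one: "integrable lborel (\<lambda>x. nwt 1 x powr (- 2))"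
  proof (rule integrableI_nonneg)
    \<comment> \<open>Minus the derivative of (1 + s^2)^(-2). Multiplied by the volume of the ball
      of radius \<open>s\<close> it is at most a multiple of 1 / (1 + s^2), whose primitive is the
      arctangent.\<close>
    let ?m = "\<lambda>s. ennreal (4 * s * (1 + s\<^sup>2) powr (- 3)) * indicator {0<..} s"
    have layer: "ennreal (nwt 1 y powr (- 2)) = (\<integral>\<^sup>+s. ?m s * indicator {norm (0 - y)<..} s \<partial>lborel)" for y :: "real^3"
    proof -
      have t: "((\<lambda>s::real. - ((1 + s\<^sup>2) powr (- 2))) \<longlongrightarrow> - 0) at_top"
      proof (intro tendsto_minus tendsto_neg_powr)
        show "filterlim (\<lambda>s::real. 1 + s\<^sup>2) at_top at_top"
          by (intro filterlim_tendsto_add_at_top[OF tendsto_const] filterlim_pow_at_top filterlim_ident) simp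
      qed simp
      have D: "((\<lambda>s. - ((1 + s\<^sup>2) powr (- 2))) has_real_derivative 4 * s * (1 + s\<^sup>2) powr (- 3)) (at s)" for s :: real
      proof -
        have p: "0 < 1 + s\<^sup>2" by (simp add: add_pos_nonneg)
        show ?thesis using p by (auto intro!: derivative_eq_intros)
      qed
      have "(\<integral>\<^sup>+s. ennreal (4 * s * (1 + s\<^sup>2) powr (- 3)) * indicator {norm y<..} s \<partial>lborel) = ennreal (- 0 - (- ((1 + (norm y)\<^sup>2) powr (- 2))))"
        using D t by (intro nn_integral_tail) (auto intro!: mult_nonneg_nonneg intro: order_trans[OF norm_ge_zero])
      also have "(1 + (norm y)\<^sup>2) = nwt 1 y" by (simp add: nwt_def power2_norm_eq_inner)
      also have "(\<integral>\<^sup>+s. ennreal (4 * s * (1 + s\<^sup>2) powr (- 3)) * indicator {norm y<..} s \<partial>lborel)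
          = (\<integral>\<^sup>+s. ?m s * indicator {norm (0 - y)<..} s \<partial>lborel)"
        by (intro nn_integral_cong) (auto simp: indicator_def intro: le_less_trans[OF norm_ge_zero])
      finally show ?thesis by simp
    qed
    have "(\<integral>\<^sup>+y. ennreal (nwt 1 y powr (- 2)) \<partial>lborel)
       = (\<integral>\<^sup>+y. ennreal 1 * (\<integral>\<^sup>+s. ?m s * indicator {norm ((0::real^3) - y)<..} s \<partial>lborel) \<partial>lborel)"
      by (simp only: layer ennreal_1 mult_1)
    also have "\<dots> = (\<integral>\<^sup>+s. ?m s * (\<integral>\<^sup>+y. ennreal 1 * indicator (ball (0::real^3) s) y \<partial>lborel) \<partial>lborel)"
      by (rule layer_cake) measurable
    also have "\<dots> \<le> (\<integral>\<^sup>+s. ennreal (4 * vball * inverse (1 + s\<^sup>2)) * indicator {0..} s \<partial>lborel)"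
    proof (rule nn_integral_mono)
      fix s :: real
      show "?m s * (\<integral>\<^sup>+y. ennreal 1 * indicator (ball (0::real^3) s) y \<partial>lborel) \<le> ennreal (4 * vball * inverse (1 + s\<^sup>2)) * indicator {0..} s"
      proof (cases "0 < s")
        case True
        have p: "0 < 1 + s\<^sup>2" by (simp add: add_pos_nonneg)
        have "s ^ 4 * (1 + s\<^sup>2) powr (- 3) \<le> (1 + s\<^sup>2)\<^sup>2 * (1 + s\<^sup>2) powr (- 3)"
        proof (rule mult_right_mono)
          have "(s\<^sup>2)\<^sup>2 \<le> (1 + s\<^sup>2)\<^sup>2" by (intro power_mono) auto
          then show "s ^ 4 \<le> (1 + s\<^sup>2)\<^sup>2" by simp
        qed simp
        also have "(1 + s\<^sup>2)\<^sup>2 = (1 + s\<^sup>2) powr 2" using p by (simp add: powr_numeral)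
        also have "(1 + s\<^sup>2) powr 2 * (1 + s\<^sup>2) powr (- 3) = (1 + s\<^sup>2) powr (2 + (- 3))"
          by (simp only: powr_add)
        also have "(2 + (- 3) :: real) = - 1" by simp
        also have "(1 + s\<^sup>2) powr (- 1) = inverse (1 + s\<^sup>2)" using p by (simp add: powr_minus)
        finally have "4 * vball * (s ^ 4 * (1 + s\<^sup>2) powr (- 3)) \<le> 4 * vball * inverse (1 + s\<^sup>2)"
          by (intro mult_left_mono) auto
        moreover have "?m s * (\<integral>\<^sup>+y. ennreal 1 * indicator (ball (0::real^3) s) y \<partial>lborel) = ennreal (4 * vball * (s ^ 4 * (1 + s\<^sup>2) powr (- 3)))"
        proof -
          have "?m s * (\<integral>\<^sup>+y. ennreal 1 * indicator (ball (0::real^3) s) y \<partial>lborel) = ennreal (4 * s * (1 + s\<^sup>2) powr (- 3)) * ennreal (vball * s ^ 3)"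
            using True by (simp add: emeasure_ball_3)
          also have "\<dots> = ennreal (4 * s * (1 + s\<^sup>2) powr (- 3) * (vball * s ^ 3))"
            using True by (intro ennreal_mult[symmetric]) auto
          also have "4 * s * (1 + s\<^sup>2) powr (- 3) * (vball * s ^ 3) = 4 * vball * (s ^ 4 * (1 + s\<^sup>2) powr (- 3))"
            by (simp add: eval_nat_numeral mult_ac)
          finally show ?thesis .
        qed
        ultimately show ?thesis using True by (simp add: ennreal_leI)
      qed simp
    qed
    also have "\<dots> = ennreal (4 * vball * (pi / 2) - 4 * vball * arctan 0)"
    proof (rule nn_integral_FTC_atLeast)
      show "((\<lambda>s. 4 * vball * arctan s) \<longlongrightarrow> 4 * vball * (pi / 2)) at_top"
        by (intro tendsto_intros tendsto_arctan_at_top)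
      show "((\<lambda>s. 4 * vball * arctan s) has_real_derivative 4 * vball * inverse (1 + s\<^sup>2)) (at s)" for s
        by (intro DERIV_cmult DERIV_arctan)
    qed (auto simp: add_nonneg_nonneg)
    also have "\<dots> < \<infinity>" by simp
    finally show "(\<integral>\<^sup>+y. ennreal (nwt 1 y powr (- 2)) \<partial>lborel) < \<infinity>" .
  qed auto
  \<comment> \<open>The largest factor for which both summands of c (|x|^2 + 1) stay below those of
    |x|^2 + \<delta>^2.\<close>
  define c where "c = min 1 (\<delta>\<^sup>2)"
  have c: "0 < c" "c \<le> 1" "c \<le> \<delta>\<^sup>2" using d by (auto simp: c_def)
  have "nwt \<delta> x powr (- p) \<le> (\<delta>\<^sup>2) powr (- (p - 2)) * (c powr (- 2) * nwt 1 x powr (- 2))" for x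
  proof -
    have "c * nwt 1 x \<le> nwt \<delta> x"
      using c mult_right_mono[OF c(2), of "x \<bullet> x"] by (simp add: nwt_def distrib_left)
    then have "nwt \<delta> x powr (- 2) \<le> (c * nwt 1 x) powr (- 2)"
      using c nwt_pos[of 1 x] by (intro powr_mono2') auto
    also have "\<dots> = c powr (- 2) * nwt 1 x powr (- 2)" by (rule powr_mult)
    finally have 1: "nwt \<delta> x powr (- 2) \<le> c powr (- 2) * nwt 1 x powr (- 2)" .
    have "nwt \<delta> x powr (- p) = nwt \<delta> x powr (- (p - 2)) * nwt \<delta> x powr (- 2)"
      by (simp add: powr_add[symmetric])
    also have "\<dots> \<le> (\<delta>\<^sup>2) powr (- (p - 2)) * (c powr (- 2) * nwt 1 x powr (- 2))"
      using 1 p by (intro mult_mono nwt_powr_le[OF d]) auto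
    finally show ?thesis .
  qed
  then have le: "norm (nwt \<delta> x powr (- p)) \<le> norm ((\<delta>\<^sup>2) powr (- (p - 2)) * (c powr (- 2) * nwt 1 x powr (- 2)))" for x
    by (simp only: real_norm_def abs_of_nonneg powr_ge_zero mult_nonneg_nonneg)
  have "integrable lborel (\<lambda>x. (\<delta>\<^sup>2) powr (- (p - 2)) * (c powr (- 2) * nwt 1 x powr (- 2)))"
    by (intro integrable_mult_right one)
  then show ?thesis
    by (rule Bochner_Integration.integrable_bound) (measurable, rule AE_I2, rule le)
qed

text \<open>Young's inequality for L2 and L1: Cauchy--Schwarz with the weight \<open>q\<close>, then
  Tonelli and translation invariance.\<close>

lemma conv_Lp_2:
  fixes k q :: "'a::euclidean_space \<Rightarrow> real"
  assumes k: "k \<in> Lp 2" and q: "integrable lborel q" "\<And>x. 0 \<le> q x"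
  shows "conv k q \<in> Lp 2"
proof -
  note [measurable] = Lp_measurable[OF k] borel_measurable_integrable[OF q(1)]
  have m[measurable]: "conv k q \<in> borel_measurable borel"
  proof -
    have "(\<lambda>x. LINT y|lborel. k (x - y) * q y) \<in> borel_measurable lborel"
      by (rule lborel.borel_measurable_lebesgue_integral) measurable
    then show ?thesis unfolding conv_def[abs_def] by simp
  qed
  define N where "N = (LINT y|lborel. q y)"
  have N: "(\<integral>\<^sup>+y. ennreal (q y) \<partial>lborel) = ennreal N" "0 \<le> N"
    unfolding N_def using q by (auto simp: nn_integral_eq_integral)
  have le: "ennreal ((conv k q x)\<^sup>2) \<le> (\<integral>\<^sup>+y. ennreal ((k (x - y))\<^sup>2 * q y) \<partial>lborel) * ennreal N" for x
  proof -
    have "ennreal \<bar>conv k q x\<bar> \<le> (\<integral>\<^sup>+y. ennreal \<bar>k (x - y) * q y\<bar> \<partial>lborel)"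
    proof (cases "integrable lborel (\<lambda>y. k (x - y) * q y)")
      case True
      then show ?thesis unfolding conv_def using integral_norm_bound_ennreal[OF True] by simp
    next
      case False
      then show ?thesis by (simp add: conv_def not_integrable_integral_eq)
    qed
    then have "(ennreal \<bar>conv k q x\<bar>)\<^sup>2 \<le> (\<integral>\<^sup>+y. ennreal \<bar>k (x - y) * q y\<bar> \<partial>lborel)\<^sup>2"
      by (intro power_mono) simp_all
    also have "\<dots> \<le> (\<integral>\<^sup>+y. ennreal ((k (x - y))\<^sup>2 * q y) \<partial>lborel) * (\<integral>\<^sup>+y. ennreal (q y) \<partial>lborel)"
    proof (rule Cauchy_Schwarz_esqrt)
      show "(ennreal \<bar>k (x - y) * q y\<bar>)\<^sup>2 \<le> ennreal ((k (x - y))\<^sup>2 * q y) * ennreal (q y)" for y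
        using q(2)[of y] by (simp add: ennreal_power ennreal_mult''[symmetric] power_mult_distrib power2_eq_square mult_ac)
    qed measurable
    finally show ?thesis by (simp add: ennreal_power N)
  qed
  have "(\<integral>\<^sup>+x. ennreal ((conv k q x)\<^sup>2) \<partial>lborel) \<le> (\<integral>\<^sup>+x. (\<integral>\<^sup>+y. ennreal ((k (x - y))\<^sup>2 * q y) \<partial>lborel) * ennreal N \<partial>lborel)"
    by (intro nn_integral_mono le)
  also have "\<dots> = (\<integral>\<^sup>+x. \<integral>\<^sup>+y. ennreal ((k (x - y))\<^sup>2 * q y) \<partial>lborel \<partial>lborel) * ennreal N"
    by (rule nn_integral_multc) measurable
  also have "(\<integral>\<^sup>+x. \<integral>\<^sup>+y. ennreal ((k (x - y))\<^sup>2 * q y) \<partial>lborel \<partial>lborel) = (\<integral>\<^sup>+y. \<integral>\<^sup>+x. ennreal ((k (x - y))\<^sup>2 * q y) \<partial>lborel \<partial>lborel)"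
    by (rule lborel_pair.Fubini') measurable
  also have "\<dots> = (\<integral>\<^sup>+y. ennreal (Lpow 2 k) * ennreal (q y) \<partial>lborel)"
  proof (rule nn_integral_cong)
    fix y
    have "(\<integral>\<^sup>+x. ennreal ((k (x - y))\<^sup>2 * q y) \<partial>lborel) = (\<integral>\<^sup>+x. ennreal ((k (x + - y))\<^sup>2) * ennreal (q y) \<partial>lborel)"
      using q(2)[of y] by (simp add: ennreal_mult')
    also have "\<dots> = (\<integral>\<^sup>+x. ennreal ((k (x + - y))\<^sup>2) \<partial>lborel) * ennreal (q y)"
      by (rule nn_integral_multc) measurable
    also have "(\<integral>\<^sup>+x. ennreal ((k (x + - y))\<^sup>2) \<partial>lborel) = (\<integral>\<^sup>+x. ennreal ((k x)\<^sup>2) \<partial>lborel)"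
      by (rule lborel_nn_integral_translate[of "\<lambda>x. ennreal ((k x)\<^sup>2)"]) measurable
    also have "\<dots> = ennreal (Lpow 2 k)"
      using k unfolding Lpow_2 Lp_2_iff by (intro nn_integral_eq_integral) auto
    finally show "(\<integral>\<^sup>+x. ennreal ((k (x - y))\<^sup>2 * q y) \<partial>lborel) = ennreal (Lpow 2 k) * ennreal (q y)" .
  qed
  also have "\<dots> = ennreal (Lpow 2 k) * ennreal N"
    by (subst nn_integral_cmult) (simp_all add: N)
  finally have "(\<integral>\<^sup>+x. ennreal ((conv k q x)\<^sup>2) \<partial>lborel) < \<infinity>"
    by (auto intro: le_less_trans simp: ennreal_mult_less_top)
  then show ?thesis unfolding Lp_2_iff by (auto intro!: integrableI_nonneg)
qed

text \<open>The constant comes from two uses of the quasi-triangle inequality and is far from sharp;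
  what matters is that it does not depend on \<open>t\<close>.\<close>

lemma moll_Lp_bound:
  fixes \<eta> f :: "'a::euclidean_space \<Rightarrow> real"
  assumes \<eta>: "integrable lborel \<eta>" "\<And>z. 0 \<le> \<eta> z" "(LINT z|lborel. \<eta> z) = 1"
    and f: "f \<in> Lp s" and s: "1 \<le> s"
  shows "moll \<eta> t f \<in> Lp s" "Lpow s (moll \<eta> t f) \<le> 2 powr s * (2 powr s * 2 + 1) * Lpow s f"
proof -
  note [measurable] = borel_measurable_integrable[OF \<eta>(1)] Lp_measurable[OF f]
  define C where "C = 2 powr s * 2 * Lpow s f"
  have C: "0 \<le> C" by (simp add: C_def)
  have le: "Lpow s (\<lambda>x. f (x + t *\<^sub>R z) - f x) \<le> C" for z
  proof -
    have "Lpow s (\<lambda>x. f (x + t *\<^sub>R z) + - f x) \<le> 2 powr s * (Lpow s (\<lambda>x. f (x + t *\<^sub>R z)) + Lpow s (\<lambda>x. - f x))"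
      using f s by (intro Lpow_add_le Lp_translate Lp_uminus) auto
    also have "\<dots> = C" by (simp add: C_def Lpow_translate) (simp add: Lpow_def)
    finally show ?thesis by simp
  qed
  have "(\<integral>\<^sup>+x. ennreal (\<bar>moll \<eta> t f x - f x\<bar> powr s) \<partial>lborel)
     \<le> (\<integral>\<^sup>+z. ennreal (\<eta> z * Lpow s (\<lambda>x. f (x + t *\<^sub>R z) - f x)) \<partial>lborel)"
    by (rule moll_diff_nn_bound[OF \<eta> f s])
  also have "\<dots> \<le> (\<integral>\<^sup>+z. ennreal (\<eta> z * C) \<partial>lborel)"
    using le \<eta>(2) by (intro nn_integral_mono ennreal_leI mult_left_mono) auto
  also have "\<dots> = ennreal C"
    using \<eta> C by (subst nn_integral_eq_integral) auto
  finally have nn: "(\<integral>\<^sup>+x. ennreal (\<bar>moll \<eta> t f x - f x\<bar> powr s) \<partial>lborel) \<le> ennreal C" .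
  have d: "(\<lambda>x. moll \<eta> t f x - f x) \<in> Lp s"
    by (intro LpI integrableI_nonneg) (use nn in \<open>auto intro: le_less_trans\<close>)
  have dC: "Lpow s (\<lambda>x. moll \<eta> t f x - f x) \<le> C"
    using nn Lp_integrable[OF d] C unfolding Lpow_def by (subst (asm) nn_integral_eq_integral) (auto simp: ennreal_le_iff)
  show "moll \<eta> t f \<in> Lp s" using Lp_add[OF d f] s by simp
  have "Lpow s (moll \<eta> t f) = Lpow s (\<lambda>x. (moll \<eta> t f x - f x) + f x)" by simp
  also have "\<dots> \<le> 2 powr s * (Lpow s (\<lambda>x. moll \<eta> t f x - f x) + Lpow s f)"
    using s by (intro Lpow_add_le d f) auto
  also have "\<dots> \<le> 2 powr s * (C + Lpow s f)" using dC by (intro mult_left_mono add_right_mono) auto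
  finally show "Lpow s (moll \<eta> t f) \<le> 2 powr s * (2 powr s * 2 + 1) * Lpow s f" by (simp add: C_def algebra_simps)
qed

section \<open>Gradient, divergence and curl\<close>

lemma sq_sum3_le: "(a + b + c)\<^sup>2 \<le> 3 * (a\<^sup>2 + b\<^sup>2 + c\<^sup>2)" for a b c :: real
proof -
  have "0 \<le> (a - b)\<^sup>2 + (b - c)\<^sup>2 + (a - c)\<^sup>2" by simp
  then show ?thesis by (simp add: power2_eq_square algebra_simps)
qed

lemma sq_add_le: "(a + b)\<^sup>2 \<le> 2 * a\<^sup>2 + 2 * b\<^sup>2" for a b :: real
proof -
  have "0 \<le> (a - b)\<^sup>2" by simp
  then show ?thesis by (simp add: power2_eq_square algebra_simps)
qed

text \<open>Expanding the squares of divergence and curl leaves mixed products of derivatives, and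
  these agree after \<open>integral_partial_swap\<close>. This elementary identity replaces singular
  integral estimates for the test field.\<close>

lemma gradient_div_curl:
  fixes f :: "3 \<Rightarrow> real^3 \<Rightarrow> real"
  assumes f: "\<And>i. f i \<in> Cc 1"
  shows "(\<Sum>i\<in>UNIV. \<Sum>j\<in>UNIV. Lpow 2 (partial j (f i)))
     = Lpow 2 (\<lambda>x. \<Sum>i\<in>UNIV. partial i (f i) x)
       + (1 / 2) * (\<Sum>i\<in>UNIV. \<Sum>j\<in>UNIV. Lpow 2 (\<lambda>x. partial j (f i) x - partial i (f j) x))"
proof -
  define Y where "Y i j k l = (LINT x|lborel. partial j (f i) x * partial l (f k) x)" for i j k l
  have int: "integrable lborel (\<lambda>x. partial j (f i) x * partial l (f k) x)" for i j k l
    by (rule Holder_1(1)[OF _ _ _ Cc_1_Lp(2)[OF f, of 2] Cc_1_Lp(2)[OF f, of 2]]) auto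
  have a: "Lpow 2 (partial j (f i)) = Y i j i j" for i j
    unfolding Lpow_2 Y_def by (simp add: power2_eq_square)
  have b: "Lpow 2 (\<lambda>x. partial j (f i) x - partial i (f j) x) = Y i j i j + Y j i j i - 2 * Y i j j i" for i j
  proof -
    have "Lpow 2 (\<lambda>x. partial j (f i) x - partial i (f j) x)
      = (LINT x|lborel. partial j (f i) x * partial j (f i) x + partial i (f j) x * partial i (f j) x - 2 * (partial j (f i) x * partial i (f j) x))"
      unfolding Lpow_2 by (intro Bochner_Integration.integral_cong refl) (simp add: power2_eq_square algebra_simps)
    then show ?thesis unfolding Y_def using int by simp
  qed
  have c: "Lpow 2 (\<lambda>x. \<Sum>i\<in>UNIV. partial i (f i) x) = (\<Sum>i\<in>UNIV. \<Sum>j\<in>UNIV. Y i i j j)"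
    unfolding Lpow_2 Y_def power2_eq_square sum_product using int by simp
  have d: "Y i i j j = Y i j j i" for i j
    unfolding Y_def by (rule integral_partial_swap[OF f f])
  have s: "Y i j k l = Y k l i j" for i j k l unfolding Y_def by (simp add: mult.commute)
  have c': "(\<Sum>i\<in>UNIV. \<Sum>j\<in>UNIV. Y i i j j) = (\<Sum>i\<in>UNIV. \<Sum>j\<in>UNIV. Y i j j i)"
    by (intro sum.cong refl d)
  show ?thesis
    unfolding a b c c' using s[of 1 2 2 1] s[of 1 3 3 1] s[of 2 3 3 2] by (simp add: sum_3 algebra_simps)
qed

text \<open>The field \<open>\<phi>\<close> is curl free, so the curl of its product with a cutoff
  contains only derivatives of the cutoff, which are of size B / (n + 1); the divergence is cutoff
  times \<open>w\<close> plus terms of the same kind. The error constant 12 is 6 from the divergence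
  plus 6 from the curls.\<close>

lemma cutoff_gradient_bound:
  fixes \<phi> :: "3 \<Rightarrow> real^3 \<Rightarrow> real"
  assumes C: "\<And>i. C_diff 1 (\<phi> i)" and sym: "\<And>i j x. partial j (\<phi> i) x = partial i (\<phi> j) x"
    and L: "\<And>i. \<phi> i \<in> Lp 2" and w: "w \<in> Lp 2" "\<And>x. (\<Sum>i\<in>UNIV. partial i (\<phi> i) x) = w x"
    and B: "0 \<le> B" "\<And>n x. \<bar>cutoff n x\<bar> \<le> B" "\<And>n i x. \<bar>partial i (cutoff n) x\<bar> \<le> B / real (Suc n)"
  shows "Lpow 2 (partial j (\<lambda>x. cutoff n x * \<phi> i x)) \<le> 2 * B\<^sup>2 * Lpow 2 w + (1 / real (Suc n)) * (12 * B\<^sup>2 * (\<Sum>i\<in>UNIV. Lpow 2 (\<phi> i)))"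
proof -
  have c1: "cutoff n \<in> Cc 1" by (rule Cc_infinity_imp_Cc[OF cutoff_Cc_infinity])
  define f where "f i x = cutoff n x * \<phi> i x" for i x
  have f: "f i \<in> Cc 1" for i unfolding f_def[abs_def] by (rule Cc_1_mult(1)[OF c1 C])
  have pf: "partial j (f i) x = partial j (cutoff n) x * \<phi> i x + cutoff n x * partial j (\<phi> i) x" for i j x
    unfolding f_def[abs_def] by (rule Cc_1_mult(2)[OF c1 C])
  note [measurable] = Lp_measurable[OF w(1)] Lp_measurable[OF L] Cc_1_measurable[OF f]
  define e where "e = B / real (Suc n)"
  have e: "0 \<le> e" "e\<^sup>2 \<le> B\<^sup>2 * (1 / real (Suc n))"
  proof -
    show "0 \<le> e" using B by (simp add: e_def)
    have "(1 / real (Suc n))\<^sup>2 \<le> (1 / real (Suc n)) * 1"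
      unfolding power2_eq_square by (intro mult_left_mono) auto
    then have "B\<^sup>2 * (1 / real (Suc n))\<^sup>2 \<le> B\<^sup>2 * (1 / real (Suc n))"
      by (intro mult_left_mono) auto
    then show "e\<^sup>2 \<le> B\<^sup>2 * (1 / real (Suc n))" by (simp add: e_def power_divide)
  qed
  have iw: "integrable lborel (\<lambda>x. (w x)\<^sup>2)" and i\<phi>: "integrable lborel (\<lambda>x. (\<phi> i x)\<^sup>2)" for i
    using w(1) L by (auto simp: Lp_2_iff)
  have cq: "(partial j (cutoff n) x * \<phi> i x)\<^sup>2 \<le> e\<^sup>2 * (\<phi> i x)\<^sup>2" for i j x
    using B(3)[of j n x] unfolding power_mult_distrib e_def[symmetric]
    by (intro mult_right_mono) (auto simp: abs_le_square_iff[symmetric] e)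
  have div: "Lpow 2 (\<lambda>x. \<Sum>i\<in>UNIV. partial i (f i) x) \<le> 2 * B\<^sup>2 * Lpow 2 w + 6 * e\<^sup>2 * (\<Sum>i\<in>UNIV. Lpow 2 (\<phi> i))"
  proof -
    have "(\<Sum>i\<in>UNIV. partial i (f i) x)\<^sup>2 \<le> 2 * B\<^sup>2 * (w x)\<^sup>2 + 6 * e\<^sup>2 * (\<Sum>i\<in>UNIV. (\<phi> i x)\<^sup>2)" for x
    proof -
      have "(\<Sum>i\<in>UNIV. partial i (f i) x) = cutoff n x * w x + (\<Sum>i\<in>UNIV. partial i (cutoff n) x * \<phi> i x)"
        unfolding w(2)[symmetric] pf by (simp add: sum.distrib sum_distrib_left)
      then have "(\<Sum>i\<in>UNIV. partial i (f i) x)\<^sup>2 \<le> 2 * (cutoff n x * w x)\<^sup>2 + 2 * (\<Sum>i\<in>UNIV. partial i (cutoff n) x * \<phi> i x)\<^sup>2"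
        using sq_add_le by simp
      also have "(cutoff n x * w x)\<^sup>2 \<le> B\<^sup>2 * (w x)\<^sup>2"
        using B(1) B(2)[of n x] unfolding power_mult_distrib by (intro mult_right_mono) (auto simp: abs_le_square_iff[symmetric])
      also have "(\<Sum>i\<in>UNIV. partial i (cutoff n) x * \<phi> i x)\<^sup>2 \<le> 3 * (\<Sum>i\<in>UNIV. e\<^sup>2 * (\<phi> i x)\<^sup>2)"
        unfolding sum_3 using cq[of 1 x 1] cq[of 2 x 2] cq[of 3 x 3]
        by (intro order_trans[OF sq_sum3_le] mult_left_mono add_mono) auto
      finally show ?thesis by (simp add: sum_distrib_left[symmetric])
    qed
    then have "Lpow 2 (\<lambda>x. \<Sum>i\<in>UNIV. partial i (f i) x) \<le> (LINT x|lborel. 2 * B\<^sup>2 * (w x)\<^sup>2 + 6 * e\<^sup>2 * (\<Sum>i\<in>UNIV. (\<phi> i x)\<^sup>2))"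
      unfolding Lpow_2 using Lp_sum[of UNIV "\<lambda>i. partial i (f i)" 2] Cc_1_Lp(2)[OF f, of 2] iw i\<phi>
      by (intro integral_mono) (auto simp: Lp_2_iff)
    then show ?thesis using iw i\<phi> by (simp add: Lpow_2)
  qed
  have curl: "Lpow 2 (\<lambda>x. partial j (f i) x - partial i (f j) x) \<le> 2 * e\<^sup>2 * (Lpow 2 (\<phi> i) + Lpow 2 (\<phi> j))" for i j
  proof -
    have "(partial j (f i) x - partial i (f j) x)\<^sup>2 \<le> 2 * e\<^sup>2 * ((\<phi> i x)\<^sup>2 + (\<phi> j x)\<^sup>2)" for x
    proof -
      have "partial j (f i) x - partial i (f j) x = partial j (cutoff n) x * \<phi> i x + - (partial i (cutoff n) x * \<phi> j x)"
        unfolding pf by (simp add: sym[of j i])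
      then have "(partial j (f i) x - partial i (f j) x)\<^sup>2 \<le> 2 * (partial j (cutoff n) x * \<phi> i x)\<^sup>2 + 2 * (- (partial i (cutoff n) x * \<phi> j x))\<^sup>2"
        by (simp only: sq_add_le)
      then show ?thesis using cq[of j x i] cq[of i x j] by (simp add: algebra_simps)
    qed
    then have "Lpow 2 (\<lambda>x. partial j (f i) x - partial i (f j) x) \<le> (LINT x|lborel. 2 * e\<^sup>2 * ((\<phi> i x)\<^sup>2 + (\<phi> j x)\<^sup>2))"
      unfolding Lpow_2 using Lp_diff[OF Cc_1_Lp(2)[OF f, of 2 j i] Cc_1_Lp(2)[OF f, of 2 i j]] i\<phi>
      by (intro integral_mono) (auto simp: Lp_2_iff)
    then show ?thesis using i\<phi> by (simp add: Lpow_2)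
  qed
  have "Lpow 2 (partial j (f i)) \<le> (\<Sum>j\<in>UNIV. Lpow 2 (partial j (f i)))"
    by (rule member_le_sum) auto
  also have "\<dots> \<le> (\<Sum>i\<in>UNIV. \<Sum>j\<in>UNIV. Lpow 2 (partial j (f i)))"
    by (rule member_le_sum[of i UNIV "\<lambda>i. \<Sum>j\<in>UNIV. Lpow 2 (partial j (f i))"]) (auto intro: sum_nonneg)
  also have "\<dots> \<le> (2 * B\<^sup>2 * Lpow 2 w + 6 * e\<^sup>2 * (\<Sum>i\<in>UNIV. Lpow 2 (\<phi> i)))
      + (1 / 2) * (\<Sum>i\<in>UNIV. \<Sum>j\<in>UNIV. 2 * e\<^sup>2 * (Lpow 2 (\<phi> i) + Lpow 2 (\<phi> j)))"
    unfolding gradient_div_curl[OF f] by (intro add_mono div mult_left_mono sum_mono curl) auto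
  also have "\<dots> = 2 * B\<^sup>2 * Lpow 2 w + 12 * e\<^sup>2 * (\<Sum>i\<in>UNIV. Lpow 2 (\<phi> i))"
    by (simp add: sum_3 algebra_simps)
  also have "\<dots> \<le> 2 * B\<^sup>2 * Lpow 2 w + 12 * (B\<^sup>2 * (1 / real (Suc n))) * (\<Sum>i\<in>UNIV. Lpow 2 (\<phi> i))"
    using e by (intro add_left_mono mult_right_mono mult_left_mono sum_nonneg) auto
  finally show ?thesis by (simp add: f_def[abs_def] mult_ac)
qed

text \<open>The integral of the trace of the Hessian at \<delta> = 1, equal to 4 times pi. Dividing
  by it makes \<open>newton_moll\<close> a probability density.\<close>

definition newton_mass :: real where "newton_mass = (LINT x|lborel. 3 * nwt 1 x powr (- 5 / 2))"

definition newton_moll :: "real^3 \<Rightarrow> real" where "newton_moll x = (1 / newton_mass) * (3 * nwt 1 x powr (- 5 / 2))"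

lemma newton_mass_pos: "0 < newton_mass"
proof -
  have i: "integrable lborel (\<lambda>x. 3 * nwt 1 x powr (- 5 / 2))"
    using nwt_powr_integrable[of 1 "5 / 2"] by simp
  \<comment> \<open>On the unit ball \<open>nwt 1\<close> is at most 2, so \<open>c\<close> bounds
    the integrand from below there.\<close>
  define c :: real where "c = 3 * 2 powr (- 5 / 2)"
  have c: "0 < c" by (simp add: c_def)
  have "c * vball = (LINT x|lborel. c * indicator (ball (0::real^3) 1) x)"
  proof -
    have "measure lborel (ball (0::real^3) 1) = vball"
      using emeasure_ball_3[of 1 "0::real^3"] by (intro measure_eq_emeasure_eq_ennreal) auto
    then show ?thesis by simp
  qed
  also have "\<dots> \<le> (LINT x|lborel. 3 * nwt 1 x powr (- 5 / 2))"
  proof (rule integral_mono[OF _ i])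
    show "integrable lborel (\<lambda>x. c * indicator (ball (0::real^3) 1) x)"
      using emeasure_ball_3[of 1 "0::real^3"] by (intro integrable_mult_right integrable_real_indicator) auto
    show "c * indicator (ball (0::real^3) 1) x \<le> 3 * nwt 1 x powr (- 5 / 2)" for x
    proof (cases "x \<in> ball 0 1")
      case True
      then have "norm x < 1" by simp
      then have "(norm x)\<^sup>2 \<le> 1" by (simp add: power_le_one)
      then have "nwt 1 x \<le> 2" by (simp add: nwt_def power2_norm_eq_inner)
      then have "2 powr (- 5 / 2) \<le> nwt 1 x powr (- 5 / 2)"
        using nwt_pos[of 1 x] by (intro powr_mono2') auto
      then show ?thesis using True by (simp add: c_def)
    qed simp
  qed
  finally have "c * vball \<le> newton_mass" by (simp only: newton_mass_def)
  moreover have "0 < vball" by (rule unit_ball_vol_pos) simp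
  ultimately show ?thesis using c mult_pos_pos[of c vball] by linarith
qed

lemma newton_moll: "integrable lborel newton_moll" "\<And>z. 0 \<le> newton_moll z" "(LINT z|lborel. newton_moll z) = 1"
proof -
  have i: "integrable lborel (\<lambda>x. 3 * nwt 1 x powr (- 5 / 2))"
    using nwt_powr_integrable[of 1 "5 / 2"] by simp
  show "integrable lborel newton_moll" unfolding newton_moll_def[abs_def] by (rule integrable_mult_right[OF i])
  show "\<And>z. 0 \<le> newton_moll z" using newton_mass_pos by (simp add: newton_moll_def)
  show "(LINT z|lborel. newton_moll z) = 1"
  proof -
    have "(LINT z|lborel. newton_moll z) = (1 / newton_mass) * newton_mass"
      unfolding newton_moll_def newton_mass_def by (rule integral_mult_right_zero)
    then show ?thesis using newton_mass_pos by simp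
  qed
qed

lemma newton_moll_measurable [measurable]: "newton_moll \<in> borel_measurable borel"
  using borel_measurable_integrable[OF newton_moll(1)] by simp

text \<open>Connects the Newton kernel with mollification: the divergence of the normalised kernel
  is \<open>newton_moll\<close> at scale \<delta>, because \<delta>^2 (\<delta>^2)^(-5/2) =
  \<delta>^(-3).\<close>

lemma newton_moll_scaled:
  assumes d: "0 < \<delta>"
  shows "(1 / \<bar>\<delta>\<bar> ^ 3) * newton_moll (0 + (- 1 / \<delta>) *\<^sub>R w) = (1 / newton_mass) * (\<Sum>i\<in>UNIV. newton_hess \<delta> i i w)"
proof -
  have "nwt \<delta> w = \<delta>\<^sup>2 * nwt 1 ((- 1 / \<delta>) *\<^sub>R w)"
    using d by (simp add: nwt_def field_simps power2_eq_square)
  then have A: "nwt \<delta> w powr (- 5 / 2) = (\<delta>\<^sup>2) powr (- 5 / 2) * nwt 1 ((- 1 / \<delta>) *\<^sub>R w) powr (- 5 / 2)"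
    by (simp only: powr_mult)
  have B: "\<delta>\<^sup>2 * (\<delta>\<^sup>2) powr (- 5 / 2) = 1 / \<bar>\<delta>\<bar> ^ 3"
  proof -
    have "\<delta>\<^sup>2 = \<delta> powr 2" using d by (simp add: powr_numeral)
    then have "\<delta>\<^sup>2 * (\<delta>\<^sup>2) powr (- 5 / 2) = \<delta> powr 2 * (\<delta> powr 2) powr (- 5 / 2)" by simp
    also have "\<dots> = \<delta> powr (2 + 2 * (- 5 / 2))" by (simp only: powr_powr powr_add)
    also have "\<dots> = \<delta> powr (- 3)" by simp
    also have "\<dots> = 1 / \<bar>\<delta>\<bar> ^ 3" using d by (simp add: powr_minus powr_numeral divide_inverse)
    finally show ?thesis .
  qed
  have "3 * \<delta>\<^sup>2 * nwt \<delta> w powr (- 5 / 2) = (\<delta>\<^sup>2 * (\<delta>\<^sup>2) powr (- 5 / 2)) * (3 * nwt 1 ((- 1 / \<delta>) *\<^sub>R w) powr (- 5 / 2))"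
    unfolding A by (simp only: mult_ac)
  then have "3 * \<delta>\<^sup>2 * nwt \<delta> w powr (- 5 / 2) = (1 / \<bar>\<delta>\<bar> ^ 3) * (3 * nwt 1 ((- 1 / \<delta>) *\<^sub>R w) powr (- 5 / 2))"
    by (simp only: B)
  then show ?thesis unfolding newton_hess_trace[OF d] newton_moll_def by (simp add: mult_ac)
qed

section \<open>Powers and difference quotients\<close>

lemma powr_diff_le:
  fixes a b \<theta> :: real
  assumes "0 \<le> a" "0 \<le> b" "1 < \<theta>"
  shows "\<bar>a powr \<theta> - b powr \<theta>\<bar> \<le> \<theta> * \<bar>a - b\<bar> * (a + b) powr (\<theta> - 1)"
proof -
  have *: "\<bar>a powr \<theta> - b powr \<theta>\<bar> \<le> \<theta> * \<bar>a - b\<bar> * (a + b) powr (\<theta> - 1)" if ab: "0 \<le> b" "b < a" for a b :: real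
  proof -
    have "\<exists>z>b. z < a \<and> (\<lambda>x. x powr \<theta>) a - (\<lambda>x. x powr \<theta>) b = (a - b) * (\<theta> * z powr (\<theta> - 1))"
    proof -
      have c: "continuous_on {b..a} (\<lambda>x. x powr \<theta>)"
        using ab assms(3) by (intro continuous_on_powr' continuous_intros) auto
      have "\<exists>z>b. z < a \<and> (\<lambda>x. x powr \<theta>) a - (\<lambda>x. x powr \<theta>) b = (\<lambda>h. h * (\<theta> * z powr (\<theta> - 1))) (a - b)"
      proof (rule mvt[OF ab(2) c])
        fix x assume "b < x" "x < a"
        then have "((\<lambda>x. x powr \<theta>) has_real_derivative \<theta> * x powr (\<theta> - 1)) (at x)"
          using ab by (intro has_real_derivative_powr) auto
        then show "((\<lambda>x. x powr \<theta>) has_derivative (\<lambda>h. h * (\<theta> * x powr (\<theta> - 1)))) (at x)"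
          by (rule has_derivative_eq_rhs[OF has_field_derivative_imp_has_derivative]) (auto simp: mult.commute)
      qed auto
      then show ?thesis by simp
    qed
    then obtain z where z: "b < z" "z < a" "a powr \<theta> - b powr \<theta> = (a - b) * (\<theta> * z powr (\<theta> - 1))" by blast
    have "(a - b) * (\<theta> * z powr (\<theta> - 1)) \<le> (a - b) * (\<theta> * (a + b) powr (\<theta> - 1))"
      using ab z assms(3) by (intro mult_left_mono powr_mono2) auto
    moreover have "0 \<le> (a - b) * (\<theta> * z powr (\<theta> - 1))" using ab z assms(3) by auto
    ultimately show ?thesis using ab z(3) by (simp add: mult_ac)
  qed
  consider "a = b" | "b < a" | "a < b" by linarith
  then show ?thesis
  proof cases
    case 2
    then show ?thesis using *[of b a] assms by simp
  next
    case 3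
    then show ?thesis using *[of a b] assms by (simp add: abs_minus_commute add.commute)
  qed simp
qed

section \<open>Powers in Lebesgue spaces\<close>

lemma Lp_powr:
  assumes "f \<in> Lp s" "\<And>x. 0 \<le> f x" "0 < \<theta>"
  shows "(\<lambda>x. f x powr \<theta>) \<in> Lp (s / \<theta>)" "Lpow (s / \<theta>) (\<lambda>x. f x powr \<theta>) = Lpow s f"
proof -
  note [measurable] = Lp_measurable[OF assms(1)]
  have e: "\<bar>f x powr \<theta>\<bar> powr (s / \<theta>) = \<bar>f x\<bar> powr s" for x
    using assms by (simp add: powr_powr)
  show "Lpow (s / \<theta>) (\<lambda>x. f x powr \<theta>) = Lpow s f" unfolding Lpow_def e ..
  show "(\<lambda>x. f x powr \<theta>) \<in> Lp (s / \<theta>)"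
    by (rule LpI, measurable) (unfold e, rule Lp_integrable[OF assms(1)])
qed

text \<open>By the mean value theorem the difference of powers is at most \<theta> |F - f| (F +
  f)^(\<theta> - 1). Hoelder with exponents s and s / (\<theta> - 1) applies, the second factor
  being bounded along the sequence.\<close>

lemma Lconv_powr:
  assumes L: "Lconv s F f" and F: "\<And>n x. 0 \<le> F n x" and f: "\<And>x. 0 \<le> f x" and s: "0 < s" and \<theta>: "1 < \<theta>"
  shows "Lconv (s / \<theta>) (\<lambda>n x. F n x powr \<theta>) (\<lambda>x. f x powr \<theta>)"
proof -
  note LD = LconvD[OF L]
  note [measurable] = Lp_measurable[OF LD(1)] Lp_measurable[OF LD(2)]
  obtain B where B: "0 \<le> B" "\<And>n. Lpow s (F n) \<le> B" using Lconv_bounded[OF L] s by auto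
  have d: "(\<lambda>x. F n x - f x) \<in> Lp s" for n using LD s by (intro Lp_diff) auto
  have S: "(\<lambda>x. F n x + f x) \<in> Lp s" for n using LD s by (intro Lp_add) auto
  define M where "M = 2 powr s * (B + Lpow s f)"
  have SM: "Lpow s (\<lambda>x. F n x + f x) \<le> M" for n
    unfolding M_def using LD s B by (intro order_trans[OF Lpow_add_le] mult_left_mono add_right_mono) auto
  have S': "(\<lambda>x. (F n x + f x) powr (\<theta> - 1)) \<in> Lp (s / (\<theta> - 1))"
    "Lpow (s / (\<theta> - 1)) (\<lambda>x. (F n x + f x) powr (\<theta> - 1)) \<le> M" for n
    using Lp_powr[OF S[of n], of "\<theta> - 1"] SM[of n] F f \<theta> by (auto simp: add_nonneg_nonneg)
  have ex: "0 < s / (\<theta> - 1)" "0 < s / \<theta>" "1 / s + 1 / (s / (\<theta> - 1)) = 1 / (s / \<theta>)"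
    using s \<theta> by (auto simp: field_simps)
  note H = Holder[OF s ex d S'(1)]
  have le: "Lpow (s / \<theta>) (\<lambda>x. F n x powr \<theta> - f x powr \<theta>)
      \<le> \<theta> powr (s / \<theta>) * (Lpow s (\<lambda>x. F n x - f x) powr (s / \<theta> / s) * M powr (s / \<theta> / (s / (\<theta> - 1))))" for n
  proof -
    have "Lpow (s / \<theta>) (\<lambda>x. F n x powr \<theta> - f x powr \<theta>)
       \<le> Lpow (s / \<theta>) (\<lambda>x. \<theta> * ((F n x - f x) * (F n x + f x) powr (\<theta> - 1)))"
    proof (rule Lpow_mono)
      show "(\<lambda>x. \<theta> * ((F n x - f x) * (F n x + f x) powr (\<theta> - 1))) \<in> Lp (s / \<theta>)" by (rule Lp_cmult[OF H(1)])
      show "\<bar>F n x powr \<theta> - f x powr \<theta>\<bar> \<le> \<bar>\<theta> * ((F n x - f x) * (F n x + f x) powr (\<theta> - 1))\<bar>" for x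
        using powr_diff_le[OF F[of n x] f[of x] \<theta>] \<theta> by (simp add: abs_mult mult.assoc)
    qed (use ex in auto)
    also have "\<dots> = \<theta> powr (s / \<theta>) * Lpow (s / \<theta>) (\<lambda>x. (F n x - f x) * (F n x + f x) powr (\<theta> - 1))"
      using \<theta> by (simp only: Lpow_cmult abs_of_pos)
    also have "\<dots> \<le> \<theta> powr (s / \<theta>) * (Lpow s (\<lambda>x. F n x - f x) powr (s / \<theta> / s) * Lpow (s / (\<theta> - 1)) (\<lambda>x. (F n x + f x) powr (\<theta> - 1)) powr (s / \<theta> / (s / (\<theta> - 1))))"
      by (intro mult_left_mono H(2)) auto
    also have "\<dots> \<le> \<theta> powr (s / \<theta>) * (Lpow s (\<lambda>x. F n x - f x) powr (s / \<theta> / s) * M powr (s / \<theta> / (s / (\<theta> - 1))))"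
      using S'(2)[of n] s \<theta> by (intro mult_left_mono powr_mono2) auto
    finally show ?thesis .
  qed
  have "(\<lambda>n. Lpow s (\<lambda>x. F n x - f x) powr (s / \<theta> / s)) \<longlonglongrightarrow> 0"
  proof -
    have p: "0 < s / \<theta> / s" using s \<theta> by simp
    have "(\<lambda>n. Lpow s (\<lambda>x. F n x - f x) powr (s / \<theta> / s)) \<longlonglongrightarrow> 0 powr (s / \<theta> / s)"
      by (rule tendsto_powr2[OF LD(3) tendsto_const _ p]) simp
    then show ?thesis by simp
  qed
  then have "(\<lambda>n. \<theta> powr (s / \<theta>) * (Lpow s (\<lambda>x. F n x - f x) powr (s / \<theta> / s) * M powr (s / \<theta> / (s / (\<theta> - 1))))) \<longlonglongrightarrow> 0"
    by (intro tendsto_mult_right_zero tendsto_mult_left_zero)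
  then have "(\<lambda>n. Lpow (s / \<theta>) (\<lambda>x. F n x powr \<theta> - f x powr \<theta>)) \<longlonglongrightarrow> 0"
    by (rule tendsto_zero_squeeze[OF Lpow_nonneg le])
  then show ?thesis
    unfolding Lconv_def using Lp_powr(1)[OF LD(1) F] Lp_powr(1)[OF LD(2) f] \<theta> by auto
qed

lemma Lconv_shift:
  assumes "Lconv s F f"
  shows "Lconv s (\<lambda>n x. F n (x + w)) (\<lambda>x. f (x + w))"
proof -
  note L = LconvD[OF assms]
  have [measurable]: "F n \<in> borel_measurable borel" "f \<in> borel_measurable borel" for n
    using L(1,2) by (auto intro: Lp_measurable)
  have "Lpow s (\<lambda>x. F n (x + w) - f (x + w)) = Lpow s (\<lambda>x. F n x - f x)" for n
    by (rule Lpow_translate[of "\<lambda>x. F n x - f x"]) measurable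
  then show ?thesis
    unfolding Lconv_def using L Lp_translate by (simp add: Lp_translate)
qed

lemma Lconv_diff:
  assumes "Lconv s F f" "Lconv s G g" "0 \<le> s"
  shows "Lconv s (\<lambda>n x. F n x - G n x) (\<lambda>x. f x - g x)"
  using Lconv_add[OF assms(1) Lconv_cmult[OF assms(2), of "-1"] assms(3)] by simp

text \<open>Needed for the derivatives of the mollifier, which change sign: |\<kappa>| divided by
  its integral is a kernel of the usual kind, and the result is dominated by a multiple of its
  action on |g|.\<close>

lemma moll_signed_Lp:
  fixes \<kappa> g :: "'a::euclidean_space \<Rightarrow> real"
  assumes \<kappa>: "integrable lborel \<kappa>" and g: "g \<in> Lp s" and s: "1 \<le> s"
  shows "moll \<kappa> t g \<in> Lp s"
proof -
  note [measurable] = borel_measurable_integrable[OF \<kappa>] Lp_measurable[OF g]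
  define m where "m = (LINT z|lborel. \<bar>\<kappa> z\<bar>)"
  have ik: "integrable lborel (\<lambda>z. \<bar>\<kappa> z\<bar>)" using \<kappa> by simp
  show ?thesis
  proof (cases "m = 0")
    case True
    then have "AE z in lborel. \<bar>\<kappa> z\<bar> = 0"
      using integral_nonneg_eq_0_iff_AE[OF ik] unfolding m_def by simp
    then have "moll \<kappa> t g x = (LINT z::'a|lborel. 0)" for x
      unfolding moll_def by (intro integral_cong_AE) (auto elim!: eventually_mono)
    then have "moll \<kappa> t g = (\<lambda>x. 0)" by auto
    then show ?thesis by simp
  next
    case False
    then have m: "0 < m" unfolding m_def by (simp add: less_le)
    define \<eta> where "\<eta> z = \<bar>\<kappa> z\<bar> / m" for z
    have \<eta>: "integrable lborel \<eta>" "\<And>z. 0 \<le> \<eta> z" "(LINT z|lborel. \<eta> z) = 1"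
      unfolding \<eta>_def[abs_def] using ik m by (auto simp: m_def[symmetric])
    have M: "(\<lambda>x. m * moll \<eta> t (\<lambda>x. \<bar>g x\<bar>) x) \<in> Lp s"
      by (rule Lp_cmult[OF moll_Lp_bound(1)[OF \<eta> Lp_abs[OF g] s]])
    have le: "\<bar>moll \<kappa> t g x\<bar> \<le> \<bar>m * moll \<eta> t (\<lambda>x. \<bar>g x\<bar>) x\<bar>" for x
    proof (cases "integrable lborel (\<lambda>z. \<kappa> z * g (x + t *\<^sub>R z))")
      case True
      have "\<bar>moll \<kappa> t g x\<bar> \<le> (LINT z|lborel. \<bar>\<kappa> z * g (x + t *\<^sub>R z)\<bar>)"
        unfolding moll_def by (rule integral_abs_bound)
      also have "\<dots> = (LINT z|lborel. m * (\<eta> z * \<bar>g (x + t *\<^sub>R z)\<bar>))"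
        using m by (intro Bochner_Integration.integral_cong refl) (simp add: \<eta>_def abs_mult)
      also have "\<dots> = m * moll \<eta> t (\<lambda>x. \<bar>g x\<bar>) x" unfolding moll_def by (rule integral_mult_right_zero)
      finally show ?thesis by (rule order_trans[OF _ abs_ge_self])
    next
      case False
      then show ?thesis by (simp add: moll_def not_integrable_integral_eq)
    qed
    show ?thesis
      by (rule Lp_mono[OF _ M le]) (use s in auto)
  qed
qed

text \<open>Fubini, so that the kernel variable is integrated last. Limits can then be taken at
  fixed \<open>z\<close>, and only moments of the kernel remain.\<close>

lemma moll_swap:
  fixes \<kappa> a b :: "'a::euclidean_space \<Rightarrow> real"
  assumes \<kappa>: "integrable lborel \<kappa>" and p: "0 < p" "0 < p'" "1 / p + 1 / p' = 1" and a: "a \<in> Lp p" and b: "b \<in> Lp p'"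
  shows "(LINT x|lborel. a x * moll \<kappa> t b x) = (LINT z|lborel. \<kappa> z * (LINT x|lborel. a x * b (x + t *\<^sub>R z)))"
    and "integrable lborel (\<lambda>z. \<kappa> z * (LINT x|lborel. a x * b (x + t *\<^sub>R z)))"
proof -
  note [measurable] = borel_measurable_integrable[OF \<kappa>] Lp_measurable[OF a] Lp_measurable[OF b]
  define C where "C = Lpow p a powr (1 / p) * Lpow p' b powr (1 / p')"
  have bt: "(\<lambda>x. b (x + w)) \<in> Lp p'" for w by (rule Lp_translate[OF b])
  have i: "integrable lborel (\<lambda>x. a x * b (x + w))" for w
    by (rule Holder_1(1)[OF p a bt])
  have le: "(LINT x|lborel. \<bar>a x * b (x + w)\<bar>) \<le> C" for w
    using Holder_1(2)[OF p a bt[of w]] by (simp add: C_def Lpow_translate)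
  have [measurable]: "(\<lambda>(z, x). \<kappa> z * (a x * b (x + t *\<^sub>R z))) \<in> borel_measurable (lborel \<Otimes>\<^sub>M lborel)"
    by measurable
  have I: "integrable (lborel \<Otimes>\<^sub>M lborel) (\<lambda>(z, x). \<kappa> z * (a x * b (x + t *\<^sub>R z)))"
  proof (rule lborel_pair.Fubini_integrable)
    show "AE z in lborel. integrable lborel (\<lambda>x. case (z, x) of (z, x) \<Rightarrow> \<kappa> z * (a x * b (x + t *\<^sub>R z)))"
      using i by auto
    have m: "(\<lambda>z. LINT x|lborel. norm (case (z, x) of (z, x) \<Rightarrow> \<kappa> z * (a x * b (x + t *\<^sub>R z)))) \<in> borel_measurable lborel"
      by (rule lborel.borel_measurable_lebesgue_integral) measurable
    show "integrable lborel (\<lambda>z. LINT x|lborel. norm (case (z, x) of (z, x) \<Rightarrow> \<kappa> z * (a x * b (x + t *\<^sub>R z))))"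
    proof (rule Bochner_Integration.integrable_bound[OF integrable_mult_left[OF integrable_abs[OF \<kappa>], of C] m], rule AE_I2)
      fix z
      have "norm (LINT x|lborel. norm (case (z, x) of (z, x) \<Rightarrow> \<kappa> z * (a x * b (x + t *\<^sub>R z))))
          \<le> (LINT x|lborel. norm (case (z, x) of (z, x) \<Rightarrow> \<kappa> z * (a x * b (x + t *\<^sub>R z))))"
        by (rule order_trans[OF integral_norm_bound]) simp
      also have "\<dots> = \<bar>\<kappa> z\<bar> * (LINT x|lborel. \<bar>a x * b (x + t *\<^sub>R z)\<bar>)"
        by (simp add: abs_mult)
      also have "\<dots> \<le> \<bar>\<kappa> z\<bar> * C" by (intro mult_left_mono le) auto
      finally show "norm (LINT x|lborel. norm (case (z, x) of (z, x) \<Rightarrow> \<kappa> z * (a x * b (x + t *\<^sub>R z)))) \<le> norm (\<bar>\<kappa> z\<bar> * C)"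
        by (rule order_trans) simp
    qed
  qed measurable
  have "(LINT x|lborel. a x * moll \<kappa> t b x) = (LINT x|lborel. (LINT z|lborel. \<kappa> z * (a x * b (x + t *\<^sub>R z))))"
  proof (intro Bochner_Integration.integral_cong refl)
    fix x
    have "a x * moll \<kappa> t b x = (LINT z|lborel. a x * (\<kappa> z * b (x + t *\<^sub>R z)))"
      unfolding moll_def by (rule integral_mult_right_zero[symmetric])
    then show "a x * moll \<kappa> t b x = (LINT z|lborel. \<kappa> z * (a x * b (x + t *\<^sub>R z)))"
      by (simp add: mult.left_commute)
  qed
  also have "\<dots> = (LINT z|lborel. (LINT x|lborel. \<kappa> z * (a x * b (x + t *\<^sub>R z))))"
    by (rule lborel_pair.Fubini_integral[OF I])
  also have "\<dots> = (LINT z|lborel. \<kappa> z * (LINT x|lborel. a x * b (x + t *\<^sub>R z)))" by simp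
  finally show "(LINT x|lborel. a x * moll \<kappa> t b x) = (LINT z|lborel. \<kappa> z * (LINT x|lborel. a x * b (x + t *\<^sub>R z)))" .
  show "integrable lborel (\<lambda>z. \<kappa> z * (LINT x|lborel. a x * b (x + t *\<^sub>R z)))"
    using lborel_pair.integrable_fst[OF I] by simp
qed

text \<open>The increment is the integral of the derivative along the segment; Cauchy--Schwarz on
  the unit interval and Tonelli give the estimate. The factor 3 comes from squaring a sum over three
  coordinates.\<close>

lemma Cc_1_diff_Lpow:
  fixes v :: "real^3 \<Rightarrow> real"
  assumes v: "v \<in> Cc 1"
  shows "Lpow 2 (\<lambda>x. v (x + w) - v x) \<le> 3 * (norm w)\<^sup>2 * (\<Sum>j\<in>UNIV. Lpow 2 (partial j v))"
proof -
  note [measurable] = Cc_1_measurable[OF v]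
  have pm: "(\<lambda>p. partial j v (fst p + snd p *\<^sub>R w)) \<in> borel_measurable (lborel \<Otimes>\<^sub>M lborel)" for j by measurable
  have p2: "(\<integral>\<^sup>+x. ennreal ((partial j v x)\<^sup>2) \<partial>lborel) = ennreal (Lpow 2 (partial j v))" for j
    using Cc_1_Lp(2)[OF v, of 2 j] unfolding Lpow_2 Lp_2_iff by (intro nn_integral_eq_integral) auto
  define c where "c = 3 * (norm w)\<^sup>2"
  have c0: "0 \<le> c" by (simp add: c_def)
  have le: "ennreal ((v (x + w) - v x)\<^sup>2) \<le> (\<integral>\<^sup>+t. indicator {0..1} t * (\<Sum>j\<in>UNIV. ennreal (c * (partial j v (x + t *\<^sub>R w))\<^sup>2)) \<partial>lborel)" for x
  proof -
    define d where "d t = (\<Sum>j\<in>UNIV. w $ j * partial j v (x + t *\<^sub>R w))" for t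
    have dm[measurable]: "d \<in> borel_measurable borel" unfolding d_def[abs_def] by measurable
    have D: "((\<lambda>t. v (x + t *\<^sub>R w)) has_real_derivative d t) (at t)" for t
      unfolding d_def by (rule Cc_1_line_DERIV[OF Cc_1D(1)[OF v]])
    have c: "continuous_on {0..1} d"
      unfolding d_def by (intro continuous_intros continuous_on_compose2[OF Cc_1D(3)[OF v]]) auto
    have "has_bochner_integral lborel (\<lambda>t. indicator {0..1} t *\<^sub>R d t) (v (x + 1 *\<^sub>R w) - v (x + 0 *\<^sub>R w))"
      by (rule has_bochner_integral_FTC_Icc[OF _ _ c])
         (use D in \<open>auto simp: has_real_derivative_iff_has_vector_derivative[symmetric] intro: has_field_derivative_at_within\<close>)
    then have i: "integrable lborel (\<lambda>t. indicator {0..1} t *\<^sub>R d t)"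
      and e: "(LINT t|lborel. indicator {0..1} t *\<^sub>R d t) = v (x + w) - v x"
      by (auto simp: has_bochner_integral_iff)
    have "ennreal \<bar>v (x + w) - v x\<bar> \<le> (\<integral>\<^sup>+t. ennreal (norm (indicator {0..1} t *\<^sub>R d t)) \<partial>lborel)"
      using integral_norm_bound_ennreal[OF i] unfolding e by simp
    then have "(ennreal \<bar>v (x + w) - v x\<bar>)\<^sup>2 \<le> (\<integral>\<^sup>+t. ennreal (norm (indicator {0..1} t *\<^sub>R d t)) \<partial>lborel)\<^sup>2"
      by (intro power_mono) auto
    also have "\<dots> \<le> (\<integral>\<^sup>+t. indicator {0..1} t * ennreal ((d t)\<^sup>2) \<partial>lborel) * (\<integral>\<^sup>+t. indicator {0..1::real} t \<partial>lborel)"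
      by (rule Cauchy_Schwarz_esqrt) (auto simp: indicator_def ennreal_power)
    also have "\<dots> = (\<integral>\<^sup>+t. indicator {0..1} t * ennreal ((d t)\<^sup>2) \<partial>lborel)"
      by simp
    also have "\<dots> \<le> (\<integral>\<^sup>+t. indicator {0..1} t * (\<Sum>j\<in>UNIV. ennreal (c * (partial j v (x + t *\<^sub>R w))\<^sup>2)) \<partial>lborel)"
    proof (intro nn_integral_mono mult_left_mono)
      fix t
      have wj: "(w $ j)\<^sup>2 \<le> (norm w)\<^sup>2" for j
        using component_le_norm_cart[of w j] by (simp add: abs_le_square_iff[symmetric])
      have "(d t)\<^sup>2 \<le> 3 * (\<Sum>j\<in>UNIV. (w $ j * partial j v (x + t *\<^sub>R w))\<^sup>2)"
        unfolding d_def sum_3 by (rule sq_sum3_le)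
      also have "\<dots> \<le> 3 * (\<Sum>j\<in>UNIV. (norm w)\<^sup>2 * (partial j v (x + t *\<^sub>R w))\<^sup>2)"
        unfolding power_mult_distrib by (intro mult_left_mono sum_mono mult_right_mono wj) auto
      also have "\<dots> = (\<Sum>j\<in>UNIV. c * (partial j v (x + t *\<^sub>R w))\<^sup>2)"
        by (simp add: c_def sum_distrib_left mult.assoc)
      finally have "ennreal ((d t)\<^sup>2) \<le> ennreal (\<Sum>j\<in>UNIV. c * (partial j v (x + t *\<^sub>R w))\<^sup>2)" by (rule ennreal_leI)
      also have "\<dots> = (\<Sum>j\<in>UNIV. ennreal (c * (partial j v (x + t *\<^sub>R w))\<^sup>2))"
        using c0 by (intro sum_ennreal[symmetric]) auto
      finally show "ennreal ((d t)\<^sup>2) \<le> (\<Sum>j\<in>UNIV. ennreal (c * (partial j v (x + t *\<^sub>R w))\<^sup>2))" .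
    qed simp
    finally show ?thesis by (simp add: ennreal_power)
  qed
  have i2: "(\<lambda>x. v (x + w) - v x) \<in> Lp 2"
    by (intro Lp_diff Lp_translate Cc_1_Lp(1)[OF v]) auto
  have "ennreal (Lpow 2 (\<lambda>x. v (x + w) - v x)) = (\<integral>\<^sup>+x. ennreal ((v (x + w) - v x)\<^sup>2) \<partial>lborel)"
    using i2 unfolding Lpow_2 Lp_2_iff by (intro nn_integral_eq_integral[symmetric]) auto
  also have "\<dots> \<le> (\<integral>\<^sup>+x. \<integral>\<^sup>+t. indicator {0..1} t * (\<Sum>j\<in>UNIV. ennreal (c * (partial j v (x + t *\<^sub>R w))\<^sup>2)) \<partial>lborel \<partial>lborel)"
    by (intro nn_integral_mono le)
  also have "\<dots> = (\<integral>\<^sup>+t. \<integral>\<^sup>+x. indicator {0..1} t * (\<Sum>j\<in>UNIV. ennreal (c * (partial j v (x + t *\<^sub>R w))\<^sup>2)) \<partial>lborel \<partial>lborel)"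
    by (rule lborel_pair.Fubini') measurable
  also have "\<dots> = (\<integral>\<^sup>+t. indicator {0..1::real} t * ennreal (c * (\<Sum>j\<in>UNIV. Lpow 2 (partial j v))) \<partial>lborel)"
  proof (rule nn_integral_cong)
    fix t :: real
    have "(\<integral>\<^sup>+x. indicator {0..1} t * (\<Sum>j\<in>UNIV. ennreal (c * (partial j v (x + t *\<^sub>R w))\<^sup>2)) \<partial>lborel)
       = indicator {0..1} t * (\<Sum>j\<in>UNIV. \<integral>\<^sup>+x. ennreal (c * (partial j v (x + t *\<^sub>R w))\<^sup>2) \<partial>lborel)"
      by (subst nn_integral_cmult, measurable) (subst nn_integral_sum, auto)
    also have "\<dots> = indicator {0..1} t * (\<Sum>j\<in>UNIV. ennreal (c * Lpow 2 (partial j v)))"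
    proof (intro arg_cong2[where f = times] sum.cong refl)
      fix j :: 3
      have "(\<integral>\<^sup>+x. ennreal (c * (partial j v (x + t *\<^sub>R w))\<^sup>2) \<partial>lborel) = (\<integral>\<^sup>+x. ennreal (c * (partial j v x)\<^sup>2) \<partial>lborel)"
        by (rule lborel_nn_integral_translate[of "\<lambda>x. ennreal (c * (partial j v x)\<^sup>2)"]) measurable
      also have "\<dots> = (\<integral>\<^sup>+x. ennreal c * ennreal ((partial j v x)\<^sup>2) \<partial>lborel)"
        using c0 by (simp add: ennreal_mult)
      also have "\<dots> = ennreal c * ennreal (Lpow 2 (partial j v))"
        by (subst nn_integral_cmult) (auto simp: p2)
      finally show "(\<integral>\<^sup>+x. ennreal (c * (partial j v (x + t *\<^sub>R w))\<^sup>2) \<partial>lborel) = ennreal (c * Lpow 2 (partial j v))"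
        using c0 by (simp add: ennreal_mult)
    qed
    also have "(\<Sum>j\<in>UNIV. ennreal (c * Lpow 2 (partial j v))) = ennreal (c * (\<Sum>j\<in>UNIV. Lpow 2 (partial j v)))"
      using c0 by (subst sum_ennreal) (auto simp: sum_distrib_left)
    finally show "(\<integral>\<^sup>+x. indicator {0..1} t * (\<Sum>j\<in>UNIV. ennreal (c * (partial j v (x + t *\<^sub>R w))\<^sup>2)) \<partial>lborel)
       = indicator {0..1} t * ennreal (c * (\<Sum>j\<in>UNIV. Lpow 2 (partial j v)))" .
  qed
  also have "\<dots> = ennreal (c * (\<Sum>j\<in>UNIV. Lpow 2 (partial j v)))"
    by (subst nn_integral_multc) auto
  finally show ?thesis using c0 by (simp add: ennreal_le_iff sum_nonneg c_def)
qed

lemma Lpow_2_tendsto: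
  assumes "Lconv 2 F f"
  shows "(\<lambda>n. Lpow 2 (F n)) \<longlonglongrightarrow> Lpow 2 f"
  using Lconv_integral_mult[OF assms assms] unfolding Lpow_2 power2_eq_square by simp

text \<open>The function lies in L6 while its increments lie in L2. The increments converge almost
  everywhere along a subsequence and Fatou's lemma applies to a tail, on which one bound
  \<open>L + e\<close> holds for all members.\<close>

lemma weak_diff_Lpow:
  fixes v :: "real^3 \<Rightarrow> real"
  assumes \<phi>: "\<And>n. \<phi> n \<in> Cc 1" and v: "Lconv 6 \<phi> v" and V: "\<And>j. Lconv 2 (\<lambda>n. partial j (\<phi> n)) (V j)"
  shows "(\<lambda>x. v (x + w) - v x) \<in> Lp 2"
    "Lpow 2 (\<lambda>x. v (x + w) - v x) \<le> 3 * (norm w)\<^sup>2 * (\<Sum>j\<in>UNIV. Lpow 2 (V j))"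
proof -
  note [measurable] = Lp_measurable[OF LconvD(2)[OF v]]
  have "Lconv 6 (\<lambda>n x. \<phi> n (x + w) - \<phi> n x) (\<lambda>x. v (x + w) - v x)"
    by (intro Lconv_diff Lconv_shift v) simp
  then obtain r where r: "strict_mono r" "AE x in lborel. (\<lambda>n. \<phi> (r n) (x + w) - \<phi> (r n) x) \<longlonglongrightarrow> v (x + w) - v x"
    by (rule Lconv_AE_subseq) auto
  define L where "L = 3 * (norm w)\<^sup>2 * (\<Sum>j\<in>UNIV. Lpow 2 (V j))"
  have lim: "(\<lambda>n. 3 * (norm w)\<^sup>2 * (\<Sum>j\<in>UNIV. Lpow 2 (partial j (\<phi> n)))) \<longlonglongrightarrow> L"
    unfolding L_def by (intro tendsto_intros Lpow_2_tendsto V)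
  have F: "(\<lambda>x. v (x + w) - v x) \<in> Lp 2 \<and> Lpow 2 (\<lambda>x. v (x + w) - v x) \<le> L + e" if e: "0 < e" for e
  proof -
    obtain N where N: "\<And>n. n \<ge> N \<Longrightarrow> 3 * (norm w)\<^sup>2 * (\<Sum>j\<in>UNIV. Lpow 2 (partial j (\<phi> n))) < L + e"
      using order_tendstoD(2)[OF lim, of "L + e"] e unfolding eventually_sequentially by auto
    have rN: "r (n + N) \<ge> N" for n using seq_suble[OF r(1), of "n + N"] by simp
    have 1: "(\<lambda>x. \<phi> (r (n + N)) (x + w) - \<phi> (r (n + N)) x) \<in> Lp 2" for n
      by (intro Lp_diff Lp_translate Cc_1_Lp(1)[OF \<phi>]) auto
    have 2: "Lpow 2 (\<lambda>x. \<phi> (r (n + N)) (x + w) - \<phi> (r (n + N)) x) \<le> L + e" for n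
      using Cc_1_diff_Lpow[OF \<phi>, of "r (n + N)" w] N[OF rN, of n] by linarith
    have 3: "AE x in lborel. (\<lambda>n. \<phi> (r (n + N)) (x + w) - \<phi> (r (n + N)) x) \<longlonglongrightarrow> v (x + w) - v x"
      using r(2) by eventually_elim (rule LIMSEQ_ignore_initial_segment)
    show ?thesis using Lpow_Fatou[OF 1 2 _ 3] by auto
  qed
  show "(\<lambda>x. v (x + w) - v x) \<in> Lp 2" using F[of 1] by simp
  show "Lpow 2 (\<lambda>x. v (x + w) - v x) \<le> 3 * (norm w)\<^sup>2 * (\<Sum>j\<in>UNIV. Lpow 2 (V j))"
    using F field_le_epsilon unfolding L_def by blast
qed

text \<open>For a C1 function \<open>\<phi> m\<close> the quotient converges classically, and by
  \<open>weak_diff_Lpow\<close> the quotient of the remainder v - \<phi> m is small uniformly in the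
  step, because the gradient of the remainder is small.\<close>

lemma weak_diffquot_Lconv:
  fixes v :: "real^3 \<Rightarrow> real"
  assumes \<phi>: "\<And>n. \<phi> n \<in> Cc 1" and v: "Lconv 6 \<phi> v" and V: "\<And>j. Lconv 2 (\<lambda>n. partial j (\<phi> n)) (V j)"
    and t: "t \<longlonglongrightarrow> 0" "\<And>n. t n \<noteq> 0"
  shows "Lconv 2 (\<lambda>n x. (v (x + t n *\<^sub>R w) - v x) / t n) (\<lambda>x. \<Sum>j\<in>UNIV. w $ j * V j x)"
proof -
  have VL: "V j \<in> Lp 2" for j using LconvD(2)[OF V] .
  have Q: "(\<lambda>x. (v (x + t n *\<^sub>R w) - v x) / t n) \<in> Lp 2" for n
    using Lp_cmult[OF weak_diff_Lpow(1)[OF \<phi> v V, of "t n *\<^sub>R w"], of "1 / t n"] by simp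
  have S: "(\<lambda>x. \<Sum>j\<in>UNIV. w $ j * V j x) \<in> Lp 2" by (intro Lp_sum Lp_cmult VL) simp
  define c where "c = 3 * (norm w)\<^sup>2"
  have c0: "0 \<le> c" by (simp add: c_def)
  have wlim: "Lconv 2 (\<lambda>m x. \<Sum>j\<in>UNIV. w $ j * partial j (\<phi> m) x) (\<lambda>x. \<Sum>j\<in>UNIV. w $ j * V j x)"
    by (intro Lconv_sum Lconv_cmult V) simp
  have dlim: "(\<lambda>m. c * (\<Sum>j\<in>UNIV. Lpow 2 (\<lambda>x. partial j (\<phi> m) x - V j x))) \<longlonglongrightarrow> c * (\<Sum>j\<in>(UNIV::3 set). 0)"
    by (intro tendsto_intros LconvD(3)[OF V])
  have "(\<lambda>n. Lpow 2 (\<lambda>x. (v (x + t n *\<^sub>R w) - v x) / t n - (\<Sum>j\<in>UNIV. w $ j * V j x))) \<longlonglongrightarrow> 0"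
  proof (rule LIMSEQ_I)
    fix e :: real assume e: "0 < e"
    \<comment> \<open>The estimates below add up to 4 (d + 4 (d + d)) = 36 d.\<close>
    define d where "d = e / 100"
    have d: "0 < d" using e by (simp add: d_def)
    have "\<forall>\<^sub>F m in sequentially. c * (\<Sum>j\<in>UNIV. Lpow 2 (\<lambda>x. partial j (\<phi> m) x - V j x)) < d"
      using order_tendstoD(2)[OF dlim, of d] d by simp
    moreover have "\<forall>\<^sub>F m in sequentially. Lpow 2 (\<lambda>x. (\<Sum>j\<in>UNIV. w $ j * partial j (\<phi> m) x) - (\<Sum>j\<in>UNIV. w $ j * V j x)) < d"
      using order_tendstoD(2)[OF LconvD(3)[OF wlim] d] .
    ultimately have "\<forall>\<^sub>F m in sequentially. c * (\<Sum>j\<in>UNIV. Lpow 2 (\<lambda>x. partial j (\<phi> m) x - V j x)) < d \<and>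
        Lpow 2 (\<lambda>x. (\<Sum>j\<in>UNIV. w $ j * partial j (\<phi> m) x) - (\<Sum>j\<in>UNIV. w $ j * V j x)) < d"
      by (rule eventually_conj)
    then obtain m where m1: "c * (\<Sum>j\<in>UNIV. Lpow 2 (\<lambda>x. partial j (\<phi> m) x - V j x)) < d"
      and m2: "Lpow 2 (\<lambda>x. (\<Sum>j\<in>UNIV. w $ j * partial j (\<phi> m) x) - (\<Sum>j\<in>UNIV. w $ j * V j x)) < d"
      using eventually_happens'[OF sequentially_bot] by blast
    note Dm = diffquot_Lconv[OF \<phi>[of m] t, of 2 w]
    obtain N where N: "\<And>n. n \<ge> N \<Longrightarrow> Lpow 2 (\<lambda>x. (\<phi> m (x + t n *\<^sub>R w) - \<phi> m x) / t n - (\<Sum>j\<in>UNIV. w $ j * partial j (\<phi> m) x)) < d"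
      using order_tendstoD(2)[OF LconvD(3)[OF Dm] d] unfolding eventually_sequentially by auto
    define r where "r x = v x - \<phi> m x" for x
    have r1: "(\<lambda>x. \<phi> n x - \<phi> m x) \<in> Cc 1" for n by (rule Cc_1_diff(1)[OF \<phi> \<phi>])
    have r2: "Lconv 6 (\<lambda>n x. \<phi> n x - \<phi> m x) r"
      unfolding r_def[abs_def] by (intro Lconv_diff v Lconv_const Cc_1_Lp(1)[OF \<phi>]) auto
    have r3: "Lconv 2 (\<lambda>n. partial j (\<lambda>x. \<phi> n x - \<phi> m x)) (\<lambda>x. V j x - partial j (\<phi> m) x)" for j
    proof -
      have "partial j (\<lambda>x. \<phi> n x - \<phi> m x) = (\<lambda>x. partial j (\<phi> n) x - partial j (\<phi> m) x)" for n
        by (rule ext) (rule Cc_1_diff(2)[OF \<phi> \<phi>])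
      then show ?thesis
        by (simp only:) (intro Lconv_diff V Lconv_const Cc_1_Lp(2)[OF \<phi>]; simp)
    qed
    show "\<exists>no. \<forall>n\<ge>no. norm (Lpow 2 (\<lambda>x. (v (x + t n *\<^sub>R w) - v x) / t n - (\<Sum>j\<in>UNIV. w $ j * V j x)) - 0) < e"
    proof (intro exI allI impI)
      fix n assume n: "N \<le> n"
      let ?A = "\<lambda>x. (r (x + t n *\<^sub>R w) - r x) / t n"
      let ?B = "\<lambda>x. (\<phi> m (x + t n *\<^sub>R w) - \<phi> m x) / t n - (\<Sum>j\<in>UNIV. w $ j * partial j (\<phi> m) x)"
      let ?C = "\<lambda>x. (\<Sum>j\<in>UNIV. w $ j * partial j (\<phi> m) x) - (\<Sum>j\<in>UNIV. w $ j * V j x)"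
      have A: "?A \<in> Lp 2" "Lpow 2 ?A < d"
      proof -
        note R = weak_diff_Lpow[OF r1 r2 r3, of "t n *\<^sub>R w"]
        show "?A \<in> Lp 2" using Lp_cmult[OF R(1), of "1 / t n"] by simp
        have "Lpow 2 ?A = \<bar>1 / t n\<bar> powr 2 * Lpow 2 (\<lambda>x. r (x + t n *\<^sub>R w) - r x)"
          using Lpow_cmult[of 2 "1 / t n" "\<lambda>x. r (x + t n *\<^sub>R w) - r x"] by simp
        also have "\<dots> \<le> \<bar>1 / t n\<bar> powr 2 * (3 * (norm (t n *\<^sub>R w))\<^sup>2 * (\<Sum>j\<in>UNIV. Lpow 2 (\<lambda>x. V j x - partial j (\<phi> m) x)))"
          by (intro mult_left_mono R(2)) auto
        also have "\<dots> = c * (\<Sum>j\<in>UNIV. Lpow 2 (\<lambda>x. partial j (\<phi> m) x - V j x))"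
          using t(2)[of n] Lpow_minus_commute[of 2 "V _" "partial _ (\<phi> m)"]
          by (simp add: c_def power_mult_distrib powr_numeral power_divide)
        finally show "Lpow 2 ?A < d" using m1 by linarith
      qed
      have B: "?B \<in> Lp 2" "Lpow 2 ?B < d" using LconvD(1,2)[OF Dm] N[OF n] by (auto intro: Lp_diff)
      have C: "?C \<in> Lp 2" "Lpow 2 ?C < d" using LconvD(1,2)[OF wlim] m2 by (auto intro: Lp_diff)
      have eq: "(v (x + t n *\<^sub>R w) - v x) / t n - (\<Sum>j\<in>UNIV. w $ j * V j x) = ?A x + (?B x + ?C x)" for x
        using t(2)[of n] by (simp add: r_def field_simps)
      have "Lpow 2 (\<lambda>x. ?A x + (?B x + ?C x)) \<le> 2 powr 2 * (Lpow 2 ?A + Lpow 2 (\<lambda>x. ?B x + ?C x))"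
        using A B C by (intro Lpow_add_le Lp_add) auto
      also have "\<dots> \<le> 2 powr 2 * (Lpow 2 ?A + 2 powr 2 * (Lpow 2 ?B + Lpow 2 ?C))"
        using B C by (intro mult_left_mono add_left_mono Lpow_add_le) auto
      also have "\<dots> \<le> 2 powr 2 * (d + 2 powr 2 * (d + d))"
        using A B C by (intro mult_left_mono add_mono) auto
      also have "\<dots> < e" using e by (simp add: d_def)
      finally show "norm (Lpow 2 (\<lambda>x. (v (x + t n *\<^sub>R w) - v x) / t n - (\<Sum>j\<in>UNIV. w $ j * V j x)) - 0) < e"
        unfolding eq by simp
    qed
  qed
  then show ?thesis unfolding Lconv_def using Q S by blast
qed

section \<open>Derivatives of mollified functions and of powers\<close>

lemma C_diff_1_iff: "C_diff 1 f \<longleftrightarrow> (\<forall>x. f differentiable (at x)) \<and> (\<forall>i. continuous_on UNIV (partial i f))"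
  unfolding One_nat_def C_diff.simps ..

lemma C_diff_1I:
  fixes f :: "real^3 \<Rightarrow> real"
  assumes "\<And>x. (f has_derivative (\<lambda>h. \<Sum>j\<in>UNIV. h $ j * g j x)) (at x)" "\<And>j. continuous_on UNIV (g j)"
  shows "C_diff 1 f" "partial j f = g j"
proof -
  show p: "partial j f = g j" for j by (rule ext) (rule has_derivative_imp_partial[OF assms(1)])
  show "C_diff 1 f" unfolding C_diff_1_iff p using assms by (auto simp: differentiable_def)
qed

lemma Lp_locally_integrable:
  fixes f :: "'a::euclidean_space \<Rightarrow> real"
  assumes f: "f \<in> Lp s" and s: "1 \<le> s"
  shows "integrable lborel (\<lambda>y. indicator (cball 0 R) y * f y)"
proof (rule Bochner_Integration.integrable_bound)
  have "integrable lborel (\<lambda>y::'a. indicator (cball 0 R) y :: real)"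
    by (rule integrable_real_indicator) (use emeasure_bounded_finite[OF bounded_cball, of 0 R] in \<open>auto simp: less_top\<close>)
  then show "integrable lborel (\<lambda>y. indicator (cball 0 R) y + \<bar>f y\<bar> powr s)"
    using Lp_integrable[OF f] by (rule Bochner_Integration.integrable_add)
  show "AE y in lborel. norm (indicator (cball 0 R) y * f y) \<le> norm (indicator (cball 0 R) y + \<bar>f y\<bar> powr s)"
  proof (rule AE_I2)
    fix y
    have "\<bar>f y\<bar> \<le> 1 + \<bar>f y\<bar> powr s"
    proof (cases "\<bar>f y\<bar> \<le> 1")
      case False
      then have "\<bar>f y\<bar> powr 1 \<le> \<bar>f y\<bar> powr s" using s by (intro powr_mono) auto
      then show ?thesis using False by simp
    qed (simp add: add_increasing2)
    then show "norm (indicator (cball 0 R) y * f y) \<le> norm (indicator (cball 0 R) y + \<bar>f y\<bar> powr s)"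
      by (auto simp: indicator_def)
  qed
  show "(\<lambda>y. indicator (cball 0 R) y * f y) \<in> borel_measurable lborel"
    using Lp_measurable[OF f] by (intro borel_measurable_times borel_measurable_indicator) auto
qed

text \<open>The derivative falls on the scaled and reflected kernel; its argument contributes the
  factor - 1 / t.\<close>

lemma moll_std_partial:
  fixes f :: "real^3 \<Rightarrow> real"
  assumes f: "f \<in> Lp s" and s: "1 \<le> s" and t: "t \<noteq> 0"
  shows "C_diff 1 (moll std_moll t f)" "partial i (moll std_moll t f) x = - (1 / t) * moll (partial i std_moll) t f x"
proof -
  note fm = Lp_measurable[OF f]
  note k1 = moll_kernel_Cc_infinity[OF t]
  have dom: "conv_dom (moll_kernel t) f" "conv_dom (partial j (moll_kernel t)) f" for j
    using Lp_locally_integrable[OF f s] Cc_infinityD[OF k1] Cc_infinityD[OF Cc_infinity_partial[OF k1]]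
    by (auto intro!: conv_dom_compact_support C_diff_continuous[of 1])
  note P = conv_partial[OF Cc_infinityD(1)[OF k1] fm dom]
  note ms = moll_std_eq_conv[OF fm t]
  show "C_diff 1 (moll std_moll t f)" unfolding ms by (rule P(2))
  have z: "partial i std_moll \<in> borel_measurable borel" by (rule Cc_1_measurable(2)[OF std_moll_Cc_1])
  have t': "- 1 / t \<noteq> 0" using t by simp
  have pk: "partial i (moll_kernel t) w = - (1 / t) * ((1 / \<bar>t\<bar> ^ 3) * partial i std_moll (0 + (- 1 / t) *\<^sub>R w))" for w
  proof -
    have "partial i (moll_kernel t) w = (1 / \<bar>t\<bar> ^ 3) * partial i (\<lambda>w. std_moll (0 + (- 1 / t) *\<^sub>R w)) w"
      unfolding moll_kernel_def[abs_def] by (rule Cc_1_cmult(2)[OF Cc_1_affine(1)[OF std_moll_Cc_1 t']])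
    also have "\<dots> = (1 / \<bar>t\<bar> ^ 3) * ((- 1 / t) * partial i std_moll (0 + (- 1 / t) *\<^sub>R w))"
      unfolding Cc_1_affine(2)[OF std_moll_Cc_1 t'] ..
    finally show ?thesis by simp
  qed
  have "partial i (moll std_moll t f) x = conv (partial i (moll_kernel t)) f x" unfolding ms P(1) ..
  also have "\<dots> = - (1 / t) * conv (\<lambda>w. (1 / \<bar>t\<bar> ^ 3) * partial i std_moll (0 + (- 1 / t) *\<^sub>R w)) f x"
    unfolding conv_def pk mult.assoc by (rule integral_mult_right_zero)
  also have "\<dots> = - (1 / t) * moll (partial i std_moll) t f x"
    unfolding moll_eq_conv[OF z fm t] ..
  finally show "partial i (moll std_moll t f) x = - (1 / t) * moll (partial i std_moll) t f x" .
qed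

text \<open>The absolute value keeps the base nonnegative on both sides of 0, where a two-sided
  derivative is wanted since a mollified density may vanish. There the derivative is 0 because a >
  1.\<close>

lemma DERIV_abs_powr:
  fixes y a :: real
  assumes y: "0 \<le> y" and a: "1 < a"
  shows "((\<lambda>r. \<bar>r\<bar> powr a) has_real_derivative a * y powr (a - 1)) (at y)"
proof (cases "y = 0")
  case True
  have "(\<lambda>r. \<bar>r\<bar> powr (a - 1)) \<midarrow>0\<rightarrow> \<bar>0\<bar> powr (a - 1)"
    using a by (intro tendsto_powr2 tendsto_intros) auto
  then have "(\<lambda>r. \<bar>r\<bar> powr (a - 1)) \<midarrow>0\<rightarrow> 0" by simp
  then have "(\<lambda>r. sgn r * \<bar>r\<bar> powr (a - 1)) \<midarrow>0\<rightarrow> 0"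
    by (rule Lim_null_comparison[rotated]) (auto simp: abs_mult sgn_if intro!: always_eventually)
  then have c: "isCont (\<lambda>r. sgn r * \<bar>r\<bar> powr (a - 1)) 0" by (simp add: isCont_def)
  have e: "\<bar>z\<bar> powr a - \<bar>0\<bar> powr a = (sgn z * \<bar>z\<bar> powr (a - 1)) * (z - 0)" for z :: real
    using powr_mult_base[of "\<bar>z\<bar>" "a - 1"] by (cases "z = 0") (auto simp: sgn_if abs_if mult.commute split: if_splits)
  have "DERIV (\<lambda>r. \<bar>r\<bar> powr a) 0 :> 0"
    unfolding CARAT_DERIV using e c by (intro exI[of _ "\<lambda>r. sgn r * \<bar>r\<bar> powr (a - 1)"]) auto
  then show ?thesis using True by simp
next
  case False
  then have "((\<lambda>r. r powr a) has_real_derivative a * y powr (a - 1)) (at y)"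
    using y by (intro has_real_derivative_powr) auto
  then show ?thesis
    by (rule has_field_derivative_transform_within_open[where S = "{0<..}"]) (use y False in auto)
qed

lemma C_diff_powr:
  fixes f :: "real^3 \<Rightarrow> real"
  assumes f: "C_diff 1 f" "\<And>x. 0 \<le> f x" and a: "1 < a"
  shows "C_diff 1 (\<lambda>x. f x powr a)" "partial i (\<lambda>x. f x powr a) x = a * f x powr (a - 1) * partial i f x"
proof -
  have c: "continuous_on UNIV f" by (rule C_diff_continuous[OF f(1)])
  have fe: "(\<lambda>x. f x powr a) = (\<lambda>x. \<bar>f x\<bar> powr a)" using f(2) by simp
  have d: "((\<lambda>x. f x powr a) has_derivative (\<lambda>h. \<Sum>j\<in>UNIV. h $ j * (a * f x powr (a - 1) * partial j f x))) (at x)" for x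
  proof -
    have 1: "(f has_derivative (\<lambda>h. \<Sum>j\<in>UNIV. h $ j * partial j f x)) (at x)"
      using f(1) unfolding C_diff_1_iff by (intro has_derivative_partial) blast
    have 2: "((\<lambda>r. \<bar>r\<bar> powr a) has_derivative (\<lambda>h. a * f x powr (a - 1) * h)) (at (f x))"
      using DERIV_abs_powr[OF f(2) a] unfolding has_field_derivative_def .
    show ?thesis
      unfolding fe by (rule has_derivative_eq_rhs[OF has_derivative_compose[OF 1 2]])
        (simp add: sum_distrib_left mult_ac fun_eq_iff)
  qed
  have cc: "continuous_on UNIV (\<lambda>x. a * f x powr (a - 1) * partial j f x)" for j
    using f(1) a unfolding C_diff_1_iff
    by (intro continuous_intros continuous_on_powr' c) (auto simp: f(2))
  show "C_diff 1 (\<lambda>x. f x powr a)" by (rule C_diff_1I(1)[OF d cc])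
  show "partial i (\<lambda>x. f x powr a) x = a * f x powr (a - 1) * partial i f x"
    by (rule fun_cong[OF C_diff_1I(2)[OF d cc]])
qed

lemma C_diff_nth: "C_diff 1 (\<lambda>x::real^3. x $ j)" "partial i (\<lambda>x::real^3. x $ j) x = (if i = j then 1 else 0)"
proof -
  have d: "((\<lambda>x::real^3. x $ j) has_derivative (\<lambda>h. \<Sum>k\<in>UNIV. h $ k * (if k = j then 1 else 0))) (at x)" for x
    by (rule has_derivative_eq_rhs[OF bounded_linear_imp_has_derivative[OF bounded_linear_vec_nth]])
      (simp add: fun_eq_iff mult_delta_right)
  show "C_diff 1 (\<lambda>x::real^3. x $ j)" by (rule C_diff_1I(1)[OF d]) simp
  show "partial i (\<lambda>x::real^3. x $ j) x = (if i = j then 1 else 0)" by (rule has_derivative_imp_partial[OF d])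
qed

text \<open>Integration by parts against a coordinate function. These first moments pick out the
  diagonal derivatives, hence the divergence, from the limit of the commutator.\<close>

lemma std_moll_partial_moment: "(LINT z|lborel. partial i std_moll z * z $ j) = (if i = j then -1 else 0)"
proof -
  have "(LINT z|lborel. partial i std_moll z * z $ j) = - (LINT z|lborel. std_moll z * (if i = j then 1 else 0))"
    using integral_by_parts[OF std_moll_Cc_1 C_diff_nth(1), of i j] unfolding C_diff_nth(2) .
  then show ?thesis by (cases "i = j") (auto simp: std_moll(4))
qed

lemma std_moll_partial_integrable: "integrable lborel (partial i std_moll)"
  by (rule Cc_1_integrable(2)[OF std_moll_Cc_1])

section \<open>The flow in terms of Borel functions\<close>

lemma lebesgue_integral_AE_borel:
  fixes f g :: "'a::euclidean_space \<Rightarrow> real"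
  assumes g: "g \<in> borel_measurable borel" and ae: "AE x in lebesgue. f x = g x"
  shows "(LINT x|lebesgue. f x) = (LINT x|lborel. g x)"
proof -
  have gl: "g \<in> borel_measurable lebesgue" using g by (simp add: measurable_completion)
  have fl: "f \<in> borel_measurable lebesgue"
    by (rule borel_measurable_AE[OF gl]) (use ae in eventually_elim, simp)
  have "(LINT x|lebesgue. f x) = (LINT x|lebesgue. g x)" by (rule integral_cong_AE[OF fl gl ae])
  then show ?thesis using g by (simp add: lebesgue_integral_eq_lborel)
qed

text \<open>By Sobolev's inequality the approximating sequence is Cauchy in L6. Its L6 limit agrees
  with \<open>v\<close> because on every ball a further subsequence converges to \<open>v\<close>
  almost everywhere.\<close>

lemma D0_2_Sobolev:
  assumes v: "v \<in> D0 2"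
  obtains \<phi> g w where "\<And>n. \<phi> n \<in> Cc_infinity" "\<And>j. Lconv 2 (\<lambda>n. partial j (\<phi> n)) (g j)"
    "AE x in lebesgue. \<forall>j. weak_grad v x $ j = g j x"
    "Lconv 6 \<phi> w" "AE x in lebesgue. v x = w x"
proof -
  obtain \<phi> g where \<phi>: "\<And>n. \<phi> n \<in> Cc_infinity" and g: "\<And>j. Lconv 2 (\<lambda>n. partial j (\<phi> n)) (g j)"
    and wg: "AE x in lebesgue. \<forall>j. weak_grad v x $ j = g j x"
    and L1: "\<And>K. compact K \<Longrightarrow> (\<lambda>n. LINT x:K|lebesgue. \<bar>\<phi> n x - v x\<bar>) \<longlonglongrightarrow> 0"
    by (rule D0_weak_grad[OF v]) (simp, blast)
  have \<phi>1: "\<phi> n \<in> Cc 1" for n by (rule Cc_infinity_imp_Cc[OF \<phi>])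
  have vl: "locally_integrable v" using v by (simp add: D0_def)
  have "\<exists>w. Lconv 6 \<phi> w"
  proof (rule Lp_complete)
    show "\<phi> n \<in> Lp 6" for n using Cc_1_Lp(1)[OF \<phi>1] by simp
    fix e :: real assume e: "0 < e"
    \<comment> \<open>Three squared derivative norms, each at most 4 d, multiply to 64 d^3 \<le> 64
      d as d \<le> 1; the second entry makes 4096 times this at most half of
      \<open>e\<close>.\<close>
    define d where "d = min 1 (e / (2 * 64 * 4096))"
    have d: "0 < d" "d \<le> 1" using e by (auto simp: d_def min_def)
    have "\<exists>N. \<forall>n\<ge>N. Lpow 2 (\<lambda>x. partial j (\<phi> n) x - g j x) < d / 2" for j
      using order_tendstoD(2)[OF LconvD(3)[OF g], of "d / 2" j] d unfolding eventually_sequentially by simp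
    then obtain N where N: "\<And>j n. n \<ge> N j \<Longrightarrow> Lpow 2 (\<lambda>x. partial j (\<phi> n) x - g j x) < d / 2" by metis
    have "Lpow 6 (\<lambda>x. \<phi> m x - \<phi> n x) < e" if mn: "m \<ge> Max (range N)" "n \<ge> Max (range N)" for m n
    proof -
      have Nj: "N j \<le> m" "N j \<le> n" for j using mn Max_ge[of "range N" "N j"] by (auto intro: order_trans)
      have p: "Lpow 2 (partial j (\<lambda>x. \<phi> m x - \<phi> n x)) \<le> 4 * d" for j
      proof -
        have "partial j (\<lambda>x. \<phi> m x - \<phi> n x) = (\<lambda>x. (partial j (\<phi> m) x - g j x) + (g j x - partial j (\<phi> n) x))"
          by (rule ext) (simp add: Cc_1_diff(2)[OF \<phi>1 \<phi>1])
        then have "Lpow 2 (partial j (\<lambda>x. \<phi> m x - \<phi> n x))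
           \<le> 2 powr 2 * (Lpow 2 (\<lambda>x. partial j (\<phi> m) x - g j x) + Lpow 2 (\<lambda>x. g j x - partial j (\<phi> n) x))"
          using LconvD(1,2)[OF g] by (simp only:) (intro Lpow_add_le Lp_diff, auto)
        also have "Lpow 2 (\<lambda>x. g j x - partial j (\<phi> n) x) = Lpow 2 (\<lambda>x. partial j (\<phi> n) x - g j x)"
          by (rule Lpow_minus_commute)
        also have "2 powr 2 * (Lpow 2 (\<lambda>x. partial j (\<phi> m) x - g j x) + Lpow 2 (\<lambda>x. partial j (\<phi> n) x - g j x)) \<le> 2 powr 2 * (d / 2 + d / 2)"
          using N[OF Nj(1), of j] N[OF Nj(2), of j] by (intro mult_left_mono add_mono) auto
        finally show ?thesis by simp
      qed
      have "Lpow 6 (\<lambda>x. \<phi> m x - \<phi> n x) \<le> 4096 * (\<Prod>j\<in>UNIV. Lpow 2 (partial j (\<lambda>x. \<phi> m x - \<phi> n x)))"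
        by (rule Sobolev[OF Cc_1_diff(1)[OF \<phi>1 \<phi>1]])
      also have "\<dots> \<le> 4096 * (\<Prod>j\<in>(UNIV::3 set). 4 * d)"
        using p by (intro mult_left_mono prod_mono) auto
      also have "\<dots> = 64 * 4096 * d * d * d" by (simp add: power3_eq_cube)
      also have "\<dots> \<le> 64 * 4096 * d * 1 * 1"
        using d by (intro mult_mono) auto
      also have "\<dots> < e" using d e by (auto simp: d_def min_def)
      finally show ?thesis .
    qed
    then show "\<exists>N. \<forall>m\<ge>N. \<forall>n\<ge>N. Lpow 6 (\<lambda>x. \<phi> m x - \<phi> n x) < e" by blast
  qed auto
  then obtain w where w: "Lconv 6 \<phi> w" by blast
  obtain r where r: "strict_mono r" "AE x in lborel. (\<lambda>n. \<phi> (r n) x) \<longlonglongrightarrow> w x"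
    using Lconv_AE_subseq[OF w] by auto
  have rl: "AE x in lebesgue. (\<lambda>n. \<phi> (r n) x) \<longlonglongrightarrow> w x" by (rule lborel_AE_imp_lebesgue[OF r(2)])
  have "AE x in lebesgue. norm x \<le> real M \<longrightarrow> v x = w x" for M :: nat
  proof -
    define D where "D n x = indicator (cball 0 (real M)) x * \<bar>\<phi> (r n) x - v x\<bar>" for n x
    have iD: "integrable lebesgue (D n)" for n
    proof -
      have "integrable lborel (\<lambda>x. indicator (cball 0 (real M)) x * \<phi> (r n) x)"
        using integrable_mult_indicator[of "cball 0 (real M)" lborel "\<phi> (r n)"] Cc_1_integrable(1)[OF \<phi>1] by simp
      from this borel_measurable_integrable[OF this]
      have "integrable lebesgue (\<lambda>x. indicator (cball 0 (real M)) x * \<phi> (r n) x)"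
        by (subst lebesgue_integral_eq_lborel) auto
      from integrable_abs[OF Bochner_Integration.integrable_diff[OF this locally_integrable_cball[OF vl, of "real M", simplified]]]
      show ?thesis by (simp add: D_def[abs_def] right_diff_distrib[symmetric] abs_mult)
    qed
    have "(\<lambda>n. LINT x|lebesgue. norm (D n x)) \<longlonglongrightarrow> 0"
      using LIMSEQ_subseq_LIMSEQ[OF L1[OF compact_cball, of 0 "real M"] r(1)]
      by (simp add: set_lebesgue_integral_def D_def comp_def abs_mult)
    from tendsto_L1_AE_subseq[OF iD this] obtain r' where
      r': "strict_mono r'" "AE x in lebesgue. (\<lambda>n. D (r' n) x) \<longlonglongrightarrow> 0" by blast
    show ?thesis
      using rl r'(2)
    proof eventually_elim
      case (elim x)
      show ?case
      proof
        assume "norm x \<le> real M"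
        then have "(\<lambda>n. \<bar>\<phi> (r (r' n)) x - v x\<bar>) \<longlonglongrightarrow> 0" using elim(2) by (simp add: D_def)
        then have "(\<lambda>n. \<phi> (r (r' n)) x) \<longlonglongrightarrow> v x" by (simp add: LIM_zero_iff tendsto_rabs_zero_iff)
        moreover have "(\<lambda>n. \<phi> (r (r' n)) x) \<longlonglongrightarrow> w x"
          using LIMSEQ_subseq_LIMSEQ[OF elim(1) r'(1)] by (simp add: comp_def)
        ultimately show "v x = w x" by (rule LIMSEQ_unique)
      qed
    qed
  qed
  then have "AE x in lebesgue. \<forall>M::nat. norm x \<le> real M \<longrightarrow> v x = w x" by (simp only: AE_all_countable simp_thms)
  then have "AE x in lebesgue. v x = w x" by eventually_elim (meson real_arch_simple)
  then show ?thesis using that[OF \<phi> g wg w] by blast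
qed

section \<open>From the vector equation to its components\<close>

lemma jacobian_nth: "jacobian f (at x) $ k $ j = partial j f x $ k"
  by (simp add: jacobian_def matrix_def partial_def)

text \<open>Test fields in a fixed coordinate direction turn the vector momentum equation into three
  scalar ones.\<close>

lemma Cc_1_axis:
  fixes f :: "real^3 \<Rightarrow> real"
  assumes f: "f \<in> Cc 1"
  shows "(\<lambda>x. f x *\<^sub>R (axis i 1 :: real^3)) \<in> Cc 1" "partial j (\<lambda>x. f x *\<^sub>R (axis i 1 :: real^3)) x = partial j f x *\<^sub>R axis i 1"
proof -
  have D: "((\<lambda>x. f x *\<^sub>R (axis i 1 :: real^3)) has_derivative (\<lambda>h. (\<Sum>j\<in>UNIV. h $ j * partial j f x) *\<^sub>R axis i 1)) (at x)" for x
    by (rule has_derivative_scaleR_left[OF Cc_1D(6)[OF f]])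
  show p: "partial j (\<lambda>x. f x *\<^sub>R (axis i 1 :: real^3)) x = partial j f x *\<^sub>R axis i 1" for j x
    using partial_eqI[OF D[of x], of j] by (simp add: sum_axis)
  have p': "partial j (\<lambda>x. f x *\<^sub>R (axis i 1 :: real^3)) = (\<lambda>x. partial j f x *\<^sub>R axis i 1)" for j
    by (rule ext) (rule p)
  obtain R where R: "\<And>x. R < norm x \<Longrightarrow> f x = 0" using Cc_1D(4)[OF f] unfolding compact_support_iff by blast
  have "compact_support (\<lambda>x. f x *\<^sub>R (axis i 1 :: real^3))"
    by (rule compact_supportI[of R]) (simp add: R)
  then show "(\<lambda>x. f x *\<^sub>R (axis i 1 :: real^3)) \<in> Cc 1"
    unfolding Cc_1_iff p' using D Cc_1D(3)[OF f]
    by (auto simp: differentiable_def intro!: continuous_intros)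
qed

lemma inner_mat: "(A :: real^3^3) \<bullet> B = (\<Sum>k\<in>UNIV. \<Sum>j\<in>UNIV. A $ k $ j * B $ k $ j)"
  by (simp add: inner_vec_def)

lemma inner_jacobian_axis:
  fixes f :: "real^3 \<Rightarrow> real"
  assumes f: "f \<in> Cc 1"
  shows "A \<bullet> jacobian (\<lambda>x. f x *\<^sub>R (axis i 1 :: real^3)) (at x) = (\<Sum>j\<in>UNIV. A $ i $ j * partial j f x)"
    "trace (jacobian (\<lambda>x. f x *\<^sub>R (axis i 1 :: real^3)) (at x)) = partial i f x"
proof -
  have J: "jacobian (\<lambda>x. f x *\<^sub>R (axis i 1 :: real^3)) (at x) $ k $ j = (if k = i then partial j f x else 0)" for k j
    unfolding jacobian_nth Cc_1_axis(2)[OF f] by (simp add: axis_def)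
  have "A \<bullet> jacobian (\<lambda>x. f x *\<^sub>R (axis i 1 :: real^3)) (at x)
     = (\<Sum>k\<in>UNIV. if k = i then (\<Sum>j\<in>UNIV. A $ k $ j * partial j f x) else 0)"
    unfolding inner_mat J by (intro sum.cong refl) auto
  then show "A \<bullet> jacobian (\<lambda>x. f x *\<^sub>R (axis i 1 :: real^3)) (at x) = (\<Sum>j\<in>UNIV. A $ i $ j * partial j f x)"
    by simp
  show "trace (jacobian (\<lambda>x. f x *\<^sub>R (axis i 1 :: real^3)) (at x)) = partial i f x"
    unfolding trace_def J by simp
qed

lemma stress_nth:
  "stress \<mu> \<eta> F $ i $ j = \<mu> * (F $ i $ j + F $ j $ i - (if i = j then 2 / 3 * trace F else 0)) + (if i = j then \<eta> * trace F else 0)"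
  by (simp add: stress_def transpose_def mat_def)

text \<open>\<open>u i\<close>, \<open>U i j\<close> and \<open>H j\<close> are Borel representatives of the components of \<open>u\<close>, of its weak derivative \<open>\<partial>\<^sub>j u\<^sub>i\<close>
  and of \<open>\<nabla>G\<close>; the sequences \<open>\<phi>\<close> and \<open>\<psi>\<close> come from the completions defining the function spaces.\<close>

locale steady_flow =
  fixes \<gamma> \<mu> \<eta> q :: real and \<rho> :: "real^3 \<Rightarrow> real" and u :: "3 \<Rightarrow> real^3 \<Rightarrow> real"
    and U :: "3 \<Rightarrow> 3 \<Rightarrow> real^3 \<Rightarrow> real" and H :: "3 \<Rightarrow> real^3 \<Rightarrow> real"
    and \<phi> :: "3 \<Rightarrow> nat \<Rightarrow> real^3 \<Rightarrow> real" and \<psi> :: "nat \<Rightarrow> real^3 \<Rightarrow> real"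
  assumes \<mu>: "0 < \<mu>" and \<eta>: "0 \<le> \<eta>" and \<gamma>: "3 \<le> \<gamma>" "\<gamma> < 6" and q: "q = 6 * \<gamma> / (5 * \<gamma> - 6)"
    and \<rho>_nonneg: "\<And>x. 0 \<le> \<rho> x" and \<rho>_Lp: "\<rho> \<in> Lp \<gamma>"
    and \<phi>: "\<And>i n. \<phi> i n \<in> Cc_infinity"
    and u_conv: "\<And>i. Lconv 6 (\<phi> i) (u i)" and U_conv: "\<And>i j. Lconv 2 (\<lambda>n. partial j (\<phi> i n)) (U i j)"
    and \<psi>: "\<And>n. \<psi> n \<in> Cc_infinity" and H_conv: "\<And>j. Lconv q (\<lambda>n. partial j (\<psi> n)) (H j)"
    and continuity_Cc_infinity: "\<And>f. f \<in> Cc_infinity \<Longrightarrow> (LINT x|lborel. (\<Sum>j\<in>UNIV. \<rho> x * u j x * partial j f x)) = 0"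
    and momentum_Cc_1: "\<And>f i. f \<in> Cc 1 \<Longrightarrow>
      (LINT x|lborel. (\<Sum>j\<in>UNIV. \<rho> x * (u i x * u j x) * partial j f x) + \<rho> x powr \<gamma> * partial i f x)
      = (LINT x|lborel. (\<Sum>j\<in>UNIV. (\<mu> * (U i j x + U j i x - (if i = j then 2 / 3 * (\<Sum>k\<in>UNIV. U k k x) else 0))
            + (if i = j then \<eta> * (\<Sum>k\<in>UNIV. U k k x) else 0)) * partial j f x))
        - (LINT x|lborel. \<rho> x * H i x * f x)"

text \<open>Every integrand of the weak formulation is changed on a null set only, so the equations
  carry over to the Borel representatives; the sequences of the two completions are kept, since
  later limits run along them.\<close>

lemma weak_solution_steady_flow:
  assumes "\<mu> > 0" and "\<eta> \<ge> 0"
    and "3 \<le> \<gamma>" and "\<gamma> < 6"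
    and G: "G \<in> D0 (6 * \<gamma> / (5 * \<gamma> - 6))"
    and ws: "weak_solution \<mu> \<eta> (\<lambda>r. r powr \<gamma>) G \<rho> u"
    and \<rho>L: "\<rho> \<in> Lspace \<gamma>"
  obtains \<rho>' u' U H \<phi> \<psi> where "steady_flow \<gamma> \<mu> \<eta> (6 * \<gamma> / (5 * \<gamma> - 6)) \<rho>' u' U H \<phi> \<psi>"
    "AE x in lebesgue. \<forall>i. u x $ i = u' i x"
proof -
  define q where "q = 6 * \<gamma> / (5 * \<gamma> - 6)"
  have q1: "1 \<le> q" using assms(3,4) by (simp add: q_def field_simps)
  from ws have \<rho>m: "\<rho> \<in> borel_measurable lebesgue" and \<rho>0: "AE x in lebesgue. \<rho> x \<ge> 0"
    and cont: "\<And>f. f \<in> Cc_infinity \<Longrightarrow> (LINT x|lebesgue. (\<rho> x *\<^sub>R u x) \<bullet> grad f x) = 0"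
    and uD: "\<And>i. (\<lambda>x. u x $ i) \<in> D0 2"
    and mom: "\<And>f. f \<in> Cc 1 \<Longrightarrow> (LINT x|lebesgue. (\<rho> x *\<^sub>R outer_prod (u x) (u x)) \<bullet> jacobian f (at x)
                          + \<rho> x powr \<gamma> * trace (jacobian f (at x)))
        = (LINT x|lebesgue. stress \<mu> \<eta> (weak_grad_vec u x) \<bullet> jacobian f (at x))
          - (LINT x|lebesgue. (\<rho> x *\<^sub>R weak_grad G x) \<bullet> f x)"
    unfolding weak_solution_def D0_vec_def by auto
  define P where "P i \<phi> g w \<longleftrightarrow> (\<forall>n. \<phi> n \<in> Cc_infinity) \<and> (\<forall>j. Lconv 2 (\<lambda>n. partial j (\<phi> n)) (g j)) \<and>
     (AE x in lebesgue. \<forall>j. weak_grad (\<lambda>x. u x $ i) x $ j = g j x) \<and> Lconv 6 \<phi> w \<and> (AE x in lebesgue. u x $ i = w x)"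
    for i and \<phi> :: "nat \<Rightarrow> real^3 \<Rightarrow> real" and g w
  have "\<exists>\<phi> g w. P i \<phi> g w" for i
    by (rule D0_2_Sobolev[OF uD[of i]]) (unfold P_def, blast)
  then obtain \<phi> U u' where "\<And>i. P i (\<phi> i) (U i) (u' i)" by metis
  then have \<phi>: "\<And>i n. \<phi> i n \<in> Cc_infinity"
    and U: "\<And>i j. Lconv 2 (\<lambda>n. partial j (\<phi> i n)) (U i j)"
    and wU: "\<And>i. AE x in lebesgue. \<forall>j. weak_grad (\<lambda>x. u x $ i) x $ j = U i j x"
    and u': "\<And>i. Lconv 6 (\<phi> i) (u' i)" and uu': "\<And>i. AE x in lebesgue. u x $ i = u' i x"
    unfolding P_def by blast+
  obtain \<psi> H where \<psi>: "\<And>n. \<psi> n \<in> Cc_infinity" and H: "\<And>j. Lconv q (\<lambda>n. partial j (\<psi> n)) (H j)"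
    and wH: "AE x in lebesgue. \<forall>j. weak_grad G x $ j = H j x"
    by (rule D0_weak_grad[OF G[folded q_def] q1]) blast
  obtain \<rho>0 where \<rho>0': "\<rho>0 \<in> borel_measurable borel" "AE x in lebesgue. \<rho> x = \<rho>0 x"
    using lebesgue_borel_version[OF \<rho>m] by blast
  \<comment> \<open>The maximum makes the representative nonnegative everywhere, not merely almost
    everywhere.\<close>
  define \<rho>' where "\<rho>' x = max 0 (\<rho>0 x)" for x
  have [measurable]: "\<rho>' \<in> borel_measurable borel" unfolding \<rho>'_def using \<rho>0'(1) by measurable
  have \<rho>\<rho>': "AE x in lebesgue. \<rho> x = \<rho>' x"
    using \<rho>0 \<rho>0'(2) by eventually_elim (simp add: \<rho>'_def)
  have um[measurable]: "u' i \<in> borel_measurable borel" for i using LconvD(2)[OF u'] by (rule Lp_measurable)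
  have Um[measurable]: "U i j \<in> borel_measurable borel" for i j using LconvD(2)[OF U] by (rule Lp_measurable)
  have Hm[measurable]: "H j \<in> borel_measurable borel" for j using LconvD(2)[OF H] by (rule Lp_measurable)
  have uall: "AE x in lebesgue. \<forall>i. u x $ i = u' i x" using uu' by (simp only: AE_all_countable simp_thms)
  have Uall: "AE x in lebesgue. \<forall>i j. weak_grad_vec u x $ i $ j = U i j x"
    using wU by (simp add: AE_all_countable weak_grad_vec_def)
  have "steady_flow \<gamma> \<mu> \<eta> q \<rho>' u' U H \<phi> \<psi>"
  proof
    show "0 < \<mu>" "0 \<le> \<eta>" "3 \<le> \<gamma>" "\<gamma> < 6" "q = 6 * \<gamma> / (5 * \<gamma> - 6)" using assms q_def by auto
    show "0 \<le> \<rho>' x" for x by (simp add: \<rho>'_def)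
    show "\<rho>' \<in> Lp \<gamma>"
    proof (rule LpI)
      have "integrable lebesgue (\<lambda>x. \<bar>\<rho> x\<bar> powr \<gamma>)" using \<rho>L by (simp add: Lspace_def)
      moreover have "(\<lambda>x. \<bar>\<rho>' x\<bar> powr \<gamma>) \<in> borel_measurable borel" by measurable
      then have "(\<lambda>x. \<bar>\<rho>' x\<bar> powr \<gamma>) \<in> borel_measurable lebesgue" by (simp add: measurable_completion)
      moreover have "AE x in lebesgue. \<bar>\<rho> x\<bar> powr \<gamma> = \<bar>\<rho>' x\<bar> powr \<gamma>"
        using \<rho>\<rho>' by eventually_elim simp
      ultimately have "integrable lebesgue (\<lambda>x. \<bar>\<rho>' x\<bar> powr \<gamma>)"
        by (rule integrable_cong_AE_imp)
      then show "integrable lborel (\<lambda>x. \<bar>\<rho>' x\<bar> powr \<gamma>)"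
        by (subst (asm) lebesgue_integral_eq_lborel) auto
    qed measurable
    show "\<phi> i n \<in> Cc_infinity" "Lconv 6 (\<phi> i) (u' i)" "Lconv 2 (\<lambda>n. partial j (\<phi> i n)) (U i j)"
      "\<psi> n \<in> Cc_infinity" "Lconv q (\<lambda>n. partial j (\<psi> n)) (H j)" for i j n
      using \<phi> u' U \<psi> H by auto
    show "(LINT x|lborel. (\<Sum>j\<in>UNIV. \<rho>' x * u' j x * partial j f x)) = 0" if f: "f \<in> Cc_infinity" for f
    proof -
      note [measurable] = Cc_1_measurable[OF Cc_infinity_imp_Cc[OF f]]
      have "(LINT x|lebesgue. (\<rho> x *\<^sub>R u x) \<bullet> grad f x) = (LINT x|lborel. (\<Sum>j\<in>UNIV. \<rho>' x * u' j x * partial j f x))"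
      proof (rule lebesgue_integral_AE_borel)
        show "AE x in lebesgue. (\<rho> x *\<^sub>R u x) \<bullet> grad f x = (\<Sum>j\<in>UNIV. \<rho>' x * u' j x * partial j f x)"
          using \<rho>\<rho>' uall by eventually_elim (simp add: inner_vec_def)
      qed measurable
      then show ?thesis using cont[OF f] by simp
    qed
    fix f :: "real^3 \<Rightarrow> real" and i assume f: "f \<in> Cc 1"
    note [measurable] = Cc_1_measurable[OF f]
    note J = inner_jacobian_axis[OF f]
    have "(LINT x|lebesgue. (\<rho> x *\<^sub>R outer_prod (u x) (u x)) \<bullet> jacobian (\<lambda>x. f x *\<^sub>R (axis i 1 :: real^3)) (at x)
                          + \<rho> x powr \<gamma> * trace (jacobian (\<lambda>x. f x *\<^sub>R (axis i 1 :: real^3)) (at x)))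
      = (LINT x|lborel. (\<Sum>j\<in>UNIV. \<rho>' x * (u' i x * u' j x) * partial j f x) + \<rho>' x powr \<gamma> * partial i f x)"
    proof (rule lebesgue_integral_AE_borel)
      show "AE x in lebesgue. (\<rho> x *\<^sub>R outer_prod (u x) (u x)) \<bullet> jacobian (\<lambda>x. f x *\<^sub>R (axis i 1 :: real^3)) (at x)
                          + \<rho> x powr \<gamma> * trace (jacobian (\<lambda>x. f x *\<^sub>R (axis i 1 :: real^3)) (at x))
         = (\<Sum>j\<in>UNIV. \<rho>' x * (u' i x * u' j x) * partial j f x) + \<rho>' x powr \<gamma> * partial i f x"
        using \<rho>\<rho>' uall by eventually_elim (simp add: J outer_prod_def)
    qed measurable
    moreover have "(LINT x|lebesgue. stress \<mu> \<eta> (weak_grad_vec u x) \<bullet> jacobian (\<lambda>x. f x *\<^sub>R (axis i 1 :: real^3)) (at x))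
      = (LINT x|lborel. (\<Sum>j\<in>UNIV. (\<mu> * (U i j x + U j i x - (if i = j then 2 / 3 * (\<Sum>k\<in>UNIV. U k k x) else 0))
            + (if i = j then \<eta> * (\<Sum>k\<in>UNIV. U k k x) else 0)) * partial j f x))"
    proof (rule lebesgue_integral_AE_borel)
      show "AE x in lebesgue. stress \<mu> \<eta> (weak_grad_vec u x) \<bullet> jacobian (\<lambda>x. f x *\<^sub>R (axis i 1 :: real^3)) (at x)
        = (\<Sum>j\<in>UNIV. (\<mu> * (U i j x + U j i x - (if i = j then 2 / 3 * (\<Sum>k\<in>UNIV. U k k x) else 0))
            + (if i = j then \<eta> * (\<Sum>k\<in>UNIV. U k k x) else 0)) * partial j f x)"
        using Uall by eventually_elim (simp only: J stress_nth trace_def)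
    qed measurable
    moreover have "(LINT x|lebesgue. (\<rho> x *\<^sub>R weak_grad G x) \<bullet> (f x *\<^sub>R (axis i 1 :: real^3))) = (LINT x|lborel. \<rho>' x * H i x * f x)"
    proof (rule lebesgue_integral_AE_borel)
      show "AE x in lebesgue. (\<rho> x *\<^sub>R weak_grad G x) \<bullet> (f x *\<^sub>R (axis i 1 :: real^3)) = \<rho>' x * H i x * f x"
        using \<rho>\<rho>' wH by eventually_elim (simp add: inner_axis)
    qed measurable
    ultimately show "(LINT x|lborel. (\<Sum>j\<in>UNIV. \<rho>' x * (u' i x * u' j x) * partial j f x) + \<rho>' x powr \<gamma> * partial i f x)
      = (LINT x|lborel. (\<Sum>j\<in>UNIV. (\<mu> * (U i j x + U j i x - (if i = j then 2 / 3 * (\<Sum>k\<in>UNIV. U k k x) else 0))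
            + (if i = j then \<eta> * (\<Sum>k\<in>UNIV. U k k x) else 0)) * partial j f x))
        - (LINT x|lborel. \<rho>' x * H i x * f x)"
      using mom[OF Cc_1_axis(1)[OF f, of i]] by simp
  qed
  then show ?thesis using uall that unfolding q_def by blast
qed

context steady_flow
begin

section \<open>Consequences of the weak formulation\<close>

definition D :: "real^3 \<Rightarrow> real" where "D x = (\<Sum>k\<in>UNIV. U k k x)"

lemma u_Lp: "u i \<in> Lp 6" and U_Lp: "U i j \<in> Lp 2" and H_Lp: "H j \<in> Lp q"
  using LconvD(2)[OF u_conv] LconvD(2)[OF U_conv] LconvD(2)[OF H_conv] by auto

lemma D_Lp: "D \<in> Lp 2"
  unfolding D_def[abs_def] by (rule Lp_sum[OF U_Lp]) simp

lemma measurable_data [measurable]: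
  "\<rho> \<in> borel_measurable borel" "u i \<in> borel_measurable borel" "U i j \<in> borel_measurable borel"
  "H j \<in> borel_measurable borel" "D \<in> borel_measurable borel"
  by (rule Lp_measurable[OF \<rho>_Lp], rule Lp_measurable[OF u_Lp], rule Lp_measurable[OF U_Lp],
      rule Lp_measurable[OF H_Lp], rule Lp_measurable[OF D_Lp])

lemma \<phi>_Cc_1: "\<phi> i n \<in> Cc 1" and \<psi>_Cc_1: "\<psi> n \<in> Cc 1"
  using Cc_infinity_imp_Cc \<phi> \<psi> by blast+

text \<open>The relation 1/\<gamma> + 1/q = 5/6 explains the exponent of the force potential: the
  force then lies in L^(6/5), dual to the space L6 of the velocity.\<close>

lemma q_bounds: "1 \<le> q" "q \<le> 2" "0 < q" "1 / \<gamma> + 1 / q = 5 / 6"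
  using \<gamma> by (auto simp: q field_simps)

lemma pressure_integrable: "integrable lborel (\<lambda>x. \<rho> x powr \<gamma>)"
  using Lp_integrable[OF \<rho>_Lp] \<rho>_nonneg by simp

text \<open>A bounded function of bounded support lies in every finite Lebesgue space, hence in the
  one that Hoelder's inequality leaves over when c < \<gamma>. For c = \<gamma> that exponent would
  be infinite, and domination by a multiple of \<rho> is used.\<close>

lemma \<rho>_mult_bounded_support:
  assumes g[measurable]: "g \<in> borel_measurable borel" and B: "\<And>x. \<bar>g x\<bar> \<le> B" and R: "\<And>x. R < norm x \<Longrightarrow> g x = 0"
    and c: "0 < c" "c \<le> \<gamma>"
  shows "(\<lambda>x. \<rho> x * g x) \<in> Lp c"
proof (cases "c = \<gamma>")
  case True
  have "(\<lambda>x. B * \<rho> x) \<in> Lp c" using Lp_cmult[OF \<rho>_Lp] True by simp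
  moreover have "\<bar>\<rho> x * g x\<bar> \<le> \<bar>B * \<rho> x\<bar>" for x
  proof -
    have "\<rho> x * \<bar>g x\<bar> \<le> \<rho> x * \<bar>B\<bar>"
      using B[of x] \<rho>_nonneg[of x] by (intro mult_left_mono) auto
    then show ?thesis using \<rho>_nonneg[of x] by (simp add: abs_mult mult.commute)
  qed
  ultimately show ?thesis using c by (intro Lp_mono[of "\<lambda>x. \<rho> x * g x" "\<lambda>x. B * \<rho> x"]) auto
next
  case False
  define b where "b = 1 / (1 / c - 1 / \<gamma>)"
  have "0 < 1 / c - 1 / \<gamma>" using c False by (simp add: field_simps)
  then have b: "0 < b" "1 / \<gamma> + 1 / b = 1 / c" by (auto simp: b_def)
  have "g \<in> Lp b" by (rule Lp_bounded_support[OF g B R b(1)])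
  then show ?thesis using Holder(1)[of \<gamma> b c \<rho> g] b c \<gamma> \<rho>_Lp by auto
qed

lemma \<rho>_mult_compact_support:
  assumes g: "continuous_on UNIV g" "compact_support g" and c: "0 < c" "c \<le> 3"
  shows "(\<lambda>x. \<rho> x * g x) \<in> Lp c"
proof -
  obtain R where R: "\<And>x. R < norm x \<Longrightarrow> g x = 0" using g(2) unfolding compact_support_iff by blast
  obtain B where B: "0 \<le> B" "\<And>x. \<bar>g x\<bar> \<le> B" using compact_support_bounded[OF g] by blast
  show ?thesis
    by (rule \<rho>_mult_bounded_support[OF borel_measurable_continuous_onI[OF g(1)] B(2) R]) (use c \<gamma> in auto)
qed

text \<open>Approximation by smooth functions with derivatives bounded on one common ball, where
  \<rho> times the velocity is integrable.\<close>

lemma continuity_Cc_1: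
  assumes f: "f \<in> Cc 1"
  shows "(LINT x|lborel. (\<Sum>j\<in>UNIV. \<rho> x * u j x * partial j f x)) = 0"
proof -
  obtain F R B where F: "\<And>n. F n \<in> Cc_infinity" and R: "\<And>n j x. R < norm x \<Longrightarrow> partial j (F n) x = 0"
    and B: "\<And>n j x. \<bar>partial j (F n) x\<bar> \<le> B" and lim: "\<And>j x. (\<lambda>n. partial j (F n) x) \<longlonglongrightarrow> partial j f x"
    using Cc_1_approx[OF f] by metis
  have B0: "0 \<le> B" using B[of 0 0 0] by linarith
  note [measurable] = Cc_1_measurable[OF Cc_infinity_imp_Cc[OF F]] Cc_1_measurable[OF f]
  have "(\<lambda>x. \<rho> x * (B * indicator (cball 0 R) x)) \<in> Lp (6 / 5)"
    by (rule \<rho>_mult_bounded_support[of _ B R]) (use \<gamma> B0 in \<open>auto simp: indicator_def\<close>)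
  then have i: "integrable lborel (\<lambda>x. \<Sum>j\<in>UNIV. \<bar>\<rho> x * (B * indicator (cball 0 R) x) * u j x\<bar>)"
    by (intro Bochner_Integration.integrable_sum integrable_abs Holder_1(1)[OF _ _ _ _ u_Lp]) auto
  have "(\<lambda>n. LINT x|lborel. (\<Sum>j\<in>UNIV. \<rho> x * u j x * partial j (F n) x))
      \<longlonglongrightarrow> (LINT x|lborel. (\<Sum>j\<in>UNIV. \<rho> x * u j x * partial j f x))"
  proof (rule integral_dominated_convergence[OF _ _ i])
    show "AE x in lborel. (\<lambda>n. \<Sum>j\<in>UNIV. \<rho> x * u j x * partial j (F n) x) \<longlonglongrightarrow> (\<Sum>j\<in>UNIV. \<rho> x * u j x * partial j f x)"
      by (intro AE_I2 tendsto_intros lim)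
    show "AE x in lborel. norm (\<Sum>j\<in>UNIV. \<rho> x * u j x * partial j (F n) x)
        \<le> (\<Sum>j\<in>UNIV. \<bar>\<rho> x * (B * indicator (cball 0 R) x) * u j x\<bar>)" for n
    proof (intro AE_I2)
      fix x
      have "\<bar>\<rho> x * u j x * partial j (F n) x\<bar> \<le> \<bar>\<rho> x * (B * indicator (cball 0 R) x) * u j x\<bar>" for j
      proof -
        have "\<bar>partial j (F n) x\<bar> \<le> B * indicator (cball 0 R) x"
          using B[of j n x] R[of x j n] by (cases "R < norm x") auto
        then have "\<bar>\<rho> x * u j x\<bar> * \<bar>partial j (F n) x\<bar> \<le> \<bar>\<rho> x * u j x\<bar> * (B * indicator (cball 0 R) x)"
          by (intro mult_left_mono) auto
        then show ?thesis using B0 by (simp add: abs_mult mult_ac)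
      qed
      then show "norm (\<Sum>j\<in>UNIV. \<rho> x * u j x * partial j (F n) x)
        \<le> (\<Sum>j\<in>UNIV. \<bar>\<rho> x * (B * indicator (cball 0 R) x) * u j x\<bar>)"
        by (intro sum_norm_le) auto
    qed
  qed measurable
  moreover have "(LINT x|lborel. (\<Sum>j\<in>UNIV. \<rho> x * u j x * partial j (F n) x)) = 0" for n
    by (rule continuity_Cc_infinity[OF F])
  ultimately show ?thesis by (simp add: LIMSEQ_const_iff)
qed

text \<open>Locally \<rho> is in L3, and 1/3 + 1/6 = 1/2 pairs the first product with a gradient in
  L2; with \<rho> in L^(3/2) locally, 2/3 + 1/6 = 5/6 pairs the second with a function in
  L6.\<close>

lemma convective_Lp:
  assumes f: "f \<in> Cc 1"
  shows "(\<lambda>x. \<rho> x * f x * u j x) \<in> Lp 2" "(\<lambda>x. \<rho> x * partial j f x * u j x) \<in> Lp (6 / 5)"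
proof -
  have "(\<lambda>x. \<rho> x * f x) \<in> Lp 3" by (rule \<rho>_mult_compact_support[OF Cc_1D(2,4)[OF f]]) auto
  then show "(\<lambda>x. \<rho> x * f x * u j x) \<in> Lp 2"
    by (rule Holder(1)[OF _ _ _ _ _ u_Lp, rotated 4]) auto
  have "(\<lambda>x. \<rho> x * partial j f x) \<in> Lp (3 / 2)" by (rule \<rho>_mult_compact_support[OF Cc_1D(3,5)[OF f]]) auto
  then show "(\<lambda>x. \<rho> x * partial j f x * u j x) \<in> Lp (6 / 5)"
    by (rule Holder(1)[OF _ _ _ _ _ u_Lp, rotated 4]) auto
qed

text \<open>The continuity equation tested with \<open>\<phi> i n * f\<close>, in the limit.\<close>

lemma convective_term:
  assumes f: "f \<in> Cc 1"
  shows "(LINT x|lborel. (\<Sum>j\<in>UNIV. \<rho> x * (u i x * u j x) * partial j f x))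
    = - (LINT x|lborel. (\<Sum>j\<in>UNIV. \<rho> x * u j x * U i j x * f x))"
proof -
  note L = convective_Lp[OF f]
  let ?A = "\<lambda>V. (\<Sum>j\<in>UNIV. LINT x|lborel. \<rho> x * f x * u j x * V j x)"
  let ?B = "\<lambda>v. (\<Sum>j\<in>UNIV. LINT x|lborel. \<rho> x * partial j f x * u j x * v x)"
  have A: "integrable lborel (\<lambda>x. \<rho> x * f x * u j x * V x)" if "V \<in> Lp 2" for j V
    by (rule Holder_1(1)[OF _ _ _ L(1) that]) auto
  have B: "integrable lborel (\<lambda>x. \<rho> x * partial j f x * u j x * v x)" if "v \<in> Lp 6" for j v
    by (rule Holder_1(1)[OF _ _ _ L(2) that]) auto
  have "?A (\<lambda>j. partial j (\<phi> i n)) + ?B (\<phi> i n) = 0" for n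
  proof -
    have "(LINT x|lborel. (\<Sum>j\<in>UNIV. \<rho> x * u j x * partial j (\<lambda>x. \<phi> i n x * f x) x)) = 0"
      using \<phi>_Cc_1 f by (intro continuity_Cc_1 Cc_1_mult(1)) (auto simp: Cc_def)
    also have "(LINT x|lborel. (\<Sum>j\<in>UNIV. \<rho> x * u j x * partial j (\<lambda>x. \<phi> i n x * f x) x))
       = (LINT x|lborel. (\<Sum>j\<in>UNIV. \<rho> x * f x * u j x * partial j (\<phi> i n) x + \<rho> x * partial j f x * u j x * \<phi> i n x))"
      using Cc_1_mult(2)[OF \<phi>_Cc_1, of f _ i n] f by (simp add: Cc_def algebra_simps del: C_diff.simps)
    also have "\<dots> = ?A (\<lambda>j. partial j (\<phi> i n)) + ?B (\<phi> i n)"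
      using A[OF Cc_1_Lp(2)[OF \<phi>_Cc_1]] B[OF Cc_1_Lp(1)[OF \<phi>_Cc_1]] by (simp add: sum.distrib)
    finally show ?thesis .
  qed
  moreover have "(\<lambda>n. ?A (\<lambda>j. partial j (\<phi> i n)) + ?B (\<phi> i n)) \<longlonglongrightarrow> ?A (U i) + ?B (u i)"
    by (intro tendsto_add tendsto_sum Lconv_integral_mult[OF Lconv_const[OF L(1)] U_conv]
        Lconv_integral_mult[OF Lconv_const[OF L(2)] u_conv]) auto
  ultimately have "?A (U i) + ?B (u i) = 0" by (simp add: LIMSEQ_const_iff)
  moreover have "?B (u i) = (LINT x|lborel. (\<Sum>j\<in>UNIV. \<rho> x * (u i x * u j x) * partial j f x))"
    using B[OF u_Lp] by (subst Bochner_Integration.integral_sum[symmetric]) (auto simp: mult_ac)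
  moreover have "?A (U i) = (LINT x|lborel. (\<Sum>j\<in>UNIV. \<rho> x * u j x * U i j x * f x))"
    using A[OF U_Lp] by (subst Bochner_Integration.integral_sum[symmetric]) (auto simp: mult_ac)
  ultimately show ?thesis by linarith
qed

text \<open>The transposed gradient in the stress acts on a test function as the divergence does.
  The identity holds for the smooth approximations and passes to the L2 limit.\<close>

lemma U_swap:
  assumes f: "f \<in> Cc 1"
  shows "(LINT x|lborel. U j i x * partial j f x) = (LINT x|lborel. U j j x * partial i f x)"
proof -
  have "(\<lambda>n. LINT x|lborel. partial i (\<phi> j n) x * partial j f x) \<longlonglongrightarrow> (LINT x|lborel. U j i x * partial j f x)"
    by (rule Lconv_integral_mult[OF U_conv Lconv_const[OF Cc_1_Lp(2)[OF f, of 2]]]) auto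
  moreover have "(\<lambda>n. LINT x|lborel. partial j (\<phi> j n) x * partial i f x) \<longlonglongrightarrow> (LINT x|lborel. U j j x * partial i f x)"
    by (rule Lconv_integral_mult[OF U_conv Lconv_const[OF Cc_1_Lp(2)[OF f, of 2]]]) auto
  ultimately show ?thesis
    unfolding integral_partial_swap[OF \<phi>_Cc_1 f, of i j _ j] by (rule LIMSEQ_unique)
qed

text \<open>By \<open>U_swap\<close> the transposed gradient contributes another \<mu> times the
  divergence term, and \<mu> - 2 \<mu> / 3 + \<eta> = \<mu> / 3 + \<eta>. The convective term is
  moved to the non-divergence form by the continuity equation, so that the test function enters it
  undifferentiated.\<close>

lemma momentum_pressure:
  assumes f: "f \<in> Cc 1"
  shows "(LINT x|lborel. \<rho> x powr \<gamma> * partial i f x)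
     = \<mu> * (\<Sum>j\<in>UNIV. LINT x|lborel. U i j x * partial j f x) + (\<mu> / 3 + \<eta>) * (LINT x|lborel. D x * partial i f x)
       - (LINT x|lborel. \<rho> x * H i x * f x) + (LINT x|lborel. (\<Sum>j\<in>UNIV. \<rho> x * u j x * U i j x * f x))"
proof -
  note [measurable] = Cc_1_measurable[OF f]
  obtain B where B: "0 \<le> B" "\<And>x. \<bar>partial i f x\<bar> \<le> B"
    using compact_support_bounded[OF Cc_1D(3,5)[OF f]] by blast
  have ip: "integrable lborel (\<lambda>x. \<rho> x powr \<gamma> * partial i f x)"
    by (rule Bochner_Integration.integrable_bound[OF integrable_mult_right[OF pressure_integrable, of B]])
       (use B in \<open>auto simp: abs_mult mult.commute[of B] intro!: mult_left_mono\<close>)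
  have ic: "integrable lborel (\<lambda>x. \<Sum>j\<in>UNIV. \<rho> x * (u i x * u j x) * partial j f x)"
  proof (intro Bochner_Integration.integrable_sum)
    fix j
    show "integrable lborel (\<lambda>x. \<rho> x * (u i x * u j x) * partial j f x)"
      using Holder_1(1)[OF _ _ _ convective_Lp(2)[OF f, of j] u_Lp[of i]] by (simp add: mult_ac)
  qed
  have iU: "integrable lborel (\<lambda>x. V x * partial j f x)" if "V \<in> Lp 2" for V j
    by (rule Holder_1(1)[OF _ _ _ that Cc_1_Lp(2)[OF f, of 2]]) auto
  let ?c = "\<eta> - 2 * \<mu> / 3"
  have "(\<Sum>j\<in>UNIV. (\<mu> * (U i j x + U j i x - (if i = j then 2 / 3 * (\<Sum>k\<in>UNIV. U k k x) else 0))
            + (if i = j then \<eta> * (\<Sum>k\<in>UNIV. U k k x) else 0)) * partial j f x)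
     = \<mu> * (\<Sum>j\<in>UNIV. U i j x * partial j f x) + \<mu> * (\<Sum>j\<in>UNIV. U j i x * partial j f x) + ?c * (D x * partial i f x)" for x
  proof -
    have "(\<mu> * (U i j x + U j i x - (if i = j then 2 / 3 * (\<Sum>k\<in>UNIV. U k k x) else 0))
            + (if i = j then \<eta> * (\<Sum>k\<in>UNIV. U k k x) else 0)) * partial j f x
        = \<mu> * (U i j x * partial j f x) + \<mu> * (U j i x * partial j f x) + (if i = j then ?c * (D x * partial j f x) else 0)" for j
      by (simp add: D_def algebra_simps)
    then show ?thesis by (simp add: sum.distrib sum_distrib_left)
  qed
  then have "(LINT x|lborel. (\<Sum>j\<in>UNIV. (\<mu> * (U i j x + U j i x - (if i = j then 2 / 3 * (\<Sum>k\<in>UNIV. U k k x) else 0))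
            + (if i = j then \<eta> * (\<Sum>k\<in>UNIV. U k k x) else 0)) * partial j f x))
     = (LINT x|lborel. \<mu> * (\<Sum>j\<in>UNIV. U i j x * partial j f x) + \<mu> * (\<Sum>j\<in>UNIV. U j i x * partial j f x) + ?c * (D x * partial i f x))"
    by (simp only:)
  also have "\<dots> = \<mu> * (\<Sum>j\<in>UNIV. LINT x|lborel. U i j x * partial j f x)
      + \<mu> * (\<Sum>j\<in>UNIV. LINT x|lborel. U j i x * partial j f x) + ?c * (LINT x|lborel. D x * partial i f x)"
    using iU[OF U_Lp] iU[OF D_Lp] by simp
  also have "(\<Sum>j\<in>UNIV. LINT x|lborel. U j i x * partial j f x) = (LINT x|lborel. D x * partial i f x)"
    unfolding U_swap[OF f] D_def using iU[OF U_Lp] by (simp add: sum_distrib_right)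
  finally have S: "(LINT x|lborel. (\<Sum>j\<in>UNIV. (\<mu> * (U i j x + U j i x - (if i = j then 2 / 3 * (\<Sum>k\<in>UNIV. U k k x) else 0))
            + (if i = j then \<eta> * (\<Sum>k\<in>UNIV. U k k x) else 0)) * partial j f x))
     = \<mu> * (\<Sum>j\<in>UNIV. LINT x|lborel. U i j x * partial j f x) + (\<mu> / 3 + \<eta>) * (LINT x|lborel. D x * partial i f x)"
    by (simp add: algebra_simps)
  show ?thesis
    using momentum_Cc_1[OF f, of i] ip ic convective_term[OF f, of i] unfolding S by simp
qed

end

section \<open>Improved integrability of the density\<close>

text \<open>Actual norms are used where constants are multiplied and powers of
  \<open>energy k\<close> must be counted; without the root, Hoelder's inequality would carry
  different exponents at each step.\<close>

definition Lnorm :: "real \<Rightarrow> ('a::euclidean_space \<Rightarrow> real) \<Rightarrow> real" where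
  "Lnorm s f = Lpow s f powr (1 / s)"

lemma Lnorm_nonneg [simp]: "0 \<le> Lnorm s f"
  by (simp add: Lnorm_def)

lemma Lnorm_Holder:
  assumes "0 < a" "0 < b" "0 < c" "1 / a + 1 / b = 1 / c" "f \<in> Lp a" "g \<in> Lp b"
  shows "(\<lambda>x. f x * g x) \<in> Lp c" "Lnorm c (\<lambda>x. f x * g x) \<le> Lnorm a f * Lnorm b g"
proof -
  note H = Holder[OF assms]
  show "(\<lambda>x. f x * g x) \<in> Lp c" by (rule H(1))
  have "Lnorm c (\<lambda>x. f x * g x) \<le> (Lpow a f powr (c / a) * Lpow b g powr (c / b)) powr (1 / c)"
    unfolding Lnorm_def using H(2) assms by (intro powr_mono2) auto
  also have "\<dots> = Lnorm a f * Lnorm b g"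
    using assms by (simp add: Lnorm_def powr_mult powr_powr)
  finally show "Lnorm c (\<lambda>x. f x * g x) \<le> Lnorm a f * Lnorm b g" .
qed

lemma integral_Lnorm_bound:
  assumes "0 < a" "0 < b" "1 / a + 1 / b = 1" "f \<in> Lp a" "g \<in> Lp b"
  shows "integrable lborel (\<lambda>x. f x * g x)" "(LINT x|lborel. \<bar>f x * g x\<bar>) \<le> Lnorm a f * Lnorm b g"
    "\<bar>LINT x|lborel. f x * g x\<bar> \<le> Lnorm a f * Lnorm b g"
  using Holder_1[OF assms] by (simp_all add: Lnorm_def)

lemma Lnorm_le_I:
  assumes "Lpow s f \<le> c powr s" "0 < s" "0 \<le> c"
  shows "Lnorm s f \<le> c"
proof -
  have "Lnorm s f \<le> (c powr s) powr (1 / s)"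
    unfolding Lnorm_def using assms by (intro powr_mono2) auto
  then show ?thesis using assms by (simp add: powr_powr)
qed

text \<open>The constant of \<open>Sobolev\<close> is 4096 = 4^6, hence the factor 4 after the sixth
  root.\<close>

lemma Sobolev_Lnorm:
  fixes f :: "real^3 \<Rightarrow> real"
  assumes f: "f \<in> Cc 1" and b: "0 \<le> b" "\<And>j. Lpow 2 (partial j f) \<le> b\<^sup>2"
  shows "Lnorm 6 f \<le> 4 * b"
proof (rule Lnorm_le_I)
  have "Lpow 6 f \<le> 4096 * (\<Prod>i\<in>(UNIV::3 set). Lpow 2 (partial i f))" by (rule Sobolev[OF f])
  also have "\<dots> \<le> 4096 * (\<Prod>i\<in>(UNIV::3 set). b\<^sup>2)"
    using b by (intro mult_left_mono prod_mono) auto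
  also have "\<dots> = (4 * b) ^ 6" by (simp add: power_mult_distrib power_mult[symmetric])
  also have "\<dots> = (4 * b) powr 6" using b by (simp add: powr_numeral)
  finally show "Lpow 6 f \<le> (4 * b) powr 6" .
qed (use b in auto)

context steady_flow
begin

lemma \<rho>H_Lp: "(\<lambda>x. \<rho> x * H i x) \<in> Lp (6 / 5)"
  by (rule Holder(1)[OF _ _ _ _ \<rho>_Lp H_Lp]) (use \<gamma> q_bounds in auto)

section \<open>Splitting the density at the truncation level\<close>

definition trunc :: "real \<Rightarrow> real^3 \<Rightarrow> real" where "trunc k x = min (\<rho> x) k"

text \<open>The summand \<open>1\<close> keeps powers of \<open>energy k\<close> monotone in the exponent.\<close>

definition energy :: "real \<Rightarrow> real" where
  "energy k = 1 + (LINT x|lborel. \<rho> x powr \<gamma>) + (LINT x|lborel. \<rho> x powr \<gamma> * trunc k x powr \<gamma>)"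

lemma trunc_measurable [measurable]: "trunc k \<in> borel_measurable borel"
  unfolding trunc_def[abs_def] by measurable

lemma trunc_bounds: "0 \<le> k \<Longrightarrow> 0 \<le> trunc k x" "trunc k x \<le> \<rho> x" "trunc k x \<le> k"
  using \<rho>_nonneg[of x] by (auto simp: trunc_def)

lemma trunc_integrable:
  assumes k: "0 \<le> k"
  shows "integrable lborel (\<lambda>x. \<rho> x powr \<gamma> * trunc k x powr \<gamma>)"
proof (rule Bochner_Integration.integrable_bound[OF integrable_mult_left[OF pressure_integrable, of "k powr \<gamma>"]])
  show "AE x in lborel. norm (\<rho> x powr \<gamma> * trunc k x powr \<gamma>) \<le> norm (\<rho> x powr \<gamma> * k powr \<gamma>)"
    using trunc_bounds(1)[OF k] trunc_bounds(3)[of k] \<gamma> by (auto simp: abs_mult intro!: AE_I2 mult_left_mono powr_mono2)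
qed measurable

lemma energy_ge_1: "1 \<le> energy k"
  unfolding energy_def by (simp add: add_nonneg_nonneg)

text \<open>On \<open>\<rho> \<le> k\<close> the convective term is controlled by the \<open>L\<^sup>6\<close> norm of the truncated density; on \<open>\<rho> > k\<close> a Chebyshev
  bound gains the power of \<open>k\<close> that the supremum of the test function loses.\<close>

lemma low_density:
  assumes k: "1 \<le> k"
  shows "(\<lambda>x. \<rho> x * indicator {x. \<rho> x \<le> k} x) \<in> Lp 6" "Lnorm 6 (\<lambda>x. \<rho> x * indicator {x. \<rho> x \<le> k} x) \<le> energy k powr (1 / 6)"
proof -
  let ?M = "\<lambda>x. \<rho> x * indicator {x. \<rho> x \<le> k} x"
  have [measurable]: "?M \<in> borel_measurable borel" by measurable
  have le: "\<bar>?M x\<bar> powr 6 \<le> \<rho> x powr \<gamma> + \<rho> x powr \<gamma> * trunc k x powr \<gamma>" for x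
  proof (cases "\<rho> x \<le> k")
    case True
    then have t: "trunc k x = \<rho> x" by (simp add: trunc_def)
    show ?thesis
    \<comment> \<open>Powers decrease in the exponent below 1 and increase above it: the first case
      uses \<gamma> < 6, the second 6 \<le> 2 \<gamma>.\<close>
    proof (cases "\<rho> x \<le> 1")
      case le1: True
      have "\<rho> x powr 6 \<le> \<rho> x powr \<gamma>" using le1 \<rho>_nonneg[of x] \<gamma> by (intro powr_mono') auto
      then show ?thesis using True \<rho>_nonneg[of x] by (simp add: add_increasing2)
    next
      case False
      then have "\<rho> x powr 6 \<le> \<rho> x powr (\<gamma> + \<gamma>)" using \<gamma> by (intro powr_mono) auto
      then have "\<rho> x powr 6 \<le> \<rho> x powr \<gamma> * \<rho> x powr \<gamma>" by (simp only: powr_add)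
      then show ?thesis using True \<rho>_nonneg[of x] unfolding t by (simp add: add_increasing)
    qed
  next
    case False
    then show ?thesis by simp
  qed
  have i: "integrable lborel (\<lambda>x. \<rho> x powr \<gamma> + \<rho> x powr \<gamma> * trunc k x powr \<gamma>)"
    using trunc_integrable[of k] k pressure_integrable by auto
  show L: "?M \<in> Lp 6"
  proof (rule LpI, measurable, rule Bochner_Integration.integrable_bound[OF i], measurable, rule AE_I2)
    fix x
    show "norm (\<bar>?M x\<bar> powr 6) \<le> norm (\<rho> x powr \<gamma> + \<rho> x powr \<gamma> * trunc k x powr \<gamma>)"
      using order_trans[OF le abs_ge_self] by (simp only: real_norm_def abs_of_nonneg powr_ge_zero)
  qed
  have "Lpow 6 ?M \<le> (LINT x|lborel. \<rho> x powr \<gamma> + \<rho> x powr \<gamma> * trunc k x powr \<gamma>)"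
    unfolding Lpow_def by (rule integral_mono[OF Lp_integrable[OF L] i le])
  also have "\<dots> \<le> energy k"
    using trunc_integrable[of k] k pressure_integrable by (simp add: energy_def)
  also have "\<dots> = (energy k powr (1 / 6)) powr 6" using energy_ge_1[of k] by (simp add: powr_powr)
  finally show "Lnorm 6 ?M \<le> energy k powr (1 / 6)" by (intro Lnorm_le_I) auto
qed

text \<open>Since 3 - \<gamma> \<le> 0, on the set \<rho> > k the power \<rho>^(3 - \<gamma>) is at
  most k^(3 - \<gamma>). There the truncated density equals \<open>k\<close>, so a factor k^\<gamma>
  is exchanged for \<open>trunc k x powr \<gamma>\<close> at the price of k^(-\<gamma>).\<close>

lemma high_density:
  assumes k: "1 \<le> k"
  shows "(\<lambda>x. \<rho> x * indicator {x. k < \<rho> x} x) \<in> Lp 3"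
    "Lnorm 3 (\<lambda>x. \<rho> x * indicator {x. k < \<rho> x} x) \<le> (k powr (3 - 2 * \<gamma>) * energy k) powr (1 / 3)"
proof -
  let ?N = "\<lambda>x. \<rho> x * indicator {x. k < \<rho> x} x"
  have [measurable]: "?N \<in> borel_measurable borel" by measurable
  have le: "\<bar>?N x\<bar> powr 3 \<le> k powr (3 - 2 * \<gamma>) * (\<rho> x powr \<gamma> * trunc k x powr \<gamma>)" for x
  proof (cases "k < \<rho> x")
    case True
    then have t: "trunc k x = k" and pos: "0 < \<rho> x" using k by (auto simp: trunc_def)
    have "\<rho> x powr 3 = \<rho> x powr (3 - \<gamma>) * \<rho> x powr \<gamma>" using pos by (simp add: powr_add[symmetric])
    also have "\<dots> \<le> k powr (3 - \<gamma>) * \<rho> x powr \<gamma>"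
      using True k \<gamma> by (intro mult_right_mono powr_mono2') auto
    also have "k powr (3 - \<gamma>) = k powr ((3 - 2 * \<gamma>) + \<gamma>)" by simp
    also have "\<dots> = k powr (3 - 2 * \<gamma>) * k powr \<gamma>" by (simp only: powr_add)
    finally show ?thesis using True pos unfolding t by (simp add: mult_ac)
  next
    case False
    then show ?thesis by simp
  qed
  have i: "integrable lborel (\<lambda>x. k powr (3 - 2 * \<gamma>) * (\<rho> x powr \<gamma> * trunc k x powr \<gamma>))"
    using trunc_integrable[of k] k by (intro integrable_mult_right) auto
  show L: "?N \<in> Lp 3"
  proof (rule LpI, measurable, rule Bochner_Integration.integrable_bound[OF i], measurable, rule AE_I2)
    fix x
    show "norm (\<bar>?N x\<bar> powr 3) \<le> norm (k powr (3 - 2 * \<gamma>) * (\<rho> x powr \<gamma> * trunc k x powr \<gamma>))"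
      using order_trans[OF le abs_ge_self] by (simp only: real_norm_def abs_of_nonneg powr_ge_zero)
  qed
  have "Lpow 3 ?N \<le> (LINT x|lborel. k powr (3 - 2 * \<gamma>) * (\<rho> x powr \<gamma> * trunc k x powr \<gamma>))"
    unfolding Lpow_def by (rule integral_mono[OF Lp_integrable[OF L] i le])
  also have "\<dots> = k powr (3 - 2 * \<gamma>) * (LINT x|lborel. \<rho> x powr \<gamma> * trunc k x powr \<gamma>)" by simp
  also have "\<dots> \<le> k powr (3 - 2 * \<gamma>) * energy k"
    by (intro mult_left_mono) (auto simp: energy_def add_nonneg_nonneg)
  finally show "Lnorm 3 ?N \<le> (k powr (3 - 2 * \<gamma>) * energy k) powr (1 / 3)"
    unfolding Lnorm_def by (intro powr_mono2) auto
qed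

text \<open>Low densities use 1/6 + 1/6 + 1/2 + 1/6 = 1 with the test function in L6. High densities
  are only in L3, and 1/3 + 1/6 + 1/2 = 1 leaves the supremum \<open>m\<close> for the test
  function.\<close>

lemma convective_bound:
  assumes f: "f \<in> Cc 1" and b: "Lnorm 6 f \<le> 4 * b" and m: "\<And>x. \<bar>f x\<bar> \<le> m" and k: "1 \<le> k"
  shows "(LINT x|lborel. \<rho> x * u j x * U i j x * f x)
    \<le> Lnorm 6 (u j) * Lnorm 2 (U i j) * (4 * (b * energy k powr (1 / 6)) + m * (k powr (3 - 2 * \<gamma>) * energy k) powr (1 / 3))"
proof -
  let ?M = "\<lambda>x. \<rho> x * indicator {x. \<rho> x \<le> k} x" and ?N = "\<lambda>x. \<rho> x * indicator {x. k < \<rho> x} x"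
  note Mb = low_density[OF k] and Nb = high_density[OF k]
  note [measurable] = Cc_1_measurable[OF f]
  have m0: "0 \<le> m" using m[of 0] by linarith
  have Mu: "(\<lambda>x. ?M x * u j x) \<in> Lp 3" "Lnorm 3 (\<lambda>x. ?M x * u j x) \<le> Lnorm 6 ?M * Lnorm 6 (u j)"
    by (rule Lnorm_Holder[OF _ _ _ _ Mb(1) u_Lp]; simp)+
  have Uf: "(\<lambda>x. U i j x * f x) \<in> Lp (3 / 2)" "Lnorm (3 / 2) (\<lambda>x. U i j x * f x) \<le> Lnorm 2 (U i j) * Lnorm 6 f"
    by (rule Lnorm_Holder[OF _ _ _ _ U_Lp Cc_1_Lp(1)[OF f, of 6]]; simp)+
  have iM: "integrable lborel (\<lambda>x. (?M x * u j x) * (U i j x * f x))"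
    and "\<bar>LINT x|lborel. (?M x * u j x) * (U i j x * f x)\<bar> \<le> Lnorm 3 (\<lambda>x. ?M x * u j x) * Lnorm (3 / 2) (\<lambda>x. U i j x * f x)"
    by (rule integral_Lnorm_bound[OF _ _ _ Mu(1) Uf(1)]; simp)+
  note this(2)
  also have "Lnorm 3 (\<lambda>x. ?M x * u j x) * Lnorm (3 / 2) (\<lambda>x. U i j x * f x)
     \<le> (Lnorm 6 ?M * Lnorm 6 (u j)) * (Lnorm 2 (U i j) * Lnorm 6 f)"
    by (intro mult_mono Mu Uf) auto
  also have "\<dots> \<le> (energy k powr (1 / 6) * Lnorm 6 (u j)) * (Lnorm 2 (U i j) * (4 * b))"
    by (intro mult_mono Mb(2) b order_refl) auto
  finally have M: "\<bar>LINT x|lborel. (?M x * u j x) * (U i j x * f x)\<bar> \<le> (energy k powr (1 / 6) * Lnorm 6 (u j)) * (Lnorm 2 (U i j) * (4 * b))" .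
  have Nu: "(\<lambda>x. ?N x * u j x) \<in> Lp 2" "Lnorm 2 (\<lambda>x. ?N x * u j x) \<le> Lnorm 3 ?N * Lnorm 6 (u j)"
    by (rule Lnorm_Holder[OF _ _ _ _ Nb(1) u_Lp]; simp)+
  have iNU: "integrable lborel (\<lambda>x. (?N x * u j x) * U i j x)"
    and NU: "(LINT x|lborel. \<bar>(?N x * u j x) * U i j x\<bar>) \<le> Lnorm 2 (\<lambda>x. ?N x * u j x) * Lnorm 2 (U i j)"
    by (rule integral_Lnorm_bound[OF _ _ _ Nu(1) U_Lp]; simp)+
  have mf: "\<bar>(?N x * u j x) * U i j x * f x\<bar> \<le> m * \<bar>(?N x * u j x) * U i j x\<bar>" for x
    using mult_left_mono[OF m[of x] abs_ge_zero[of "(?N x * u j x) * U i j x"]] by (simp add: abs_mult mult_ac)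
  have imNU: "integrable lborel (\<lambda>x. m * \<bar>(?N x * u j x) * U i j x\<bar>)"
    by (intro integrable_mult_right integrable_abs iNU)
  have iN: "integrable lborel (\<lambda>x. (?N x * u j x) * U i j x * f x)"
  proof (rule Bochner_Integration.integrable_bound[OF imNU], measurable, rule AE_I2)
    show "norm ((?N x * u j x) * U i j x * f x) \<le> norm (m * \<bar>(?N x * u j x) * U i j x\<bar>)" for x
      using order_trans[OF mf abs_ge_self] by (simp only: real_norm_def)
  qed
  have "(LINT x|lborel. (?N x * u j x) * U i j x * f x) \<le> (LINT x|lborel. m * \<bar>(?N x * u j x) * U i j x\<bar>)"
    by (rule integral_mono[OF iN imNU order_trans[OF abs_ge_self mf]])
  also have "\<dots> = m * (LINT x|lborel. \<bar>(?N x * u j x) * U i j x\<bar>)" by (rule integral_mult_right_zero)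
  also have "\<dots> \<le> m * (Lnorm 3 ?N * Lnorm 6 (u j) * Lnorm 2 (U i j))"
    by (intro mult_left_mono m0 order_trans[OF NU] mult_right_mono Nu(2)) auto
  also have "\<dots> \<le> m * ((k powr (3 - 2 * \<gamma>) * energy k) powr (1 / 3) * Lnorm 6 (u j) * Lnorm 2 (U i j))"
    by (intro mult_left_mono m0 mult_right_mono Nb(2)) auto
  finally have N: "(LINT x|lborel. (?N x * u j x) * U i j x * f x)
      \<le> m * ((k powr (3 - 2 * \<gamma>) * energy k) powr (1 / 3) * Lnorm 6 (u j) * Lnorm 2 (U i j))" .
  have "(LINT x|lborel. \<rho> x * u j x * U i j x * f x)
     = (LINT x|lborel. (?M x * u j x) * (U i j x * f x) + (?N x * u j x) * U i j x * f x)"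
    by (intro Bochner_Integration.integral_cong refl) (auto simp: indicator_def)
  also have "\<dots> = (LINT x|lborel. (?M x * u j x) * (U i j x * f x)) + (LINT x|lborel. (?N x * u j x) * U i j x * f x)"
    by (rule Bochner_Integration.integral_add[OF iM iN])
  also have "\<dots> \<le> (energy k powr (1 / 6) * Lnorm 6 (u j)) * (Lnorm 2 (U i j) * (4 * b))
      + m * ((k powr (3 - 2 * \<gamma>) * energy k) powr (1 / 3) * Lnorm 6 (u j) * Lnorm 2 (U i j))"
    using M N by linarith
  finally show ?thesis by (simp add: algebra_simps)
qed

text \<open>Collects the norms of the data that multiply the size of the test field; neither the
  truncation level nor the regularisation occurs in it.\<close>

definition test_const :: real where
  "test_const = (\<Sum>i\<in>UNIV. \<mu> * (\<Sum>j\<in>UNIV. Lnorm 2 (U i j)) + (\<mu> / 3 + \<eta>) * Lnorm 2 D + 4 * Lnorm (6 / 5) (\<lambda>x. \<rho> x * H i x)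
      + 4 * (\<Sum>j\<in>UNIV. Lnorm 6 (u j) * Lnorm 2 (U i j)))"

lemma test_const_nonneg: "0 \<le> test_const"
  unfolding test_const_def using \<mu> \<eta> by (intro sum_nonneg add_nonneg_nonneg mult_nonneg_nonneg) auto

text \<open>The viscous and force terms are linear in the gradient size \<open>b\<close>, the
  convective term is linear in the two quantities abbreviated by \<open>e\<close> and
  \<open>h\<close>; each term is majorised by its coefficient times b + e + h.\<close>

lemma pressure_test_bound:
  assumes f: "\<And>i. f i \<in> Cc 1" and b: "0 \<le> b" "\<And>i j. Lpow 2 (partial j (f i)) \<le> b\<^sup>2"
    and m: "\<And>i x. \<bar>f i x\<bar> \<le> m" and k: "1 \<le> k"
  shows "(\<Sum>i\<in>UNIV. LINT x|lborel. \<rho> x powr \<gamma> * partial i (f i) x)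
     \<le> test_const * (b + b * energy k powr (1 / 6) + m * (k powr (3 - 2 * \<gamma>) * energy k) powr (1 / 3))"
proof -
  define e where "e = b * energy k powr (1 / 6)"
  define h where "h = m * (k powr (3 - 2 * \<gamma>) * energy k) powr (1 / 3)"
  have m0: "0 \<le> m" using m[of 0 0] by linarith
  have eh: "0 \<le> e" "0 \<le> h" using b m0 by (auto simp: e_def h_def)
  have f6: "Lnorm 6 (f i) \<le> 4 * b" for i by (rule Sobolev_Lnorm[OF f b])
  have f2: "Lnorm 2 (partial j (f i)) \<le> b" for i j
    using b by (intro Lnorm_le_I) (auto simp: powr_numeral)
  have V: "\<bar>LINT x|lborel. V x * partial j (f i) x\<bar> \<le> Lnorm 2 V * b" if V: "V \<in> Lp 2" for V i j
  proof -
    have "\<bar>LINT x|lborel. V x * partial j (f i) x\<bar> \<le> Lnorm 2 V * Lnorm 2 (partial j (f i))"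
      by (rule integral_Lnorm_bound(3)[OF _ _ _ V Cc_1_Lp(2)[OF f, of 2]]) auto
    also have "\<dots> \<le> Lnorm 2 V * b" by (intro mult_left_mono f2) auto
    finally show ?thesis .
  qed
  have Hb: "\<bar>LINT x|lborel. \<rho> x * H i x * f i x\<bar> \<le> Lnorm (6 / 5) (\<lambda>x. \<rho> x * H i x) * (4 * b)" for i
  proof -
    have "\<bar>LINT x|lborel. \<rho> x * H i x * f i x\<bar> \<le> Lnorm (6 / 5) (\<lambda>x. \<rho> x * H i x) * Lnorm 6 (f i)"
      by (rule integral_Lnorm_bound(3)[OF _ _ _ \<rho>H_Lp Cc_1_Lp(1)[OF f, of 6]]) auto
    also have "\<dots> \<le> Lnorm (6 / 5) (\<lambda>x. \<rho> x * H i x) * (4 * b)" by (intro mult_left_mono f6) auto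
    finally show ?thesis .
  qed
  have "(LINT x|lborel. \<rho> x powr \<gamma> * partial i (f i) x)
     \<le> (\<mu> * (\<Sum>j\<in>UNIV. Lnorm 2 (U i j)) + (\<mu> / 3 + \<eta>) * Lnorm 2 D + 4 * Lnorm (6 / 5) (\<lambda>x. \<rho> x * H i x)
      + 4 * (\<Sum>j\<in>UNIV. Lnorm 6 (u j) * Lnorm 2 (U i j))) * (b + e + h)" for i
  proof -
    let ?S = "\<Sum>j\<in>UNIV. Lnorm 6 (u j) * Lnorm 2 (U i j)"
    have S0: "0 \<le> ?S" by (intro sum_nonneg) auto
    have "integrable lborel (\<lambda>x. \<rho> x * u j x * U i j x * f i x)" for j
      using Holder_1(1)[OF _ _ _ convective_Lp(1)[OF f[of i], of j] U_Lp[of i j]] by (simp add: mult_ac)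
    then have "(LINT x|lborel. (\<Sum>j\<in>UNIV. \<rho> x * u j x * U i j x * f i x)) = (\<Sum>j\<in>UNIV. LINT x|lborel. \<rho> x * u j x * U i j x * f i x)"
      by (rule Bochner_Integration.integral_sum)
    also have "\<dots> \<le> (\<Sum>j\<in>UNIV. Lnorm 6 (u j) * Lnorm 2 (U i j) * (4 * e + h))"
      unfolding e_def h_def by (intro sum_mono convective_bound[OF f f6 m k])
    also have "\<dots> = ?S * (4 * e + h)" by (simp add: sum_distrib_right)
    also have "\<dots> \<le> 4 * ?S * (b + e + h)"
      using mult_nonneg_nonneg[OF S0 eh(2)] mult_nonneg_nonneg[OF S0 b(1)] by (simp add: algebra_simps)
    finally have c: "(LINT x|lborel. (\<Sum>j\<in>UNIV. \<rho> x * u j x * U i j x * f i x)) \<le> 4 * ?S * (b + e + h)" .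
    have "\<mu> * (\<Sum>j\<in>UNIV. LINT x|lborel. U i j x * partial j (f i) x) \<le> \<mu> * (\<Sum>j\<in>UNIV. Lnorm 2 (U i j) * b)"
      using V[OF U_Lp] \<mu> by (intro mult_left_mono sum_mono) (auto intro: order_trans[OF abs_ge_self])
    also have "\<dots> = \<mu> * (\<Sum>j\<in>UNIV. Lnorm 2 (U i j)) * b" by (simp add: sum_distrib_right)
    also have "\<dots> \<le> \<mu> * (\<Sum>j\<in>UNIV. Lnorm 2 (U i j)) * (b + e + h)"
      using eh \<mu> by (intro mult_left_mono) (auto intro!: mult_nonneg_nonneg sum_nonneg)
    finally have u: "\<mu> * (\<Sum>j\<in>UNIV. LINT x|lborel. U i j x * partial j (f i) x) \<le> \<mu> * (\<Sum>j\<in>UNIV. Lnorm 2 (U i j)) * (b + e + h)" .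
    have "(\<mu> / 3 + \<eta>) * (LINT x|lborel. D x * partial i (f i) x) \<le> (\<mu> / 3 + \<eta>) * (Lnorm 2 D * b)"
      using V[OF D_Lp] \<mu> \<eta> by (intro mult_left_mono) (auto intro: order_trans[OF abs_ge_self])
    also have "\<dots> \<le> (\<mu> / 3 + \<eta>) * (Lnorm 2 D * (b + e + h))"
      using eh \<mu> \<eta> by (intro mult_left_mono) auto
    finally have d: "(\<mu> / 3 + \<eta>) * (LINT x|lborel. D x * partial i (f i) x) \<le> (\<mu> / 3 + \<eta>) * (Lnorm 2 D * (b + e + h))" .
    have "- (LINT x|lborel. \<rho> x * H i x * f i x) \<le> Lnorm (6 / 5) (\<lambda>x. \<rho> x * H i x) * (4 * b)"
      using Hb[of i] by linarith
    also have "\<dots> \<le> Lnorm (6 / 5) (\<lambda>x. \<rho> x * H i x) * (4 * (b + e + h))"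
      using eh by (intro mult_left_mono) auto
    finally have hh: "- (LINT x|lborel. \<rho> x * H i x * f i x) \<le> Lnorm (6 / 5) (\<lambda>x. \<rho> x * H i x) * (4 * (b + e + h))" .
    have "\<mu> * (\<Sum>j\<in>UNIV. Lnorm 2 (U i j)) * (b + e + h) + (\<mu> / 3 + \<eta>) * (Lnorm 2 D * (b + e + h))
         + Lnorm (6 / 5) (\<lambda>x. \<rho> x * H i x) * (4 * (b + e + h)) + 4 * ?S * (b + e + h)
       = (\<mu> * (\<Sum>j\<in>UNIV. Lnorm 2 (U i j)) + (\<mu> / 3 + \<eta>) * Lnorm 2 D + 4 * Lnorm (6 / 5) (\<lambda>x. \<rho> x * H i x) + 4 * ?S) * (b + e + h)"
    proof -
      have "a * w + c * (d * w) + n * (4 * w) + 4 * s * w = (a + c * d + 4 * n + 4 * s) * w" for a c d n s w :: real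
        by (simp add: algebra_simps)
      then show ?thesis .
    qed
    then show ?thesis
      unfolding momentum_pressure[OF f[of i], of i] using c u d hh by linarith
  qed
  then have "(\<Sum>i\<in>UNIV. LINT x|lborel. \<rho> x powr \<gamma> * partial i (f i) x)
     \<le> (\<Sum>i\<in>UNIV. (\<mu> * (\<Sum>j\<in>UNIV. Lnorm 2 (U i j)) + (\<mu> / 3 + \<eta>) * Lnorm 2 D + 4 * Lnorm (6 / 5) (\<lambda>x. \<rho> x * H i x)
      + 4 * (\<Sum>j\<in>UNIV. Lnorm 6 (u j) * Lnorm 2 (U i j))) * (b + e + h))"
    by (rule sum_mono)
  also have "\<dots> = test_const * (b + e + h)"
    unfolding test_const_def by (rule sum_distrib_right[symmetric])
  finally show ?thesis by (simp only: e_def h_def)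
qed


section \<open>The test field and the bound uniform in the truncation\<close>

definition truncp :: "real \<Rightarrow> real^3 \<Rightarrow> real" where "truncp k x = trunc k x powr \<gamma>"

lemma truncp_measurable [measurable]: "truncp k \<in> borel_measurable borel"
  unfolding truncp_def[abs_def] by measurable

lemma truncp_bounds:
  assumes k: "0 \<le> k"
  shows "0 \<le> truncp k x" "truncp k x \<le> k powr \<gamma>" "truncp k x \<le> \<rho> x powr \<gamma>"
  using trunc_bounds(1)[OF k, of x] trunc_bounds(2)[of k x] trunc_bounds(3)[of k x] \<gamma>
  by (auto simp: truncp_def intro!: powr_mono2)

lemma truncp_Lp:
  assumes k: "0 \<le> k"
  shows "integrable lborel (truncp k)" "truncp k \<in> Lp 2" "Lpow 2 (truncp k) \<le> energy k"
proof -
  show "integrable lborel (truncp k)"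
    by (rule Bochner_Integration.integrable_bound[OF pressure_integrable])
       (use truncp_bounds(1,3)[OF k] in auto)
  have le: "(truncp k x)\<^sup>2 \<le> \<rho> x powr \<gamma> * trunc k x powr \<gamma>" for x
    using mult_right_mono[OF truncp_bounds(3)[OF k] truncp_bounds(1)[OF k], of x x] by (simp add: power2_eq_square truncp_def)
  have i: "integrable lborel (\<lambda>x. (truncp k x)\<^sup>2)"
    by (rule Bochner_Integration.integrable_bound[OF trunc_integrable[OF k]])
       (use order_trans[OF le abs_ge_self] in auto)
  then show "truncp k \<in> Lp 2" by (simp add: Lp_2_iff)
  have "Lpow 2 (truncp k) \<le> (LINT x|lborel. \<rho> x powr \<gamma> * trunc k x powr \<gamma>)"
    unfolding Lpow_2 by (rule integral_mono[OF i trunc_integrable[OF k] le])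
  also have "\<dots> \<le> energy k" by (simp add: energy_def add_nonneg_nonneg)
  finally show "Lpow 2 (truncp k) \<le> energy k" .
qed

text \<open>A right inverse of the divergence up to mollification: the field is curl free and its
  divergence is the truncated pressure mollified at scale \<delta>. Tested against the pressure, it
  produces the quantity in \<open>energy k\<close>.\<close>

definition pot :: "real \<Rightarrow> real \<Rightarrow> 3 \<Rightarrow> real^3 \<Rightarrow> real" where
  "pot k \<delta> i x = (1 / newton_mass) * conv (newton_grad \<delta> i) (truncp k) x"

lemma pot_C_diff:
  assumes k: "0 \<le> k" and d: "0 < \<delta>"
  shows "C_diff 1 (pot k \<delta> i)" "partial j (pot k \<delta> i) x = (1 / newton_mass) * conv (newton_hess \<delta> i j) (truncp k) x"
proof -
  have dom: "conv_dom (newton_grad \<delta> i) (truncp k)"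
    by (rule conv_dom_bounded[OF newton_grad_bounded[OF d] truncp_Lp(1)[OF k]])
  have dom': "conv_dom (partial j (newton_grad \<delta> i)) (truncp k)" for j
    unfolding newton_grad_partial[OF d] by (rule conv_dom_bounded[OF newton_hess_bounded[OF d] truncp_Lp(1)[OF k]])
  note P = conv_partial[OF newton_grad_C_diff[OF d] truncp_measurable dom dom', unfolded newton_grad_partial[OF d]]
  show "C_diff 1 (pot k \<delta> i)" unfolding pot_def[abs_def] by (rule C_diff_cmult[OF P(2)])
  show "partial j (pot k \<delta> i) x = (1 / newton_mass) * conv (newton_hess \<delta> i j) (truncp k) x"
    unfolding pot_def[abs_def] using P(2) by (subst partial_cmult) (auto simp: P(1))
qed

lemma pot_div:
  assumes k: "0 \<le> k" and d: "0 < \<delta>"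
  shows "(\<Sum>i\<in>UNIV. partial i (pot k \<delta> i) x) = moll newton_moll \<delta> (truncp k) x"
proof -
  have [measurable]: "newton_hess \<delta> i j \<in> borel_measurable borel" for i j
    by (rule borel_measurable_continuous_onI[OF newton_hess_continuous[OF d]])
  have i: "integrable lborel (\<lambda>y. newton_hess \<delta> i i (x - y) * truncp k y)" for i
    by (rule conv_integrable[OF _ _ conv_dom_bounded[OF newton_hess_bounded[OF d] truncp_Lp(1)[OF k]]]) measurable
  have "moll newton_moll \<delta> (truncp k) x = conv (\<lambda>w. (1 / \<bar>\<delta>\<bar> ^ 3) * newton_moll (0 + (- 1 / \<delta>) *\<^sub>R w)) (truncp k) x"
    by (rule moll_eq_conv) (use d in auto)
  also have "\<dots> = (LINT y|lborel. (1 / newton_mass) * (\<Sum>i\<in>UNIV. newton_hess \<delta> i i (x - y) * truncp k y))"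
    unfolding newton_moll_scaled[OF d] conv_def by (simp add: sum_distrib_right mult.assoc)
  also have "\<dots> = (1 / newton_mass) * (\<Sum>i\<in>UNIV. conv (newton_hess \<delta> i i) (truncp k) x)"
    unfolding conv_def using i by (subst integral_mult_right_zero) simp
  also have "\<dots> = (\<Sum>i\<in>UNIV. partial i (pot k \<delta> i) x)"
    unfolding pot_C_diff(2)[OF assms] by (simp add: sum_distrib_left)
  finally show ?thesis by simp
qed

text \<open>The kernel decays like |x|^(-2) and so is square integrable in three dimensions, while
  the truncated pressure is integrable. This is what makes the cutoff errors vanish as the cutoff
  widens.\<close>

lemma pot_Lp:
  assumes k: "0 \<le> k" and d: "0 < \<delta>"
  shows "pot k \<delta> i \<in> Lp 2"
  unfolding pot_def[abs_def]
proof (rule Lp_cmult[OF conv_Lp_2[OF _ truncp_Lp(1)[OF k] truncp_bounds(1)[OF k]]])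
  have [measurable]: "newton_grad \<delta> i \<in> borel_measurable borel"
    by (rule borel_measurable_continuous_onI[OF newton_grad_continuous[OF d]])
  have le: "(newton_grad \<delta> i x)\<^sup>2 \<le> nwt \<delta> x powr (- 2)" for x
  proof -
    have "\<bar>newton_grad \<delta> i x\<bar>\<^sup>2 \<le> (nwt \<delta> x powr (- 1))\<^sup>2"
      by (rule power_mono[OF newton_grad_le[OF d]]) simp
    also have "(nwt \<delta> x powr (- 1))\<^sup>2 = nwt \<delta> x powr (- 1 + - 1)" by (simp only: power2_eq_square powr_add)
    finally show ?thesis by simp
  qed
  have "integrable lborel (\<lambda>x. (newton_grad \<delta> i x)\<^sup>2)"
    by (rule Bochner_Integration.integrable_bound[OF nwt_powr_integrable[OF d, of 2]])
       (use le in auto)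
  then show "newton_grad \<delta> i \<in> Lp 2" by (simp add: Lp_2_iff)
qed

definition pot_const :: real where "pot_const = (1 / newton_mass) * (2 * vball + 4 * sqrt vball)"

lemma pot_const_nonneg: "0 \<le> pot_const"
  unfolding pot_const_def using newton_mass_pos by simp

lemma pot_bound:
  assumes k: "1 \<le> k" and d: "0 < \<delta>"
  shows "\<bar>pot k \<delta> i x\<bar> \<le> pot_const * (energy k powr (1 / 3) * k powr (\<gamma> / 3))"
proof -
  have k0: "0 \<le> k" "0 < k" using k by auto
  define E where "E = energy k"
  have E: "1 \<le> E" "0 < E" using energy_ge_1[of k] by (auto simp: E_def)
  \<comment> \<open>Balances the two terms of the potential bound, k^\<gamma> T against E^(1/2)
    T^(-1/2); both become E^(1/3) k^(\<gamma>/3).\<close>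
  define T where "T = E powr (1 / 3) * k powr (- 2 * \<gamma> / 3)"
  have T: "0 < T" using E k0 by (simp add: T_def)
  have t1: "k powr \<gamma> * T = E powr (1 / 3) * k powr (\<gamma> / 3)"
  proof -
    have "k powr \<gamma> * T = E powr (1 / 3) * (k powr \<gamma> * k powr (- 2 * \<gamma> / 3))" by (simp add: T_def)
    also have "k powr \<gamma> * k powr (- 2 * \<gamma> / 3) = k powr (\<gamma> + - 2 * \<gamma> / 3)" by (simp only: powr_add)
    also have "\<gamma> + - 2 * \<gamma> / 3 = \<gamma> / 3" by simp
    finally show ?thesis .
  qed
  have t2: "E powr (1 / 2) * T powr (- 1 / 2) = E powr (1 / 3) * k powr (\<gamma> / 3)"
  proof -
    have "T powr (- 1 / 2) = E powr (1 / 3 * (- 1 / 2)) * k powr (- 2 * \<gamma> / 3 * (- 1 / 2))"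
      unfolding T_def by (simp only: powr_mult powr_powr)
    then have "E powr (1 / 2) * T powr (- 1 / 2) = E powr (1 / 2 + 1 / 3 * (- 1 / 2)) * k powr (- 2 * \<gamma> / 3 * (- 1 / 2))"
      by (simp only: powr_add mult.assoc)
    also have "1 / 2 + 1 / 3 * (- 1 / 2) = (1 / 3 :: real)" by simp
    also have "- 2 * \<gamma> / 3 * (- 1 / 2) = \<gamma> / 3" by simp
    finally show ?thesis .
  qed
  have "\<bar>conv (newton_grad \<delta> i) (truncp k) x\<bar> \<le> 2 * k powr \<gamma> * vball * T + 4 * sqrt (Lpow 2 (truncp k)) * sqrt vball * T powr (- 1 / 2)"
    by (rule conv_newton_grad_bound[OF truncp_measurable truncp_bounds(1,2)[OF k0(1)] truncp_Lp(2)[OF k0(1)] T d])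
  also have "\<dots> \<le> 2 * k powr \<gamma> * vball * T + 4 * E powr (1 / 2) * sqrt vball * T powr (- 1 / 2)"
    using truncp_Lp(3)[OF k0(1)] E unfolding E_def[symmetric]
    by (intro add_left_mono mult_right_mono mult_left_mono) (auto simp: powr_half_sqrt)
  also have "\<dots> = 2 * vball * (k powr \<gamma> * T) + 4 * sqrt vball * (E powr (1 / 2) * T powr (- 1 / 2))"
    by (simp only: mult_ac)
  also have "\<dots> = (2 * vball + 4 * sqrt vball) * (E powr (1 / 3) * k powr (\<gamma> / 3))"
    unfolding t1 t2 by (simp only: distrib_right)
  finally have "\<bar>conv (newton_grad \<delta> i) (truncp k) x\<bar> \<le> (2 * vball + 4 * sqrt vball) * (E powr (1 / 3) * k powr (\<gamma> / 3))" .
  then have "(1 / newton_mass) * \<bar>conv (newton_grad \<delta> i) (truncp k) x\<bar>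
      \<le> (1 / newton_mass) * ((2 * vball + 4 * sqrt vball) * (E powr (1 / 3) * k powr (\<gamma> / 3)))"
    using newton_mass_pos by (intro mult_left_mono) auto
  then show ?thesis
    using newton_mass_pos by (simp only: pot_def pot_const_def E_def[symmetric] abs_mult mult.assoc) simp
qed

text \<open>Testing with cutoff times \<open>pot\<close> and removing the cutoff at fixed \<delta>
  and \<open>k\<close>. Both are absent from the final constant: \<delta> because every bound for
  the field is uniform in it, \<open>k\<close> by cancellation of powers.\<close>

lemma pressure_moll_bound:
  assumes B: "0 \<le> B" "\<And>n x. \<bar>cutoff n x\<bar> \<le> B" "\<And>n i x. \<bar>partial i (cutoff n) x\<bar> \<le> B / real (Suc n)"
    and k: "1 \<le> k" and d: "0 < \<delta>"
  shows "(LINT x|lborel. \<rho> x powr \<gamma> * moll newton_moll \<delta> (truncp k) x)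
     \<le> test_const * (2 * sqrt (72 * B\<^sup>2 + 1) + B * pot_const) * energy k powr (2 / 3)"
proof -
  have k0: "0 \<le> k" using k by simp
  define E where "E = energy k"
  have E: "1 \<le> E" using energy_ge_1[of k] by (simp add: E_def)
  define w where "w = moll newton_moll \<delta> (truncp k)"
  have w2: "w \<in> Lp 2" and wE: "Lpow 2 w \<le> 36 * E"
  proof -
    note M = moll_Lp_bound[OF newton_moll truncp_Lp(2)[OF k0], of \<delta>]
    show "w \<in> Lp 2" unfolding w_def by (rule M(1)) simp
    have "Lpow 2 w \<le> 2 powr 2 * (2 powr 2 * 2 + 1) * Lpow 2 (truncp k)" unfolding w_def by (rule M(2)) simp
    also have "\<dots> \<le> 36 * E" using truncp_Lp(3)[OF k0] by (simp add: E_def)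
    finally show "Lpow 2 w \<le> 36 * E" .
  qed
  have wb: "\<bar>w x\<bar> \<le> k powr \<gamma>" for x
    unfolding w_def using truncp_bounds[OF k0] newton_moll by (intro moll_bound) auto
  note [measurable] = Lp_measurable[OF w2] Lp_measurable[OF pot_Lp[OF k0 d]]
  define f where "f n i x = cutoff n x * pot k \<delta> i x" for n i x
  have c1: "cutoff n \<in> Cc 1" for n by (rule Cc_infinity_imp_Cc[OF cutoff_Cc_infinity])
  have f: "f n i \<in> Cc 1" for n i unfolding f_def[abs_def] by (rule Cc_1_mult(1)[OF c1 pot_C_diff(1)[OF k0 d]])
  define m0 where "m0 = pot_const * (E powr (1 / 3) * k powr (\<gamma> / 3))"
  define m where "m = B * m0"
  have pm: "\<bar>pot k \<delta> i x\<bar> \<le> m0" for i x using pot_bound[OF k d] by (simp add: m0_def E_def)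
  have m00: "0 \<le> m0" using pm[of 0 0] abs_ge_zero order_trans by blast
  have fm: "\<bar>f n i x\<bar> \<le> m" for n i x
    unfolding f_def m_def abs_mult using B pm by (intro mult_mono) auto
  \<comment> \<open>The mollified truncated pressure satisfies \<open>Lpow 2 w \<le> 36 * E\<close>,
    with 36 the crude constant of \<open>moll_Lp_bound\<close> at exponent 2; the cutoff doubles it
    to 72 B^2. The added 1 absorbs the remaining cutoff error, which is below 1 \<le> E for large
    n.\<close>
  define b where "b = sqrt (72 * B\<^sup>2 + 1) * E powr (1 / 2)"
  have b0: "0 \<le> b" by (simp add: b_def)
  have b2: "b\<^sup>2 = (72 * B\<^sup>2 + 1) * E" using E by (simp add: b_def power_mult_distrib powr_half_sqrt)
  define S where "S = 12 * B\<^sup>2 * (\<Sum>i\<in>UNIV. Lpow 2 (pot k \<delta> i))"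
  have "(\<lambda>n. 1 / real (Suc n) * S) \<longlonglongrightarrow> 0"
    by (rule tendsto_mult_left_zero[OF inverse_Suc_LIMSEQ])
  then have "\<forall>\<^sub>F n in sequentially. 1 / real (Suc n) * S < 1" by (rule order_tendstoD(2)) simp
  then obtain n0 where n0: "\<And>n. n \<ge> n0 \<Longrightarrow> 1 / real (Suc n) * S < 1" unfolding eventually_sequentially by blast
  have fb: "Lpow 2 (partial j (f n i)) \<le> b\<^sup>2" if n: "n \<ge> n0" for n i j
  proof -
    have "Lpow 2 (partial j (f n i)) \<le> 2 * B\<^sup>2 * Lpow 2 w + (1 / real (Suc n)) * S"
      unfolding f_def[abs_def] S_def
    proof (rule cutoff_gradient_bound[OF pot_C_diff(1)[OF k0 d] _ pot_Lp[OF k0 d] w2 _ B])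
      show "partial j (pot k \<delta> i) x = partial i (pot k \<delta> j) x" for i j x
        unfolding pot_C_diff(2)[OF k0 d] by (simp add: conv_def newton_hess_sym[of \<delta> i j])
      show "(\<Sum>i\<in>UNIV. partial i (pot k \<delta> i) x) = w x" for x
        unfolding w_def by (rule pot_div[OF k0 d])
    qed
    also have "\<dots> \<le> 2 * B\<^sup>2 * (36 * E) + E"
    proof (rule add_mono)
      show "2 * B\<^sup>2 * Lpow 2 w \<le> 2 * B\<^sup>2 * (36 * E)" using wE by (intro mult_left_mono) auto
      show "1 / real (Suc n) * S \<le> E" using n0[OF n] E by linarith
    qed
    also have "\<dots> = b\<^sup>2" unfolding b2 by (simp add: algebra_simps)
    finally show ?thesis .
  qed
  define X where "X = test_const * (b + b * E powr (1 / 6) + m * (k powr (3 - 2 * \<gamma>) * E) powr (1 / 3))"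
  have le: "(\<Sum>i\<in>UNIV. LINT x|lborel. \<rho> x powr \<gamma> * partial i (f n i) x) \<le> X" if n: "n \<ge> n0" for n
    unfolding X_def E_def by (rule pressure_test_bound[OF f b0 fb[OF n] fm k])
  define g where "g n x = \<rho> x powr \<gamma> * (\<Sum>i\<in>UNIV. partial i (f n i) x)" for n x
  have gf: "(\<Sum>i\<in>UNIV. partial i (f n i) x) = cutoff n x * w x + (\<Sum>i\<in>UNIV. partial i (cutoff n) x * pot k \<delta> i x)" for n x
  proof -
    have "partial i (f n i) x = partial i (cutoff n) x * pot k \<delta> i x + cutoff n x * partial i (pot k \<delta> i) x" for i
      unfolding f_def[abs_def] by (rule Cc_1_mult(2)[OF c1 pot_C_diff(1)[OF k0 d]])
    then show ?thesis
      unfolding w_def pot_div[OF k0 d, symmetric] by (simp add: sum.distrib sum_distrib_left)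
  qed
  define W where "W = B * k powr \<gamma> + 3 * (B * m0)"
  have pB: "\<bar>partial i (cutoff n) x\<bar> \<le> B" for i n x
  proof -
    have "B / real (Suc n) \<le> B / 1" using B(1) by (intro divide_left_mono) auto
    then show ?thesis using B(3)[of i n x] by simp
  qed
  have gb: "norm (g n x) \<le> \<rho> x powr \<gamma> * W" for n x
  proof -
    have "\<bar>\<Sum>i\<in>UNIV. partial i (f n i) x\<bar> \<le> \<bar>cutoff n x * w x\<bar> + (\<Sum>i\<in>UNIV. \<bar>partial i (cutoff n) x * pot k \<delta> i x\<bar>)"
      unfolding gf by (intro order_trans[OF abs_triangle_ineq] add_left_mono sum_abs)
    also have "\<dots> \<le> B * k powr \<gamma> + (\<Sum>i\<in>(UNIV::3 set). B * m0)"
      unfolding abs_mult using B wb pm pB by (intro add_mono sum_mono mult_mono) auto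
    also have "\<dots> = W" by (simp add: W_def)
    finally show ?thesis unfolding g_def by (simp add: abs_mult mult_left_mono)
  qed
  note [measurable] = Cc_1_measurable[OF f] Cc_1_measurable[OF c1]
  have iW: "integrable lborel (\<lambda>x. \<rho> x powr \<gamma> * W)" using pressure_integrable by simp
  have "(\<lambda>n. LINT x|lborel. g n x) \<longlonglongrightarrow> (LINT x|lborel. \<rho> x powr \<gamma> * w x)"
  proof (rule integral_dominated_convergence[OF _ _ iW])
    show "AE x in lborel. (\<lambda>n. g n x) \<longlonglongrightarrow> \<rho> x powr \<gamma> * w x"
    proof (rule AE_I2)
      fix x
      have z: "(\<lambda>n. partial i (cutoff n) x) \<longlonglongrightarrow> 0" for i
      proof (rule tendsto_rabs_zero_cancel, rule tendsto_zero_squeeze)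
        show "\<bar>partial i (cutoff n) x\<bar> \<le> 1 / real (Suc n) * B" for n using B(3)[of i n x] by simp
        show "(\<lambda>n. 1 / real (Suc n) * B) \<longlonglongrightarrow> 0" by (rule tendsto_mult_left_zero[OF inverse_Suc_LIMSEQ])
      qed simp
      have "(\<lambda>n. g n x) \<longlonglongrightarrow> \<rho> x powr \<gamma> * (1 * w x + (\<Sum>i\<in>UNIV. 0 * pot k \<delta> i x))"
        unfolding g_def gf by (intro tendsto_intros z cutoff_LIMSEQ)
      then show "(\<lambda>n. g n x) \<longlonglongrightarrow> \<rho> x powr \<gamma> * w x" by simp
    qed
    show "AE x in lborel. norm (g n x) \<le> \<rho> x powr \<gamma> * W" for n by (rule AE_I2[OF gb])
  qed (unfold g_def, measurable)
  moreover have "(LINT x|lborel. g n x) \<le> X" if n: "n \<ge> n0" for n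
  proof -
    have "integrable lborel (\<lambda>x. \<rho> x powr \<gamma> * partial i (f n i) x)" for i
    proof -
      obtain C where C: "\<And>x. \<bar>partial i (f n i) x\<bar> \<le> C"
        using compact_support_bounded[OF Cc_1D(3,5)[OF f[of n i], of i]] by blast
      show ?thesis
        by (rule Bochner_Integration.integrable_bound[OF integrable_mult_left[OF pressure_integrable, of C]])
           (use order_trans[OF C abs_ge_self] in \<open>auto simp: abs_mult intro!: mult_left_mono\<close>)
    qed
    then have "(LINT x|lborel. g n x) = (\<Sum>i\<in>UNIV. LINT x|lborel. \<rho> x powr \<gamma> * partial i (f n i) x)"
      unfolding g_def sum_distrib_left by (rule Bochner_Integration.integral_sum)
    then show ?thesis using le[OF n] by simp
  qed
  ultimately have "(LINT x|lborel. \<rho> x powr \<gamma> * w x) \<le> X"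
    by (intro LIMSEQ_le_const2) auto
  also have "X \<le> test_const * ((2 * sqrt (72 * B\<^sup>2 + 1) + B * pot_const) * E powr (2 / 3))"
    unfolding X_def
  proof (rule mult_left_mono[OF _ test_const_nonneg])
    let ?s = "sqrt (72 * B\<^sup>2 + 1)"
    have e1: "E powr (1 / 2) \<le> E powr (2 / 3)" using E by (intro powr_mono) auto
    have e2: "E powr (1 / 2) * E powr (1 / 6) = E powr (2 / 3)" by (simp add: powr_add[symmetric])
    have e3: "m * (k powr (3 - 2 * \<gamma>) * E) powr (1 / 3) \<le> B * pot_const * E powr (2 / 3)"
    proof -
      have "k powr (\<gamma> / 3) * k powr ((3 - 2 * \<gamma>) * (1 / 3)) = k powr (\<gamma> / 3 + (3 - 2 * \<gamma>) * (1 / 3))"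
        by (simp only: powr_add)
      \<comment> \<open>The supremum of the field grows like k^(\<gamma>/3), the high-density norm
        decays like k^((3 - 2 \<gamma>)/3); the product has exponent 1 - \<gamma>/3, which is
        nonpositive by \<gamma> \<ge> 3.\<close>
      also have "\<dots> \<le> k powr 0"
      proof (rule powr_mono[OF _ k])
        have "\<gamma> / 3 + (3 - 2 * \<gamma>) * (1 / 3) = 1 - \<gamma> / 3" by (simp add: left_diff_distrib diff_divide_distrib)
        then show "\<gamma> / 3 + (3 - 2 * \<gamma>) * (1 / 3) \<le> 0" using \<gamma>(1) by simp
      qed
      also have "\<dots> = 1" using k by simp
      finally have kk: "k powr (\<gamma> / 3) * k powr ((3 - 2 * \<gamma>) * (1 / 3)) \<le> 1" .
      have ee: "E powr (1 / 3) * E powr (1 / 3) = E powr (2 / 3)" by (simp add: powr_add[symmetric])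
      have "m * (k powr (3 - 2 * \<gamma>) * E) powr (1 / 3)
        = B * pot_const * (E powr (1 / 3) * E powr (1 / 3)) * (k powr (\<gamma> / 3) * k powr ((3 - 2 * \<gamma>) * (1 / 3)))"
        unfolding m_def m0_def powr_mult powr_powr by (simp only: mult_ac)
      also have "\<dots> \<le> B * pot_const * (E powr (1 / 3) * E powr (1 / 3)) * 1"
        using B(1) pot_const_nonneg by (intro mult_left_mono kk) auto
      finally show ?thesis by (simp only: ee mult_1_right)
    qed
    have "b \<le> ?s * E powr (2 / 3)" unfolding b_def by (intro mult_left_mono e1) simp
    moreover have "b * E powr (1 / 6) = ?s * E powr (2 / 3)" unfolding b_def e2[symmetric] by (simp only: mult.assoc)
    moreover have "(2 * s + c) * w = s * w + (s * w + c * w)" for s c w :: real by (simp add: algebra_simps)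
    ultimately show "b + b * E powr (1 / 6) + m * (k powr (3 - 2 * \<gamma>) * E) powr (1 / 3)
       \<le> (2 * ?s + B * pot_const) * E powr (2 / 3)"
      using e3 by (simp only:)
  qed
  finally show ?thesis by (simp only: w_def E_def mult.assoc)
qed

text \<open>As \<delta> tends to 0, the pressure tested with the mollified truncation tends to the
  main part of \<open>energy k\<close>, which gives E \<le> (1 + P + C) E^(2/3). Since E is finite
  and at least 1, dividing is allowed and E \<le> (1 + P + C)^3.\<close>

lemma energy_bounded: "\<exists>K. \<forall>k\<ge>1. energy k \<le> K"
proof -
  obtain B where B: "0 \<le> B" "\<And>n x. \<bar>cutoff n x\<bar> \<le> B" "\<And>n i x. \<bar>partial i (cutoff n) x\<bar> \<le> B / real (Suc n)"
    using cutoff_bounds by blast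
  define C where "C = test_const * (2 * sqrt (72 * B\<^sup>2 + 1) + B * pot_const)"
  define P where "P = (LINT x|lborel. \<rho> x powr \<gamma>)"
  have C0: "0 \<le> C" unfolding C_def using test_const_nonneg B(1) pot_const_nonneg by (intro mult_nonneg_nonneg add_nonneg_nonneg) auto
  have P0: "0 \<le> P" by (simp add: P_def)
  have "energy k \<le> (1 + P + C) ^ 3" if k: "1 \<le> k" for k
  proof -
    have k0: "0 \<le> k" using k by simp
    define E where "E = energy k"
    have E: "1 \<le> E" using energy_ge_1[of k] by (simp add: E_def)
    define t where "t n = 1 / real (Suc n)" for n
    have t: "t \<longlonglongrightarrow> 0" "\<And>n. 0 < t n" using inverse_Suc_LIMSEQ unfolding t_def by auto
    have "Lconv 2 (\<lambda>n. moll newton_moll (t n) (truncp k)) (truncp k)"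
      by (rule moll_Lconv[OF newton_moll truncp_Lp(2)[OF k0] _ t(1)]) simp
    then obtain r where r: "AE x in lborel. (\<lambda>n. moll newton_moll (t (r n)) (truncp k) x) \<longlonglongrightarrow> truncp k x"
      by (rule Lconv_AE_subseq) auto
    have i: "integrable lborel (\<lambda>x. \<rho> x powr \<gamma> * k powr \<gamma>)" using pressure_integrable by simp
    have "(\<lambda>n. LINT x|lborel. \<rho> x powr \<gamma> * moll newton_moll (t (r n)) (truncp k) x) \<longlonglongrightarrow> (LINT x|lborel. \<rho> x powr \<gamma> * truncp k x)"
    proof (rule integral_dominated_convergence[OF _ _ i])
      show "AE x in lborel. (\<lambda>n. \<rho> x powr \<gamma> * moll newton_moll (t (r n)) (truncp k) x) \<longlonglongrightarrow> \<rho> x powr \<gamma> * truncp k x"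
        using r by eventually_elim (intro tendsto_intros)
      have "\<bar>moll newton_moll (t (r n)) (truncp k) x\<bar> \<le> k powr \<gamma>" for n x
        using truncp_bounds[OF k0] newton_moll by (intro moll_bound) auto
      then show "AE x in lborel. norm (\<rho> x powr \<gamma> * moll newton_moll (t (r n)) (truncp k) x) \<le> \<rho> x powr \<gamma> * k powr \<gamma>" for n
        by (auto simp: abs_mult intro!: mult_left_mono)
    qed measurable
    moreover have "(LINT x|lborel. \<rho> x powr \<gamma> * moll newton_moll (t (r n)) (truncp k) x) \<le> C * E powr (2 / 3)" for n
      unfolding C_def E_def by (rule pressure_moll_bound[OF B k t(2)])
    ultimately have "(LINT x|lborel. \<rho> x powr \<gamma> * truncp k x) \<le> C * E powr (2 / 3)"
      by (intro LIMSEQ_le_const2) auto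
    then have "E \<le> (1 + P) * 1 + C * E powr (2 / 3)"
      unfolding E_def energy_def P_def truncp_def by simp
    also have "\<dots> \<le> (1 + P) * E powr (2 / 3) + C * E powr (2 / 3)"
      using E P0 by (intro add_right_mono mult_left_mono ge_one_powr_ge_zero) auto
    also have "\<dots> = (1 + P + C) * E powr (2 / 3)" by (simp only: distrib_right)
    finally have *: "E \<le> (1 + P + C) * E powr (2 / 3)" .
    have "E powr (1 / 3) * E powr (2 / 3) \<le> (1 + P + C) * E powr (2 / 3)"
      using * E by (simp add: powr_add[symmetric])
    then have "E powr (1 / 3) \<le> 1 + P + C" using E by simp
    then have "(E powr (1 / 3)) ^ 3 \<le> (1 + P + C) ^ 3" by (intro power_mono) auto
    moreover have "(E powr (1 / 3)) ^ 3 = E"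
    proof -
      have "(E powr (1 / 3)) ^ 3 = (E powr (1 / 3)) powr 3" using E by (simp add: powr_numeral)
      also have "\<dots> = E" using E by (simp add: powr_powr)
      finally show ?thesis .
    qed
    ultimately show ?thesis by (simp add: E_def)
  qed
  then show ?thesis by blast
qed

text \<open>Fatou's lemma along integer truncation levels; at each point the truncation is
  eventually inactive.\<close>

lemma \<rho>_Lp_2\<gamma>: "\<rho> \<in> Lp (2 * \<gamma>)"
proof -
  obtain K where K: "\<And>k. 1 \<le> k \<Longrightarrow> energy k \<le> K" using energy_bounded by blast
  define F where "F n x = \<rho> x powr \<gamma> * trunc (real (Suc n)) x powr \<gamma>" for n x
  have iF: "integrable lborel (F n)" for n unfolding F_def[abs_def] by (rule trunc_integrable) simp
  have F0: "0 \<le> F n x" for n x by (simp add: F_def)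
  have FK: "Lpow 1 (F n) \<le> K" for n
  proof -
    have "Lpow 1 (F n) = (LINT x|lborel. F n x)" using F0 by (simp add: Lpow_1)
    also have "\<dots> \<le> energy (real (Suc n))" unfolding F_def energy_def by (simp add: add_nonneg_nonneg)
    also have "\<dots> \<le> K" by (rule K) simp
    finally show ?thesis .
  qed
  have lim: "AE x in lborel. (\<lambda>n. F n x) \<longlonglongrightarrow> \<rho> x powr \<gamma> * \<rho> x powr \<gamma>"
  proof (rule AE_I2)
    fix x
    obtain N :: nat where "\<rho> x \<le> real N" using real_arch_simple by blast
    then have "\<forall>n\<ge>N. F n x = \<rho> x powr \<gamma> * \<rho> x powr \<gamma>" by (auto simp: F_def trunc_def min_def)
    then show "(\<lambda>n. F n x) \<longlonglongrightarrow> \<rho> x powr \<gamma> * \<rho> x powr \<gamma>"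
      by (intro tendsto_eventually) (auto simp: eventually_sequentially)
  qed
  have F1: "F n \<in> Lp 1" for n using iF by (simp only: Lp_1_iff)
  have m: "(\<lambda>x. \<rho> x powr \<gamma> * \<rho> x powr \<gamma>) \<in> borel_measurable borel" by measurable
  have "(\<lambda>x. \<rho> x powr \<gamma> * \<rho> x powr \<gamma>) \<in> Lp 1"
    by (rule Lpow_Fatou(1)[OF F1 FK m lim zero_less_one])
  then have "integrable lborel (\<lambda>x. \<rho> x powr \<gamma> * \<rho> x powr \<gamma>)" by (simp add: Lp_1_iff)
  moreover have "\<rho> x powr \<gamma> * \<rho> x powr \<gamma> = \<bar>\<rho> x\<bar> powr (2 * \<gamma>)" for x
    using \<rho>_nonneg[of x] by (simp only: powr_add[symmetric] mult_2 abs_of_nonneg)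
  ultimately have "integrable lborel (\<lambda>x. \<bar>\<rho> x\<bar> powr (2 * \<gamma>))" by (simp only:)
  then show ?thesis by (rule LpI[OF measurable_data(1)])
qed

end

section \<open>Renormalisation\<close>

context steady_flow
begin

text \<open>Mollifying the continuity equation and multiplying by \<open>wt\<close> leaves the terms \<open>(\<rho> u) \<cdot> \<nabla>(wt)\<close> and \<open>u \<cdot> \<nabla>(dens\<^sup>\<gamma>)\<close>.
  After a shift of variables their difference is the integral of \<open>\<partial>\<^sub>i std_moll\<close> against \<open>commutator\<close>, whose difference
  quotient of \<open>u\<close> converges in \<open>L\<^sup>2\<close>.\<close>

definition dens :: "real \<Rightarrow> real^3 \<Rightarrow> real" where "dens t = moll std_moll t \<rho>"
definition wt :: "real \<Rightarrow> real^3 \<Rightarrow> real" where "wt t x = dens t x powr (\<gamma> - 1)"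

section \<open>Bounds and limits for the commutator\<close>

lemma \<rho>_Lp_between: "\<gamma> \<le> s \<Longrightarrow> s \<le> 2 * \<gamma> \<Longrightarrow> \<rho> \<in> Lp s"
  by (rule Lp_interpolate(1)[OF \<rho>_Lp \<rho>_Lp_2\<gamma>])

lemma dens_nonneg: "0 \<le> dens t x"
  unfolding dens_def moll_def by (intro integral_nonneg_AE AE_I2 mult_nonneg_nonneg std_moll(2) \<rho>_nonneg)

lemma dens_Lp:
  assumes "\<gamma> \<le> s" "s \<le> 2 * \<gamma>"
  shows "dens t \<in> Lp s" "Lpow s (dens t) \<le> 2 powr s * (2 powr s * 2 + 1) * Lpow s \<rho>"
  unfolding dens_def
  using moll_Lp_bound[OF std_moll(3,2,4) \<rho>_Lp_between[OF assms]] assms(1) \<gamma>(1) by auto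

lemma wt_Lp:
  assumes "\<gamma> \<le> s" "s \<le> 2 * \<gamma>"
  shows "wt t \<in> Lp (s / (\<gamma> - 1))" "Lpow (s / (\<gamma> - 1)) (wt t) = Lpow s (dens t)"
  unfolding wt_def[abs_def] using Lp_powr[OF dens_Lp(1)[OF assms] dens_nonneg, of "\<gamma> - 1" t] \<gamma>(1) by auto

lemma dens_powr_Lp_2: "(\<lambda>x. dens t x powr \<gamma>) \<in> Lp 2"
  using Lp_powr(1)[OF dens_Lp(1)[of "2 * \<gamma>"] dens_nonneg, of \<gamma> t] \<gamma>(1) by simp

lemma dens_measurable [measurable]: "dens t \<in> borel_measurable borel"
  using dens_Lp(1)[of \<gamma> t] \<gamma>(1) by (auto intro: Lp_measurable)

lemma wt_measurable [measurable]: "wt t \<in> borel_measurable borel"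
  unfolding wt_def[abs_def] by measurable

lemma dens_conv: "t \<longlonglongrightarrow> 0 \<Longrightarrow> Lconv (2 * \<gamma>) (\<lambda>n. dens (t n)) \<rho>"
  unfolding dens_def using \<gamma>(1) by (intro moll_Lconv std_moll \<rho>_Lp_2\<gamma>) auto

definition weight_const :: real where
  "weight_const = Lnorm (2 * \<gamma>) \<rho>
     * (2 powr (2 * \<gamma>) * (2 powr (2 * \<gamma>) * 2 + 1) * Lpow (2 * \<gamma>) \<rho>) powr (1 / (2 * \<gamma> / (\<gamma> - 1)))"

lemma weight_exponents: "0 < 2 * \<gamma>" "0 < 2 * \<gamma> / (\<gamma> - 1)" "1 / (2 * \<gamma>) + 1 / (2 * \<gamma> / (\<gamma> - 1)) = 1 / 2"
  using \<gamma>(1) by (auto simp: field_simps)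

text \<open>The exponents 1/(2 \<gamma>) and (\<gamma> - 1)/(2 \<gamma>) add up to 1/2, which is
  what pairing with a difference quotient in L2 requires. The bound holds for every shift and every
  mollification scale.\<close>

lemma weight_Lp:
  "(\<lambda>y. \<rho> (y + w) * wt t y) \<in> Lp 2" "Lnorm 2 (\<lambda>y. \<rho> (y + w) * wt t y) \<le> weight_const"
proof -
  have g: "\<gamma> \<le> 2 * \<gamma>" "2 * \<gamma> \<le> 2 * \<gamma>" using \<gamma>(1) by auto
  note H = Lnorm_Holder[OF weight_exponents(1,2) _ weight_exponents(3) Lp_translate[OF \<rho>_Lp_2\<gamma>] wt_Lp(1)[OF g]]
  show "(\<lambda>y. \<rho> (y + w) * wt t y) \<in> Lp 2" by (rule H(1)) simp
  have "Lnorm 2 (\<lambda>y. \<rho> (y + w) * wt t y) \<le> Lnorm (2 * \<gamma>) (\<lambda>y. \<rho> (y + w)) * Lnorm (2 * \<gamma> / (\<gamma> - 1)) (wt t)"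
    by (rule H(2)) simp
  also have "Lnorm (2 * \<gamma>) (\<lambda>y. \<rho> (y + w)) = Lnorm (2 * \<gamma>) \<rho>"
    unfolding Lnorm_def by (simp add: Lpow_translate)
  also have "Lnorm (2 * \<gamma>) \<rho> * Lnorm (2 * \<gamma> / (\<gamma> - 1)) (wt t) \<le> weight_const"
    unfolding weight_const_def
  proof (rule mult_left_mono)
    show "Lnorm (2 * \<gamma> / (\<gamma> - 1)) (wt t)
      \<le> (2 powr (2 * \<gamma>) * (2 powr (2 * \<gamma>) * 2 + 1) * Lpow (2 * \<gamma>) \<rho>) powr (1 / (2 * \<gamma> / (\<gamma> - 1)))"
      unfolding Lnorm_def[of "2 * \<gamma> / (\<gamma> - 1)"] wt_Lp(2)[OF g]
      using \<gamma>(1) by (intro powr_mono2 dens_Lp(2) g) auto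
  qed simp
  finally show "Lnorm 2 (\<lambda>y. \<rho> (y + w) * wt t y) \<le> weight_const" .
qed

text \<open>The commutator of mollification and transport in the manner of DiPerna and Lions,
  integrated against the weight with the kernel variable \<open>z\<close> held fixed.\<close>

definition commutator :: "real \<Rightarrow> 3 \<Rightarrow> real^3 \<Rightarrow> real" where
  "commutator t i z = (LINT y|lborel. (\<rho> (y + t *\<^sub>R z) * wt t y) * ((u i (y + t *\<^sub>R z) - u i y) / t))"

lemma diffquot_Lp:
  assumes t: "t \<noteq> 0"
  shows "(\<lambda>y. (u i (y + t *\<^sub>R z) - u i y) / t) \<in> Lp 2"
    "Lnorm 2 (\<lambda>y. (u i (y + t *\<^sub>R z) - u i y) / t) \<le> sqrt (3 * (\<Sum>j\<in>UNIV. Lpow 2 (U i j))) * norm z"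
proof -
  define S where "S = (\<Sum>j\<in>UNIV. Lpow 2 (U i j))"
  have S: "0 \<le> S" unfolding S_def by (intro sum_nonneg) simp
  note W = weak_diff_Lpow[OF \<phi>_Cc_1 u_conv U_conv, of i "t *\<^sub>R z"]
  show "(\<lambda>y. (u i (y + t *\<^sub>R z) - u i y) / t) \<in> Lp 2"
    using Lp_cmult[OF W(1), of "1 / t"] by simp
  have "Lpow 2 (\<lambda>y. (u i (y + t *\<^sub>R z) - u i y) / t) = \<bar>1 / t\<bar> powr 2 * Lpow 2 (\<lambda>y. u i (y + t *\<^sub>R z) - u i y)"
    using Lpow_cmult[of 2 "1 / t" "\<lambda>y. u i (y + t *\<^sub>R z) - u i y"] by simp
  also have "\<dots> \<le> \<bar>1 / t\<bar> powr 2 * (3 * (norm (t *\<^sub>R z))\<^sup>2 * S)"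
    unfolding S_def by (intro mult_left_mono W(2)) auto
  also have "\<dots> = (sqrt (3 * S) * norm z)\<^sup>2"
    using t S by (simp add: power_mult_distrib power_divide)
  also have "\<dots> = (sqrt (3 * S) * norm z) powr 2"
    using S by (simp add: powr_numeral)
  finally show "Lnorm 2 (\<lambda>y. (u i (y + t *\<^sub>R z) - u i y) / t) \<le> sqrt (3 * (\<Sum>j\<in>UNIV. Lpow 2 (U i j))) * norm z"
    unfolding S_def[symmetric] using S by (intro Lnorm_le_I) auto
qed

lemma commutator_bound:
  assumes t: "t \<noteq> 0"
  shows "\<bar>commutator t i z\<bar> \<le> weight_const * sqrt (3 * (\<Sum>j\<in>UNIV. Lpow 2 (U i j))) * norm z"
proof -
  have "\<bar>commutator t i z\<bar> \<le> Lnorm 2 (\<lambda>y. \<rho> (y + t *\<^sub>R z) * wt t y) * Lnorm 2 (\<lambda>y. (u i (y + t *\<^sub>R z) - u i y) / t)"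
    unfolding commutator_def by (rule integral_Lnorm_bound(3)[OF _ _ _ weight_Lp(1) diffquot_Lp(1)[OF t]]) auto
  also have "\<dots> \<le> weight_const * (sqrt (3 * (\<Sum>j\<in>UNIV. Lpow 2 (U i j))) * norm z)"
  proof (rule mult_mono[OF weight_Lp(2) diffquot_Lp(2)[OF t]])
    show "0 \<le> weight_const" by (rule order_trans[OF _ weight_Lp(2)]) simp
  qed simp
  finally show ?thesis by (simp only: mult.assoc)
qed

text \<open>Both factors converge strongly in L2: the weight because \<rho> lies in L^(2 \<gamma>),
  the quotient of the velocity by \<open>weak_diffquot_Lconv\<close>. Since \<rho> \<rho>^(\<gamma>
  - 1) = \<rho>^\<gamma>, the limit is a directional derivative against the pressure.\<close>

lemma commutator_LIMSEQ:
  assumes t: "t \<longlonglongrightarrow> 0" "\<And>n. t n \<noteq> 0"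
  shows "(\<lambda>n. commutator (t n) i z) \<longlonglongrightarrow> (\<Sum>j\<in>UNIV. z $ j * (LINT x|lborel. \<rho> x powr \<gamma> * U i j x))"
proof -
  have tz: "(\<lambda>n. t n *\<^sub>R z) \<longlonglongrightarrow> 0" using tendsto_scaleR[OF t(1) tendsto_const[of z]] by simp
  have 1: "Lconv (2 * \<gamma>) (\<lambda>n y. \<rho> (y + t n *\<^sub>R z)) \<rho>"
    by (rule Lconv_translate[OF \<rho>_Lp_2\<gamma> weight_exponents(1) tz])
  have 2: "Lconv (2 * \<gamma> / (\<gamma> - 1)) (\<lambda>n. wt (t n)) (\<lambda>x. \<rho> x powr (\<gamma> - 1))"
    unfolding wt_def[abs_def] using \<gamma>(1) by (intro Lconv_powr dens_conv t(1) dens_nonneg \<rho>_nonneg) auto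
  have "Lconv 2 (\<lambda>n y. \<rho> (y + t n *\<^sub>R z) * wt (t n) y) (\<lambda>x. \<rho> x * \<rho> x powr (\<gamma> - 1))"
    by (rule Lconv_mult[OF 1 2 weight_exponents(1,2) _ weight_exponents(3)]) simp
  moreover have "\<rho> x * \<rho> x powr (\<gamma> - 1) = \<rho> x powr \<gamma>" for x
    using powr_mult_base[OF \<rho>_nonneg[of x], of "\<gamma> - 1"] by simp
  ultimately have 3: "Lconv 2 (\<lambda>n y. \<rho> (y + t n *\<^sub>R z) * wt (t n) y) (\<lambda>x. \<rho> x powr \<gamma>)" by simp
  have p2: "(\<lambda>x. \<rho> x powr \<gamma>) \<in> Lp 2" by (rule LconvD(2)[OF 3])
  have "(\<lambda>n. commutator (t n) i z) \<longlonglongrightarrow> (LINT x|lborel. \<rho> x powr \<gamma> * (\<Sum>j\<in>UNIV. z $ j * U i j x))"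
    unfolding commutator_def
    by (rule Lconv_integral_mult[OF 3 weak_diffquot_Lconv[OF \<phi>_Cc_1 u_conv U_conv t]]) auto
  also have "(LINT x|lborel. \<rho> x powr \<gamma> * (\<Sum>j\<in>UNIV. z $ j * U i j x)) = (LINT x|lborel. (\<Sum>j\<in>UNIV. z $ j * (\<rho> x powr \<gamma> * U i j x)))"
    by (simp only: sum_distrib_left mult.left_commute)
  also have "\<dots> = (\<Sum>j\<in>UNIV. LINT x|lborel. z $ j * (\<rho> x powr \<gamma> * U i j x))"
    by (rule Bochner_Integration.integral_sum) (intro integrable_mult_right Holder_1(1)[OF _ _ _ p2 U_Lp]; simp)
  also have "\<dots> = (\<Sum>j\<in>UNIV. z $ j * (LINT x|lborel. \<rho> x powr \<gamma> * U i j x))"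
    by (simp only: integral_mult_right_zero)
  finally show ?thesis .
qed

text \<open>The limit of the commutator is linear in \<open>z\<close>, and the first moments of the
  differentiated mollifier are - 1 on the diagonal and 0 off it. The bound linear in |z| is an
  integrable majorant, because the mollifier has compact support.\<close>

lemma commutator_integral_LIMSEQ:
  assumes t: "t \<longlonglongrightarrow> 0" "\<And>n. t n \<noteq> 0"
    and m: "\<And>n. (\<lambda>z. partial i std_moll z * commutator (t n) i z) \<in> borel_measurable lborel"
  shows "(\<lambda>n. LINT z|lborel. partial i std_moll z * commutator (t n) i z) \<longlonglongrightarrow> - (LINT x|lborel. \<rho> x powr \<gamma> * U i i x)"
proof -
  define c where "c j = (LINT x|lborel. \<rho> x powr \<gamma> * U i j x)" for j
  define K where "K = weight_const * sqrt (3 * (\<Sum>j\<in>UNIV. Lpow 2 (U i j)))"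
  have zm: "partial i std_moll \<in> borel_measurable borel" by (rule Cc_1_measurable(2)[OF std_moll_Cc_1])
  have cs: "compact_support (\<lambda>z. partial i std_moll z * g z)" for g
    by (rule compact_support_mult[OF Cc_1D(5)[OF std_moll_Cc_1]])
  have in_j: "integrable lborel (\<lambda>z. partial i std_moll z * z $ j)" for j
    unfolding Lp_1_iff[symmetric]
    by (intro Lp_compact_support cs continuous_intros Cc_1D(3)[OF std_moll_Cc_1] continuous_on_component) auto
  have in_K: "integrable lborel (\<lambda>z. \<bar>partial i std_moll z * (K * norm z)\<bar>)"
    by (intro integrable_abs, unfold Lp_1_iff[symmetric])
       (intro Lp_compact_support cs continuous_intros Cc_1D(3)[OF std_moll_Cc_1], auto)
  have "(\<lambda>n. LINT z|lborel. partial i std_moll z * commutator (t n) i z)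
      \<longlonglongrightarrow> (LINT z|lborel. partial i std_moll z * (\<Sum>j\<in>UNIV. z $ j * c j))"
  proof (rule integral_dominated_convergence[OF _ m in_K])
    show "AE z in lborel. (\<lambda>n. partial i std_moll z * commutator (t n) i z) \<longlonglongrightarrow> partial i std_moll z * (\<Sum>j\<in>UNIV. z $ j * c j)"
      unfolding c_def by (intro AE_I2 tendsto_mult_left commutator_LIMSEQ[OF t])
    show "AE z in lborel. norm (partial i std_moll z * commutator (t n) i z) \<le> \<bar>partial i std_moll z * (K * norm z)\<bar>" for n
    proof (rule AE_I2)
      fix z
      have "\<bar>commutator (t n) i z\<bar> \<le> \<bar>K * norm z\<bar>"
        using commutator_bound[OF t(2), of n i z] unfolding K_def by linarith
      then show "norm (partial i std_moll z * commutator (t n) i z) \<le> \<bar>partial i std_moll z * (K * norm z)\<bar>"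
        unfolding real_norm_def abs_mult[of "partial i std_moll z"] by (rule mult_left_mono) simp
    qed
    show "(\<lambda>z. partial i std_moll z * (\<Sum>j\<in>UNIV. z $ j * c j)) \<in> borel_measurable lborel"
      using zm by (intro borel_measurable_times borel_measurable_sum) auto
  qed
  also have "(LINT z|lborel. partial i std_moll z * (\<Sum>j\<in>UNIV. z $ j * c j)) = (LINT z|lborel. (\<Sum>j\<in>UNIV. (partial i std_moll z * z $ j) * c j))"
    by (simp only: sum_distrib_left mult.assoc)
  also have "\<dots> = (\<Sum>j\<in>UNIV. LINT z|lborel. (partial i std_moll z * z $ j) * c j)"
    by (rule Bochner_Integration.integral_sum) (intro integrable_mult_left in_j)
  also have "\<dots> = (\<Sum>j\<in>UNIV. (if i = j then -1 else 0) * c j)"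
    by (simp only: integral_mult_left_zero std_moll_partial_moment)
  also have "\<dots> = - c i" by (simp add: mult_delta_left if_distrib[of "\<lambda>x. x * _"] cong: if_cong)
  finally show ?thesis unfolding c_def .
qed


text \<open>The exponent \<open>s = 6 \<gamma> / 5\<close> solves \<open>\<gamma> / s + 1 / 6 = 1\<close>: it makes \<open>wt * \<rho> * u\<close> integrable for \<open>\<rho>\<close> in \<open>L\<^sup>s\<close> and \<open>u\<close> in \<open>L\<^sup>6\<close>.\<close>

lemma renorm_exponents:
  "0 < 6 * \<gamma> / 5" "0 < 6 * \<gamma> / 5 / (\<gamma> - 1)" "0 < 1 / (5 / (6 * \<gamma>) + 1 / 6)" "0 < 1 / (1 / 6 + 1 / (6 * \<gamma> / 5 / (\<gamma> - 1)))"
  "1 / (6 * \<gamma> / 5) + 1 / 6 = 1 / (1 / (5 / (6 * \<gamma>) + 1 / 6))"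
  "1 / 6 + 1 / (6 * \<gamma> / 5 / (\<gamma> - 1)) = 1 / (1 / (1 / 6 + 1 / (6 * \<gamma> / 5 / (\<gamma> - 1))))"
  "1 / (1 / (5 / (6 * \<gamma>) + 1 / 6)) + 1 / (6 * \<gamma> / 5 / (\<gamma> - 1)) = 1"
  "1 / (1 / (1 / 6 + 1 / (6 * \<gamma> / 5 / (\<gamma> - 1)))) + 1 / (6 * \<gamma> / 5) = 1"
  "1 / (6 * \<gamma> / 5 / (\<gamma> - 1)) + 1 / (6 * \<gamma> / 5) = 1 / (6 / 5)"
  "1 \<le> 6 * \<gamma> / 5 / (\<gamma> - 1)" "\<gamma> \<le> 6 * \<gamma> / 5" "6 * \<gamma> / 5 \<le> 2 * \<gamma>" "1 \<le> 6 * \<gamma> / 5"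
  using \<gamma> by (auto simp: field_simps intro!: add_pos_pos)

lemma renorm_Lp:
  "\<rho> \<in> Lp (6 * \<gamma> / 5)" "dens t \<in> Lp (6 * \<gamma> / 5)" "wt t \<in> Lp (6 * \<gamma> / 5 / (\<gamma> - 1))"
  "(\<lambda>x. \<rho> x * u i x) \<in> Lp (1 / (5 / (6 * \<gamma>) + 1 / 6))"
  "(\<lambda>x. u i x * wt t x) \<in> Lp (1 / (1 / 6 + 1 / (6 * \<gamma> / 5 / (\<gamma> - 1))))"
proof -
  show 1: "\<rho> \<in> Lp (6 * \<gamma> / 5)" by (rule \<rho>_Lp_between[OF renorm_exponents(11,12)])
  show "dens t \<in> Lp (6 * \<gamma> / 5)" by (rule dens_Lp(1)[OF renorm_exponents(11,12)])
  show 2: "wt t \<in> Lp (6 * \<gamma> / 5 / (\<gamma> - 1))" by (rule wt_Lp(1)[OF renorm_exponents(11,12)])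
  show "(\<lambda>x. \<rho> x * u i x) \<in> Lp (1 / (5 / (6 * \<gamma>) + 1 / 6))"
    by (rule Holder(1)[OF renorm_exponents(1) _ renorm_exponents(3,5) 1 u_Lp]) simp
  show "(\<lambda>x. u i x * wt t x) \<in> Lp (1 / (1 / 6 + 1 / (6 * \<gamma> / 5 / (\<gamma> - 1))))"
    by (rule Holder(1)[OF _ renorm_exponents(2,4,6) u_Lp 2]) simp
qed

text \<open>The derivative of \<open>dens t x powr \<gamma>\<close> is \<gamma> times
  \<open>wt t x\<close> times the derivative of the mollified density, and the latter falls on the
  kernel with the factor - 1 / t. Integrating by parts cancels that sign.\<close>

lemma pressure_divergence:
  assumes t: "t \<noteq> 0"
  shows "(LINT x|lborel. U i i x * dens t x powr \<gamma>)
    = (\<gamma> / t) * (LINT x|lborel. (u i x * wt t x) * moll (partial i std_moll) t \<rho> x)"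
proof -
  define M where "M = moll (partial i std_moll) t \<rho>"
  note P = moll_std_partial[OF \<rho>_Lp _ t, folded dens_def]
  have g1: "1 \<le> \<gamma>" "1 < \<gamma>" using \<gamma>(1) by auto
  note Q = C_diff_powr[OF P(1)[OF g1(1)] dens_nonneg g1(2)]
  have M_Lp: "M \<in> Lp (6 * \<gamma> / 5)" unfolding M_def
    by (rule moll_signed_Lp[OF std_moll_partial_integrable renorm_Lp(1) renorm_exponents(13)])
  have wM: "(\<lambda>x. wt t x * M x) \<in> Lp (6 / 5)"
    by (rule Holder(1)[OF renorm_exponents(2,1) _ renorm_exponents(9) renorm_Lp(3) M_Lp]) simp
  have eq: "(LINT x|lborel. partial i (\<phi> i n) x * dens t x powr \<gamma>) = (\<gamma> / t) * (LINT x|lborel. \<phi> i n x * (wt t x * M x))" for n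
  proof -
    have "(LINT x|lborel. partial i (\<phi> i n) x * dens t x powr \<gamma>)
        = - (LINT x|lborel. \<phi> i n x * partial i (\<lambda>x. dens t x powr \<gamma>) x)"
      by (rule integral_by_parts[OF \<phi>_Cc_1 Q(1)])
    also have "\<dots> = - (LINT x|lborel. - (\<gamma> / t) * (\<phi> i n x * (wt t x * M x)))"
      unfolding Q(2) P(2)[OF g1(1)] M_def wt_def by (simp add: mult_ac)
    also have "\<dots> = (\<gamma> / t) * (LINT x|lborel. \<phi> i n x * (wt t x * M x))"
      by (simp only: mult_minus_left Bochner_Integration.integral_minus integral_mult_right_zero minus_minus)
    finally show ?thesis .
  qed
  have "(\<lambda>n. LINT x|lborel. partial i (\<phi> i n) x * dens t x powr \<gamma>) \<longlonglongrightarrow> (LINT x|lborel. U i i x * dens t x powr \<gamma>)"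
    by (rule Lconv_integral_mult[OF U_conv Lconv_const[OF dens_powr_Lp_2]]) auto
  moreover have "(\<lambda>n. (\<gamma> / t) * (LINT x|lborel. \<phi> i n x * (wt t x * M x))) \<longlonglongrightarrow> (\<gamma> / t) * (LINT x|lborel. u i x * (wt t x * M x))"
    by (intro tendsto_mult_left Lconv_integral_mult[OF u_conv Lconv_const[OF wM]]) auto
  ultimately have "(LINT x|lborel. U i i x * dens t x powr \<gamma>) = (\<gamma> / t) * (LINT x|lborel. u i x * (wt t x * M x))"
    unfolding eq by (rule LIMSEQ_unique)
  then show ?thesis by (simp only: M_def mult.assoc)
qed

text \<open>Up to the factor 1 / t the mollified derivative is the gradient of
  \<open>moll std_moll (- t) (wt t)\<close>, so the claim is the continuity equation tested with
  that function. Cutoffs supply compact support and are removed by dominated convergence.\<close>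

lemma momentum_flux_divergence:
  assumes t: "t \<noteq> 0"
  shows "(\<Sum>i\<in>UNIV. LINT x|lborel. (\<rho> x * u i x) * moll (partial i std_moll) (- t) (wt t) x) = 0"
proof -
  obtain B where B: "0 \<le> B" "\<And>n x. \<bar>cutoff n x\<bar> \<le> B" "\<And>n i x. \<bar>partial i (cutoff n) x\<bar> \<le> B / real (Suc n)"
    using cutoff_bounds by blast
  have t': "- t \<noteq> 0" using t by simp
  define g where "g = moll std_moll (- t) (wt t)"
  note P = moll_std_partial[OF renorm_Lp(3)[of t] renorm_exponents(10) t', folded g_def]
  define M where "M i = moll (partial i std_moll) (- t) (wt t)" for i
  have M_Lp: "M i \<in> Lp (6 * \<gamma> / 5 / (\<gamma> - 1))" for i unfolding M_def
    by (rule moll_signed_Lp[OF std_moll_partial_integrable renorm_Lp(3) renorm_exponents(10)])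
  have g_Lp: "g \<in> Lp (6 * \<gamma> / 5 / (\<gamma> - 1))" unfolding g_def
    by (rule moll_signed_Lp[OF std_moll(3) renorm_Lp(3) renorm_exponents(10)])
  have pg: "partial i g x = (1 / t) * M i x" for i x unfolding M_def using P(2)[of i x] by simp
  note [measurable] = Lp_measurable[OF M_Lp] Lp_measurable[OF g_Lp]
  have c1: "cutoff n \<in> Cc 1" for n by (rule Cc_infinity_imp_Cc[OF cutoff_Cc_infinity])
  note [measurable] = Cc_1_measurable[OF c1]
  have i1: "integrable lborel (\<lambda>x. (\<rho> x * u i x) * M i x)" for i
    by (rule Holder_1(1)[OF renorm_exponents(3,2,7) renorm_Lp(4) M_Lp])
  have i2: "integrable lborel (\<lambda>x. (\<rho> x * u i x) * g x)" for i
    by (rule Holder_1(1)[OF renorm_exponents(3,2,7) renorm_Lp(4) g_Lp])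
  define F where "F n x = (\<Sum>i\<in>UNIV. (\<rho> x * u i x) * (partial i (cutoff n) x * g x + cutoff n x * ((1 / t) * M i x)))" for n x
  have zero: "(LINT x|lborel. F n x) = 0" for n
    using continuity_Cc_1[OF Cc_1_mult(1)[OF c1[of n] P(1)]]
    unfolding Cc_1_mult(2)[OF c1 P(1)] pg F_def .
  define W where "W x = (\<Sum>i\<in>UNIV. B * \<bar>(\<rho> x * u i x) * g x\<bar> + (B * \<bar>1 / t\<bar>) * \<bar>(\<rho> x * u i x) * M i x\<bar>)" for x
  have iW: "integrable lborel W"
    unfolding W_def
    by (intro Bochner_Integration.integrable_sum Bochner_Integration.integrable_add integrable_mult_right integrable_abs i1 i2)
  have "(\<lambda>n. LINT x|lborel. F n x) \<longlonglongrightarrow> (LINT x|lborel. (\<Sum>i\<in>UNIV. (\<rho> x * u i x) * (0 * g x + 1 * ((1 / t) * M i x))))"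
  proof (rule integral_dominated_convergence[OF _ _ iW])
    show "F n \<in> borel_measurable lborel" for n unfolding F_def by measurable
    show "(\<lambda>x. \<Sum>i\<in>UNIV. (\<rho> x * u i x) * (0 * g x + 1 * ((1 / t) * M i x))) \<in> borel_measurable lborel" by measurable
    have pc: "(\<lambda>n. partial i (cutoff n) x) \<longlonglongrightarrow> 0" for i x
    proof (rule Lim_null_comparison)
      show "\<forall>\<^sub>F n in sequentially. norm (partial i (cutoff n) x) \<le> B * (1 / real (Suc n))"
        using B(3) by (intro always_eventually allI) simp
      show "(\<lambda>n. B * (1 / real (Suc n))) \<longlonglongrightarrow> 0"
        by (rule tendsto_mult_right_zero[OF inverse_Suc_LIMSEQ])
    qed
    show "AE x in lborel. (\<lambda>n. F n x) \<longlonglongrightarrow> (\<Sum>i\<in>UNIV. (\<rho> x * u i x) * (0 * g x + 1 * ((1 / t) * M i x)))"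
      unfolding F_def by (intro AE_I2 tendsto_intros pc cutoff_LIMSEQ)
    show "AE x in lborel. norm (F n x) \<le> W x" for n
    proof (rule AE_I2)
      fix x
      have pb: "\<bar>partial i (cutoff n) x\<bar> \<le> B" for i
      proof (rule order_trans[OF B(3)])
        show "B / real (Suc n) \<le> B" using B(1) by (simp add: divide_le_eq mult_le_cancel_left1)
      qed
      have "\<bar>(\<rho> x * u i x) * (partial i (cutoff n) x * g x + cutoff n x * ((1 / t) * M i x))\<bar>
        \<le> B * \<bar>(\<rho> x * u i x) * g x\<bar> + (B * \<bar>1 / t\<bar>) * \<bar>(\<rho> x * u i x) * M i x\<bar>" for i
      proof -
        have "\<bar>(\<rho> x * u i x) * (partial i (cutoff n) x * g x + cutoff n x * ((1 / t) * M i x))\<bar>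
          = \<bar>partial i (cutoff n) x * ((\<rho> x * u i x) * g x) + cutoff n x * ((1 / t) * ((\<rho> x * u i x) * M i x))\<bar>"
          by (simp add: algebra_simps)
        also have "\<dots> \<le> \<bar>partial i (cutoff n) x\<bar> * \<bar>(\<rho> x * u i x) * g x\<bar> + \<bar>cutoff n x\<bar> * (\<bar>1 / t\<bar> * \<bar>(\<rho> x * u i x) * M i x\<bar>)"
          unfolding abs_mult[symmetric] by (rule abs_triangle_ineq)
        also have "\<dots> \<le> B * \<bar>(\<rho> x * u i x) * g x\<bar> + B * (\<bar>1 / t\<bar> * \<bar>(\<rho> x * u i x) * M i x\<bar>)"
          by (intro add_mono mult_right_mono pb B(2) mult_nonneg_nonneg abs_ge_zero)
        finally show ?thesis by (simp only: mult.assoc)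
      qed
      then show "norm (F n x) \<le> W x"
        unfolding F_def W_def real_norm_def by (intro order_trans[OF sum_abs] sum_mono)
    qed
  qed
  then have "(LINT x|lborel. (\<Sum>i\<in>UNIV. (\<rho> x * u i x) * (0 * g x + 1 * ((1 / t) * M i x)))) = 0"
    unfolding zero by (simp add: LIMSEQ_const_iff)
  also have "(LINT x|lborel. (\<Sum>i\<in>UNIV. (\<rho> x * u i x) * (0 * g x + 1 * ((1 / t) * M i x))))
      = (LINT x|lborel. (1 / t) * (\<Sum>i\<in>UNIV. (\<rho> x * u i x) * M i x))"
    by (intro Bochner_Integration.integral_cong refl) (simp add: sum_distrib_left mult_ac)
  also have "\<dots> = (1 / t) * (\<Sum>i\<in>UNIV. LINT x|lborel. (\<rho> x * u i x) * M i x)"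
    unfolding integral_mult_right_zero Bochner_Integration.integral_sum[OF i1] ..
  finally show ?thesis using t by (simp add: M_def)
qed

text \<open>Expanding the velocity difference gives two integrals. In the first, the shift by
  \<open>t *\<^sub>R z\<close> is moved from the momentum to the weight, which turns
  \<open>t\<close> into \<open>- t\<close>; in the second, only the density is shifted. Both are
  then brought to mollified form by \<open>moll_swap\<close>.\<close>

lemma commutator_swap:
  assumes t: "t \<noteq> 0"
  shows "(LINT z|lborel. partial i std_moll z * commutator t i z)
    = (1 / t) * ((LINT x|lborel. (\<rho> x * u i x) * moll (partial i std_moll) (- t) (wt t) x)
        - (LINT x|lborel. (u i x * wt t x) * moll (partial i std_moll) t \<rho> x))"
    "integrable lborel (\<lambda>z. partial i std_moll z * commutator t i z)"
proof -
  define a where "a z = (LINT x|lborel. (\<rho> x * u i x) * wt t (x + (- t) *\<^sub>R z))" for z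
  define b where "b z = (LINT x|lborel. (u i x * wt t x) * \<rho> (x + t *\<^sub>R z))" for z
  note A = moll_swap[OF std_moll_partial_integrable[of i] renorm_exponents(3,2,7) renorm_Lp(4)[of i] renorm_Lp(3)[of t], where t = "- t", folded a_def]
  note Bs = moll_swap[OF std_moll_partial_integrable[of i] renorm_exponents(4,1,8) renorm_Lp(5)[of i t] renorm_Lp(1), where t = t, folded b_def]
  have c: "commutator t i z = (1 / t) * (a z - b z)" for z
  proof -
    let ?w = "t *\<^sub>R z"
    have a': "a z = (LINT y|lborel. (\<rho> (y + ?w) * u i (y + ?w)) * wt t y)"
      unfolding a_def
      by (subst lborel_integral_translate[symmetric, where w = ?w]) (auto simp: algebra_simps)
    have ia: "integrable lborel (\<lambda>y. (\<rho> (y + ?w) * u i (y + ?w)) * wt t y)"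
      by (rule Holder_1(1)[OF renorm_exponents(3,2,7) Lp_translate[OF renorm_Lp(4)] renorm_Lp(3)])
    have ib: "integrable lborel (\<lambda>y. (u i y * wt t y) * \<rho> (y + ?w))"
      by (rule Holder_1(1)[OF renorm_exponents(4,1,8) renorm_Lp(5) Lp_translate[OF renorm_Lp(1)]])
    have "commutator t i z = (LINT y|lborel. (1 / t) * ((\<rho> (y + ?w) * u i (y + ?w)) * wt t y - (u i y * wt t y) * \<rho> (y + ?w)))"
      unfolding commutator_def
      by (intro Bochner_Integration.integral_cong refl) (simp add: algebra_simps diff_divide_distrib)
    also have "\<dots> = (1 / t) * (a z - b z)"
      unfolding integral_mult_right_zero Bochner_Integration.integral_diff[OF ia ib] a' b_def ..
    finally show ?thesis .
  qed
  have e: "partial i std_moll z * commutator t i z = (1 / t) * (partial i std_moll z * a z - partial i std_moll z * b z)" for z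
    unfolding c by (simp add: algebra_simps)
  show "integrable lborel (\<lambda>z. partial i std_moll z * commutator t i z)"
    unfolding e by (intro integrable_mult_right Bochner_Integration.integrable_diff A(2) Bs(2))
  show "(LINT z|lborel. partial i std_moll z * commutator t i z)
    = (1 / t) * ((LINT x|lborel. (\<rho> x * u i x) * moll (partial i std_moll) (- t) (wt t) x)
        - (LINT x|lborel. (u i x * wt t x) * moll (partial i std_moll) t \<rho> x))"
    unfolding e integral_mult_right_zero Bochner_Integration.integral_diff[OF A(2) Bs(2)] A(1) Bs(1) ..
qed

text \<open>Of the two parts of the commutator, the momentum part vanishes by the continuity
  equation; the other is the divergence integral, with the factor \<gamma> / t of
  \<open>pressure_divergence\<close> inverted.\<close>

lemma commutator_sum:
  assumes t: "t \<noteq> 0"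
  shows "(\<Sum>i\<in>UNIV. LINT z|lborel. partial i std_moll z * commutator t i z)
    = - (1 / \<gamma>) * (LINT x|lborel. D x * dens t x powr \<gamma>)"
proof -
  define I where "I i = (LINT x|lborel. (\<rho> x * u i x) * moll (partial i std_moll) (- t) (wt t) x)" for i
  define J where "J i = (LINT x|lborel. (u i x * wt t x) * moll (partial i std_moll) t \<rho> x)" for i
  have "(LINT x|lborel. D x * dens t x powr \<gamma>) = (LINT x|lborel. (\<Sum>i\<in>UNIV. U i i x * dens t x powr \<gamma>))"
    by (simp only: D_def sum_distrib_right)
  also have "\<dots> = (\<Sum>i\<in>UNIV. LINT x|lborel. U i i x * dens t x powr \<gamma>)"
    by (rule Bochner_Integration.integral_sum, rule Holder_1(1)[OF _ _ _ U_Lp dens_powr_Lp_2]) auto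
  also have "\<dots> = (\<gamma> / t) * (\<Sum>i\<in>UNIV. J i)"
    unfolding pressure_divergence[OF t] J_def by (simp only: sum_distrib_left)
  finally have D: "(LINT x|lborel. D x * dens t x powr \<gamma>) = (\<gamma> / t) * (\<Sum>i\<in>UNIV. J i)" .
  have "(\<Sum>i\<in>UNIV. LINT z|lborel. partial i std_moll z * commutator t i z) = (\<Sum>i\<in>UNIV. (1 / t) * (I i - J i))"
    unfolding commutator_swap(1)[OF t] I_def J_def ..
  also have "\<dots> = (1 / t) * ((\<Sum>i\<in>UNIV. I i) - (\<Sum>i\<in>UNIV. J i))"
    by (simp only: sum_distrib_left[symmetric] sum_subtractf)
  also have "(\<Sum>i\<in>UNIV. I i) = 0" unfolding I_def by (rule momentum_flux_divergence[OF t])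
  finally show ?thesis unfolding D using \<gamma>(1) by simp
qed

lemma \<rho>_powr_Lp_2: "(\<lambda>x. \<rho> x powr \<gamma>) \<in> Lp 2"
  using Lp_powr(1)[OF \<rho>_Lp_2\<gamma> \<rho>_nonneg, of \<gamma>] \<gamma>(1) by simp

text \<open>The summed commutators have the limit minus X, with X the integral in question, and by
  \<open>commutator_sum\<close> also the limit - X / \<gamma>. Hence (1 - 1/\<gamma>) X = 0, and
  \<gamma> \<noteq> 1.\<close>

lemma renormalized_pressure: "(LINT x|lborel. \<rho> x powr \<gamma> * D x) = 0"
proof -
  define t where "t n = 1 / real (Suc n)" for n
  have t: "t \<longlonglongrightarrow> 0" "\<And>n. t n \<noteq> 0" using inverse_Suc_LIMSEQ unfolding t_def by auto
  have "(\<lambda>n. \<Sum>i\<in>UNIV. LINT z|lborel. partial i std_moll z * commutator (t n) i z)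
      \<longlonglongrightarrow> (\<Sum>i\<in>UNIV. - (LINT x|lborel. \<rho> x powr \<gamma> * U i i x))"
    by (intro tendsto_sum commutator_integral_LIMSEQ t borel_measurable_integrable commutator_swap(2))
  moreover have "(\<Sum>i\<in>UNIV. - (LINT x|lborel. \<rho> x powr \<gamma> * U i i x)) = - (LINT x|lborel. \<rho> x powr \<gamma> * D x)"
  proof -
    have "(LINT x|lborel. \<rho> x powr \<gamma> * D x) = (LINT x|lborel. (\<Sum>i\<in>UNIV. \<rho> x powr \<gamma> * U i i x))"
      by (simp only: D_def sum_distrib_left)
    also have "\<dots> = (\<Sum>i\<in>UNIV. LINT x|lborel. \<rho> x powr \<gamma> * U i i x)"
      by (rule Bochner_Integration.integral_sum, rule Holder_1(1)[OF _ _ _ \<rho>_powr_Lp_2 U_Lp]) auto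
    finally show ?thesis by (simp only: sum_negf)
  qed
  ultimately have 1: "(\<lambda>n. - (1 / \<gamma>) * (LINT x|lborel. D x * dens (t n) x powr \<gamma>)) \<longlonglongrightarrow> - (LINT x|lborel. \<rho> x powr \<gamma> * D x)"
    unfolding commutator_sum[OF t(2)] by simp
  have "Lconv 2 (\<lambda>n x. dens (t n) x powr \<gamma>) (\<lambda>x. \<rho> x powr \<gamma>)"
    using Lconv_powr[OF dens_conv[OF t(1)] dens_nonneg \<rho>_nonneg, of \<gamma>] \<gamma>(1) by simp
  then have "(\<lambda>n. - (1 / \<gamma>) * (LINT x|lborel. D x * dens (t n) x powr \<gamma>)) \<longlonglongrightarrow> - (1 / \<gamma>) * (LINT x|lborel. D x * \<rho> x powr \<gamma>)"
    by (intro tendsto_mult_left Lconv_integral_mult[OF Lconv_const[OF D_Lp]]) auto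
  note e = LIMSEQ_unique[OF 1 this]
  have c: "(LINT x|lborel. D x * \<rho> x powr \<gamma>) = (LINT x|lborel. \<rho> x powr \<gamma> * D x)"
    by (simp only: mult.commute)
  have "(1 - 1 / \<gamma>) * (LINT x|lborel. \<rho> x powr \<gamma> * D x) = 0"
    using e[unfolded c] by (simp only: left_diff_distrib mult_minus_left neg_equal_iff_equal mult_1_left right_minus_eq)
  moreover have "1 - 1 / \<gamma> \<noteq> 0" using \<gamma>(1) by simp
  ultimately show ?thesis using mult_eq_0_iff by blast
qed

end

section \<open>The energy identity\<close>

context steady_flow
begin

text \<open>The assumptions 3 \<le> \<gamma> < 6 place 6 between \<gamma> and 2 \<gamma>.\<close>

lemma \<rho>_Lp_6: "\<rho> \<in> Lp 6"
  using \<gamma> by (intro \<rho>_Lp_between) auto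

lemma \<rho>uu_Lp_2: "(\<lambda>x. \<rho> x * (u i x * u j x)) \<in> Lp 2"
proof (rule Holder(1)[OF _ _ _ _ \<rho>_Lp_6])
  show "(\<lambda>x. u i x * u j x) \<in> Lp 3" by (rule Holder(1)[OF _ _ _ _ u_Lp u_Lp]) auto
qed auto

text \<open>With the density now in L6 globally, 1/6 + 1/6 + 1/2 = 5/6: the convective term lies in
  the dual of L6, so the velocity itself can be paired with it.\<close>

lemma convection_Lp: "(\<lambda>x. \<Sum>j\<in>UNIV. \<rho> x * u j x * U i j x) \<in> Lp (6 / 5)"
proof (rule Lp_sum)
  have \<rho>u: "(\<lambda>x. \<rho> x * u j x) \<in> Lp 3" for j by (rule Holder(1)[OF _ _ _ _ \<rho>_Lp_6 u_Lp]) auto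
  show "(\<lambda>x. \<rho> x * u j x * U i j x) \<in> Lp (6 / 5)" for j by (rule Holder(1)[OF _ _ _ _ \<rho>u U_Lp]) auto
qed simp

text \<open>The force potential is approximated by the test functions \<open>\<psi> n\<close>, for
  which the sum is the continuity equation. The exponent \<open>r\<close> of the momentum is
  conjugate to \<open>q\<close>, since 1/\<gamma> + 1/6 + 1/q = 1.\<close>

lemma force_power: "(\<Sum>j\<in>UNIV. LINT x|lborel. \<rho> x * H j x * u j x) = 0"
proof -
  define r where "r = 1 / (1 / \<gamma> + 1 / 6)"
  have r: "0 < r" "1 / \<gamma> + 1 / 6 = 1 / r" "1 / r + 1 / q = 1"
    using \<gamma>(1) q_bounds(4) by (auto simp: r_def add_pos_pos)
  have \<rho>u: "(\<lambda>x. \<rho> x * u j x) \<in> Lp r" for j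
    by (rule Holder(1)[OF _ _ r(1,2) \<rho>_Lp u_Lp]) (use \<gamma>(1) in auto)
  have "(\<lambda>n. \<Sum>j\<in>UNIV. LINT x|lborel. \<rho> x * u j x * partial j (\<psi> n) x)
      \<longlonglongrightarrow> (\<Sum>j\<in>UNIV. LINT x|lborel. \<rho> x * u j x * H j x)"
    by (intro tendsto_sum Lconv_integral_mult[OF Lconv_const[OF \<rho>u] H_conv r(1) q_bounds(3) r(3)])
  moreover have "(\<Sum>j\<in>UNIV. LINT x|lborel. \<rho> x * u j x * partial j (\<psi> n) x) = 0" for n
  proof -
    have i: "integrable lborel (\<lambda>x. \<rho> x * u j x * partial j (\<psi> n) x)" for j
      by (rule Holder_1(1)[OF r(1) q_bounds(3) r(3) \<rho>u LconvD(1)[OF H_conv]])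
    show ?thesis
      using continuity_Cc_1[OF \<psi>_Cc_1, of n] unfolding Bochner_Integration.integral_sum[OF i] .
  qed
  ultimately have "(\<Sum>j\<in>UNIV. LINT x|lborel. \<rho> x * u j x * H j x) = 0"
    by (simp add: LIMSEQ_const_iff)
  then show ?thesis by (simp only: mult.assoc mult.commute[of "u _ _"])
qed

text \<open>Integrating by parts shows that the term equals its own negative.\<close>

lemma convection_power: "(LINT x|lborel. (\<Sum>j\<in>UNIV. \<rho> x * u j x * U i j x) * u i x) = 0"
proof -
  define X where "X = (LINT x|lborel. (\<Sum>j\<in>UNIV. \<rho> x * u j x * U i j x) * u i x)"
  have "(\<lambda>n. LINT x|lborel. (\<Sum>j\<in>UNIV. \<rho> x * u j x * U i j x) * \<phi> i n x) \<longlonglongrightarrow> X"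
    unfolding X_def by (rule Lconv_integral_mult[OF Lconv_const[OF convection_Lp] u_conv]) auto
  then have 1: "(\<lambda>n. - (LINT x|lborel. (\<Sum>j\<in>UNIV. \<rho> x * u j x * U i j x) * \<phi> i n x)) \<longlonglongrightarrow> - X"
    by (rule tendsto_minus)
  have "(\<lambda>n. \<Sum>j\<in>UNIV. LINT x|lborel. \<rho> x * (u i x * u j x) * partial j (\<phi> i n) x)
      \<longlonglongrightarrow> (\<Sum>j\<in>UNIV. LINT x|lborel. \<rho> x * (u i x * u j x) * U i j x)"
    by (intro tendsto_sum Lconv_integral_mult[OF Lconv_const[OF \<rho>uu_Lp_2] U_conv]) auto
  moreover have "(\<Sum>j\<in>UNIV. LINT x|lborel. \<rho> x * (u i x * u j x) * partial j (\<phi> i n) x)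
      = - (LINT x|lborel. (\<Sum>j\<in>UNIV. \<rho> x * u j x * U i j x) * \<phi> i n x)" for n
  proof -
    have i: "integrable lborel (\<lambda>x. \<rho> x * (u i x * u j x) * partial j (\<phi> i n) x)" for j
      by (rule Holder_1(1)[OF _ _ _ \<rho>uu_Lp_2 LconvD(1)[OF U_conv]]) auto
    show ?thesis
      using convective_term[OF \<phi>_Cc_1, of i i n]
      unfolding Bochner_Integration.integral_sum[OF i] by (simp only: sum_distrib_right)
  qed
  moreover have "(\<Sum>j\<in>UNIV. LINT x|lborel. \<rho> x * (u i x * u j x) * U i j x) = X"
  proof -
    have i: "integrable lborel (\<lambda>x. \<rho> x * (u i x * u j x) * U i j x)" for j
      by (rule Holder_1(1)[OF _ _ _ \<rho>uu_Lp_2 U_Lp]) auto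
    have "X = (LINT x|lborel. (\<Sum>j\<in>UNIV. \<rho> x * (u i x * u j x) * U i j x))"
      unfolding X_def sum_distrib_right by (simp only: mult_ac)
    then show ?thesis by (simp only: Bochner_Integration.integral_sum[OF i])
  qed
  ultimately have 2: "(\<lambda>n. - (LINT x|lborel. (\<Sum>j\<in>UNIV. \<rho> x * u j x * U i j x) * \<phi> i n x)) \<longlonglongrightarrow> X"
    by (simp only:)
  from LIMSEQ_unique[OF 1 2] show ?thesis unfolding X_def[symmetric] by linarith
qed

text \<open>The momentum equation is tested with \<open>\<phi> i n\<close> and every term passes to
  the limit: the pressure is now in L2 and pairs with gradients, and the convective and force terms
  are in L^(6/5) and pair with L6.\<close>

lemma energy_identity_component:
  "(LINT x|lborel. \<rho> x powr \<gamma> * U i i x)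
     = \<mu> * (\<Sum>j\<in>UNIV. Lpow 2 (U i j)) + (\<mu> / 3 + \<eta>) * (LINT x|lborel. D x * U i i x)
       - (LINT x|lborel. \<rho> x * H i x * u i x)"
proof -
  define R where "R n = \<mu> * (\<Sum>j\<in>UNIV. LINT x|lborel. U i j x * partial j (\<phi> i n) x) + (\<mu> / 3 + \<eta>) * (LINT x|lborel. D x * partial i (\<phi> i n) x)
       - (LINT x|lborel. \<rho> x * H i x * \<phi> i n x) + (LINT x|lborel. (\<Sum>j\<in>UNIV. \<rho> x * u j x * U i j x) * \<phi> i n x)" for n
  have eq: "(LINT x|lborel. \<rho> x powr \<gamma> * partial i (\<phi> i n) x) = R n" for n
    unfolding R_def sum_distrib_right by (rule momentum_pressure[OF \<phi>_Cc_1])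
  have "(\<lambda>n. LINT x|lborel. \<rho> x powr \<gamma> * partial i (\<phi> i n) x) \<longlonglongrightarrow> (LINT x|lborel. \<rho> x powr \<gamma> * U i i x)"
    by (rule Lconv_integral_mult[OF Lconv_const[OF \<rho>_powr_Lp_2] U_conv]) auto
  then have l: "R \<longlonglongrightarrow> (LINT x|lborel. \<rho> x powr \<gamma> * U i i x)" unfolding eq .
  have "R \<longlonglongrightarrow> \<mu> * (\<Sum>j\<in>UNIV. LINT x|lborel. U i j x * U i j x) + (\<mu> / 3 + \<eta>) * (LINT x|lborel. D x * U i i x)
       - (LINT x|lborel. \<rho> x * H i x * u i x) + (LINT x|lborel. (\<Sum>j\<in>UNIV. \<rho> x * u j x * U i j x) * u i x)"
    unfolding R_def
    by (intro tendsto_add tendsto_diff tendsto_mult_left tendsto_sum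
        Lconv_integral_mult[OF Lconv_const[OF U_Lp] U_conv] Lconv_integral_mult[OF Lconv_const[OF D_Lp] U_conv]
        Lconv_integral_mult[OF Lconv_const[OF \<rho>H_Lp] u_conv] Lconv_integral_mult[OF Lconv_const[OF convection_Lp] u_conv]) auto
  from LIMSEQ_unique[OF l this] show ?thesis
    unfolding convection_power Lpow_2 power2_eq_square by (simp only: add_0_right)
qed

lemma energy_identity: "\<mu> * (\<Sum>i\<in>UNIV. \<Sum>j\<in>UNIV. Lpow 2 (U i j)) + (\<mu> / 3 + \<eta>) * Lpow 2 D = 0"
proof -
  have sum_U: "(\<Sum>i\<in>UNIV. LINT x|lborel. g x * U i i x) = (LINT x|lborel. g x * D x)" if g: "g \<in> Lp 2" for g
  proof -
    have i: "integrable lborel (\<lambda>x. g x * U i i x)" for i by (rule Holder_1(1)[OF _ _ _ g U_Lp]) auto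
    show ?thesis unfolding D_def sum_distrib_left Bochner_Integration.integral_sum[OF i] ..
  qed
  have "0 = (\<Sum>i\<in>UNIV. LINT x|lborel. \<rho> x powr \<gamma> * U i i x)"
    unfolding sum_U[OF \<rho>_powr_Lp_2] renormalized_pressure ..
  also have "\<dots> = \<mu> * (\<Sum>i\<in>UNIV. \<Sum>j\<in>UNIV. Lpow 2 (U i j)) + (\<mu> / 3 + \<eta>) * (\<Sum>i\<in>UNIV. LINT x|lborel. D x * U i i x)
      - (\<Sum>i\<in>UNIV. LINT x|lborel. \<rho> x * H i x * u i x)"
    unfolding energy_identity_component by (simp only: sum.distrib sum_subtractf sum_distrib_left)
  finally show ?thesis
    unfolding force_power sum_U[OF D_Lp] Lpow_2 power2_eq_square by simp
qed

lemma gradient_vanishes: "Lpow 2 (U i j) = 0"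
proof -
  have 1: "0 \<le> (\<mu> / 3 + \<eta>) * Lpow 2 D" using \<mu> \<eta> by simp
  have S: "0 \<le> (\<Sum>i\<in>UNIV. \<Sum>j\<in>UNIV. Lpow 2 (U i j))" by (intro sum_nonneg) simp
  then have "0 \<le> \<mu> * (\<Sum>i\<in>UNIV. \<Sum>j\<in>UNIV. Lpow 2 (U i j))" using \<mu> by simp
  with 1 energy_identity have "\<mu> * (\<Sum>i\<in>UNIV. \<Sum>j\<in>UNIV. Lpow 2 (U i j)) = 0" by linarith
  then have "(\<Sum>i\<in>UNIV. \<Sum>j\<in>UNIV. Lpow 2 (U i j)) = 0" using \<mu> by simp
  then have "(\<Sum>j\<in>UNIV. Lpow 2 (U i j)) = 0" for i
    by (simp add: sum_nonneg_eq_0_iff sum_nonneg)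
  then show ?thesis by (simp add: sum_nonneg_eq_0_iff)
qed

text \<open>Sobolev's inequality is known for test functions only, so it is applied to
  \<open>\<phi> i n\<close>; the gradients of these tend to 0 in L2 while the functions tend to
  \<open>u i\<close> in L6.\<close>

lemma velocity_vanishes: "AE x in lborel. u i x = 0"
proof -
  have lim: "(\<lambda>n. 2 powr 6 * (Lpow 6 (\<lambda>x. \<phi> i n x - u i x) + 4096 * (\<Prod>j\<in>UNIV. Lpow 2 (partial j (\<phi> i n)))))
     \<longlonglongrightarrow> 2 powr 6 * (0 + 4096 * (\<Prod>j\<in>UNIV. Lpow 2 (U i j)))"
    by (intro tendsto_mult_left tendsto_add tendsto_prod LconvD(3)[OF u_conv] Lpow_2_tendsto U_conv)
  have "Lpow 6 (u i) \<le> 2 powr 6 * (Lpow 6 (\<lambda>x. \<phi> i n x - u i x) + 4096 * (\<Prod>j\<in>UNIV. Lpow 2 (partial j (\<phi> i n))))" for n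
  proof -
    have "Lpow 6 (u i) = Lpow 6 (\<lambda>x. (u i x - \<phi> i n x) + \<phi> i n x)" by simp
    also have "\<dots> \<le> 2 powr 6 * (Lpow 6 (\<lambda>x. u i x - \<phi> i n x) + Lpow 6 (\<phi> i n))"
      by (intro Lpow_add_le Lp_diff u_Lp Cc_1_Lp(1)[OF \<phi>_Cc_1]) auto
    also have "\<dots> \<le> 2 powr 6 * (Lpow 6 (\<lambda>x. \<phi> i n x - u i x) + 4096 * (\<Prod>j\<in>UNIV. Lpow 2 (partial j (\<phi> i n))))"
      unfolding Lpow_minus_commute[of 6 "u i"] by (intro mult_left_mono add_left_mono Sobolev \<phi>_Cc_1) auto
    finally show ?thesis .
  qed
  then have "Lpow 6 (u i) \<le> 2 powr 6 * (0 + 4096 * (\<Prod>j\<in>(UNIV::3 set). Lpow 2 (U i j)))"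
    using lim by (intro LIMSEQ_le_const) auto
  also have "\<dots> = 0" by (simp add: gradient_vanishes)
  finally have "Lpow 6 (u i) = 0" using Lpow_nonneg[of 6 "u i"] by linarith
  then have "AE x in lborel. \<bar>u i x\<bar> powr 6 = 0"
    unfolding Lpow_def using integral_nonneg_eq_0_iff_AE[OF Lp_integrable[OF u_Lp]] by simp
  then show ?thesis by eventually_elim simp
qed

end

theorem theorem7:
  fixes \<gamma> \<mu> \<eta> :: real
    and G \<rho> :: "real^3 \<Rightarrow> real"
    and u :: "real^3 \<Rightarrow> real^3"
  assumes "\<mu> > 0" and "\<eta> \<ge> 0"
    and "3 \<le> \<gamma>" and "\<gamma> < 6"
    and "G \<in> D0 (6 * \<gamma> / (5 * \<gamma> - 6))"
    and "weak_solution \<mu> \<eta> (\<lambda>r. r powr \<gamma>) G \<rho> u"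
    and "\<rho> \<in> Lspace \<gamma>"
  shows "AE x in lebesgue. u x = 0"
proof -
  obtain \<rho>' u' U H \<phi> \<psi> where flow: "steady_flow \<gamma> \<mu> \<eta> (6 * \<gamma> / (5 * \<gamma> - 6)) \<rho>' u' U H \<phi> \<psi>"
    and u: "AE x in lebesgue. \<forall>i. u x $ i = u' i x"
    using weak_solution_steady_flow[OF assms] by blast
  have "AE x in lebesgue. \<forall>i. u' i x = 0"
    unfolding AE_all_countable by (intro allI lborel_AE_imp_lebesgue steady_flow.velocity_vanishes[OF flow])
  with u show ?thesis by eventually_elim (simp add: vec_eq_iff)
qed

end
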